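(* (1) Suppose $p_{11}+p_{-1-1}+p_{1-1}+p_{-11}<1$. Then, as $i\to\infty$, $j>0$ and $j/i\to0$, $$G_{i,j}^{n_0,m_0}=\frac{C_0\left(m_0\,s_x(0)^{n_0}s_y(0)^{m_0-1}-\tilde h'(s_y(0))\right)}{s_x(j/i)^i\,s_y(j/i)^j}\left(\frac{j}{i\sqrt i}+\mathcal{O}\Big(\frac{j^2}{i^2\sqrt i}\Big)\right),$$ where $$C_0=\left(\frac2\pi\right)^{1/2}\frac{s_y'(0)\,s_x(0)^{1/2}}{\left(-\tilde d(s_y(0))\,X_1''(s_y(0))\right)^{1/2}},$$ with $s_x(0)=x_3$, $s_y(0)=Y_1(x_3)$ and $s_y'(0)=\dfrac{x_3P_l(x_3)^{1/2}}{2a(x_3)^{3/2}c(x_3)^{1/2}}$. The analogous result holds as $j\to\infty$, $i>0$ and $j/i\to\infty$, after exchanging the two coordinates (i.e. replacing $p_{ij}$ by $p_{ji}$ and exchanging the roles of $i$ and $j$, $n_0$ and $m_0$, $h$ and $\tilde h$, and $s_x$ and $s_y$). (2) Suppose $p_{11}+p_{-1-1}+p_{1-1}+p_{-11}=1$. If $n_0+m_0$ and $i+j$ do not have the same parity, then $G_{i,j}^{n_0,m_0}=0$; if they have the same parity, the asymptotic of $G_{i,j}^{n_0,m_0}$ is given by two times the right-hand side of the formula in (1).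
   Context: Walk. $(X(n),Y(n))_{n\ge0}$ is a Markov chain on $(\mathbb{Z}_+)^2$, $\mathbb{Z}_+=\{0,1,2,\dots\}$. From every $(i_0,j_0)$ with $i_0,j_0\ge1$ it jumps to $(i_0+i,j_0+j)$ with probability $p_{ij}$ (independent of $(i_0,j_0)$; $p_{1-1}$ means $p_{1,-1}$, etc.), where $p_{ij}=0$ if $|i|>1$ or $|j|>1$, $p_{00}=0$, $\sum_{i,j}p_{ij}=1$. All points $(0,0),(i,0),(0,j)$, $i,j\ge1$, are absorbing. In the list $p_{11},p_{10},p_{1-1},p_{0-1},p_{-1-1},p_{-10},p_{-11},p_{01}$ there are no three consecutive zeros. The drift satisfies $M_x=\sum ip_{ij}>0$, $M_y=\sum jp_{ij}>0$. The starting point is $(n_0,m_0)$ with integers $n_0,m_0\ge1$. Green functions: for $i,j\ge1$, $G_{i,j}^{n_0,m_0}=\mathbb{E}_{(n_0,m_0)}\big[\sum_{n\ge0}1_{\{(X(n),Y(n))=(i,j)\}}\big]$. Polynomials. $a(x)=p_{11}x^2+p_{01}x+p_{-11}$, $b(x)=p_{10}x^2-x+p_{-10}$, $c(x)=p_{1-1}x^2+p_{0-1}x+p_{-1-1}$, $d=b^2-4ac$; $\tilde a(y)=p_{11}y^2+p_{10}y+p_{1-1}$, $\tilde b(y)=p_{01}y^2-y+p_{0-1}$, $\tilde c(y)=p_{-11}y^2+p_{-10}y+p_{-1-1}$, $\tilde d=\tilde b^2-4\tilde a\tilde c$. The polynomial $d$ has degree 3 or 4 with distinct real roots $x_1,\dots,x_4$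 ($x_4=\infty$ if the degree is 3), enumerated so that $|x_1|<|x_2|<1<|x_3|<|x_4|$ and $x_2,x_3>0$, except that if $p_{11}+p_{-1-1}+p_{1-1}+p_{-11}=1$ one has $0<x_2=-x_1<1<x_3=-x_4$. If $x_4<0$, $[x_3,x_4]$ means $[x_3,+\infty[\,\cup\,]-\infty,x_4]$. The roots $y_1,\dots,y_4$ of $\tilde d$ are enumerated in the same way. $X_1=(-\tilde b+\sqrt{\tilde d})/(2\tilde a)$ on $\mathbb{C}\setminus([y_1,y_2]\cup[y_3,y_4])$, with the holomorphic branch of $\sqrt{\tilde d}$ positive on $]y_2,y_3[$; $Y_1(x_3)=-b(x_3)/(2a(x_3))=(c(x_3)/a(x_3))^{1/2}$. Further, $r=ac'-a'c$, $r_1=ba'-b'a$, $r_2=cb'-c'b$ and $P_l=r^2-r_1r_2$. Absorption. $h_i$ and $\tilde h_j$ are the probabilities, starting from $(n_0,m_0)$, of being absorbed at $(i,0)$ and $(0,j)$ respectively; $h(x)=\sum_{i\ge1}h_ix^i$, $\tilde h(y)=\sum_{j\ge1}\tilde h_jy^j$. These functions extend holomorphically to $\mathbb{C}\setminus[x_3,x_4]$ and $\mathbb{C}\setminus[y_3,y_4]$ respectively; the extensions are denoted by the same letters. Saddle point. For $(u,v)\in\mathbb{R}^2$ let $\phi(u,v)=\sum_{i,j}p_{ij}e^{iu}e^{jv}$. For $\gamma\in[0,\pi/2]$ let $(u(\gamma),v(\gamma))$ be the unique point of $\{\phi=1\}$ at which $\mathrm{grad}\,\phi/|\mathrm{grad}\,\phi|=(\cos\gamma,\sin\gamma)$,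 and put $s_x(\tan\gamma)=e^{u(\gamma)}$, $s_y(\tan\gamma)=e^{v(\gamma)}$ (with $\tan(\pi/2)=\infty$). Thus $s_x(j/i)$, $s_y(j/i)$ are the values for $\gamma=\arctan(j/i)$, and $s_y'(0)$ is the derivative at $0$ of $s_y$ as a function of its argument $\tan\gamma$. *)

theory Defs
  imports "HOL-Probability.Probability" "HOL-Complex_Analysis.Complex_Analysis"
begin

section \<open>The walk\<close>

type_synonym weights = "int \<Rightarrow> int \<Rightarrow> real"

text \<open>Exchange of the two coordinates. The polynomials and branch points carrying a tilde, or
  named after \<open>y\<close>, are those of the exchanged weights: e.g. \<open>d\<tilde> = disc_poly (flip p)\<close>
  and \<open>y\<^sub>3 = x3 (flip p)\<close>.\<close>

definition flip :: "weights \<Rightarrow> weights" where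
  "flip p = (\<lambda>i j. p j i)"

definition drift_x :: "weights \<Rightarrow> real" where
  "drift_x p = (\<Sum>i\<in>{-1..1}. \<Sum>j\<in>{-1..1}. of_int i * p i j)"

definition drift_y :: "weights \<Rightarrow> real" where
  "drift_y p = (\<Sum>i\<in>{-1..1}. \<Sum>j\<in>{-1..1}. of_int j * p i j)"

definition no_three_consecutive_zeros :: "weights \<Rightarrow> bool" where
  "no_three_consecutive_zeros p \<longleftrightarrow>
     (let L = [p 1 1, p 1 0, p 1 (-1), p 0 (-1), p (-1) (-1), p (-1) 0, p (-1) 1, p 0 1]
      in \<not> (\<exists>k. k + 2 < length L \<and> L ! k = 0 \<and> L ! (k + 1) = 0 \<and> L ! (k + 2) = 0))"

definition walk_weights :: "weights \<Rightarrow> bool" where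
  "walk_weights p \<longleftrightarrow>
     (\<forall>i j. 0 \<le> p i j) \<and>
     (\<forall>i j. \<bar>i\<bar> > 1 \<or> \<bar>j\<bar> > 1 \<longrightarrow> p i j = 0) \<and>
     p 0 0 = 0 \<and>
     (\<Sum>i\<in>{-1..1}. \<Sum>j\<in>{-1..1}. p i j) = 1 \<and>
     no_three_consecutive_zeros p"

definition transition :: "weights \<Rightarrow> nat \<times> nat \<Rightarrow> nat \<times> nat \<Rightarrow> real" where
  "transition p s t =
     (if 1 \<le> fst s \<and> 1 \<le> snd s
      then p (int (fst t) - int (fst s)) (int (snd t) - int (snd s))
      else if t = s then 1 else 0)"

text \<open>\<open>(X, Y)\<close> is a Markov chain on the probability space \<open>M\<close> with the above transition
  probabilities, started at \<open>(n0, m0)\<close>. The Markov property is stated in product form, which avoids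
  conditioning on null events.\<close>

definition absorbed_walk ::
  "weights \<Rightarrow> nat \<Rightarrow> nat \<Rightarrow> 'w measure \<Rightarrow> (nat \<Rightarrow> 'w \<Rightarrow> nat) \<Rightarrow> (nat \<Rightarrow> 'w \<Rightarrow> nat) \<Rightarrow> bool" where
  "absorbed_walk p n0 m0 M X Y \<longleftrightarrow>
     prob_space M \<and>
     (\<forall>n. X n \<in> measurable M (count_space UNIV)) \<and>
     (\<forall>n. Y n \<in> measurable M (count_space UNIV)) \<and>
     measure M {w \<in> space M. (X 0 w, Y 0 w) = (n0, m0)} = 1 \<and>
     (\<forall>n s. measure M {w \<in> space M. \<forall>k\<le>Suc n. (X k w, Y k w) = s k}
          = measure M {w \<in> space M. \<forall>k\<le>n. (X k w, Y k w) = s k} * transition p (s n) (s (Suc n)))"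

definition green ::
  "'w measure \<Rightarrow> (nat \<Rightarrow> 'w \<Rightarrow> nat) \<Rightarrow> (nat \<Rightarrow> 'w \<Rightarrow> nat) \<Rightarrow> nat \<Rightarrow> nat \<Rightarrow> ennreal" where
  "green M X Y i j = (\<integral>\<^sup>+w. (\<Sum>n. indicator {(i, j)} (X n w, Y n w)) \<partial>M)"

section \<open>Polynomials and branch points\<close>

definition a_poly :: "weights \<Rightarrow> real poly" where
  "a_poly p = [:p (-1) 1, p 0 1, p 1 1:]"

definition b_poly :: "weights \<Rightarrow> real poly" where
  "b_poly p = [:p (-1) 0, -1, p 1 0:]"

definition c_poly :: "weights \<Rightarrow> real poly" where
  "c_poly p = [:p (-1) (-1), p 0 (-1), p 1 (-1):]"

definition disc_poly :: "weights \<Rightarrow> real poly" where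
  "disc_poly p = (b_poly p)\<^sup>2 - 4 * a_poly p * c_poly p"

definition Pl_poly :: "weights \<Rightarrow> real poly" where
  "Pl_poly p =
     (let a = a_poly p; b = b_poly p; c = c_poly p;
          r = a * pderiv c - pderiv a * c;
          r1 = b * pderiv a - pderiv b * a;
          r2 = c * pderiv b - pderiv c * b
      in r\<^sup>2 - r1 * r2)"

definition diagonal_mass :: "weights \<Rightarrow> real" where
  "diagonal_mass p = p 1 1 + p (-1) (-1) + p 1 (-1) + p (-1) 1"

text \<open>The fourth root is \<open>\<infinity>\<close> when the discriminant has degree 3.\<close>

definition is_branch_points :: "weights \<Rightarrow> real \<Rightarrow> real \<Rightarrow> real \<Rightarrow> ereal \<Rightarrow> bool" where
  "is_branch_points p t1 t2 t3 t4 \<longleftrightarrow>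
     distinct [ereal t1, ereal t2, ereal t3, t4] \<and>
     (degree (disc_poly p) = 4 \<and> \<bar>t4\<bar> \<noteq> \<infinity> \<or> degree (disc_poly p) = 3 \<and> t4 = \<infinity>) \<and>
     {t. poly (disc_poly p) t = 0} = {t. ereal t \<in> {ereal t1, ereal t2, ereal t3, t4}} \<and>
     t2 > 0 \<and> t3 > 0 \<and>
     (if diagonal_mass p = 1
      then t2 = - t1 \<and> t2 < 1 \<and> 1 < t3 \<and> ereal t3 = - t4
      else \<bar>t1\<bar> < \<bar>t2\<bar> \<and> \<bar>t2\<bar> < 1 \<and> 1 < \<bar>t3\<bar> \<and> ereal \<bar>t3\<bar> < \<bar>t4\<bar>)"

definition branch_points :: "weights \<Rightarrow> real \<times> real \<times> real \<times> ereal" where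
  "branch_points p = (THE (t1, t2, t3, t4). is_branch_points p t1 t2 t3 t4)"

definition x1 :: "weights \<Rightarrow> real" where "x1 p = fst (branch_points p)"
definition x2 :: "weights \<Rightarrow> real" where "x2 p = fst (snd (branch_points p))"
definition x3 :: "weights \<Rightarrow> real" where "x3 p = fst (snd (snd (branch_points p)))"
definition x4 :: "weights \<Rightarrow> ereal" where "x4 p = snd (snd (snd (branch_points p)))"

definition cut12 :: "weights \<Rightarrow> complex set" where
  "cut12 p = of_real ` {x1 p..x2 p}"

definition cut34 :: "weights \<Rightarrow> complex set" where
  "cut34 p = of_real ` {t. if x4 p < 0 then x3 p \<le> t \<or> ereal t \<le> x4 p
                           else x3 p \<le> t \<and> ereal t \<le> x4 p}"

section \<open>The algebraic functions\<close>

abbreviation cpoly :: "real poly \<Rightarrow> complex \<Rightarrow> complex" where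
  "cpoly q \<equiv> poly (map_poly of_real q)"

text \<open>The holomorphic branch of the square root of the discriminant that is positive on
  the interval between the second and third branch points.\<close>

definition is_sqrt_disc :: "weights \<Rightarrow> (complex \<Rightarrow> complex) \<Rightarrow> bool" where
  "is_sqrt_disc p S \<longleftrightarrow>
     S holomorphic_on - (cut12 p \<union> cut34 p) \<and>
     (\<forall>z \<in> - (cut12 p \<union> cut34 p). (S z)\<^sup>2 = cpoly (disc_poly p) z) \<and>
     (\<forall>t \<in> {x2 p<..<x3 p}. S (of_real t) \<in> \<real> \<and> 0 < Re (S (of_real t)))"

definition sqrt_disc :: "weights \<Rightarrow> complex \<Rightarrow> complex" where
  "sqrt_disc p = (SOME S. is_sqrt_disc p S)"

definition X1 :: "weights \<Rightarrow> complex \<Rightarrow> complex" where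
  "X1 p y = (- cpoly (b_poly (flip p)) y + sqrt_disc (flip p) y) / (2 * cpoly (a_poly (flip p)) y)"

section \<open>Absorption\<close>

definition absorption_prob ::
  "'w measure \<Rightarrow> (nat \<Rightarrow> 'w \<Rightarrow> nat) \<Rightarrow> (nat \<Rightarrow> 'w \<Rightarrow> nat) \<Rightarrow> nat \<Rightarrow> real" where
  "absorption_prob M X Y i = measure M {w \<in> space M. \<exists>n. (X n w, Y n w) = (i, 0)}"

definition absorption_series ::
  "'w measure \<Rightarrow> (nat \<Rightarrow> 'w \<Rightarrow> nat) \<Rightarrow> (nat \<Rightarrow> 'w \<Rightarrow> nat) \<Rightarrow> complex \<Rightarrow> complex" where
  "absorption_series M X Y z = (\<Sum>i. of_real (absorption_prob M X Y (Suc i)) * z ^ Suc i)"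

text \<open>Holomorphic extension to \<open>D\<close> of a function given on the open unit disc. When there is none
  the function itself is returned; in either case the result agrees with \<open>f\<close> on the unit disc.\<close>

definition holomorphic_extension :: "complex set \<Rightarrow> (complex \<Rightarrow> complex) \<Rightarrow> complex \<Rightarrow> complex" where
  "holomorphic_extension D f =
     (if \<exists>F. F holomorphic_on D \<and> (\<forall>z\<in>ball 0 1. F z = f z)
      then SOME F. F holomorphic_on D \<and> (\<forall>z\<in>ball 0 1. F z = f z)
      else f)"

text \<open>\<open>h p M X Y\<close> generates the absorption probabilities on the horizontal axis; the function
  \<open>h\<tilde>\<close> for the vertical axis is \<open>h (flip p) M Y X\<close>.\<close>

definition h ::
  "weights \<Rightarrow> 'w measure \<Rightarrow> (nat \<Rightarrow> 'w \<Rightarrow> nat) \<Rightarrow> (nat \<Rightarrow> 'w \<Rightarrow> nat) \<Rightarrow> complex \<Rightarrow> complex" where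
  "h p M X Y = holomorphic_extension (- cut34 p) (absorption_series M X Y)"

definition h_tilde ::
  "weights \<Rightarrow> 'w measure \<Rightarrow> (nat \<Rightarrow> 'w \<Rightarrow> nat) \<Rightarrow> (nat \<Rightarrow> 'w \<Rightarrow> nat) \<Rightarrow> complex \<Rightarrow> complex" where
  "h_tilde p M X Y = h (flip p) M Y X"

section \<open>The saddle point\<close>

definition phi :: "weights \<Rightarrow> real \<times> real \<Rightarrow> real" where
  "phi p z = (\<Sum>i\<in>{-1..1}. \<Sum>j\<in>{-1..1}. p i j * exp (of_int i * fst z) * exp (of_int j * snd z))"

definition saddle :: "weights \<Rightarrow> real \<Rightarrow> real \<times> real" where
  "saddle p \<gamma> =
     (THE z. phi p z = 1 \<and> (\<exists>g. GDERIV (phi p) z :> g \<and> g /\<^sub>R norm g = (cos \<gamma>, sin \<gamma>)))"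

text \<open>These are used for finite \<open>t = tan \<gamma> \<ge> 0\<close>. The angle \<open>\<pi>/2\<close> becomes the angle 0
  after the exchange of coordinates, so the value \<open>t = \<infinity>\<close> is not needed.\<close>

definition s_x :: "weights \<Rightarrow> real \<Rightarrow> real" where
  "s_x p t = exp (fst (saddle p (arctan t)))"

definition s_y :: "weights \<Rightarrow> real \<Rightarrow> real" where
  "s_y p t = exp (snd (saddle p (arctan t)))"

text \<open>A one-sided derivative: the functions live on \<open>t \<ge> 0\<close>.\<close>

definition s_y'0 :: "weights \<Rightarrow> real" where
  "s_y'0 p = vector_derivative (s_y p) (at 0 within {0..})"

section \<open>The expansion near the horizontal axis\<close>

text \<open>Real parts are taken of numbers that are real: \<open>X1''\<close> and \<open>h\<tilde>'\<close> are evaluated at a point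
  of the real interval \<open>]y\<^sub>2, 1[\<close>, where both functions take real values.\<close>

definition C0 :: "weights \<Rightarrow> real" where
  "C0 p = sqrt (2 / pi) * (s_y'0 p * sqrt (s_x p 0)) /
     sqrt (- poly (disc_poly (flip p)) (s_y p 0) * Re ((deriv ^^ 2) (X1 p) (of_real (s_y p 0))))"

definition leading_factor ::
  "weights \<Rightarrow> 'w measure \<Rightarrow> (nat \<Rightarrow> 'w \<Rightarrow> nat) \<Rightarrow> (nat \<Rightarrow> 'w \<Rightarrow> nat) \<Rightarrow> nat \<Rightarrow> nat \<Rightarrow> real" where
  "leading_factor p M X Y n0 m0 =
     C0 p * (real m0 * s_x p 0 ^ n0 * s_y p 0 ^ (m0 - 1)
             - Re (deriv (h_tilde p M X Y) (of_real (s_y p 0))))"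

text \<open>The regime \<open>i \<rightarrow> \<infinity>\<close>, \<open>j > 0\<close>, \<open>j / i \<rightarrow> 0\<close>.\<close>

definition near_axis :: "(nat \<times> nat) filter" where
  "near_axis = inf (filtercomap fst at_top)
     (inf (principal {(i, j). 0 < j}) (filtercomap (\<lambda>(i, j). real j / real i) (nhds 0)))"

text \<open>\<open>G i j = \<kappa> * L / (s_x(j/i) ^ i * s_y(j/i) ^ j) * (j / (i \<surd>i) + O(j\<^sup>2 / (i\<^sup>2 \<surd>i)))\<close> in that
  regime, for \<open>(i, j) \<in> A\<close>.\<close>

definition axis_expansion ::
  "real \<Rightarrow> (nat \<times> nat) set \<Rightarrow> weights \<Rightarrow> 'w measure \<Rightarrow> (nat \<Rightarrow> 'w \<Rightarrow> nat) \<Rightarrow> (nat \<Rightarrow> 'w \<Rightarrow> nat)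
     \<Rightarrow> nat \<Rightarrow> nat \<Rightarrow> bool" where
  "axis_expansion \<kappa> A p M X Y n0 m0 \<longleftrightarrow>
     (\<exists>\<epsilon>. \<epsilon> \<in> O[inf near_axis (principal A)](\<lambda>(i, j). (real j)\<^sup>2 / ((real i)\<^sup>2 * sqrt (real i))) \<and>
       (\<forall>\<^sub>F (i, j) in inf near_axis (principal A).
          green M X Y i j < \<infinity> \<and>
          enn2real (green M X Y i j) =
            \<kappa> * (leading_factor p M X Y n0 m0 /
                  (s_x p (real j / real i) ^ i * s_y p (real j / real i) ^ j) *
                (real j / (real i * sqrt (real i)) + \<epsilon> (i, j)))))"

text \<open>The explicit values of \<open>s_x(0)\<close>, \<open>s_y(0) = Y\<^sub>1(x\<^sub>3)\<close> and \<open>s_y'(0)\<close>.\<close>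

definition axis_constants :: "weights \<Rightarrow> bool" where
  "axis_constants p \<longleftrightarrow>
     (let x = x3 p; a = poly (a_poly p) x; b = poly (b_poly p) x; c = poly (c_poly p) x
      in s_x p 0 = x \<and>
         s_y p 0 = - b / (2 * a) \<and>
         s_y p 0 = sqrt (c / a) \<and>
         (s_y p has_real_derivative
            x * sqrt (poly (Pl_poly p) x) / (2 * a powr (3/2) * sqrt c)) (at 0 within {0..}))"

end

theory Submission
  imports Defs
begin

text \<open>
  Paths in the quadrant are half-plane paths, minus those that reach the vertical axis first and then
  continue as half-plane paths. Because the steps of a path are exchangeable, the weight of the
  half-plane paths from height \<open>l\<close> to height \<open>j\<close> with \<open>u\<close> up steps is the weight of the free
  paths times a ballot factor close to \<open>j l / (u + 1)\<close>. Writing \<open>1 / (u + 1)\<close> as the integral of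
  \<open>s\<^sup>u\<close> over \<open>[0, 1]\<close> and inverting a Fourier series in the second coordinate turns the Green
  function into \<open>j\<close> times a double integral of \<open>F(s, y)\<^sup>i y\<^sup>-\<^sup>j\<close>, where \<open>F\<close> is the generating
  function of the first passage to the next column. The \<open>s\<close>-integral is concentrated at \<open>s = 1\<close>; the
  \<open>y\<close>-integral is a Laplace integral whose saddle point depends on \<open>j / i\<close>. The absorbed paths
  contribute the derivative of the absorption series. The leading coefficient is positive because it
  is the value of a harmonic function of the killed walk which is positive far to the right.\<close>

text \<open>The expansion has to hold uniformly as j/i tends to 0, with j possibly fixed and with
  relative error j/i, so the factor j must leave the integral exactly. Hence paths are counted by
  the ballot factor and not by a difference of two Fourier coefficients. The power of i splits
  accordingly: the s-integral is governed by its endpoint s = 1 and gives 1/i, the Laplace integral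
  in y gives 1/sqrt i. The ballot factor is replaced by its first-order term; the error carries
  another j and another 1 - s, hence another 1/i. All circles stay near |y| = \<open>Y0\<close>, and
  \<open>Y0 < 1\<close> because the vertical drift is positive. The absorption series converges
  there, so its continuation to the cut plane never has to be built. Positivity of the leading
  coefficient is needed because the claimed error term is multiplied by that coefficient. In the
  diagonal case |F| has two maxima on the circle; integrating over half of it, for points of the
  right parity, keeps one of them and produces the factor 2.\<close>

locale drift_walk =
  fixes p :: weights
  assumes weights: "walk_weights p" and drift_x_pos: "drift_x p > 0" and drift_y_pos: "drift_y p > 0"
begin

lemma p_nonneg [simp]: "0 <= p i j"
  using weights by (auto simp: walk_weights_def)

lemma p_00 [simp]: "p 0 0 = 0"
  using weights by (auto simp: walk_weights_def)

lemma p_far: "\<bar>i\<bar> > 1 | \<bar>j\<bar> > 1 ==> p i j = 0"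
  using weights by (auto simp: walk_weights_def)

lemma sum_unit_interval: "(\<Sum>k\<in>{-1..1::int}. f k) = f (-1) + f 0 + (f 1 :: 'b::comm_monoid_add)"
proof -
  have "{-1..1::int} = {-1, 0, 1}" by auto
  then show ?thesis by (simp add: add.assoc)
qed

lemma p_total: "p 1 1 + p 1 0 + p 1 (-1) + p 0 (-1) + p (-1) (-1) + p (-1) 0 + p (-1) 1 + p 0 1 = 1"
  using weights by (simp add: walk_weights_def sum_unit_interval)

section \<open>Free paths and the ballot formula\<close>

definition up_op :: "(int => int => nat => real) => int => int => nat => real" where
  "up_op f i b u = (if u = 0 then 0 else
     p (-1) 1 * f (i + 1) (b - 1) (u - 1) + p 0 1 * f i (b - 1) (u - 1) + p 1 1 * f (i - 1) (b - 1) (u - 1))"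

definition flat_op :: "(int => int => nat => real) => int => int => nat => real" where
  "flat_op f i b u = p (-1) 0 * f (i + 1) b u + p 1 0 * f (i - 1) b u"

definition down_op :: "(int => int => nat => real) => int => int => nat => real" where
  "down_op f i b u =
     p (-1) (-1) * f (i + 1) (b + 1) u + p 0 (-1) * f i (b + 1) u + p 1 (-1) * f (i - 1) (b + 1) u"

text \<open>\<open>T n i b u\<close> is the total weight of the unrestricted \<open>n\<close>-step paths with displacement
  \<open>(i, b)\<close> and exactly \<open>u\<close> steps that increase the second coordinate.\<close>

primrec T :: "nat => int => int => nat => real" where
  "T 0 = (%i b u. if i = 0 & b = 0 & u = 0 then 1 else 0)"
| "T (Suc n) = (%i b u. up_op (T n) i b u + flat_op (T n) i b u + down_op (T n) i b u)"

lemma T_nonneg: "0 <= T n i b u"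
  by (induction n arbitrary: i b u) (auto simp: up_op_def flat_op_def down_op_def intro!: add_nonneg_nonneg)

text \<open>A step changes the second coordinate by at most one, and a rise by b uses at least b up
  steps.\<close>

lemma T_zero: "u > n | \<bar>b\<bar> > int n | int u < b ==> T n i b u = 0"
proof (induction n arbitrary: i b u)
  case (Suc n)
  have "up_op (T n) i b u = 0" "flat_op (T n) i b u = 0" "down_op (T n) i b u = 0"
  proof -
    have "T n i' (b - 1) (u - 1) = 0" if "u > 0" for i'
      using Suc.prems that by (intro Suc.IH) linarith
    moreover have "T n i' b u = 0" for i'
      using Suc.prems by (intro Suc.IH) linarith
    moreover have "T n i' (b + 1) u = 0" for i'
      using Suc.prems by (intro Suc.IH) linarith
    ultimately show "up_op (T n) i b u = 0" "flat_op (T n) i b u = 0" "down_op (T n) i b u = 0"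
      by (auto simp: up_op_def flat_op_def down_op_def)
  qed
  then show ?case by simp
qed auto

text \<open>The steps of a path are exchangeable, so each step is equally likely to be an up step.\<close>

lemma T_exchange_up: "real u * T n i b u = (case n of 0 => 0 | Suc m => real n * up_op (T m) i b u)"
proof (induction n arbitrary: i b u)
  case (Suc n)
  define g where "g i b u = (case n of 0 => 0 | Suc m => real n * up_op (T m) i b u)" for i b u
  have IH: "real u * T n i b u = g i b u" for i b u
    using Suc.IH by (simp add: g_def)
  \<comment> \<open>The step operators commute, so one more step applied to
    \<open>n * up_op (T m)\<close> gives \<open>n * up_op (T n)\<close>. The additional
    \<open>up_op (T n)\<close> below accounts for the up step just added.\<close>
  have g: "up_op g i b u + flat_op g i b u + down_op g i b u = real n * up_op (T n) i b u"
  proof (cases n)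
    case (Suc m)
    show ?thesis
      by (simp add: g_def Suc up_op_def flat_op_def down_op_def algebra_simps)
  qed (simp add: g_def[abs_def] up_op_def flat_op_def down_op_def)
  have "real u * up_op (T n) i b u = up_op g i b u + up_op (T n) i b u"
    by (cases u) (simp_all add: up_op_def IH[symmetric] algebra_simps)
  moreover have "real u * flat_op (T n) i b u = flat_op g i b u"
    "real u * down_op (T n) i b u = down_op g i b u"
    by (simp_all add: flat_op_def down_op_def IH[symmetric] algebra_simps)
  ultimately show ?case using g by (simp add: algebra_simps)
qed simp

text \<open>A path with u up steps and displacement b has u - b down steps, so this is the same
  count with a down step marked.\<close>

lemma T_exchange_down:
  "(real u - of_int b) * T n i b u = (case n of 0 => 0 | Suc m => real n * down_op (T m) i b u)"
proof (induction n arbitrary: i b u)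
  case (Suc n)
  define g where "g i b u = (case n of 0 => 0 | Suc m => real n * down_op (T m) i b u)" for i b u
  have IH: "(real u - of_int b) * T n i b u = g i b u" for i b u
    using Suc.IH by (simp add: g_def)
  have g: "up_op g i b u + flat_op g i b u + down_op g i b u = real n * down_op (T n) i b u"
  proof (cases n)
    case (Suc m)
    show ?thesis
      by (simp add: g_def Suc up_op_def flat_op_def down_op_def algebra_simps)
  qed (simp add: g_def[abs_def] up_op_def flat_op_def down_op_def)
  have "(real u - of_int b) * up_op (T n) i b u = up_op g i b u"
    by (cases u) (simp_all add: up_op_def IH[symmetric] algebra_simps)
  moreover have "(real u - of_int b) * flat_op (T n) i b u = flat_op g i b u"
    "(real u - of_int b) * down_op (T n) i b u = down_op g i b u + down_op (T n) i b u"
    by (simp_all add: flat_op_def down_op_def IH[symmetric] algebra_simps)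
  ultimately show ?case using g by (simp add: algebra_simps)
qed simp

text \<open>A path from height l to height j with u up steps has d = u - j + l down steps. By the
  reflection principle the share of these paths that reaches height 0 is the binomial coefficient of
  u + d over u + l divided by that of u + d over u; cancelling factorials gives this
  product.\<close>

definition ballot_ratio :: "nat => nat => int => real" where
  "ballot_ratio l u j = (\<Prod>k=1..l. (real u + real k - of_int j) / (real u + real k))"

lemma ballot_ratio_0 [simp]: "ballot_ratio 0 u j = 1"
  by (simp add: ballot_ratio_def)

lemma ballot_ratio_Suc:
  "ballot_ratio (Suc l) u j = ballot_ratio l u j * ((real u + real l + 1 - of_int j) / (real u + real l + 1))"
  by (simp add: ballot_ratio_def algebra_simps)

text \<open>This recursion and the one for down steps say how the reflected share changes when the
  last step is removed; \<open>ballot_ratio_step\<close> averages the two.\<close>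

lemma ballot_ratio_up:
  "(real v + 1) * ballot_ratio l v (j - 1) = (real v + 1 + real l) * ballot_ratio l (Suc v) j"
proof (induction l)
  case (Suc l)
  have "(real v + 1) * ballot_ratio (Suc l) v (j - 1)
      = ((real v + 1) * ballot_ratio l v (j - 1)) * ((real v + real l + 2 - of_int j) / (real v + real l + 1))"
    by (simp add: ballot_ratio_Suc algebra_simps)
  also have "... = ballot_ratio l (Suc v) j * (real v + real l + 2 - of_int j)"
    unfolding Suc by (simp add: divide_simps)
  also have "... = (real v + 1 + real (Suc l)) * ballot_ratio (Suc l) (Suc v) j"
    by (simp add: ballot_ratio_Suc divide_simps)
  finally show ?case .
qed simp

lemma ballot_ratio_down:
  "(real u - of_int j + real l) * ballot_ratio l u (j + 1) = (real u - of_int j) * ballot_ratio l u j"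
proof (induction l)
  case (Suc l)
  have "(real u - of_int j + real (Suc l)) * ballot_ratio (Suc l) u (j + 1)
      = ((real u - of_int j + real l) * ballot_ratio l u (j + 1)) * ((real u + real l + 1 - of_int j) / (real u + real l + 1))"
    unfolding ballot_ratio_Suc by (simp add: divide_simps) (simp add: algebra_simps)
  also have "... = (real u - of_int j) * ballot_ratio (Suc l) u j"
    unfolding Suc ballot_ratio_Suc by simp
  finally show ?case .
qed simp

text \<open>The weight of the \<open>n\<close>-step paths from \<open>(0, l)\<close> to \<open>(i, j)\<close> that stay above the
  horizontal axis (for \<open>j >= 0\<close>): exchangeability turns the classical ballot count into a
  factor that only depends on the number of up steps.\<close>

definition K :: "nat => nat => int => int => real" where
  "K n l i j = (\<Sum>u\<le>n. T n i (j - int l) u * (1 - ballot_ratio l u j))"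

lemma K_axis [simp]: "K n l i 0 = 0"
proof -
  have "ballot_ratio l u 0 = 1" for u
    by (auto simp: ballot_ratio_def intro!: prod.neutral)
  then show ?thesis by (simp add: K_def)
qed

lemma K_0: "j >= 1 ==> K 0 l i j = (if i = 0 & j = int l then 1 else 0)"
proof -
  assume "j >= 1"
  \<comment> \<open>At u = 0 and j = l the factor with k = l is zero.\<close>
  have "ballot_ratio l 0 (int l) = 0" if "l >= 1"
    using that by (auto simp: ballot_ratio_def intro!: bexI[of _ l])
  then show ?thesis using \<open>j >= 1\<close> by (auto simp: K_def)
qed

text \<open>By exchangeability the last of N = n + 1 steps is up with weight u/N and down with
  weight (u - b)/N. If A and B are the shares left after removing an up or a down step, then u A =
  (u + l) R and (u - b) B = (u - j) R, and b = j - l makes them average to R. A flat step leaves the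
  share unchanged.\<close>

lemma ballot_ratio_step:
  assumes "b = j - int l" "j >= 1"
  shows "up_op (T n) i b u * (1 - ballot_ratio l (u - 1) (j - 1)) + flat_op (T n) i b u * (1 - ballot_ratio l u j)
     + down_op (T n) i b u * (1 - ballot_ratio l u (j + 1)) = T (Suc n) i b u * (1 - ballot_ratio l u j)"
proof -
  define t where "t = T (Suc n) i b u"
  define U where "U = up_op (T n) i b u"
  define D where "D = down_op (T n) i b u"
  define N where "N = real (Suc n)"
  have N: "N > 0" by (simp add: N_def)
  have U: "N * U = real u * t" using T_exchange_up[of u "Suc n" i b] by (simp add: U_def t_def N_def)
  have D: "N * D = (real u - of_int b) * t" using T_exchange_down[of u b "Suc n" i] by (simp add: D_def t_def N_def)
  have F: "flat_op (T n) i b u = t - U - D" by (simp add: t_def U_def D_def)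
  define R where "R = ballot_ratio l u j"
  define A where "A = ballot_ratio l (u - 1) (j - 1)"
  define B where "B = ballot_ratio l u (j + 1)"
  have up: "t * (real u * A) = t * ((real u + real l) * R)"
  proof (cases u)
    \<comment> \<open>Here \<open>u - 1\<close> is truncated to 0, so A carries no information.
      Either j <= l and the factor with k = j kills R, or b > 0 cannot be reached without up
      steps.\<close>
    case 0
    show ?thesis
    proof (cases "j <= int l")
      case True
      then have "R = 0" using assms(2) 0
        by (auto simp: R_def ballot_ratio_def intro!: bexI[of _ "nat j"])
      then show ?thesis using 0 by simp
    next
      case False
      then have "t = 0" using assms 0 by (simp add: t_def T_zero del: T.simps)
      then show ?thesis by simp
    qed
  next
    case (Suc v)
    then show ?thesis using ballot_ratio_up[of v l j] by (simp add: A_def R_def algebra_simps)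
  qed
  have dn: "(real u - of_int b) * B = (real u - of_int j) * R"
  proof -
    have "real u - of_int b = real u - of_int j + real l" using assms by simp
    then show ?thesis unfolding R_def B_def by (simp only: ballot_ratio_down)
  qed
  have "N * (U * A + D * B) = (N * U) * A + (N * D) * B" by (simp add: algebra_simps)
  also have "... = t * (real u * A) + t * ((real u - of_int b) * B)" unfolding U D by (simp add: algebra_simps)
  also have "... = (real u * t) * R + ((real u - of_int b) * t) * R"
  proof -
    have b: "real_of_int b = of_int j - real l" using assms by simp
    show ?thesis unfolding up dn unfolding b by (simp add: algebra_simps)
  qed
  also have "... = N * ((U + D) * R)" unfolding U[symmetric] D[symmetric] by (simp add: algebra_simps)
  finally have "U * A + D * B = (U + D) * R"
    using N by simp
  then show ?thesis
    unfolding F U_def[symmetric] D_def[symmetric] R_def[symmetric] t_def[symmetric] A_def[symmetric] B_def[symmetric]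
    by (simp add: algebra_simps)
qed

text \<open>Splits by the last step; an up step lowers both the height and the count u, hence the
  ratio at \<open>u - 1\<close> and \<open>j - 1\<close> in that part. Together with
  \<open>K_axis\<close> and \<open>K_0\<close> this identifies \<open>K\<close> as the kernel of the
  walk killed on the horizontal axis.\<close>

lemma K_forward:
  assumes "j >= 1"
  shows "K (Suc n) l i j = (\<Sum>k\<in>{-1..1}. \<Sum>e\<in>{-1..1}. p k e * K n l (i - k) (j - e))"
proof -
  define b where "b = j - int l"
  have K1: "K n l i' (j - 1) = (\<Sum>u\<le>n. T n i' (b - 1) u * (1 - ballot_ratio l u (j - 1)))" for i'
    unfolding K_def b_def by (simp add: algebra_simps)
  have K0: "K n l i' j = (\<Sum>u\<le>Suc n. T n i' b u * (1 - ballot_ratio l u j))" for i'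
    unfolding K_def b_def by (simp add: T_zero)
  have K2: "K n l i' (j + 1) = (\<Sum>u\<le>Suc n. T n i' (b + 1) u * (1 - ballot_ratio l u (j + 1)))" for i'
    unfolding K_def b_def by (simp add: T_zero algebra_simps)
  have up: "(\<Sum>u\<le>Suc n. up_op (T n) i b u * (1 - ballot_ratio l (u - 1) (j - 1))) =
     p (-1) 1 * K n l (i + 1) (j - 1) + p 0 1 * K n l i (j - 1) + p 1 1 * K n l (i - 1) (j - 1)"
    unfolding sum.atMost_Suc_shift K1 sum_distrib_left
    by (simp add: up_op_def sum.distrib[symmetric]) (simp add: algebra_simps)
  have flat: "(\<Sum>u\<le>Suc n. flat_op (T n) i b u * (1 - ballot_ratio l u j)) =
     p (-1) 0 * K n l (i + 1) j + p 1 0 * K n l (i - 1) j"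
    unfolding K0 flat_op_def sum_distrib_left sum.distrib[symmetric]
    by (rule sum.cong) (auto simp: algebra_simps)
  have down: "(\<Sum>u\<le>Suc n. down_op (T n) i b u * (1 - ballot_ratio l u (j + 1))) =
     p (-1) (-1) * K n l (i + 1) (j + 1) + p 0 (-1) * K n l i (j + 1) + p 1 (-1) * K n l (i - 1) (j + 1)"
    unfolding K2 down_op_def sum_distrib_left sum.distrib[symmetric]
    by (rule sum.cong) (auto simp: algebra_simps)
  have "K (Suc n) l i j = (\<Sum>u\<le>Suc n. T (Suc n) i b u * (1 - ballot_ratio l u j))"
    by (simp add: K_def b_def)
  also have "... = (\<Sum>u\<le>Suc n. up_op (T n) i b u * (1 - ballot_ratio l (u - 1) (j - 1)) + flat_op (T n) i b u * (1 - ballot_ratio l u j)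
     + down_op (T n) i b u * (1 - ballot_ratio l u (j + 1)))"
    by (rule sum.cong[OF refl]) (rule ballot_ratio_step[OF b_def assms, symmetric])
  finally show ?thesis
    unfolding sum.distrib up flat down by (simp add: sum_unit_interval algebra_simps)
qed

section \<open>The ballot factor for paths with many up steps\<close>

text \<open>Bonferroni inequalities of first and second order; the square of the sum over 2 bounds
  the second elementary symmetric function.\<close>

lemma prod_one_minus_bounds:
  fixes x :: "nat => real"
  assumes "\<And>k. k \<in> {1..l} ==> 0 <= x k & x k <= 1"
  shows "0 <= (\<Prod>k=1..l. 1 - x k) & (\<Prod>k=1..l. 1 - x k) <= 1 & 1 - sum x {1..l} <= (\<Prod>k=1..l. 1 - x k) \<and>
     (\<Prod>k=1..l. 1 - x k) <= 1 - sum x {1..l} + (sum x {1..l})\<^sup>2 / 2"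
  using assms
proof (induction l)
  case (Suc l)
  define P where "P = (\<Prod>k=1..l. 1 - x k)"
  define S where "S = sum x {1..l}"
  define y where "y = x (Suc l)"
  have IH: "0 <= P" "P <= 1" "1 - S <= P" "P <= 1 - S + S\<^sup>2 / 2"
    using Suc by (auto simp: P_def S_def)
  have y: "0 <= y" "y <= 1" using Suc.prems[of "Suc l"] by (auto simp: y_def)
  have S: "0 <= S" using Suc.prems by (auto simp: S_def intro!: sum_nonneg)
  have PS: "(\<Prod>k=1..Suc l. 1 - x k) = P * (1 - y)" "sum x {1..Suc l} = S + y"
    by (simp_all add: P_def S_def y_def)
  have 1: "P * (1 - y) <= (1 - S + S\<^sup>2 / 2) * (1 - y)"
    using IH y by (intro mult_right_mono) auto
  have 2: "P * y <= 1 * y" using IH y by (intro mult_right_mono) auto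
  have 3: "0 <= P * y" "0 <= P * (1 - y)" "0 <= S\<^sup>2 * y" "0 <= y * y" using IH y S by auto
  show ?case unfolding PS
  proof (intro conjI)
    show "P * (1 - y) <= 1" using IH(2) 3(1) by (simp add: algebra_simps)
    show "1 - (S + y) <= P * (1 - y)" using IH(3) 2 by (simp add: algebra_simps)
    show "P * (1 - y) <= 1 - (S + y) + (S + y)\<^sup>2 / 2"
    proof -
      have "(1 - S + S\<^sup>2 / 2) * (1 - y) = 1 - (S + y) + (S + y)\<^sup>2 / 2 - y * y / 2 - S\<^sup>2 * y / 2"
        by (simp add: power2_eq_square field_simps)
      then show ?thesis using 1 3(3,4) by linarith
    qed
  qed (use 3 in auto)
qed simp

text \<open>With x_k = j/(u + k) the ballot factor is 1 minus the product of the 1 - x_k, and the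
  sum of the x_k is close to A = l j/(u + 1); both errors are of order A^2. The denominator (u +
  1)(u + 2) is preferred to (u + 1)^2 because its reciprocal is the integral of s^u (1 - s) over
  [0, 1].\<close>

lemma ballot_factor_bounds:
  assumes "j >= 1" "int u >= j - int l"
  shows "0 <= 1 - ballot_ratio l u j" "1 - ballot_ratio l u j <= 1"
    and "\<bar>1 - ballot_ratio l u j - real l * of_int j / (real u + 1)\<bar>
       <= 4 * (real l)\<^sup>2 * (of_int j)\<^sup>2 / ((real u + 1) * (real u + 2))"
proof -
  define A where "A = real l * of_int j / (real u + 1)"
  have j: "(1::real) <= of_int j" using assms by simp
  have A0: "0 <= A" using j by (simp add: A_def)
  have A2: "2 * A\<^sup>2 <= 4 * (real l)\<^sup>2 * (of_int j)\<^sup>2 / ((real u + 1) * (real u + 2))"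
  proof -
    have "2 * A\<^sup>2 = 2 * (real l * of_int j)\<^sup>2 / ((real u + 1) * (real u + 1))"
      by (simp add: A_def power2_eq_square)
    also have "... <= 4 * (real l * of_int j)\<^sup>2 / ((real u + 1) * (real u + 2))"
    proof -
      have "1 / (real u + 1) <= 2 / (real u + 2)" by (simp add: field_simps)
      then have "2 * (real l * of_int j)\<^sup>2 / (real u + 1) * (1 / (real u + 1)) \<le>
          2 * (real l * of_int j)\<^sup>2 / (real u + 1) * (2 / (real u + 2))"
        by (intro mult_left_mono) auto
      then show ?thesis by (simp add: mult.assoc)
    qed
    finally show ?thesis by (simp add: power_mult_distrib mult.assoc)
  qed
  consider "int u + 1 >= j" | "int u + 1 < j" by linarith
  then have "0 <= 1 - ballot_ratio l u j & 1 - ballot_ratio l u j <= 1 \<and>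
      \<bar>1 - ballot_ratio l u j - A\<bar> <= 4 * (real l)\<^sup>2 * (of_int j)\<^sup>2 / ((real u + 1) * (real u + 2))"
  proof cases
    case 1
    define x where "x k = of_int j / (real u + real k)" for k :: nat
    have R: "ballot_ratio l u j = (\<Prod>k=1..l. 1 - x k)"
      unfolding ballot_ratio_def x_def by (rule prod.cong) (auto simp: divide_simps)
    have ju: "of_int j <= real u + 1" using 1 by linarith
    have x: "0 <= x k & x k <= 1" if "k \<in> {1..l}" for k
    proof -
      have "real u + 1 <= real u + real k" using that by auto
      then show ?thesis using ju j by (auto simp: x_def divide_simps)
    qed
    have xu: "sum x {1..l} <= A"
    proof -
      have "sum x {1..l} <= (\<Sum>k=1..l. of_int j / (real u + 1))"
        using j by (intro sum_mono) (auto simp: x_def intro!: divide_left_mono)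
      then show ?thesis by (simp add: A_def)
    qed
    have S0: "0 <= sum x {1..l}" using x by (intro sum_nonneg) auto
    \<comment> \<open>Each x_k is at least j/(u + l). The loss against A is A times (l - 1)/(u + l),
      and that quotient is at most A.\<close>
    have xl: "A - A\<^sup>2 <= sum x {1..l}"
    proof (cases "l = 0")
      case False
      then have l: "real l >= 1" by simp
      have "real l * (of_int j / (real u + real l)) = (\<Sum>k=1..l. of_int j / (real u + real l))" by simp
      also have "... <= sum x {1..l}"
        using j by (intro sum_mono) (auto simp: x_def intro!: divide_left_mono)
      finally have 1: "real l * (of_int j / (real u + real l)) <= sum x {1..l}" .
      have "A - real l * (of_int j / (real u + real l)) = A * ((real l - 1) / (real u + real l))"
        using l by (simp add: A_def divide_simps) (simp add: algebra_simps)
      also have "... <= A * A"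
      proof (rule mult_left_mono[OF _ A0])
        have "(real l - 1) / (real u + real l) <= real l / (real u + 1)"
          using l by (simp add: frac_le)
        also have "... <= A" using j l by (simp add: A_def divide_right_mono mult_left_mono)
        finally show "(real l - 1) / (real u + real l) <= A" .
      qed
      finally show ?thesis using 1 by (simp add: power2_eq_square)
    qed (simp add: A_def)
    have sq: "(sum x {1..l})\<^sup>2 <= A\<^sup>2" using xu S0 by (intro power_mono) auto
    have b: "0 <= ballot_ratio l u j" "ballot_ratio l u j <= 1" "1 - sum x {1..l} <= ballot_ratio l u j"
      "ballot_ratio l u j <= 1 - sum x {1..l} + (sum x {1..l})\<^sup>2 / 2"
      using prod_one_minus_bounds[of l x] x unfolding R by auto
    have "0 <= A\<^sup>2" by simp
    then have "\<bar>1 - ballot_ratio l u j - A\<bar> <= 2 * A\<^sup>2"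
      using b xu xl sq unfolding abs_le_iff by (intro conjI) linarith+
    then show ?thesis using b A2 by linarith
  next
    \<comment> \<open>Now some x_k may exceed 1. The factor with k = j - u vanishes, its index being
      at most l by the second hypothesis, and A >= 1 gives A <= A^2.\<close>
    case 2
    have R: "ballot_ratio l u j = 0"
      unfolding ballot_ratio_def using 2 assms
      by (auto intro!: prod_zero bexI[of _ "nat (j - int u)"])
    have "1 <= A"
    proof -
      have l: "real l >= 1" using 2 assms by simp
      have "real u + 1 <= of_int j" using 2 by linarith
      also have "... <= real l * of_int j" using l j by (simp add: mult_le_cancel_right1)
      finally show ?thesis by (simp add: A_def)
    qed
    then have "A <= A\<^sup>2" by (simp add: power2_eq_square mult_le_cancel_left1)
    then show ?thesis using A2 \<open>1 <= A\<close> unfolding R by (simp add: abs_le_iff)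
  qed
  then show "0 <= 1 - ballot_ratio l u j" "1 - ballot_ratio l u j <= 1"
    "\<bar>1 - ballot_ratio l u j - real l * of_int j / (real u + 1)\<bar>
       <= 4 * (real l)\<^sup>2 * (of_int j)\<^sup>2 / ((real u + 1) * (real u + 2))"
    by (auto simp: A_def)
qed

lemma K_nonneg: "j >= 1 ==> 0 <= K n l i j"
  unfolding K_def
proof (rule sum_nonneg)
  fix u assume j: "j >= 1"
  show "0 <= T n i (j - int l) u * (1 - ballot_ratio l u j)"
  proof (cases "int u >= j - int l")
    case True
    then show ?thesis using ballot_factor_bounds(1)[OF j] T_nonneg by simp
  qed (simp add: T_zero)
qed

lemma K_le: "j >= 1 ==> K n l i j <= (\<Sum>u\<le>n. T n i (j - int l) u)"
  unfolding K_def
proof (rule sum_mono)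
  fix u assume j: "j >= 1"
  show "T n i (j - int l) u * (1 - ballot_ratio l u j) <= T n i (j - int l) u"
  proof (cases "int u >= j - int l")
    case True
    then show ?thesis using ballot_factor_bounds(1,2)[OF j True] T_nonneg[of n i "j - int l" u]
      by (intro mult_right_le_one_le)
  qed (simp add: T_zero)
qed

text \<open>The weights 1/(u + 1) here and 1/((u + 1)(u + 2)) in \<open>T2\<close> are the integrals
  of s^u and of s^u (1 - s) over [0, 1].\<close>

definition T1 :: "nat => int => int => real" where
  "T1 n i b = (\<Sum>u\<le>n. T n i b u / (real u + 1))"

definition T2 :: "nat => int => int => real" where
  "T2 n i b = (\<Sum>u\<le>n. T n i b u / ((real u + 1) * (real u + 2)))"

lemma K_approx:
  assumes "j >= 1"
  shows "\<bar>K n l i j - of_int j * (real l * T1 n i (j - int l))\<bar> <= 4 * (of_int j)\<^sup>2 * ((real l)\<^sup>2 * T2 n i (j - int l))"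
proof -
  have "K n l i j - of_int j * (real l * T1 n i (j - int l)) =
     (\<Sum>u\<le>n. T n i (j - int l) u * (1 - ballot_ratio l u j - real l * of_int j / (real u + 1)))"
    unfolding K_def T1_def sum_distrib_left sum_subtractf[symmetric]
    by (rule sum.cong) (auto simp: field_simps)
  also have "\<bar>...\<bar> <= (\<Sum>u\<le>n. T n i (j - int l) u * (4 * (real l)\<^sup>2 * (of_int j)\<^sup>2 / ((real u + 1) * (real u + 2))))"
  proof (rule order.trans[OF sum_abs], rule sum_mono)
    fix u
    show "\<bar>T n i (j - int l) u * (1 - ballot_ratio l u j - real l * of_int j / (real u + 1))\<bar>
       <= T n i (j - int l) u * (4 * (real l)\<^sup>2 * (of_int j)\<^sup>2 / ((real u + 1) * (real u + 2)))"
    proof (cases "int u >= j - int l")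
      case True
      then show ?thesis
        using mult_left_mono[OF ballot_factor_bounds(3)[OF assms True] T_nonneg[of n i "j - int l" u]] T_nonneg[of n i "j - int l" u]
        by (simp only: abs_mult abs_of_nonneg)
    qed (simp add: T_zero)
  qed
  also have "... = 4 * (of_int j)\<^sup>2 * ((real l)\<^sup>2 * T2 n i (j - int l))"
    unfolding T2_def sum_distrib_left by (rule sum.cong) (auto simp: field_simps)
  finally show ?thesis .
qed

section \<open>The walk killed on the axes\<close>

primrec Q :: "nat => int => int => int => int => real" where
  "Q 0 = (%x y i j. if x >= 1 & y >= 1 & x = i & y = j then 1 else 0)"
| "Q (Suc n) = (%x y i j. if x >= 1 & y >= 1
     then \<Sum>k\<in>{-1..1}. \<Sum>e\<in>{-1..1}. p k e * Q n (x + k) (y + e) i j else 0)"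

lemma Q_nonneg: "0 <= Q n x y i j"
  by (induction n arbitrary: x y) (auto intro!: sum_nonneg)

lemma Q_outside: "i < 1 | j < 1 ==> Q n x y i j = 0"
  by (induction n arbitrary: x y) auto

lemma Q_far: "j > y + int n | i > x + int n ==> Q n x y i j = 0"
  by (induction n arbitrary: x y) (auto intro!: sum.neutral)

text \<open>\<open>Q\<close> is defined by its first step, but the comparison with \<open>K\<close>
  needs the last one. The two one-step sums act on different arguments and commute.\<close>

lemma Q_forward:
  "Q (Suc n) x y i j = (if i >= 1 & j >= 1
     then \<Sum>k\<in>{-1..1}. \<Sum>e\<in>{-1..1}. p k e * Q n x y (i - k) (j - e) else 0)"
proof (induction n arbitrary: x y)
  case 0
  have "(\<Sum>k\<in>{-1..1}. \<Sum>e\<in>{-1..1}. p k e * Q 0 (x + k) (y + e) i j) =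
     (\<Sum>k\<in>{-1..1}. \<Sum>e\<in>{-1..1}. p k e * Q 0 x y (i - k) (j - e))"
    if "i >= 1" "j >= 1" "x >= 1" "y >= 1"
    using that by (intro sum.cong) auto
  then show ?case by (auto simp del: Q.simps(1) simp: Q.simps(2) Q_outside) (auto)
next
  case (Suc n)
  show ?case
  proof (cases "i >= 1 & j >= 1 & x >= 1 & y >= 1")
    case True
    have "Q (Suc (Suc n)) x y i j = (\<Sum>k\<in>{-1..1}. \<Sum>e\<in>{-1..1}. p k e * Q (Suc n) (x + k) (y + e) i j)"
      using True by (subst Q.simps(2)) simp
    also have "... = (\<Sum>k\<in>{-1..1}. \<Sum>e\<in>{-1..1}. p k e * (\<Sum>k'\<in>{-1..1}. \<Sum>e'\<in>{-1..1}. p k' e' * Q n (x + k) (y + e) (i - k') (j - e')))"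
      using True unfolding Suc by simp
    also have "... = (\<Sum>k\<in>{-1..1}. \<Sum>e\<in>{-1..1}. p k e * (\<Sum>k'\<in>{-1..1}. \<Sum>e'\<in>{-1..1}. p k' e' * Q n (x + k') (y + e') (i - k) (j - e)))"
      unfolding sum_unit_interval by (simp add: algebra_simps)
    also have "... = (\<Sum>k\<in>{-1..1}. \<Sum>e\<in>{-1..1}. p k e * Q (Suc n) x y (i - k) (j - e))"
      using True by simp
    finally show ?thesis using True by simp
  next
    case False
    then show ?thesis using Q_outside[of i j "Suc (Suc n)" x y] by auto
  qed
qed

text \<open>Probability of being absorbed at \<open>(0, l)\<close> at time \<open>n\<close>.\<close>

definition hit :: "nat => int => int => int => real" where
  "hit n x y l = (case n of 0 => 0 | Suc m => \<Sum>e\<in>{-1..1}. p (-1) e * Q m x y 1 (l - e))"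

lemma hit_0 [simp]: "hit 0 x y l = 0"
  by (simp add: hit_def)

lemma hit_Suc: "hit (Suc m) x y l = (\<Sum>e\<in>{-1..1}. p (-1) e * Q m x y 1 (l - e))"
  by (simp add: hit_def)

lemma hit_nonneg: "0 <= hit n x y l"
  by (cases n) (auto simp: hit_Suc Q_nonneg intro!: sum_nonneg)

lemma hit_far: "l > y + int n ==> hit n x y l = 0"
  by (cases n) (auto simp: hit_Suc sum_unit_interval Q_far)

text \<open>The first-step recursion starts at time 2, since absorption at time 1 leaves no interior
  point to restart from.\<close>

lemma hit_Suc_Suc:
  assumes "x >= 1" "y >= 1"
  shows "hit (Suc (Suc n)) x y l = (\<Sum>k\<in>{-1..1}. \<Sum>e\<in>{-1..1}. p k e * hit (Suc n) (x + k) (y + e) l)"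
  unfolding hit_Suc sum_unit_interval using assms by (simp add: sum_unit_interval algebra_simps)

text \<open>Both sides satisfy the same forward recursion, so no paths have to be cut. Mass absorbed
  at the last step enters through \<open>K 0 l\<close>, the unit mass at (0, l). Absorption above
  height y + n is impossible, so any larger L serves.\<close>

theorem half_plane_decomposition:
  assumes "x >= 1" "y >= 1" "j >= 0" "L >= y + n"
  shows "K n y (i - int x) j = (if i >= 1 then Q n (int x) (int y) i j else 0)
     + (\<Sum>r\<le>n. \<Sum>l=1..L. hit r (int x) (int y) (int l) * K (n - r) l i j)"
  using assms(3,4)
proof (induction n arbitrary: i j)
  case 0
  then show ?case using assms by (cases "j = 0") (auto simp: K_0)
next
  case (Suc n)
  note p_00 [simp del]
  define H where "H r l = hit r (int x) (int y) (int l)" for r l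
  show ?case
  proof (cases "j = 0")
    case True
    then show ?thesis using Q_outside by auto
  next
    case False
    then have j: "j >= 1" using Suc.prems by simp
    let ?Q = "%i j. if i >= 1 then Q n (int x) (int y) i j else 0"
    have "K (Suc n) y (i - int x) j = (\<Sum>k\<in>{-1..1}. \<Sum>e\<in>{-1..1}. p k e * K n y (i - k - int x) (j - e))"
      unfolding K_forward[OF j] by (simp add: algebra_simps)
    also have "... = (\<Sum>k\<in>{-1..1}. \<Sum>e\<in>{-1..1}. p k e * (?Q (i - k) (j - e)
         + (\<Sum>r\<le>n. \<Sum>l=1..L. H r l * K (n - r) l (i - k) (j - e))))"
      unfolding H_def using j Suc.prems by (intro sum.cong refl arg_cong2[where f = "(*)"] Suc.IH) auto
    also have "... = (\<Sum>k\<in>{-1..1}. \<Sum>e\<in>{-1..1}. p k e * ?Q (i - k) (j - e)) +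
         (\<Sum>r\<le>n. \<Sum>l=1..L. H r l * (\<Sum>k\<in>{-1..1}. \<Sum>e\<in>{-1..1}. p k e * K (n - r) l (i - k) (j - e)))"
      unfolding sum_unit_interval by (simp add: algebra_simps sum.distrib sum_distrib_left)
    also have "(\<Sum>r\<le>n. \<Sum>l=1..L. H r l * (\<Sum>k\<in>{-1..1}. \<Sum>e\<in>{-1..1}. p k e * K (n - r) l (i - k) (j - e)))
        = (\<Sum>r\<le>n. \<Sum>l=1..L. H r l * K (Suc n - r) l i j)"
      by (intro sum.cong refl) (simp add: K_forward[OF j, symmetric] Suc_diff_le)
    also have "(\<Sum>k\<in>{-1..1}. \<Sum>e\<in>{-1..1}. p k e * ?Q (i - k) (j - e)) =
        (if i >= 1 then Q (Suc n) (int x) (int y) i j else 0) + (\<Sum>l=1..L. H (Suc n) l * K 0 l i j)"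
    proof -
      have KL: "(\<Sum>l=1..L. H (Suc n) l * K 0 l i j) = (if i = 0 then hit (Suc n) (int x) (int y) j else 0)"
      proof -
        have "(\<Sum>l=1..L. H (Suc n) l * K 0 l i j) = (\<Sum>l=1..L. if l = nat j then (if i = 0 then H (Suc n) (nat j) else 0) else 0)"
          using j by (intro sum.cong) (auto simp: K_0)
        also have "... = (if nat j \<in> {1..L} then (if i = 0 then H (Suc n) (nat j) else 0) else 0)"
          by (subst sum.delta) auto
        also have "... = (if i = 0 then hit (Suc n) (int x) (int y) j else 0)"
          using j Suc.prems hit_far[where l = j and y = "int y" and n = "Suc n" and x = "int x"] by (auto simp: H_def)
        finally show ?thesis .
      qed
      \<comment> \<open>To the right of the axis the sum over the last step is
        \<open>Q_forward\<close>, on the axis it is the mass absorbed now, and to the left no killed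
        path arrives.\<close>
      consider "i >= 1" | "i = 0" | "i < 0" by linarith
      then show ?thesis
      proof cases
        case 1
        have "?Q (i - k) (j - e) = Q n (int x) (int y) (i - k) (j - e)" for k e
          by (auto simp: Q_outside)
        then show ?thesis using 1 j unfolding KL by (simp add: Q_forward del: Q.simps)
      next
        case 2
        then show ?thesis unfolding KL by (simp add: hit_Suc sum_unit_interval)
      next
        case 3
        then show ?thesis unfolding KL by (simp add: sum_unit_interval)
      qed
    qed
    finally show ?thesis unfolding H_def by simp
  qed
qed

end

section \<open>The curve \<open>\<phi> = 1\<close>\<close>

definition phi_u :: "weights => real => real => real" where
  "phi_u p u v = p 1 1 * exp (u + v) + p 1 0 * exp u + p 1 (-1) * exp (u - v)
     - p (-1) (-1) * exp (- u - v) - p (-1) 0 * exp (- u) - p (-1) 1 * exp (v - u)"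

definition phi_v :: "weights => real => real => real" where
  "phi_v p u v = p 1 1 * exp (u + v) + p 0 1 * exp v + p (-1) 1 * exp (v - u)
     - p (-1) (-1) * exp (- u - v) - p 0 (-1) * exp (- v) - p 1 (-1) * exp (u - v)"

lemma phi_v_flip: "phi_v p u v = phi_u (flip p) v u"
  by (simp add: phi_u_def phi_v_def flip_def add.commute)

lemma phi_flip: "phi (flip p) (u, v) = phi p (v, u)"
  unfolding phi_def flip_def by (subst sum.swap) (simp add: mult_ac)

lemma flip_flip [simp]: "flip (flip p) = p"
  by (simp add: flip_def)

context drift_walk begin

lemma phi_expand:
  "phi p (u, v) = p 1 1 * exp (u + v) + p 1 0 * exp u + p 1 (-1) * exp (u - v) + p 0 (-1) * exp (- v)
     + p (-1) (-1) * exp (- u - v) + p (-1) 0 * exp (- u) + p (-1) 1 * exp (v - u) + p 0 1 * exp v"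
  by (simp add: phi_def sum_unit_interval exp_add exp_diff exp_minus field_simps)

lemma phi_0: "phi p (0, 0) = 1"
  using p_total by (simp add: phi_expand)

text \<open>The eight directions are cyclically ordered, and two more triples run over the end of
  the list. Positive vertical drift prevents the first of these from vanishing, the two drifts
  together prevent the second.\<close>

lemma triples:
  "0 < p 1 1 | 0 < p 1 0 | 0 < p 1 (-1)"
  "0 < p 1 0 | 0 < p 1 (-1) | 0 < p 0 (-1)"
  "0 < p 1 (-1) | 0 < p 0 (-1) | 0 < p (-1) (-1)"
  "0 < p 0 (-1) | 0 < p (-1) (-1) | 0 < p (-1) 0"
  "0 < p (-1) (-1) | 0 < p (-1) 0 | 0 < p (-1) 1"
  "0 < p (-1) 0 | 0 < p (-1) 1 | 0 < p 0 1"
  "0 < p (-1) 1 | 0 < p 0 1 | 0 < p 1 1"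
  "0 < p 0 1 | 0 < p 1 1 | 0 < p 1 0"
proof -
  let ?L = "[p 1 1, p 1 0, p 1 (-1), p 0 (-1), p (-1) (-1), p (-1) 0, p (-1) 1, p 0 1]"
  have L: "\<not> (k + 2 < length ?L & ?L ! k = 0 & ?L ! (k + 1) = 0 & ?L ! (k + 2) = 0)" for k
    using weights unfolding walk_weights_def no_three_consecutive_zeros_def Let_def by blast
  have pos: "0 < p i j \<longleftrightarrow> p i j ~= 0" for i j using p_nonneg[of i j] by (metis less_le)
  show t: "0 < p 1 1 | 0 < p 1 0 | 0 < p 1 (-1)"
    using L[of 0] by (auto simp: pos)
  show "0 < p 1 0 | 0 < p 1 (-1) | 0 < p 0 (-1)"
    using L[of 1] by (auto simp: pos)
  show "0 < p 1 (-1) | 0 < p 0 (-1) | 0 < p (-1) (-1)"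
    using L[of 2] by (auto simp: pos numeral_eq_Suc)
  show "0 < p 0 (-1) | 0 < p (-1) (-1) | 0 < p (-1) 0"
    using L[of 3] by (auto simp: pos numeral_eq_Suc)
  show "0 < p (-1) (-1) | 0 < p (-1) 0 | 0 < p (-1) 1"
    using L[of 4] by (auto simp: pos numeral_eq_Suc)
  show "0 < p (-1) 0 | 0 < p (-1) 1 | 0 < p 0 1"
    using L[of 5] by (auto simp: pos numeral_eq_Suc)
  have dx: "p 1 1 + p 1 0 + p 1 (-1) > p (-1) 1 + p (-1) 0 + p (-1) (-1)"
    and dy: "p 1 1 + p 0 1 + p (-1) 1 > p 1 (-1) + p 0 (-1) + p (-1) (-1)"
    using drift_x_pos drift_y_pos by (simp_all add: drift_x_def drift_y_def sum_unit_interval)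
  show "0 < p (-1) 1 | 0 < p 0 1 | 0 < p 1 1"
    using dy p_nonneg by (smt (verit, ccfv_threshold))
  show "0 < p 0 1 | 0 < p 1 1 | 0 < p 1 0"
    using dx dy p_nonneg by (smt (verit, ccfv_threshold))
qed

text \<open>Exchanging the coordinates traverses the cyclic list backwards from the same starting
  point, so a triple that ran over the end moves inside. This is why the cyclic triples were
  recorded.\<close>

lemma drift_walk_flip: "drift_walk (flip p)"
proof
  have "no_three_consecutive_zeros (flip p)"
  proof -
    have "\<not> (k + 2 < length L & L ! k = 0 & L ! (k + 1) = 0 & L ! (k + 2) = 0)"
      if "L = [p 1 1, p 0 1, p (-1) 1, p (-1) 0, p (-1) (-1), p 0 (-1), p 1 (-1), p 1 0]" for k L
    proof
      assume A: "k + 2 < length L & L ! k = 0 & L ! (k + 1) = 0 & L ! (k + 2) = 0"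
      then have "k \<in> {0, 1, 2, 3, 4, 5}" by (auto simp: that)
      then consider "k = 0" | "k = 1" | "k = 2" | "k = 3" | "k = 4" | "k = 5" by blast
      then show False
      proof cases
        case 1 then show ?thesis using A triples(7) by (simp add: that)
      next
        case 2 then show ?thesis using A triples(6) by (auto simp: that)
      next
        case 3 then show ?thesis using A triples(5) by (auto simp: that numeral_eq_Suc)
      next
        case 4 then show ?thesis using A triples(4) by (auto simp: that numeral_eq_Suc)
      next
        case 5 then show ?thesis using A triples(3) by (auto simp: that numeral_eq_Suc)
      next
        case 6 then show ?thesis using A triples(2) by (auto simp: that numeral_eq_Suc)
      qed
    qed
    then show ?thesis by (auto simp: no_three_consecutive_zeros_def flip_def Let_def)
  qed
  then show "walk_weights (flip p)"
    using weights by (auto simp: walk_weights_def flip_def sum_unit_interval)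
  show "0 < drift_x (flip p)" "0 < drift_y (flip p)"
    using drift_x_pos drift_y_pos by (auto simp: drift_x_def drift_y_def flip_def sum_unit_interval)
qed

lemma exp_tangent: "exp (a::real) + exp a * (b - a) <= exp b" "b ~= a ==> exp (a::real) + exp a * (b - a) < exp b"
proof -
  have e: "exp b = exp a * exp (b - a)" by (simp add: exp_diff)
  have "exp a * (1 + (b - a)) <= exp a * exp (b - a)" by (intro mult_left_mono exp_ge_add_one_self) simp
  then show "exp a + exp a * (b - a) <= exp b" unfolding e by (simp add: algebra_simps)
  assume "b ~= a"
  then have "1 + (b - a) < exp (b - a)"
  proof (cases "b - a > - 2")
    case True
    \<comment> \<open>Squaring exp h >= 1 + h gains the strictly positive term h^2.\<close>
    define h where "h = (b - a) / 2"
    have "h ~= 0" using \<open>b ~= a\<close> by (simp add: h_def)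
    then have "0 < h\<^sup>2" by simp
    moreover have "(1 + h)\<^sup>2 = 1 + (b - a) + h\<^sup>2" by (simp add: h_def power2_eq_square field_simps)
    ultimately have "1 + (b - a) < (1 + h)\<^sup>2" by linarith
    also have "... <= (exp h)\<^sup>2" using True by (intro power_mono exp_ge_add_one_self) (simp add: h_def field_simps)
    also have "... = exp (b - a)" by (simp add: h_def power2_eq_square exp_add[symmetric])
    finally show ?thesis .
  next
    case False
    then have "1 + (b - a) < 0" by simp
    then show ?thesis using exp_gt_zero[of "b - a"] by linarith
  qed
  then have "exp a * (1 + (b - a)) < exp a * exp (b - a)" by simp
  then show "exp a + exp a * (b - a) < exp b" unfolding e by (simp add: algebra_simps)
qed

text \<open>Strict convexity. The difference is a sum of eight convexity gaps, one per step; if all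
  vanished, the displacement (w, z) would be orthogonal to every step of positive weight, which the
  triples rule out.\<close>

lemma phi_tangent:
  assumes "(u', v') ~= (u, v)"
  shows "phi p (u, v) + phi_u p u v * (u' - u) + phi_v p u v * (v' - v) < phi p (u', v')"
proof -
  define w where "w = u' - u"
  define z where "z = v' - v"
  have wz: "w ~= 0 | z ~= 0" using assms by (auto simp: w_def z_def)
  define g where "g k a b = k * (exp b - exp a - exp a * (b - a))" for k a b :: real
  have g0: "0 <= g k a b" if "0 <= k" for k a b
    unfolding g_def using exp_tangent(1)[of a b] that by (intro mult_nonneg_nonneg) auto
  have g1: "0 < g k a b" if "0 < k" "b ~= a" for k a b
    unfolding g_def using exp_tangent(2)[of b a] that by (intro mult_pos_pos) auto
  have e: "phi p (u', v') - (phi p (u, v) + phi_u p u v * (u' - u) + phi_v p u v * (v' - v)) =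
     g (p 1 1) (u + v) (u' + v') + g (p 1 0) u u' + g (p 1 (-1)) (u - v) (u' - v') + g (p 0 (-1)) (- v) (- v')
     + g (p (-1) (-1)) (- u - v) (- u' - v') + g (p (-1) 0) (- u) (- u') + g (p (-1) 1) (v - u) (v' - u') + g (p 0 1) v v'"
    unfolding phi_expand phi_u_def phi_v_def g_def by (simp add: algebra_simps)
  have pos: "0 < g (p 1 1) (u + v) (u' + v') | 0 < g (p 1 0) u u' | 0 < g (p 1 (-1)) (u - v) (u' - v') | 0 < g (p 0 (-1)) (- v) (- v')
     | 0 < g (p (-1) (-1)) (- u - v) (- u' - v') | 0 < g (p (-1) 0) (- u) (- u') | 0 < g (p (-1) 1) (v - u) (v' - u') | 0 < g (p 0 1) v v'"
  proof (rule ccontr)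
    assume "\<not> ?thesis"
    then have nt: "\<not> 0 < g (p 1 1) (u + v) (u' + v')" "\<not> 0 < g (p 1 0) u u'" "\<not> 0 < g (p 1 (-1)) (u - v) (u' - v')"
      "\<not> 0 < g (p 0 (-1)) (- v) (- v')" "\<not> 0 < g (p (-1) (-1)) (- u - v) (- u' - v')"
      "\<not> 0 < g (p (-1) 0) (- u) (- u')" "\<not> 0 < g (p (-1) 1) (v - u) (v' - u')" "\<not> 0 < g (p 0 1) v v'"
      by simp_all
    have key: "\<not> 0 < k | b = a" if "\<not> 0 < g k a b" for k a b
      using g1 that by blast
    have n1: "\<not> 0 < p 1 1 | w + z = 0" using key[OF nt(1)] unfolding w_def z_def by linarith
    have n2: "\<not> 0 < p 1 0 | w = 0" using key[OF nt(2)] unfolding w_def z_def by linarith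
    have n3: "\<not> 0 < p 1 (-1) | w - z = 0" using key[OF nt(3)] unfolding w_def z_def by linarith
    have n4: "\<not> 0 < p 0 (-1) | z = 0" using key[OF nt(4)] unfolding w_def z_def by linarith
    have n5: "\<not> 0 < p (-1) (-1) | w + z = 0" using key[OF nt(5)] unfolding w_def z_def by linarith
    have n6: "\<not> 0 < p (-1) 0 | w = 0" using key[OF nt(6)] unfolding w_def z_def by linarith
    have n7: "\<not> 0 < p (-1) 1 | w - z = 0" using key[OF nt(7)] unfolding w_def z_def by linarith
    have n8: "\<not> 0 < p 0 1 | z = 0" using key[OF nt(8)] unfolding w_def z_def by linarith
    note n = n1 n2 n3 n4 n5 n6 n7 n8
    show False
    proof (cases "w = 0")
      case True
      then show ?thesis using n triples(1,2,3) wz by (auto)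
    next
      case False
      then show ?thesis using n triples(1,2,8,5) by (cases "z = 0") auto
    qed
  qed
  have nn: "0 <= g (p 1 1) (u + v) (u' + v')" "0 <= g (p 1 0) u u'" "0 <= g (p 1 (-1)) (u - v) (u' - v')"
    "0 <= g (p 0 (-1)) (- v) (- v')" "0 <= g (p (-1) (-1)) (- u - v) (- u' - v')"
    "0 <= g (p (-1) 0) (- u) (- u')" "0 <= g (p (-1) 1) (v - u) (v' - u')" "0 <= g (p 0 1) v v'"
    by (auto intro: g0)
  show ?thesis using e pos nn by linarith
qed

lemma sublevel_bounded: "\<exists>C\<ge>0. \<forall>u v. phi p (u, v) <= 1 --> \<bar>u\<bar> <= C & \<bar>v\<bar> <= C"
proof -
  \<comment> \<open>A term of positive weight that is at most 1 bounds its exponent by - ln p, hence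
    by C. Bounding a single coordinate may need two such exponents, whence the factor 2
    below.\<close>
  define C where "C = (\<Sum>i\<in>{-1..1}. \<Sum>j\<in>{-1..1}. \<bar>ln (p i j)\<bar>)"
  have C0: "C >= 0" by (auto simp: C_def intro!: sum_nonneg)
  have C: "\<bar>ln (p i j)\<bar> <= C" if "i \<in> {-1..1}" "j \<in> {-1..1}" for i j
  proof -
    have "\<bar>ln (p i j)\<bar> <= (\<Sum>j\<in>{-1..1}. \<bar>ln (p i j)\<bar>)" using that by (intro member_le_sum) auto
    also have "... <= C" unfolding C_def using that by (intro member_le_sum sum_nonneg) auto
    finally show ?thesis .
  qed
  have key: "a <= C" if "p i j * exp a <= 1" "0 < p i j" "i \<in> {-1..1}" "j \<in> {-1..1}" for i j a
  proof -
    have "exp (ln (p i j) + a) <= 1" using that by (simp add: exp_add)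
    then have "ln (p i j) + a <= 0" by simp
    then show ?thesis using C[OF that(3,4)] by linarith
  qed
  have "\<bar>u\<bar> <= 2 * C & \<bar>v\<bar> <= 2 * C" if "phi p (u, v) <= 1" for u v
  proof -
    have nn: "0 <= p i j * exp a" for i j a by simp
    note le = that[unfolded phi_expand]
    have "p 1 1 * exp (u + v) <= 1" "p 1 0 * exp u <= 1" "p 1 (-1) * exp (u - v) <= 1" "p 0 (-1) * exp (- v) <= 1"
      "p (-1) (-1) * exp (- u - v) <= 1" "p (-1) 0 * exp (- u) <= 1" "p (-1) 1 * exp (v - u) <= 1" "p 0 1 * exp v <= 1"
      using le nn[of 1 1 "u+v"] nn[of 1 0 u] nn[of 1 "-1" "u-v"] nn[of 0 "-1" "-v"] nn[of "-1" "-1" "-u-v"]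
        nn[of "-1" 0 "-u"] nn[of "-1" 1 "v-u"] nn[of 0 1 v] by linarith+
    then have n: "\<not> 0 < p 1 1 | u + v <= C" "\<not> 0 < p 1 0 | u <= C" "\<not> 0 < p 1 (-1) | u - v <= C"
      "\<not> 0 < p 0 (-1) | - v <= C" "\<not> 0 < p (-1) (-1) | - u - v <= C" "\<not> 0 < p (-1) 0 | - u <= C"
      "\<not> 0 < p (-1) 1 | v - u <= C" "\<not> 0 < p 0 1 | v <= C"
      by (auto intro: key)
    have "u <= 2 * C" using n triples(1,2,8) C0 by (smt (verit))
    moreover have "v <= 2 * C" using n triples(6,7,8) C0 by (smt (verit))
    moreover have "- u <= 2 * C" using n triples(4,5,6) C0 by (smt (verit))
    moreover have "- v <= 2 * C" using n triples(2,3,4) C0 by (smt (verit))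
    ultimately show ?thesis by linarith
  qed
  then show ?thesis using C0 by (intro exI[of _ "2 * C"]) auto
qed

lemma phi_continuous: "continuous_on A (phi p)"
  unfolding phi_def by (intro continuous_intros)

lemma phi_has_derivative_u: "((%u. phi p (u, v)) has_real_derivative phi_u p u v) (at u)"
  unfolding phi_expand phi_u_def by (auto intro!: derivative_eq_intros simp: algebra_simps)

lemma phi_has_derivative_v: "((%v. phi p (u, v)) has_real_derivative phi_v p u v) (at v)"
  unfolding phi_expand phi_v_def by (auto intro!: derivative_eq_intros simp: algebra_simps)

text \<open>Take the point of the compact set where phi <= 1 that is extreme in direction \<sigma>.
  It is not the origin, where \<open>phi_v\<close> is the positive vertical drift, so the strict
  tangent inequality against the origin fixes the sign of \<open>phi_u\<close>.\<close>

lemma extreme_point: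
  assumes "\<sigma> = 1 | \<sigma> = (-1::real)"
  shows "\<exists>u v. phi p (u, v) = 1 & phi_v p u v = 0 & \<sigma> * phi_u p u v > 0 & \<sigma> * u > 0"
proof -
  define E where "E = {z. phi p z <= 1}"
  obtain C where C: "\<And>u v. phi p (u, v) <= 1 ==> \<bar>u\<bar> <= C & \<bar>v\<bar> <= C"
    using sublevel_bounded by blast
  have "E \<subseteq> cbox (-C, -C) (C, C)"
    using C by (auto simp: E_def cbox_Pair_eq abs_le_iff) force+
  then have "bounded E" using bounded_subset bounded_cbox by blast
  moreover have "closed E"
    unfolding E_def by (intro closed_Collect_le continuous_on_const) (rule phi_continuous)
  ultimately have "compact E" by (simp add: compact_eq_bounded_closed)
  moreover have "(0, 0) \<in> E" using phi_0 by (simp add: E_def)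
  ultimately obtain z where z: "z \<in> E" "\<And>z'. z' \<in> E ==> \<sigma> * fst z' <= \<sigma> * fst z"
    using continuous_attains_sup[of E "%z. \<sigma> * fst z"] by (force intro!: continuous_intros)
  obtain u v where uv: "z = (u, v)" by (cases z)
  \<comment> \<open>Otherwise a small shift in direction \<sigma> would stay in E and increase the
    maximised coordinate.\<close>
  have ge1: "1 <= phi p (u, w)" for w
  proof (rule ccontr)
    assume less: "\<not> 1 <= phi p (u, w)"
    have "isCont (%x. phi p (x, w)) u" using phi_has_derivative_u DERIV_isCont by blast
    then have "eventually (%x. phi p (x, w) < 1) (at u)"
      using less by (intro order_tendstoD(2)[where y = "phi p (u, w)"]) (auto simp: isCont_def)
    then obtain d where d: "d > 0" "\<And>x. x ~= u ==> dist x u < d ==> phi p (x, w) < 1"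
      by (auto simp: eventually_at)
    have "phi p (u + \<sigma> * (d / 2), w) < 1" using d assms by (intro d(2)) (auto simp: dist_real_def)
    then have "(u + \<sigma> * (d / 2), w) \<in> E" by (simp add: E_def)
    then have "\<sigma> * (u + \<sigma> * (d / 2)) <= \<sigma> * u" using z(2) uv by fastforce
    then show False using d assms by (auto simp: algebra_simps)
  qed
  have 1: "phi p (u, v) = 1" using ge1[of v] z(1) uv by (auto simp: E_def)
  have 2: "phi_v p u v = 0"
    using DERIV_local_min[OF phi_has_derivative_v[of u v], of 1] ge1 1 by simp
  have "\<sigma> * 0 <= \<sigma> * u" using z(2)[OF \<open>(0,0) \<in> E\<close>] uv by simp
  then have \<sigma>u: "0 <= \<sigma> * u" by simp
  have "(u, v) ~= (0, 0)"
  proof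
    assume "(u, v) = (0, 0)"
    then have "phi_v p 0 0 = 0" using 2 by simp
    then show False using drift_y_pos by (simp add: phi_v_def drift_y_def sum_unit_interval)
  qed
  then have "phi_u p u v * u > 0" using phi_tangent[of 0 0 u v] 1 2 phi_0 by (auto simp: algebra_simps)
  then have "0 < \<sigma> * phi_u p u v & 0 < \<sigma> * u"
    using \<sigma>u assms by (auto simp: zero_less_mult_iff)
  then show ?thesis using 1 2 by blast
qed

lemma phi_GDERIV: "GDERIV (phi p) (u, v) :> (phi_u p u v, phi_v p u v)"
proof -
  have e: "phi p = (%z. p 1 1 * exp (fst z + snd z) + p 1 0 * exp (fst z) + p 1 (-1) * exp (fst z - snd z) + p 0 (-1) * exp (- snd z)
     + p (-1) (-1) * exp (- fst z - snd z) + p (-1) 0 * exp (- fst z) + p (-1) 1 * exp (snd z - fst z) + p 0 1 * exp (snd z))"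
    using phi_expand by (auto simp: fun_eq_iff)
  show ?thesis
    unfolding gderiv_def e phi_u_def phi_v_def
    by (auto intro!: derivative_eq_intros simp: fun_eq_iff algebra_simps)
qed

text \<open>For uniqueness: two points of the curve with gradients in the same direction give strict
  tangent inequalities with opposite increments, which contradict each other.\<close>

lemma saddle_eqI:
  assumes "phi p (u, v) = 1" "phi_u p u v > 0" "phi_v p u v = t * phi_u p u v"
  shows "saddle p (arctan t) = (u, v)"
  unfolding saddle_def
proof (rule the_equality)
  define n where "n = (cos (arctan t), sin (arctan t))"
  define r where "r = norm (phi_u p u v, phi_v p u v)"
  have r: "r = phi_u p u v * sqrt (1 + t\<^sup>2)"
  proof -
    have "(phi_u p u v)\<^sup>2 + (phi_v p u v)\<^sup>2 = (phi_u p u v)\<^sup>2 * (1 + t\<^sup>2)"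
      unfolding assms(3) by (simp add: power2_eq_square algebra_simps)
    then show ?thesis using assms(2) by (simp add: r_def norm_Pair real_sqrt_mult)
  qed
  have s: "sqrt (1 + t\<^sup>2) > 0" by (simp add: add_pos_nonneg)
  have n: "n = (1 / sqrt (1 + t\<^sup>2), t / sqrt (1 + t\<^sup>2))" by (simp add: n_def cos_arctan sin_arctan)
  have "(phi_u p u v, phi_v p u v) /\<^sub>R norm (phi_u p u v, phi_v p u v) = n"
    unfolding r_def[symmetric] r n using assms(2,3) s by (simp add: field_simps)
  then show "phi p (u, v) = 1 & (\<exists>g. GDERIV (phi p) (u, v) :> g & g /\<^sub>R norm g = (cos (arctan t), sin (arctan t)))"
    using assms(1) phi_GDERIV[of u v] unfolding n_def by blast
  fix z assume z: "phi p z = 1 & (\<exists>g. GDERIV (phi p) z :> g & g /\<^sub>R norm g = (cos (arctan t), sin (arctan t)))"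
  obtain u' v' where z': "z = (u', v')" by (cases z)
  obtain g where g: "GDERIV (phi p) z :> g" "g /\<^sub>R norm g = n" using z n_def by auto
  have "g = (phi_u p u' v', phi_v p u' v')"
  proof -
    have "(%h. inner h g) = (%h. inner h (phi_u p u' v', phi_v p u' v'))"
      using has_derivative_unique[OF g(1)[unfolded gderiv_def] phi_GDERIV[of u' v', unfolded gderiv_def, folded z']] .
    then show ?thesis by (metis inner_commute vector_eq_rdot inner_eq_zero_iff)
  qed
  moreover have "norm g ~= 0" using g(2) s unfolding n by (auto simp: zero_prod_def)
  then have "norm g > 0" "g = norm g *\<^sub>R n" using g(2) by auto
  ultimately have g': "phi_u p u' v' = norm g / sqrt (1 + t\<^sup>2)" "phi_v p u' v' = t * (norm g / sqrt (1 + t\<^sup>2))"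
    "norm g / sqrt (1 + t\<^sup>2) > 0"
    using s unfolding n by (auto simp: field_simps)
  show "z = (u, v)"
  proof (rule ccontr)
    assume "z ~= (u, v)"
    then have ne: "(u', v') ~= (u, v)" "(u, v) ~= (u', v')" using z' by auto
    define a where "a = phi_u p u v"
    define a' where "a' = norm g / sqrt (1 + t\<^sup>2)"
    have "a * ((u' - u) + t * (v' - v)) < 0"
      using phi_tangent[OF ne(1)] z z' assms by (simp add: a_def algebra_simps)
    moreover have "a' * ((u - u') + t * (v - v')) < 0"
      using phi_tangent[OF ne(2)] z z' assms unfolding g'(1,2) a'_def[symmetric] by (simp add: algebra_simps)
    moreover have "a > 0" "a' > 0" using assms(2) g'(3) by (auto simp: a_def a'_def)
    ultimately have "(u' - u) + t * (v' - v) < 0" "(u - u') + t * (v - v') < 0"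
      by (simp_all add: mult_less_0_iff)
    then show False by (simp add: algebra_simps)
  qed
qed

end

section \<open>Branch points\<close>

lemma poly_distinct_roots_factor:
  fixes q :: "'a::field poly"
  assumes "distinct rs" "\<And>r. r \<in> set rs ==> poly q r = 0" "degree q = length rs"
  shows "\<exists>c. q = smult c (\<Prod>r\<leftarrow>rs. [:-r, 1:])"
  using assms
proof (induction rs arbitrary: q)
  case Nil
  then have "degree q = 0" by simp
  then obtain c where "q = [:c:]" by (rule degree_eq_zeroE)
  then show ?case by (intro exI[of _ c]) simp
next
  case (Cons r rs)
  then have "[:-r, 1:] dvd q" by (simp add: poly_eq_0_iff_dvd)
  then obtain e where e: "q = [:-r, 1:] * e" by (rule dvdE)
  have "q ~= 0" using Cons.prems(3) by auto
  then have "e ~= 0" using e by auto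
  then have "degree q = Suc (degree e)" unfolding e by (subst degree_mult_eq) auto
  moreover have "poly e s = 0" if "s \<in> set rs" for s
    using Cons.prems(1,2) that unfolding e by force
  ultimately obtain c where "e = smult c (\<Prod>r\<leftarrow>rs. [:-r, 1:])"
    using Cons.IH[of e] Cons.prems by auto
  then show ?case unfolding e by (intro exI[of _ c]) simp
qed

lemma cpoly_of_real: "cpoly q (of_real x) = of_real (poly q x)"
  by (induction q) (simp_all add: map_poly_pCons)

lemma ordered_pair_unique:
  fixes t1 t2 :: real
  assumes "t1 = s1 | t1 = s2" "t2 = s1 | t2 = s2" "\<bar>t1\<bar> < \<bar>t2\<bar>" "\<bar>s1\<bar> < \<bar>s2\<bar>"
  shows "t1 = s1" "t2 = s2"
  using assms by auto

context drift_walk begin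

abbreviation "a \<equiv> poly (a_poly p)"
abbreviation "b \<equiv> poly (b_poly p)"
abbreviation "c \<equiv> poly (c_poly p)"
abbreviation "d \<equiv> poly (disc_poly p)"

lemma a_eq: "a x = p 1 1 * x\<^sup>2 + p 0 1 * x + p (-1) 1"
  and b_eq: "b x = p 1 0 * x\<^sup>2 - x + p (-1) 0"
  and c_eq: "c x = p 1 (-1) * x\<^sup>2 + p 0 (-1) * x + p (-1) (-1)"
  and d_eq: "d x = (b x)\<^sup>2 - 4 * a x * c x"
  by (simp_all add: a_poly_def b_poly_def c_poly_def disc_poly_def power2_eq_square algebra_simps)

lemma pos_iff: "0 < p i j \<longleftrightarrow> p i j ~= 0"
  using p_nonneg[of i j] by (metis less_le)

lemma a_pos: "x > 0 ==> a x > 0"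
proof -
  assume x: "x > 0"
  have n: "0 <= p 1 1 * x\<^sup>2" "0 <= p 0 1 * x" "0 <= p (-1) 1" using x by auto
  consider "0 < p (-1) 1" | "0 < p 0 1 * x" | "0 < p 1 1 * x\<^sup>2"
    using triples(7) x by (auto simp del: zero_less_power2)
  then show ?thesis using n unfolding a_eq by cases linarith+
qed

lemma c_pos: "x > 0 ==> c x > 0"
proof -
  assume x: "x > 0"
  have n: "0 <= p 1 (-1) * x\<^sup>2" "0 <= p 0 (-1) * x" "0 <= p (-1) (-1)" using x by auto
  consider "0 < p (-1) (-1)" | "0 < p 0 (-1) * x" | "0 < p 1 (-1) * x\<^sup>2"
    using triples(3) x by (auto simp del: zero_less_power2)
  then show ?thesis using n unfolding c_eq by cases linarith+
qed

text \<open>In exponential coordinates the quadratic in y with coefficients a, b, c is x y (phi -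
  1). Its positive double roots sit where the curve has a vertical tangent, which links the zeros of
  d to the extreme points.\<close>

lemma kernel_phi: "a (exp u) * (exp v)\<^sup>2 + b (exp u) * exp v + c (exp u) = exp u * exp v * (phi p (u, v) - 1)"
  unfolding a_eq b_eq c_eq phi_expand
  by (simp add: exp_add exp_diff exp_minus power2_eq_square field_simps)

lemma kernel_phi_v: "a (exp u) * (exp v)\<^sup>2 - c (exp u) = exp u * exp v * phi_v p u v"
  unfolding a_eq c_eq phi_v_def
  by (simp add: exp_add exp_diff exp_minus power2_eq_square field_simps)

definition a' where "a' x = 2 * p 1 1 * x + p 0 1"
definition b' where "b' x = 2 * p 1 0 * x - 1"
definition c' where "c' x = 2 * p 1 (-1) * x + p 0 (-1)"

lemma pderiv_abc: "poly (pderiv (a_poly p)) x = a' x" "poly (pderiv (b_poly p)) x = b' x" "poly (pderiv (c_poly p)) x = c' x"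
  by (simp_all add: a_poly_def b_poly_def c_poly_def a'_def b'_def c'_def pderiv_pCons algebra_simps)

lemma kernel_phi_u:
  "phi p (u, v) = 1 ==> a' (exp u) * (exp v)\<^sup>2 + b' (exp u) * exp v + c' (exp u) = exp v * phi_u p u v"
proof -
  assume "phi p (u, v) = 1"
  then have 0: "a (exp u) * (exp v)\<^sup>2 + b (exp u) * exp v + c (exp u) = 0" using kernel_phi by simp
  have "exp u * (a' (exp u) * (exp v)\<^sup>2 + b' (exp u) * exp v + c' (exp u)) - (a (exp u) * (exp v)\<^sup>2 + b (exp u) * exp v + c (exp u))
      = exp u * (exp v * phi_u p u v)"
    unfolding a_eq b_eq c_eq a'_def b'_def c'_def phi_u_def
    by (simp add: exp_add exp_diff exp_minus power2_eq_square field_simps)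
  then show ?thesis using 0 by simp
qed

lemma d_deriv: "(d has_real_derivative 2 * b x * b' x - 4 * a' x * c x - 4 * a x * c' x) (at x)"
proof -
  have "d = (%x. (b x)\<^sup>2 - 4 * a x * c x)" by (rule ext) (rule d_eq)
  moreover have "((%x. (b x)\<^sup>2 - 4 * a x * c x) has_real_derivative 2 * b x * b' x - 4 * a' x * c x - 4 * a x * c' x) (at x)"
    by (auto intro!: derivative_eq_intros simp: pderiv_abc)
  ultimately show ?thesis by simp
qed

text \<open>Where the gradient is horizontal, exp v is a double root of the quadratic, so b and c
  are determined by a and exp v. The derivative of d has the sign opposite to \<open>phi_u\<close>,
  which tells on which side d is negative.\<close>

lemma horizontal_point:
  assumes "phi p (u, v) = 1" "phi_v p u v = 0"
  shows "c (exp u) = a (exp u) * (exp v)\<^sup>2" "b (exp u) = - 2 * a (exp u) * exp v" "d (exp u) = 0"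
    and "(d has_real_derivative - 4 * a (exp u) * exp v * phi_u p u v) (at (exp u))"
proof -
  show c: "c (exp u) = a (exp u) * (exp v)\<^sup>2" using kernel_phi_v[of u v] assms by simp
  have "exp v * (2 * a (exp u) * exp v + b (exp u)) = 0"
    using kernel_phi[of u v] assms unfolding c by (simp add: power2_eq_square algebra_simps)
  then show b: "b (exp u) = - 2 * a (exp u) * exp v" by simp
  show "d (exp u) = 0" unfolding d_eq c b by (simp add: power2_eq_square)
  have "2 * b (exp u) * b' (exp u) - 4 * a' (exp u) * c (exp u) - 4 * a (exp u) * c' (exp u) =
     - 4 * a (exp u) * (a' (exp u) * (exp v)\<^sup>2 + b' (exp u) * exp v + c' (exp u))"
    unfolding c b by (simp add: power2_eq_square algebra_simps)
  also have "... = - 4 * a (exp u) * exp v * phi_u p u v"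
    unfolding kernel_phi_u[OF assms(1)] by simp
  finally show "(d has_real_derivative - 4 * a (exp u) * exp v * phi_u p u v) (at (exp u))"
    using d_deriv[of "exp u"] by simp
qed

lemma diagonal_iff: "diagonal_mass p = 1 \<longleftrightarrow> p 1 0 = 0 & p 0 1 = 0 & p (-1) 0 = 0 & p 0 (-1) = 0"
  unfolding diagonal_mass_def using p_total p_nonneg[of 1 0] p_nonneg[of 0 1] p_nonneg[of "-1" 0] p_nonneg[of 0 "-1"]
  by (intro iffI conjI) linarith+

lemma disc_coeffs: "disc_poly p =
  [: (p (-1) 0)\<^sup>2 - 4 * p (-1) 1 * p (-1) (-1),
     - 2 * p (-1) 0 - 4 * (p (-1) 1 * p 0 (-1) + p 0 1 * p (-1) (-1)),
     1 + 2 * p 1 0 * p (-1) 0 - 4 * (p (-1) 1 * p 1 (-1) + p 0 1 * p 0 (-1) + p 1 1 * p (-1) (-1)),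
     - 2 * p 1 0 - 4 * (p 0 1 * p 1 (-1) + p 1 1 * p 0 (-1)),
     (p 1 0)\<^sup>2 - 4 * p 1 1 * p 1 (-1) :]"
  unfolding poly_eq_poly_eq_iff[symmetric]
  by (rule ext) (simp add: d_eq a_eq b_eq c_eq power2_eq_square algebra_simps)

text \<open>If the leading coefficient vanishes, the next one is minus a sum of nonnegative terms;
  it can vanish only together with three cyclically consecutive weights.\<close>

lemma disc_degree: "degree (disc_poly p) = 4 | degree (disc_poly p) = 3"
proof (cases "(p 1 0)\<^sup>2 - 4 * p 1 1 * p 1 (-1) = 0")
  case True
  have "- 2 * p 1 0 - 4 * (p 0 1 * p 1 (-1) + p 1 1 * p 0 (-1)) ~= 0"
  proof
    assume 0: "- 2 * p 1 0 - 4 * (p 0 1 * p 1 (-1) + p 1 1 * p 0 (-1)) = 0"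
    define A B where "A = p 0 1 * p 1 (-1)" and "B = p 1 1 * p 0 (-1)"
    have "0 <= A" "0 <= B" "0 <= p 1 0" by (auto simp: A_def B_def)
    moreover have e: "p 1 0 + (2 * A + 2 * B) = 0" using 0 by (simp add: A_def B_def algebra_simps)
    ultimately have "p 1 0 = 0 & 2 * A + 2 * B = 0"
      using add_nonneg_eq_0_iff[of "p 1 0" "2 * A + 2 * B"] by simp
    then have "p 1 0 = 0 & A = 0 & B = 0"
      using add_nonneg_eq_0_iff[of "2 * A" "2 * B"] \<open>0 <= A\<close> \<open>0 <= B\<close> by simp
    then have "p 1 0 = 0" "p 0 1 * p 1 (-1) = 0" "p 1 1 * p 0 (-1) = 0"
      by (simp_all add: A_def B_def)
    then show False using True triples(1,2,8) by (auto simp: pos_iff)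
  qed
  then show ?thesis unfolding disc_coeffs using True by simp
qed (simp add: disc_coeffs)

lemma disc_nonzero: "disc_poly p ~= 0"
  using disc_degree by auto

text \<open>The coefficients of a and c are nonnegative, so passing from x to -x cannot increase |a|
  or |c|, and it cannot decrease |b| when b x <= 0. Equality throughout forces all weight onto the
  diagonal steps.\<close>

lemma d_minus_pos:
  assumes "x > 0" "d x = 0" "b x <= 0" "diagonal_mass p ~= 1"
  shows "d (- x) > 0"
proof -
  have am: "\<bar>a (-x)\<bar> <= a x" and cm: "\<bar>c (-x)\<bar> <= c x"
    using assms(1) unfolding a_eq c_eq abs_le_iff by (auto simp: add_nonneg_nonneg)
  have ac: "a (-x) * c (-x) <= a x * c x"
    using mult_mono'[OF am cm] by (metis abs_ge_self abs_ge_zero abs_mult order.trans)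
  have bm: "b (-x) = - b x + 2 * (p 1 0 * x\<^sup>2 + p (-1) 0)"
    by (simp add: b_eq)
  have bn: "0 <= p 1 0 * x\<^sup>2 + p (-1) 0" by simp
  have d0: "(b x)\<^sup>2 = 4 * (a x * c x)" using assms(2) by (simp add: d_eq)
  have "b x ~= 0" using d0 a_pos[OF assms(1)] c_pos[OF assms(1)] by auto
  then have bneg: "b x < 0" using assms(3) by simp
  have "(b (-x))\<^sup>2 >= (b x)\<^sup>2"
  proof -
    define B2 where "B2 = p 1 0 * x\<^sup>2 + p (-1) 0"
    have "\<bar>b x\<bar> <= \<bar>- b x + 2 * B2\<bar>" using bneg bn unfolding B2_def[symmetric] by linarith
    then show ?thesis unfolding bm B2_def[symmetric] by (simp add: abs_le_square_iff)
  qed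
  moreover have "(b (-x))\<^sup>2 ~= (b x)\<^sup>2 | a (-x) * c (-x) ~= a x * c x"
  proof (rule ccontr)
    assume "\<not> ?thesis"
    then have e: "(b (-x))\<^sup>2 = (b x)\<^sup>2" "a (-x) * c (-x) = a x * c x" by auto
    from e(1) have "b (-x) = b x | b (-x) = - b x" by (simp add: power2_eq_iff)
    then have "p 1 0 * x\<^sup>2 + p (-1) 0 = 0" using bneg bn bm by auto
    then have p0: "p 1 0 = 0" "p (-1) 0 = 0"
      using assms(1) p_nonneg[of 1 0] p_nonneg[of "-1" 0]
      by (auto simp: add_nonneg_eq_0_iff)
    have A: "a x > 0" "c x > 0" using a_pos c_pos assms(1) by auto
    have "\<bar>a (-x)\<bar> * \<bar>c (-x)\<bar> = a x * c x" using e(2) A by (metis abs_mult abs_of_pos mult_pos_pos)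
    moreover have "\<bar>a (-x)\<bar> * \<bar>c (-x)\<bar> <= \<bar>a (-x)\<bar> * c x" using cm by (intro mult_left_mono) auto
    ultimately have aa: "\<bar>a (-x)\<bar> = a x" using am A by (metis mult_le_cancel_right_pos order_antisym)
    then have cc: "\<bar>c (-x)\<bar> = c x" using \<open>\<bar>a (-x)\<bar> * \<bar>c (-x)\<bar> = a x * c x\<close> A by simp
    have "a (-x) = a x & c (-x) = c x | a (-x) = - a x & c (-x) = - c x"
    proof (cases "a (-x) > 0")
      case True
      then have "a (-x) = a x" using aa by simp
      then show ?thesis using e(2) A by auto
    next
      case False
      then have am': "a (-x) = - a x" using aa by simp
      have "a x * (c (-x) + c x) = 0" using e(2) unfolding am' by (simp add: algebra_simps)
      then show ?thesis using A am' by auto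
    qed
    then show False
    proof
      assume "a (-x) = a x & c (-x) = c x"
      then have "p 0 1 = 0" "p 0 (-1) = 0" using assms(1) by (auto simp: a_eq c_eq)
      then show False using p0 assms(4) diagonal_iff by simp
    next
      assume "a (-x) = - a x & c (-x) = - c x"
      then have "p 1 1 * x\<^sup>2 + p (-1) 1 = 0" "p 1 (-1) * x\<^sup>2 + p (-1) (-1) = 0" by (auto simp: a_eq c_eq)
      then have "p 1 1 = 0" "p 1 (-1) = 0"
        using assms(1) p_nonneg by (auto simp: add_nonneg_eq_0_iff)
      then show False using p0 triples(1) by simp
    qed
  qed
  ultimately show ?thesis using ac d0 unfolding d_eq by auto
qed

text \<open>The left-most and right-most points of the curve, read through the exponential; s and t
  turn out to be \<open>x2 p\<close> and \<open>x3 p\<close>.\<close>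

definition is_left_right :: "real => real => bool" where
  "is_left_right s t \<longleftrightarrow> (\<exists>v w. phi p (ln s, v) = 1 & phi_v p (ln s) v = 0 & phi_u p (ln s) v < 0 \<and>
     phi p (ln t, w) = 1 & phi_v p (ln t) w = 0 & phi_u p (ln t) w > 0 & 0 < s & s < 1 & 1 < t)"

lemma ex_left_right: "\<exists>s t. is_left_right s t"
proof -
  obtain u v where 1: "phi p (u, v) = 1" "phi_v p u v = 0" "phi_u p u v < 0" "u < 0"
    using extreme_point[of "-1"] by auto
  obtain u' v' where 2: "phi p (u', v') = 1" "phi_v p u' v' = 0" "phi_u p u' v' > 0" "u' > 0"
    using extreme_point[of 1] by auto
  show ?thesis
    unfolding is_left_right_def
    by (rule exI[of _ "exp u"], rule exI[of _ "exp u'"], rule exI[of _ v], rule exI[of _ v']) (use 1 2 in auto)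
qed

lemma left_right_signs:
  assumes "is_left_right s t"
  shows "0 < s" "s < 1" "1 < t" "d s = 0" "d t = 0" "b s <= 0" "b t <= 0"
    and "\<exists>D>0. (d has_real_derivative D) (at s)" "\<exists>D<0. (d has_real_derivative D) (at t)"
proof -
  obtain v w where vw: "phi p (ln s, v) = 1" "phi_v p (ln s) v = 0" "phi_u p (ln s) v < 0"
     "phi p (ln t, w) = 1" "phi_v p (ln t) w = 0" "phi_u p (ln t) w > 0" and st: "0 < s" "s < 1" "1 < t"
    using assms unfolding is_left_right_def by blast
  then have e: "exp (ln s) = s" "exp (ln t) = t" by auto
  show "0 < s" "s < 1" "1 < t" by fact+
  show "d s = 0" "d t = 0" using horizontal_point(3)[OF vw(1,2)] horizontal_point(3)[OF vw(4,5)] e by auto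
  have ap: "a s > 0" "a t > 0" using a_pos st by auto
  show "b s <= 0" "b t <= 0"
    using horizontal_point(2)[OF vw(1,2)] horizontal_point(2)[OF vw(4,5)] e ap by auto
  show "\<exists>D>0. (d has_real_derivative D) (at s)"
    using horizontal_point(4)[OF vw(1,2)] vw(3) ap unfolding e
    by (intro exI[of _ "- 4 * a s * exp v * phi_u p (ln s) v"]) (auto simp: mult_less_0_iff)
  show "\<exists>D<0. (d has_real_derivative D) (at t)"
    using horizontal_point(4)[OF vw(4,5)] vw(6) ap unfolding e
    by (intro exI[of _ "- 4 * a t * exp w * phi_u p (ln t) w"]) auto
qed

text \<open>d is negative just left of s and just right of t, and outside the diagonal case it is
  positive at -s and -t. Sign changes give a root between -s and s and, in degree 4, one outside
  [-t, t]. In the diagonal case d is even. Counting against the degree shows that there are no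
  others.\<close>

lemma ex_branch_points:
  assumes "is_left_right s t"
  shows "\<exists>t1 t4. is_branch_points p t1 s t t4"
proof -
  note st = left_right_signs[OF assms]
  obtain w where w: "- s < w" "w < s" "d w < 0"
  proof -
    obtain D where D: "D > 0" "(d has_real_derivative D) (at s)" using st by blast
    obtain e where e: "e > 0" "\<And>h. h > 0 ==> h < e ==> d (s - h) < d s"
      using DERIV_pos_inc_left[OF D(2,1)] by auto
    show ?thesis using e(2)[of "min (e/2) (s/2)"] e(1) st by (intro that[of "s - min (e/2) (s/2)"]) auto
  qed
  obtain w' where w': "t < w'" "d w' < 0"
  proof -
    obtain D where D: "D < 0" "(d has_real_derivative D) (at t)" using st by blast
    obtain e where e: "e > 0" "\<And>h. h > 0 ==> h < e ==> d (t + h) < d t"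
      using DERIV_neg_dec_right[OF D(2,1)] by auto
    show ?thesis using e(2)[of "e/2"] e(1) st by (intro that[of "t + e/2"]) auto
  qed
  define R where "R = {x. d x = 0}"
  have fR: "finite R" unfolding R_def using poly_roots_finite[OF disc_nonzero] .
  have cR: "card R <= degree (disc_poly p)" unfolding R_def using card_poly_roots_bound[OF disc_nonzero] .
  show ?thesis
  proof (cases "diagonal_mass p = 1")
    case True
    then have z: "p 1 0 = 0" "p 0 1 = 0" "p (-1) 0 = 0" "p 0 (-1) = 0" using diagonal_iff by auto
    have even: "d (- x) = d x" for x by (simp add: d_eq a_eq b_eq c_eq z)
    have deg: "degree (disc_poly p) = 4"
      using z triples(1,2,8) unfolding disc_coeffs by (auto simp: pos_iff)
    have sub: "{- s, s, t, - t} \<subseteq> R" using st even by (auto simp: R_def)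
    have "card {- s, s, t, - t} = 4" using st by auto
    then have "R = {- s, s, t, - t}" using card_subset_eq[OF fR sub] cR deg card_mono[OF fR sub] by auto
    then have "is_branch_points p (- s) s t (ereal (- t))"
      unfolding is_branch_points_def R_def using st deg True by auto
    then show ?thesis by blast
  next
    case False
    have ds: "d (- s) > 0" and dt: "d (- t) > 0" using d_minus_pos st False by auto
    obtain x1 where x1: "- s < x1" "x1 < w" "d x1 = 0"
      using poly_IVT_neg[OF w(1) ds w(3)] by auto
    have x1': "\<bar>x1\<bar> < s" using x1 w by auto
    show ?thesis
    proof (cases "degree (disc_poly p) = 4")
      case deg: True
      have "\<exists>x4. \<bar>x4\<bar> > t & d x4 = 0"
      \<comment> \<open>The sign of the leading coefficient decides whether the fourth root lies to
        the right of t or to the left of -t.\<close>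
      proof (cases "lead_coeff (disc_poly p) > 0")
        case True
        then obtain N where N: "\<And>x. x >= N ==> d x >= lead_coeff (disc_poly p)" using poly_pinfty_gt_lc by blast
        then have "d (max N (w' + 1)) > 0" using True by (meson less_le_trans max.cobounded1)
        then obtain x where "w' < x" "d x = 0"
          using poly_IVT_pos[of w' "max N (w' + 1)" "disc_poly p"] w' by (auto simp: less_max_iff_disj)
        then show ?thesis using w' st by (intro exI[of _ x]) auto
      next
        case neg: False
        define q where "q = - (disc_poly p \<circ>\<^sub>p [:0, -1:])"
        have q: "poly q x = - d (- x)" for x by (simp add: q_def poly_pcompose)
        have "lead_coeff q = - lead_coeff (disc_poly p)"
          unfolding q_def by (simp add: lead_coeff_comp deg)
        moreover have "lead_coeff (disc_poly p) ~= 0" using disc_nonzero by simp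
        ultimately have lq: "lead_coeff q > 0" using neg by linarith
        then obtain N where N: "\<And>x. x >= N ==> poly q x >= lead_coeff q" using poly_pinfty_gt_lc by blast
        then have "poly q (max N (t + 1)) > 0" using lq by (meson less_le_trans max.cobounded1)
        then have "d (- max N (t + 1)) < 0" by (simp add: q)
        then obtain x where "x < - t" "d x = 0"
          using poly_IVT_pos[of "- max N (t + 1)" "- t" "disc_poly p"] dt by (auto simp: less_max_iff_disj)
        then show ?thesis using st by (intro exI[of _ x]) auto
      qed
      then obtain x4 where x4: "\<bar>x4\<bar> > t" "d x4 = 0" by blast
      have sub: "{x1, s, t, x4} \<subseteq> R" using st x1 x4 by (auto simp: R_def)
      have dist: "distinct [x1, s, t, x4]" using x1' x4 st by auto
      then have "card {x1, s, t, x4} = 4" by auto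
      then have "R = {x1, s, t, x4}" using card_subset_eq[OF fR sub] cR deg card_mono[OF fR sub] by auto
      then have "is_branch_points p x1 s t (ereal x4)"
        unfolding is_branch_points_def R_def using st deg False x1' x4 dist by auto
      then show ?thesis by blast
    next
      case False': False
      then have deg: "degree (disc_poly p) = 3" using disc_degree by auto
      have sub: "{x1, s, t} \<subseteq> R" using st x1 by (auto simp: R_def)
      have "x1 ~= s" "x1 ~= t" "s ~= t" using x1' st(1-3) by auto
      then have "card {x1, s, t} = 3" by simp
      then have "R = {x1, s, t}" using card_subset_eq[OF fR sub] cR deg card_mono[OF fR sub] by auto
      then have "is_branch_points p x1 s t \<infinity>"
        unfolding is_branch_points_def R_def using st deg False x1' by auto
      then show ?thesis by blast
    qed
  qed
qed

lemma branch_points_order: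
  assumes "is_branch_points p t1 t2 t3 t4"
  shows "diagonal_mass p ~= 1 ==> \<bar>t1\<bar> < \<bar>t2\<bar> & \<bar>t2\<bar> < 1 & 1 < \<bar>t3\<bar> & ereal \<bar>t3\<bar> < \<bar>t4\<bar>"
    and "diagonal_mass p = 1 ==> t2 = - t1 & 0 < t2 & t2 < 1 & 1 < t3 & ereal t3 = - t4"
    and "\<bar>t4\<bar> = \<infinity> --> t4 = \<infinity>" and "\<bar>t4\<bar> ~= \<infinity> \<longleftrightarrow> degree (disc_poly p) = 4"
proof -
  have i: "if diagonal_mass p = 1 then t2 = - t1 & t2 < 1 & 1 < t3 & ereal t3 = - t4
      else \<bar>t1\<bar> < \<bar>t2\<bar> & \<bar>t2\<bar> < 1 & 1 < \<bar>t3\<bar> & ereal \<bar>t3\<bar> < \<bar>t4\<bar>"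
    and p: "t2 > 0"
    using assms unfolding is_branch_points_def by blast+
  have g: "degree (disc_poly p) = 4 & \<bar>t4\<bar> ~= \<infinity> | degree (disc_poly p) = 3 & t4 = \<infinity>"
    using assms unfolding is_branch_points_def by (elim conjE) assumption
  show "diagonal_mass p ~= 1 ==> \<bar>t1\<bar> < \<bar>t2\<bar> & \<bar>t2\<bar> < 1 & 1 < \<bar>t3\<bar> & ereal \<bar>t3\<bar> < \<bar>t4\<bar>"
    "diagonal_mass p = 1 ==> t2 = - t1 & 0 < t2 & t2 < 1 & 1 < t3 & ereal t3 = - t4"
    using i p by auto
  show "\<bar>t4\<bar> = \<infinity> --> t4 = \<infinity>" "\<bar>t4\<bar> ~= \<infinity> \<longleftrightarrow> degree (disc_poly p) = 4" using g by auto
qed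

text \<open>Required because \<open>branch_points\<close> is a definite description. The set of
  roots is given, comparison with 1 separates the inner pair from the outer one, and within a pair
  the absolute values, or in the diagonal case the signs, differ.\<close>

lemma branch_points_unique:
  assumes "is_branch_points p t1 t2 t3 t4" "is_branch_points p s1 s2 s3 s4"
  shows "t1 = s1 & t2 = s2 & t3 = s3 & t4 = s4"
proof -
  define R where "R = {x. d x = 0}"
  have t: "R = {x. ereal x \<in> {ereal t1, ereal t2, ereal t3, t4}}"
    using assms(1) unfolding is_branch_points_def R_def by blast
  have s: "R = {x. ereal x \<in> {ereal s1, ereal s2, ereal s3, s4}}"
    using assms(2) unfolding is_branch_points_def R_def by blast
  have mem: "t1 \<in> R" "t2 \<in> R" "t3 \<in> R" unfolding t by simp_all
  have mems: "ereal t1 \<in> {ereal s1, ereal s2, ereal s3, s4}" "ereal t2 \<in> {ereal s1, ereal s2, ereal s3, s4}"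
    "ereal t3 \<in> {ereal s1, ereal s2, ereal s3, s4}"
    using mem unfolding s by blast+
  note ord_t = branch_points_order[OF assms(1)] and ord_s = branch_points_order[OF assms(2)]
  have fin: "\<bar>t4\<bar> = \<infinity> \<longleftrightarrow> \<bar>s4\<bar> = \<infinity>" "\<bar>t4\<bar> = \<infinity> --> t4 = \<infinity>" "\<bar>s4\<bar> = \<infinity> --> s4 = \<infinity>"
    using ord_t(3,4) ord_s(3,4) by auto
  show ?thesis
  proof (cases "\<bar>t4\<bar> = \<infinity>")
    case True
    then have inf: "t4 = \<infinity>" "s4 = \<infinity>" using fin by auto
    have nd: "diagonal_mass p ~= 1" using ord_t(2) inf by auto
    have o: "\<bar>t1\<bar> < \<bar>t2\<bar>" "\<bar>t2\<bar> < 1" "1 < \<bar>t3\<bar>" "\<bar>s1\<bar> < \<bar>s2\<bar>" "\<bar>s2\<bar> < 1" "1 < \<bar>s3\<bar>"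
      using ord_t(1)[OF nd] ord_s(1)[OF nd] by simp_all
    have m: "t1 = s1 | t1 = s2 | t1 = s3" "t2 = s1 | t2 = s2 | t2 = s3" "t3 = s1 | t3 = s2 | t3 = s3"
      using mems by (simp_all add: inf)
    have "t1 ~= s3" "t2 ~= s3" "t3 ~= s1" "t3 ~= s2" using o by (auto simp del: abs_less_iff)
    then show ?thesis using m ordered_pair_unique[of t1 s1 s2 t2] o inf by blast
  next
    case False
    then obtain x4 y4 where xy: "t4 = ereal x4" "s4 = ereal y4" using fin by (metis abs_ereal.simps ereal_cases)
    have "x4 \<in> R" unfolding t xy by simp
    then have m4: "x4 \<in> {s1, s2, s3, y4}" unfolding s xy by simp
    have m: "t1 \<in> {s1, s2, s3, y4}" "t2 \<in> {s1, s2, s3, y4}" "t3 \<in> {s1, s2, s3, y4}"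
      using mems by (simp_all add: xy)
    show ?thesis
    proof (cases "diagonal_mass p = 1")
      case True
      then have o: "t2 = - t1" "0 < t2" "t2 < 1" "1 < t3" "x4 = - t3" "s2 = - s1" "0 < s2" "s2 < 1" "1 < s3" "y4 = - s3"
        using ord_t(2)[OF True] ord_s(2)[OF True] by (auto simp: xy)
      have "t2 ~= s1" "t2 ~= s3" "t2 ~= y4" "t3 ~= s1" "t3 ~= s2" "t3 ~= y4" using o by linarith+
      then have "t2 = s2" "t3 = s3" using m by blast+
      then show ?thesis using o by (simp add: xy)
    next
      case False
      then have o: "\<bar>t1\<bar> < \<bar>t2\<bar>" "\<bar>t2\<bar> < 1" "1 < \<bar>t3\<bar>" "\<bar>t3\<bar> < \<bar>x4\<bar>" "\<bar>s1\<bar> < \<bar>s2\<bar>" "\<bar>s2\<bar> < 1" "1 < \<bar>s3\<bar>" "\<bar>s3\<bar> < \<bar>y4\<bar>"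
        using ord_t(1)[OF False] ord_s(1)[OF False] by (simp_all add: xy)
      then have "t1 ~= s3" "t2 ~= s3" "t1 ~= y4" "t2 ~= y4" "t3 ~= s1" "t3 ~= s2" "x4 ~= s1" "x4 ~= s2" by auto
      then have m': "t1 = s1 | t1 = s2" "t2 = s1 | t2 = s2" "t3 = s3 | t3 = y4" "x4 = s3 | x4 = y4"
        using m m4 by blast+
      show ?thesis
        using ordered_pair_unique[OF m'(1,2) o(1,5)] ordered_pair_unique[OF m'(3,4) o(4,8)] by (simp add: xy)
    qed
  qed
qed

lemma branch_points_left_right:
  assumes "is_left_right s t"
  shows "is_branch_points p (x1 p) (x2 p) (x3 p) (x4 p)" "x2 p = s" "x3 p = t"
proof -
  obtain t1 t4 where b: "is_branch_points p t1 s t t4" using ex_branch_points[OF assms] by blast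
  have "branch_points p = (t1, s, t, t4)"
    unfolding branch_points_def
  proof (rule the_equality)
    show "case (t1, s, t, t4) of (t1, t2, t3, t4) => is_branch_points p t1 t2 t3 t4" using b by simp
  next
    fix x assume "case x of (t1, t2, t3, t4) => is_branch_points p t1 t2 t3 t4"
    then show "x = (t1, s, t, t4)" using branch_points_unique[OF _ b] by (cases x) auto
  qed
  then show "is_branch_points p (x1 p) (x2 p) (x3 p) (x4 p)" "x2 p = s" "x3 p = t"
    using b by (auto simp: x1_def x2_def x3_def x4_def)
qed

lemma is_branch_points: "is_branch_points p (x1 p) (x2 p) (x3 p) (x4 p)"
  using ex_left_right branch_points_left_right by blast

text \<open>The root is a product of two factors, one per cut, built from \<open>csqrt\<close> of
  arguments that are nonpositive only on that cut. The second cut has three shapes: a half-line in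
  degree 3, two half-lines meeting at infinity if x4 is negative, a segment otherwise.\<close>

lemma ex_sqrt_disc: "\<exists>S. is_sqrt_disc p S"
proof -
  define t1 t2 t3 t4 where "t1 = x1 p" and "t2 = x2 p" and "t3 = x3 p" and "t4 = x4 p"
  note t_defs = t1_def t2_def t3_def t4_def
  have B: "is_branch_points p t1 t2 t3 t4" using is_branch_points by (simp add: t_defs)
  have t: "t1 < t2" "0 < t2" "t2 < 1" "1 < t3" using B by (auto simp: is_branch_points_def split: if_splits)
  \<comment> \<open>This fixes the sign of the constant k below. As a + b + c vanishes at 1, the
    value is the square of a - c, that is of the vertical drift.\<close>
  have d1: "d 1 > 0"
  proof -
    have "a 1 + b 1 + c 1 = 0" using p_total by (simp add: a_eq b_eq c_eq)
    then have b1: "b 1 = - (a 1 + c 1)" by simp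
    have "d 1 = (a 1 - c 1)\<^sup>2" unfolding d_eq b1 by (simp add: power2_eq_square algebra_simps)
    moreover have "a 1 - c 1 ~= 0" using drift_y_pos by (simp add: a_eq c_eq drift_y_def sum_unit_interval)
    ultimately show ?thesis by simp
  qed
  have of_real_cut: "of_real x \<in> cut12 p \<longleftrightarrow> t1 <= x & x <= t2" for x
    by (auto simp: cut12_def t_defs)
  have of_real_cut': "of_real x \<in> cut34 p \<longleftrightarrow> (if t4 < 0 then t3 <= x | ereal x <= t4 else t3 <= x & ereal x <= t4)" for x
    by (auto simp: cut34_def t_defs)
  define S12 where "S12 z = (z - of_real t1) * csqrt ((z - of_real t2) / (z - of_real t1))" for z
  have S12_hol: "S12 holomorphic_on - cut12 p"
  proof -
    have ne: "z - of_real t1 ~= 0" if "z \<in> - cut12 p" for z using that of_real_cut[of t1] t by auto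
    have "(z - of_real t2) / (z - of_real t1) \<notin> \<real>\<^sub>\<le>\<^sub>0" if z: "z \<in> - cut12 p" for z
    proof
      assume "(z - of_real t2) / (z - of_real t1) \<in> \<real>\<^sub>\<le>\<^sub>0"
      then obtain r where r: "r <= 0" "(z - of_real t2) / (z - of_real t1) = of_real r" by (auto elim: nonpos_Reals_cases)
      then have "z - of_real t2 = of_real r * (z - of_real t1)" using ne[OF z] by (simp add: field_simps)
      then have "z * of_real (1 - r) = of_real (t2 - r * t1)" by (simp add: algebra_simps)
      then have "z = of_real ((t2 - r * t1) / (1 - r))" using r(1) by (simp add: field_simps of_real_eq_1_iff[symmetric])
      moreover have "t1 <= (t2 - r * t1) / (1 - r)" using r(1) t by (simp add: field_simps)
      moreover have "(t2 - r * t1) / (1 - r) <= t2" using r(1) t mult_left_mono_neg[of t1 t2 r] by (simp add: field_simps)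
      ultimately have "z \<in> cut12 p" using of_real_cut[of "(t2 - r * t1) / (1 - r)"] by (simp only:)
      then show False using z by simp
    qed
    then show ?thesis unfolding S12_def using ne by (intro holomorphic_intros) auto
  qed
  have S12_sq: "(S12 z)\<^sup>2 = (z - of_real t1) * (z - of_real t2)" if "z \<in> - cut12 p" for z
  proof -
    have "z - of_real t1 ~= 0" using that of_real_cut[of t1] t by auto
    then show ?thesis unfolding S12_def power_mult_distrib power2_csqrt by (simp add: power2_eq_square)
  qed
  have csqrt_real: "csqrt (of_real x) \<in> \<real> & Re (csqrt (of_real x)) > 0" if "x > 0" for x
    using that by (simp add: of_real_sqrt[symmetric])
  have S12_pos: "S12 (of_real x) \<in> \<real> & Re (S12 (of_real x)) > 0" if "x > t2" for x
  proof -
    have "(of_real x - of_real t2) / (of_real x - of_real t1) = (of_real ((x - t2) / (x - t1)) :: complex)" by simp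
    then have "S12 (of_real x) = of_real ((x - t1) * sqrt ((x - t2) / (x - t1)))"
      unfolding S12_def using that t by (simp only: of_real_diff[symmetric]) (simp add: of_real_sqrt[symmetric] del: of_real_diff of_real_divide)
    then show ?thesis using that t by simp
  qed
  have "\<exists>G S34. S34 holomorphic_on - cut34 p & (\<forall>z\<in>- cut34 p. (S34 z)\<^sup>2 = G z) & (\<forall>x. t2 < x & x < t3 -->
      S34 (of_real x) \<in> \<real> & Re (S34 (of_real x)) > 0) & (\<exists>k. \<forall>z. cpoly (disc_poly p) z = of_real k * (z - of_real t1) * (z - of_real t2) * G z)"
  proof (cases "t4 = \<infinity>")
    case inf: True
    define S34 where "S34 z = csqrt (1 - z / of_real t3)" for z
    have cut: "of_real x \<in> cut34 p \<longleftrightarrow> t3 <= x" for x using of_real_cut' inf by simp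
    have "1 - z / of_real t3 \<notin> \<real>\<^sub>\<le>\<^sub>0" if "z \<in> - cut34 p" for z
    proof
      assume "1 - z / of_real t3 \<in> \<real>\<^sub>\<le>\<^sub>0"
      then obtain r where r: "r <= 0" "1 - z / of_real t3 = of_real r" by (auto elim: nonpos_Reals_cases)
      then have "z = of_real (t3 * (1 - r))" using t by (simp add: field_simps)
      moreover have "t3 <= t3 * (1 - r)" using r t by simp
      ultimately have "z \<in> cut34 p" using cut[of "t3 * (1 - r)"] by (simp only:)
      then show False using that by simp
    qed
    then have "S34 holomorphic_on - cut34 p" unfolding S34_def using t by (intro holomorphic_intros) auto
    moreover have "(S34 z)\<^sup>2 = 1 - z / of_real t3" for z by (simp add: S34_def)
    moreover have "S34 (of_real x) \<in> \<real> & Re (S34 (of_real x)) > 0" if "x < t3" for x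
      using csqrt_real[of "1 - x / t3"] that t by (simp add: S34_def)
    moreover have "\<exists>k. \<forall>z. cpoly (disc_poly p) z = of_real k * (z - of_real t1) * (z - of_real t2) * (1 - z / of_real t3)"
    proof -
      have "distinct [t1, t2, t3]" "degree (disc_poly p) = 3" "\<And>r. r \<in> set [t1, t2, t3] ==> d r = 0"
        using B inf by (auto simp: is_branch_points_def)
      then obtain k where k: "disc_poly p = smult k (\<Prod>r\<leftarrow>[t1, t2, t3]. [:-r, 1:])"
        using poly_distinct_roots_factor[of "[t1, t2, t3]" "disc_poly p"] by auto
      show ?thesis
        by (rule exI[of _ "- k * t3"], subst k) (use t in \<open>auto simp: map_poly_pCons field_simps\<close>)
    qed
    ultimately show ?thesis by (intro exI[of _ "%z. 1 - z / of_real t3"] exI[of _ S34]) auto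
  next
    case False
    then obtain x4 where x4: "t4 = ereal x4" using B by (cases t4) (auto simp: is_branch_points_def)
    have "distinct [t1, t2, t3, x4]" "degree (disc_poly p) = 4" "\<And>r. r \<in> set [t1, t2, t3, x4] ==> d r = 0"
      using B by (auto simp: is_branch_points_def x4)
    then obtain k where k: "disc_poly p = smult k (\<Prod>r\<leftarrow>[t1, t2, t3, x4]. [:-r, 1:])"
      using poly_distinct_roots_factor[of "[t1, t2, t3, x4]" "disc_poly p"] by auto
    have x4': "\<bar>x4\<bar> >= t3" "x4 ~= t3" using B t by (auto simp: is_branch_points_def x4 split: if_splits)
    have K: "cpoly (disc_poly p) z = of_real k * (z - of_real t1) * (z - of_real t2) * ((of_real t3 - z) * (of_real x4 - z))" for z
      by (subst k) (simp add: map_poly_pCons algebra_simps)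
    show ?thesis
    proof (cases "x4 < 0")
      case True
      define S34 where "S34 z = csqrt (of_real t3 - z) * csqrt (z - of_real x4)" for z
      have cut: "of_real x \<in> cut34 p \<longleftrightarrow> t3 <= x | x <= x4" for x using of_real_cut' True by (simp add: x4)
      have "of_real t3 - z \<notin> \<real>\<^sub>\<le>\<^sub>0 & z - of_real x4 \<notin> \<real>\<^sub>\<le>\<^sub>0" if "z \<in> - cut34 p" for z
      proof (intro conjI notI)
        assume "of_real t3 - z \<in> \<real>\<^sub>\<le>\<^sub>0"
        then obtain r where r: "r <= 0" "of_real t3 - z = of_real r" by (auto elim: nonpos_Reals_cases)
        then have "z = of_real (t3 - r)" by (simp add: algebra_simps)
        then have "z \<in> cut34 p" using cut[of "t3 - r"] r(1) by (simp only:) simp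
        then show False using that by simp
      next
        assume "z - of_real x4 \<in> \<real>\<^sub>\<le>\<^sub>0"
        then obtain r where r: "r <= 0" "z - of_real x4 = of_real r" by (auto elim: nonpos_Reals_cases)
        then have "z = of_real (x4 + r)" by (simp add: algebra_simps)
        then have "z \<in> cut34 p" using cut[of "x4 + r"] r(1) by (simp only:) simp
        then show False using that by simp
      qed
      then have "S34 holomorphic_on - cut34 p" unfolding S34_def by (intro holomorphic_intros) auto
      moreover have "(S34 z)\<^sup>2 = (of_real t3 - z) * (z - of_real x4)" for z by (simp add: S34_def power_mult_distrib)
      moreover have "S34 (of_real x) \<in> \<real> & Re (S34 (of_real x)) > 0" if "t2 < x" "x < t3" for x
        using csqrt_real[of "t3 - x"] csqrt_real[of "x - x4"] that t True by (auto simp: S34_def complex_is_Real_iff)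
      moreover have "\<exists>k. \<forall>z. cpoly (disc_poly p) z = of_real k * (z - of_real t1) * (z - of_real t2) * ((of_real t3 - z) * (z - of_real x4))"
        by (rule exI[of _ "- k"]) (simp add: K algebra_simps)
      ultimately show ?thesis by (intro exI[of _ "%z. (of_real t3 - z) * (z - of_real x4)"] exI[of _ S34]) auto
    next
      case False
      then have x43: "x4 > t3" using x4' by auto
      define S34 where "S34 z = (of_real x4 - z) * csqrt ((of_real t3 - z) / (of_real x4 - z))" for z
      have cut: "of_real x \<in> cut34 p \<longleftrightarrow> t3 <= x & x <= x4" for x using of_real_cut' False by (simp add: x4)
      have ne: "of_real x4 - z ~= 0" if "z \<in> - cut34 p" for z using that cut[of x4] x43 by auto
      have "(of_real t3 - z) / (of_real x4 - z) \<notin> \<real>\<^sub>\<le>\<^sub>0" if z: "z \<in> - cut34 p" for z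
      proof
        assume "(of_real t3 - z) / (of_real x4 - z) \<in> \<real>\<^sub>\<le>\<^sub>0"
        then obtain r where r: "r <= 0" "(of_real t3 - z) / (of_real x4 - z) = of_real r" by (auto elim: nonpos_Reals_cases)
        then have "of_real t3 - z = of_real r * (of_real x4 - z)" using ne[OF z] by (simp add: field_simps)
        then have "z * of_real (1 - r) = of_real (t3 - r * x4)" by (simp add: algebra_simps)
        then have "z = of_real ((t3 - r * x4) / (1 - r))" using r(1) by (simp add: field_simps of_real_eq_1_iff[symmetric])
        moreover have "t3 <= (t3 - r * x4) / (1 - r)" using r(1) x43 mult_left_mono_neg[of t3 x4 r] by (simp add: field_simps)
        moreover have "(t3 - r * x4) / (1 - r) <= x4" using r(1) x43 by (simp add: field_simps)
        ultimately have "z \<in> cut34 p" using cut[of "(t3 - r * x4) / (1 - r)"] by (simp only:)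
        then show False using z by simp
      qed
      then have "S34 holomorphic_on - cut34 p" unfolding S34_def using ne by (intro holomorphic_intros) auto
      moreover have "(S34 z)\<^sup>2 = (of_real t3 - z) * (of_real x4 - z)" if "z \<in> - cut34 p" for z
        unfolding S34_def power_mult_distrib power2_csqrt using ne[OF that] by (simp add: power2_eq_square)
      moreover have "S34 (of_real x) \<in> \<real> & Re (S34 (of_real x)) > 0" if "t2 < x" "x < t3" for x
      proof -
        have "(of_real t3 - of_real x) / (of_real x4 - of_real x) = (of_real ((t3 - x) / (x4 - x)) :: complex)" by simp
        then have "S34 (of_real x) = of_real ((x4 - x) * sqrt ((t3 - x) / (x4 - x)))"
          unfolding S34_def using that t x43 by (simp only: of_real_diff[symmetric]) (simp add: of_real_sqrt[symmetric] del: of_real_diff of_real_divide)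
        then show ?thesis using that x43 by simp
      qed
      ultimately show ?thesis using K by (intro exI[of _ "%z. (of_real t3 - z) * (of_real x4 - z)"] exI[of _ S34]) auto
    qed
  qed
  then obtain G S34 k where S: "S34 holomorphic_on - cut34 p" "\<And>z. z \<in> - cut34 p ==> (S34 z)\<^sup>2 = G z"
      "\<And>x. t2 < x ==> x < t3 ==> S34 (of_real x) \<in> \<real> & Re (S34 (of_real x)) > 0"
      "\<And>z. cpoly (disc_poly p) z = of_real k * (z - of_real t1) * (z - of_real t2) * G z"
    by blast
  have cp: "cpoly (disc_poly p) (of_real x) = of_real (d x)" for x :: real
    by (rule cpoly_of_real)
  have k: "k > 0"
  proof -
    have "1 \<in> - cut34 p" using of_real_cut'[of 1] t B by (cases t4) (auto simp: is_branch_points_def)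
    then have "(S34 1)\<^sup>2 = G 1" by (rule S(2))
    moreover have s1: "S34 1 = of_real (Re (S34 1))" "Re (S34 1) > 0" using S(3)[of 1] t by auto
    ultimately have G1: "G 1 = of_real ((Re (S34 1))\<^sup>2)" by (metis of_real_power)
    have "complex_of_real (d 1) = of_real (k * (1 - t1) * (1 - t2) * (Re (S34 1))\<^sup>2)"
      using S(4)[of 1] cp[of 1] unfolding G1 by simp
    then have "d 1 = k * ((1 - t1) * (1 - t2) * (Re (S34 1))\<^sup>2)" unfolding of_real_eq_iff by simp
    moreover have "(1 - t1) * (1 - t2) * (Re (S34 1))\<^sup>2 > 0" using t s1(2) by simp
    ultimately show ?thesis using d1 by (metis zero_less_mult_pos2)
  qed
  have "is_sqrt_disc p (%z. of_real (sqrt k) * S12 z * S34 z)"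
    unfolding is_sqrt_disc_def
  proof (intro conjI ballI)
    show "(%z. of_real (sqrt k) * S12 z * S34 z) holomorphic_on - (cut12 p \<union> cut34 p)"
      by (intro holomorphic_intros holomorphic_on_subset[OF S12_hol] holomorphic_on_subset[OF S(1)]) auto
  next
    fix z assume "z \<in> - (cut12 p \<union> cut34 p)"
    then show "(of_real (sqrt k) * S12 z * S34 z)\<^sup>2 = cpoly (disc_poly p) z"
      unfolding power_mult_distrib using S12_sq S(2) k by (simp add: S(4) mult.assoc flip: of_real_power)
  next
    fix x assume "x \<in> {x2 p<..<x3 p}"
    then have x: "t2 < x" "x < t3" by (auto simp: t_defs)
    obtain r where r: "S12 (of_real x) = of_real r" "r > 0" using S12_pos[OF x(1)] by (metis Re_complex_of_real Reals_cases)
    obtain r' where r': "S34 (of_real x) = of_real r'" "r' > 0" using S(3)[OF x] by (metis Re_complex_of_real Reals_cases)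
    show "of_real (sqrt k) * S12 (of_real x) * S34 (of_real x) \<in> \<real>"
      "0 < Re (of_real (sqrt k) * S12 (of_real x) * S34 (of_real x))"
      unfolding r(1) r'(1) using r(2) r'(2) k by auto
  qed
  then show ?thesis by blast
qed

lemma sqrt_disc: "is_sqrt_disc p (sqrt_disc p)"
  unfolding sqrt_disc_def using ex_sqrt_disc by (rule someI_ex)

end

section \<open>Complex weights on a line\<close>

text \<open>Total weight of the n-step walks on the integers from 0 to i, where a step to the left
  has weight \<alpha>, a pause \<beta> and a step to the right \<gamma>.\<close>

primrec line_weight :: "complex => complex => complex => nat => int => complex" where
  "line_weight \<alpha> \<beta> \<gamma> 0 = (%i. if i = 0 then 1 else 0)"
| "line_weight \<alpha> \<beta> \<gamma> (Suc n) = (%i. \<alpha> * line_weight \<alpha> \<beta> \<gamma> n (i + 1) + \<beta> * line_weight \<alpha> \<beta> \<gamma> n i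
     + \<gamma> * line_weight \<alpha> \<beta> \<gamma> n (i - 1))"

text \<open>Generating function, at the real tilt x, of the moduli of the three weights. When it is
  less than 1, sums over the number of steps converge geometrically.\<close>

definition line_norm :: "real => complex => complex => complex => real" where
  "line_norm x \<alpha> \<beta> \<gamma> = norm \<alpha> / x + norm \<beta> + norm \<gamma> * x"

definition line_green :: "complex => complex => complex => int => complex" where
  "line_green \<alpha> \<beta> \<gamma> i = (\<Sum>n. line_weight \<alpha> \<beta> \<gamma> n i)"

lemma line_weight_reflect: "line_weight \<alpha> \<beta> \<gamma> n (- i) = line_weight \<gamma> \<beta> \<alpha> n i"
proof (induction n arbitrary: i)
  case (Suc n)
  have "line_weight \<alpha> \<beta> \<gamma> n (- i + 1) = line_weight \<gamma> \<beta> \<alpha> n (i - 1)"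
    "line_weight \<alpha> \<beta> \<gamma> n (- i - 1) = line_weight \<gamma> \<beta> \<alpha> n (i + 1)"
  proof -
    have e: "- i + 1 = - (i - 1)" "- i - 1 = - (i + 1)" by simp_all
    show "line_weight \<alpha> \<beta> \<gamma> n (- i + 1) = line_weight \<gamma> \<beta> \<alpha> n (i - 1)"
      "line_weight \<alpha> \<beta> \<gamma> n (- i - 1) = line_weight \<gamma> \<beta> \<alpha> n (i + 1)"
      unfolding e Suc by (rule refl)+
  qed
  then show ?case using Suc[of i] by simp
qed simp

lemma line_green_reflect: "line_green \<alpha> \<beta> \<gamma> (- i) = line_green \<gamma> \<beta> \<alpha> i"
  by (simp add: line_green_def line_weight_reflect)

lemma line_norm_reflect: "x > 0 ==> line_norm (1 / x) \<gamma> \<beta> \<alpha> = line_norm x \<alpha> \<beta> \<gamma>"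
  by (simp add: line_norm_def)

lemma line_norm_nonneg: "x > 0 ==> 0 <= line_norm x \<alpha> \<beta> \<gamma>"
  by (simp add: line_norm_def)

lemma line_step_bound:
  assumes "x > 0" "norm (g (i + 1)) <= M * x powi (- (i + 1))" "norm (g i) <= M * x powi (- i)"
    "norm (g (i - 1)) <= M * x powi (- (i - 1))"
  shows "norm (\<alpha> * g (i + 1) + \<beta> * g i + \<gamma> * g (i - 1)) <= (M * line_norm x \<alpha> \<beta> \<gamma>) * x powi (- i)"
proof -
  have "norm (\<alpha> * g (i + 1) + \<beta> * g i + \<gamma> * g (i - 1)) <= norm \<alpha> * norm (g (i + 1)) + norm \<beta> * norm (g i) + norm \<gamma> * norm (g (i - 1))"
    by (metis (no_types, opaque_lifting) add.assoc norm_mult norm_triangle_le norm_triangle_mono order_refl)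
  also have "... <= norm \<alpha> * (M * x powi (- (i + 1))) + norm \<beta> * (M * x powi (- i)) + norm \<gamma> * (M * x powi (- (i - 1)))"
    using assms by (intro add_mono mult_left_mono) auto
  also have "x powi (- (i + 1)) = x powi (- i) / x" using assms(1) by (simp add: power_int_diff)
  also have "x powi (- (i - 1)) = x powi (- i) * x" using assms(1) by (simp add: power_int_diff power_int_minus divide_simps)
  finally show ?thesis by (simp add: line_norm_def algebra_simps)
qed

lemma line_weight_bound:
  assumes "x > 0" "line_norm x \<alpha> \<beta> \<gamma> <= q"
  shows "norm (line_weight \<alpha> \<beta> \<gamma> n i) <= q ^ n * x powi (- i)"
proof (induction n arbitrary: i)
  case 0
  then show ?case using assms by simp
next
  case (Suc n)
  have q: "0 <= q" using line_norm_nonneg[OF assms(1)] assms(2) order_trans by blast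
  have "norm (line_weight \<alpha> \<beta> \<gamma> (Suc n) i) <= (q ^ n * line_norm x \<alpha> \<beta> \<gamma>) * x powi (- i)"
    unfolding line_weight.simps by (rule line_step_bound[OF assms(1) Suc Suc Suc])
  also have "... <= (q ^ n * q) * x powi (- i)"
    using assms q by (intro mult_right_mono mult_left_mono) auto
  finally show ?case by (simp add: mult.commute)
qed

text \<open>Each use of the recurrence improves the weighted bound on g by the factor q < 1, and the
  zero at the origin keeps the recurrence on the half-line.\<close>

lemma line_unique:
  assumes "x > 0" "line_norm x \<alpha> \<beta> \<gamma> < 1" "g 0 = 0"
    and rec: "\<And>i. i >= 1 ==> g i = \<alpha> * g (i + 1) + \<beta> * g i + \<gamma> * g (i - 1)"
    and bd: "\<And>i. i >= 0 ==> norm (g i) <= C * x powi (- i)"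
    and "i >= 0"
  shows "g i = (0 :: complex)"
proof -
  define q where "q = line_norm x \<alpha> \<beta> \<gamma>"
  have q: "0 <= q" "q < 1" using line_norm_nonneg[OF assms(1)] assms(2) by (auto simp: q_def)
  have C: "0 <= C" using bd[of 0] by (simp add: order_trans[OF norm_ge_zero])
  have "norm (g i) <= C * q ^ n * x powi (- i)" if "i >= 0" for n i
    using that
  proof (induction n arbitrary: i)
    case (Suc n)
    show ?case
    proof (cases "i = 0")
      case False
      then have i: "i >= 1" using Suc.prems by simp
      have "norm (g i) = norm (\<alpha> * g (i + 1) + \<beta> * g i + \<gamma> * g (i - 1))"
        by (rule arg_cong[where f = norm, OF rec[OF i]])
      also have "... <= (C * q ^ n * q) * x powi (- i)"
        unfolding q_def by (rule line_step_bound[OF assms(1)]; rule Suc.IH[unfolded q_def]) (use i in auto)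
      finally have "norm (g i) <= (C * q ^ n * q) * x powi (- i)" .
      then show ?thesis by (simp add: mult_ac)
    qed (use C q assms in auto)
  qed (use bd in simp)
  then have le: "norm (g i) <= C * q ^ n * x powi (- i)" for n using \<open>i >= 0\<close> by blast
  have "(%n. C * q ^ n * x powi (- i)) \<longlonglongrightarrow> C * 0 * x powi (- i)"
    using q by (intro tendsto_intros LIMSEQ_power_zero) auto
  then have "norm (g i) <= C * 0 * x powi (- i)"
    using le by (intro LIMSEQ_le_const) auto
  then show ?thesis by simp
qed

text \<open>For complex weights of norm less than 1 the Green function on the line is geometric on both
  half-lines, because the recurrence it satisfies has only one bounded solution on a half-line.\<close>

context
  fixes x :: real and \<alpha> \<beta> \<gamma> :: complex
  assumes x: "x > 0" and less: "line_norm x \<alpha> \<beta> \<gamma> < 1"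
begin

lemma line_weight_summable: "summable (%n. line_weight \<alpha> \<beta> \<gamma> n i)"
proof (rule summable_comparison_test)
  show "summable (%n. line_norm x \<alpha> \<beta> \<gamma> ^ n * x powi (- i))"
    using less line_norm_nonneg[OF x] by (intro summable_mult2 summable_geometric) auto
qed (use line_weight_bound[OF x order_refl] in blast)

lemma line_green_bound: "norm (line_green \<alpha> \<beta> \<gamma> i) <= 1 / (1 - line_norm x \<alpha> \<beta> \<gamma>) * x powi (- i)"
proof -
  have s: "summable (%n. line_norm x \<alpha> \<beta> \<gamma> ^ n)"
    using less line_norm_nonneg[OF x] by (intro summable_geometric) auto
  have "norm (line_green \<alpha> \<beta> \<gamma> i) <= (\<Sum>n. line_norm x \<alpha> \<beta> \<gamma> ^ n * x powi (- i))"
    unfolding line_green_def using line_weight_bound[OF x order_refl] s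
    by (intro norm_suminf_le summable_mult2) auto
  also have "... = 1 / (1 - line_norm x \<alpha> \<beta> \<gamma>) * x powi (- i)"
    using s less line_norm_nonneg[OF x] by (simp add: suminf_mult2[symmetric] suminf_geometric)
  finally show ?thesis .
qed

lemma line_green_rec:
  "line_green \<alpha> \<beta> \<gamma> i = (if i = 0 then 1 else 0) + (\<alpha> * line_green \<alpha> \<beta> \<gamma> (i + 1) + \<beta> * line_green \<alpha> \<beta> \<gamma> i + \<gamma> * line_green \<alpha> \<beta> \<gamma> (i - 1))"
proof -
  have "line_green \<alpha> \<beta> \<gamma> i = (\<Sum>n. line_weight \<alpha> \<beta> \<gamma> (Suc n) i) + line_weight \<alpha> \<beta> \<gamma> 0 i"
    unfolding line_green_def using suminf_split_head[OF line_weight_summable] by simp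
  also have "(\<Sum>n. line_weight \<alpha> \<beta> \<gamma> (Suc n) i) = \<alpha> * line_green \<alpha> \<beta> \<gamma> (i + 1) + \<beta> * line_green \<alpha> \<beta> \<gamma> i + \<gamma> * line_green \<alpha> \<beta> \<gamma> (i - 1)"
    unfolding line_green_def line_weight.simps
    using line_weight_summable by (simp add: suminf_add[symmetric] suminf_mult summable_add summable_mult)
  finally show ?thesis by (simp only: line_weight.simps add.commute)
qed

lemma line_green_rec_nonzero:
  "i ~= 0 ==> line_green \<alpha> \<beta> \<gamma> i = \<alpha> * line_green \<alpha> \<beta> \<gamma> (i + 1) + \<beta> * line_green \<alpha> \<beta> \<gamma> i + \<gamma> * line_green \<alpha> \<beta> \<gamma> (i - 1)"
  by (subst (1) line_green_rec) (simp only: if_False add_0_left)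

text \<open>The cross-multiplied form avoids a division, since the value at 0 is shown to be nonzero
  only later.\<close>

lemma line_green_Suc: "i >= 0 ==> line_green \<alpha> \<beta> \<gamma> (i + 1) * line_green \<alpha> \<beta> \<gamma> 0 = line_green \<alpha> \<beta> \<gamma> 1 * line_green \<alpha> \<beta> \<gamma> i"
proof -
  assume i: "i >= 0"
  define V where "V = line_green \<alpha> \<beta> \<gamma>"
  define C where "C = 1 / (1 - line_norm x \<alpha> \<beta> \<gamma>)"
  have C: "C > 0" using less by (simp add: C_def)
  have V: "norm (V i) <= C * x powi (- i)" for i using line_green_bound by (simp add: V_def C_def)
  have "V (i + 1) * V 0 - V 1 * V i = 0"
  proof (rule line_unique[OF x less, where g = "%i. V (i + 1) * V 0 - V 1 * V i" and C = "C * norm (V 0) / x + norm (V 1) * C"])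
    fix i :: int assume i: "i >= 1"
    have "V i = \<alpha> * V (i + 1) + \<beta> * V i + \<gamma> * V (i - 1)" "V (i + 1) = \<alpha> * V (i + 2) + \<beta> * V (i + 1) + \<gamma> * V i"
      using line_green_rec[of i] line_green_rec[of "i + 1"] i by (simp_all add: V_def algebra_simps)
    moreover have e: "i + 1 + 1 = i + 2" "i - 1 + 1 = i" by simp_all
    ultimately show "V (i + 1) * V 0 - V 1 * V i = \<alpha> * (V (i + 1 + 1) * V 0 - V 1 * V (i + 1)) + \<beta> * (V (i + 1) * V 0 - V 1 * V i)
        + \<gamma> * (V (i - 1 + 1) * V 0 - V 1 * V (i - 1))"
      unfolding e by algebra
  next
    fix i :: int assume "i >= 0"
    have "norm (V (i + 1) * V 0 - V 1 * V i) <= norm (V (i + 1)) * norm (V 0) + norm (V 1) * norm (V i)"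
      by (metis norm_mult norm_triangle_ineq4)
    also have "... <= (C * x powi (- (i + 1))) * norm (V 0) + norm (V 1) * (C * x powi (- i))"
      by (intro add_mono mult_left_mono mult_right_mono V norm_ge_zero)
    also have "x powi (- (i + 1)) = x powi (- i) / x" using x by (simp add: power_int_diff)
    finally show "norm (V (i + 1) * V 0 - V 1 * V i) <= (C * norm (V 0) / x + norm (V 1) * C) * x powi (- i)"
      by (simp add: algebra_simps)
  qed (use i in auto)
  then show ?thesis by (simp add: V_def)
qed

end

context
  fixes x :: real and \<alpha> \<beta> \<gamma> :: complex
  assumes x: "x > 0" and less: "line_norm x \<alpha> \<beta> \<gamma> < 1"
begin

private lemma reflected: "1 / x > 0" "line_norm (1 / x) \<gamma> \<beta> \<alpha> < 1"
  using x less line_norm_reflect[OF x] by auto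

text \<open>A zero at 0 would, by uniqueness on both half-lines, make the Green function vanish
  everywhere, against the source term at 0.\<close>

lemma line_green_0_nonzero: "line_green \<alpha> \<beta> \<gamma> 0 ~= 0"
proof
  assume 0: "line_green \<alpha> \<beta> \<gamma> 0 = 0"
  have "line_green \<alpha> \<beta> \<gamma> i = 0" if "i >= 0" for i
    by (rule line_unique[OF x less 0 line_green_rec_nonzero[OF x less] line_green_bound[OF x less] that]) auto
  moreover have "line_green \<gamma> \<beta> \<alpha> 0 = 0" using 0 line_green_reflect[of \<alpha> \<beta> \<gamma> 0] by simp
  then have "line_green \<gamma> \<beta> \<alpha> i = 0" if "i >= 0" for i
    by (rule line_unique[OF reflected _ line_green_rec_nonzero[OF reflected] line_green_bound[OF reflected] that]) auto
  then have "line_green \<alpha> \<beta> \<gamma> (-1) = 0" using line_green_reflect[of \<alpha> \<beta> \<gamma> 1] by simp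
  ultimately show False using line_green_rec[OF x less, of 0] by simp
qed

end

abbreviation "line_ratio \<alpha> \<beta> \<gamma> \<equiv> line_green \<alpha> \<beta> \<gamma> 1 / line_green \<alpha> \<beta> \<gamma> 0"

context
  fixes x :: real and \<alpha> \<beta> \<gamma> :: complex
  assumes x: "x > 0" and less: "line_norm x \<alpha> \<beta> \<gamma> < 1"
begin

lemma line_green_geometric: "line_green \<alpha> \<beta> \<gamma> (int i) = line_green \<alpha> \<beta> \<gamma> 0 * line_ratio \<alpha> \<beta> \<gamma> ^ i"
proof (induction i)
  case (Suc i)
  have "line_green \<alpha> \<beta> \<gamma> (int i + 1) = line_ratio \<alpha> \<beta> \<gamma> * line_green \<alpha> \<beta> \<gamma> (int i)"
    using line_green_Suc[OF x less, of "int i"] line_green_0_nonzero[OF x less] by (simp add: field_simps)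
  then show ?case using Suc by (simp add: add.commute)
qed simp

lemma line_ratio_bound: "norm (line_ratio \<alpha> \<beta> \<gamma>) <= 1 / x"
proof (rule ccontr)
  assume "\<not> ?thesis"
  then have r: "norm (line_ratio \<alpha> \<beta> \<gamma>) * x > 1" using x by (simp add: field_simps)
  define V0 where "V0 = norm (line_green \<alpha> \<beta> \<gamma> 0)"
  have V0: "V0 > 0" using line_green_0_nonzero[OF x less] by (simp add: V0_def)
  define C where "C = 1 / (1 - line_norm x \<alpha> \<beta> \<gamma>)"
  obtain n where n: "C / V0 < (norm (line_ratio \<alpha> \<beta> \<gamma>) * x) ^ n" using real_arch_pow[OF r] by blast
  have "V0 * norm (line_ratio \<alpha> \<beta> \<gamma>) ^ n <= C * x powi (- int n)"
    using line_green_bound[OF x less, of "int n"] unfolding line_green_geometric by (simp add: V0_def C_def norm_mult norm_power norm_divide)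
  then have "V0 * (norm (line_ratio \<alpha> \<beta> \<gamma>) * x) ^ n <= C"
    using x by (simp add: power_int_minus power_mult_distrib field_simps)
  then show False using n V0 by (simp add: field_simps)
qed

lemma line_ratio_eq: "line_ratio \<alpha> \<beta> \<gamma> = \<gamma> + \<beta> * line_ratio \<alpha> \<beta> \<gamma> + \<alpha> * (line_ratio \<alpha> \<beta> \<gamma>)\<^sup>2"
proof -
  define r where "r = line_ratio \<alpha> \<beta> \<gamma>"
  define V0 where "V0 = line_green \<alpha> \<beta> \<gamma> 0"
  have V0: "V0 ~= 0" using line_green_0_nonzero[OF x less] by (simp add: V0_def)
  have e: "line_green \<alpha> \<beta> \<gamma> 1 = V0 * r" "line_green \<alpha> \<beta> \<gamma> 2 = V0 * r\<^sup>2"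
    using line_green_geometric[of 1] line_green_geometric[of 2]
    unfolding r_def[symmetric] unfolding V0_def[symmetric] by simp_all
  have "line_green \<alpha> \<beta> \<gamma> 1 = \<alpha> * line_green \<alpha> \<beta> \<gamma> 2 + \<beta> * line_green \<alpha> \<beta> \<gamma> 1 + \<gamma> * line_green \<alpha> \<beta> \<gamma> 0"
    using line_green_rec_nonzero[OF x less, of 1] by simp
  then have "V0 * r = \<alpha> * (V0 * r\<^sup>2) + \<beta> * (V0 * r) + \<gamma> * V0"
    unfolding e V0_def[symmetric] .
  then have "V0 * r = V0 * (\<gamma> + \<beta> * r + \<alpha> * r\<^sup>2)" by (simp add: algebra_simps)
  then have "r = \<gamma> + \<beta> * r + \<alpha> * r\<^sup>2" using V0 by (metis mult_left_cancel)
  then show ?thesis unfolding r_def .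
qed

end

text \<open>The ratio f to the right and the ratio g to the left solve mirrored quadratics, which
  together give (1 - f g)(\<gamma> g - \<alpha> f) = 0. As f g differs from 1, both neighbours
  contribute equally to the equation at 0, and what remains is the derivative of the quadratic at
  f.\<close>

lemma line_green_ratio:
  assumes "x > 0" "line_norm x \<alpha> \<beta> \<gamma> < 1" "line_ratio \<alpha> \<beta> \<gamma> * line_ratio \<gamma> \<beta> \<alpha> ~= 1"
  shows "line_green \<alpha> \<beta> \<gamma> 0 * (1 - \<beta> - 2 * \<alpha> * line_ratio \<alpha> \<beta> \<gamma>) = 1"
proof -
  have refl: "1 / x > 0" "line_norm (1 / x) \<gamma> \<beta> \<alpha> < 1" using assms line_norm_reflect by auto
  define V0 where "V0 = line_green \<alpha> \<beta> \<gamma> 0"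
  define f where "f = line_ratio \<alpha> \<beta> \<gamma>"
  define g where "g = line_ratio \<gamma> \<beta> \<alpha>"
  have V0': "line_green \<gamma> \<beta> \<alpha> 0 = V0" using line_green_reflect[of \<alpha> \<beta> \<gamma> 0] by (simp add: V0_def)
  have V0: "V0 ~= 0" using line_green_0_nonzero[OF assms(1,2)] by (simp add: V0_def)
  have "line_green \<alpha> \<beta> \<gamma> (-1) = V0 * g" using line_green_reflect[of \<alpha> \<beta> \<gamma> 1] V0 by (simp add: g_def V0')
  moreover have "line_green \<alpha> \<beta> \<gamma> 1 = V0 * f" using V0 by (simp add: f_def V0_def)
  ultimately have 1: "V0 = 1 + (\<alpha> * (V0 * f) + \<beta> * V0 + \<gamma> * (V0 * g))"
    using line_green_rec[OF assms(1,2), of 0] by (simp add: V0_def)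
  have f: "f = \<gamma> + \<beta> * f + \<alpha> * f\<^sup>2" unfolding f_def by (rule line_ratio_eq[OF assms(1,2)])
  have g: "g = \<alpha> + \<beta> * g + \<gamma> * g\<^sup>2" unfolding g_def by (rule line_ratio_eq[OF refl])
  have "(1 - f * g) * (\<gamma> * g - \<alpha> * f) = 0"
  proof -
    have "\<gamma> * g = (f - \<beta> * f - \<alpha> * f\<^sup>2) * g" using f by algebra
    moreover have "\<alpha> * f = (g - \<beta> * g - \<gamma> * g\<^sup>2) * f" using g by algebra
    ultimately show ?thesis by algebra
  qed
  moreover have "1 - f * g ~= 0"
    using assms(3) unfolding f_def[symmetric] g_def[symmetric] by (metis right_minus_eq)
  ultimately have "\<gamma> * g = \<alpha> * f" by (metis mult_eq_0_iff right_minus_eq)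
  then show ?thesis using 1 unfolding f_def[symmetric] unfolding V0_def[symmetric] by algebra
qed

lemma line_green_continuous:
  assumes "continuous_on A \<alpha>" "continuous_on A \<beta>" "continuous_on A \<gamma>"
    and "x > 0" "q < 1" "\<And>z. z \<in> A ==> line_norm x (\<alpha> z) (\<beta> z) (\<gamma> z) <= q"
  shows "continuous_on A (%z. line_green (\<alpha> z) (\<beta> z) (\<gamma> z) i)"
    and "uniform_limit A (%n z. \<Sum>k<n. line_weight (\<alpha> z) (\<beta> z) (\<gamma> z) k i) (%z. line_green (\<alpha> z) (\<beta> z) (\<gamma> z) i) sequentially"
proof -
  show u: "uniform_limit A (%n z. \<Sum>k<n. line_weight (\<alpha> z) (\<beta> z) (\<gamma> z) k i) (%z. line_green (\<alpha> z) (\<beta> z) (\<gamma> z) i) sequentially"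
  proof (cases "A = {}")
    case False
    then obtain z where "z \<in> A" by blast
    then have q: "0 <= q" using assms(6)[of z] line_norm_nonneg[OF assms(4)] order_trans by blast
    show ?thesis
      unfolding line_green_def
    proof (rule Weierstrass_m_test[where M = "%n. q ^ n * x powi (- i)"])
      show "norm (line_weight (\<alpha> z) (\<beta> z) (\<gamma> z) n i) <= q ^ n * x powi (- i)" if "z \<in> A" for n z
        using line_weight_bound[OF assms(4) assms(6)[OF that]] .
      show "summable (%n. q ^ n * x powi (- i))" using q assms(5) by (intro summable_mult2 summable_geometric) auto
    qed
  qed simp
  have w: "continuous_on A (%z. line_weight (\<alpha> z) (\<beta> z) (\<gamma> z) n i)" for n i
    by (induction n arbitrary: i) (auto intro!: continuous_intros assms(1-3))
  show "continuous_on A (%z. line_green (\<alpha> z) (\<beta> z) (\<gamma> z) i)"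
    by (rule uniform_limit_theorem[OF _ u]) (auto intro!: always_eventually continuous_intros w)
qed

lemma line_green_holomorphic:
  assumes "open A" "\<alpha> holomorphic_on A" "\<beta> holomorphic_on A" "\<gamma> holomorphic_on A"
    and "x > 0" "q < 1" "\<And>z. z \<in> A ==> line_norm x (\<alpha> z) (\<beta> z) (\<gamma> z) <= q"
  shows "(%z. line_green (\<alpha> z) (\<beta> z) (\<gamma> z) i) holomorphic_on A"
proof (rule holomorphic_uniform_sequence[OF assms(1)])
  have w: "(%z. line_weight (\<alpha> z) (\<beta> z) (\<gamma> z) n i) holomorphic_on A" for n i
    by (induction n arbitrary: i) (auto intro!: holomorphic_intros assms(2-4))
  show "(%z. \<Sum>k<n. line_weight (\<alpha> z) (\<beta> z) (\<gamma> z) k i) holomorphic_on A" for n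
    by (intro holomorphic_intros w)
  fix z assume "z \<in> A"
  then obtain d where d: "d > 0" "cball z d \<subseteq> A" using assms(1) open_contains_cball by blast
  have "uniform_limit A (%n z. \<Sum>k<n. line_weight (\<alpha> z) (\<beta> z) (\<gamma> z) k i) (%z. line_green (\<alpha> z) (\<beta> z) (\<gamma> z) i) sequentially"
    by (rule line_green_continuous(2)[OF _ _ _ assms(5-7)]) (auto intro!: holomorphic_on_imp_continuous_on assms)
  then show "\<exists>d>0. cball z d \<subseteq> A & uniform_limit (cball z d) (%n z. \<Sum>k<n. line_weight (\<alpha> z) (\<beta> z) (\<gamma> z) k i) (%z. line_green (\<alpha> z) (\<beta> z) (\<gamma> z) i) sequentially"
    using d uniform_limit_on_subset by blast
qed

context drift_walk begin

section \<open>The right-most point of the curve\<close>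

text \<open>The saddle of angle 0: the point of the curve with gradient in direction (1, 0).
  \<open>X0\<close> turns out to be \<open>x3 p\<close> and \<open>Y0\<close> to be
  \<open>s_y p 0\<close>.\<close>

definition right_point :: "real \<times> real" where
  "right_point = (SOME z. phi p z = 1 & phi_v p (fst z) (snd z) = 0 & phi_u p (fst z) (snd z) > 0)"

definition "u0 = fst right_point"
definition "v0 = snd right_point"
definition "X0 = exp u0"
definition "Y0 = exp v0"

lemma right_point: "phi p (u0, v0) = 1" "phi_v p u0 v0 = 0" "phi_u p u0 v0 > 0"
proof -
  obtain u v where "phi p (u, v) = 1 & phi_v p u v = 0 & phi_u p u v > 0"
    using extreme_point[of 1] by auto
  then have "\<exists>z. phi p z = 1 & phi_v p (fst z) (snd z) = 0 & phi_u p (fst z) (snd z) > 0"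
    by (intro exI[of _ "(u, v)"]) simp
  then have "phi p right_point = 1 & phi_v p (fst right_point) (snd right_point) = 0 & phi_u p (fst right_point) (snd right_point) > 0"
    unfolding right_point_def by (rule someI_ex)
  then show "phi p (u0, v0) = 1" "phi_v p u0 v0 = 0" "phi_u p u0 v0 > 0" by (auto simp: u0_def v0_def)
qed

lemma drifts: "phi_u p 0 0 = drift_x p" "phi_v p 0 0 = drift_y p"
  by (simp_all add: phi_u_def phi_v_def drift_x_def drift_y_def sum_unit_interval)

text \<open>The tangent inequality at the right-most point, tested at the origin, gives u0 > 0. The
  one at the origin, where the gradient is the drift, then forces v0 < 0 and puts \<open>Y0\<close>
  inside the unit disc.\<close>

lemma u0_pos: "u0 > 0" and v0_neg: "v0 < 0"
proof -
  have ne: "(u0, v0) ~= (0, 0)" using right_point(2) drifts(2) drift_y_pos by auto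
  have "phi_u p u0 v0 * (0 - u0) < 0"
    using phi_tangent[of 0 0 u0 v0] ne right_point phi_0 by auto
  then show u: "u0 > 0" using right_point(3) by (simp add: zero_less_mult_iff mult_less_0_iff)
  have "drift_x p * u0 + drift_y p * v0 < 0"
    using phi_tangent[OF ne] right_point(1) phi_0 by (simp add: drifts)
  moreover have "0 < drift_x p * u0" using u drift_x_pos by simp
  ultimately have "drift_y p * v0 < 0" by linarith
  then show "v0 < 0" using drift_y_pos by (simp add: mult_less_0_iff)
qed

lemma X0_gt_1: "X0 > 1" and Y0_pos: "Y0 > 0" and Y0_less_1: "Y0 < 1"
  using u0_pos v0_neg by (auto simp: X0_def Y0_def)

lemma right_point_branch: "\<exists>s. is_left_right s X0"
proof -
  obtain u v where 1: "phi p (u, v) = 1" "phi_v p u v = 0" "phi_u p u v < 0" "u < 0"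
    using extreme_point[of "-1"] by auto
  show ?thesis
    unfolding is_left_right_def X0_def
    by (rule exI[of _ "exp u"], rule exI[of _ v], rule exI[of _ v0]) (use 1 right_point u0_pos in auto)
qed

lemma x3_eq: "x3 p = X0"
  using right_point_branch branch_points_left_right(3) by blast

lemma kernel_Y0: "c X0 = a X0 * Y0\<^sup>2" "b X0 = - 2 * a X0 * Y0" "a X0 > 0" "c X0 > 0"
  using horizontal_point(1,2)[OF right_point(1,2)] a_pos[of X0] c_pos[of X0] by (simp_all add: X0_def Y0_def)

definition col :: "int => real => real" where
  "col k y = p k 1 * y + p k 0 + p k (-1) / y"

lemma col_nonneg: "y > 0 ==> col k y >= 0"
  by (simp add: col_def)

lemma phi_cols: "phi p (u, v) = col (-1) (exp v) / exp u + col 0 (exp v) + col 1 (exp v) * exp u"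
  unfolding phi_expand col_def by (simp add: exp_add exp_diff exp_minus field_simps)

lemma phi_u_cols: "phi_u p u v = col 1 (exp v) * exp u - col (-1) (exp v) / exp u"
  unfolding phi_u_def col_def by (simp add: exp_add exp_diff exp_minus field_simps)

lemma col_1_pos: "y > 0 ==> col 1 y > 0"
proof -
  assume y: "y > 0"
  have n: "0 <= p 1 1 * y" "0 <= p 1 0" "0 <= p 1 (-1) / y" using y by auto
  consider "0 < p 1 1 * y" | "0 < p 1 0" | "0 < p 1 (-1) / y" using triples(1) y by auto
  then show ?thesis using n unfolding col_def by cases linarith+
qed

section \<open>The generating function of the first passage to the next column\<close>

text \<open>A step changing the first coordinate by \<open>k\<close> gets the weight \<open>stp k s y\<close>: \<open>y\<close> marks the
  second coordinate and \<open>s\<close> marks the up steps.\<close>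

definition stp :: "int => complex => complex => complex" where
  "stp k s y = of_real (p k 1) * s * y + of_real (p k 0) + of_real (p k (-1)) / y"

definition VV :: "int => complex => complex => complex" where
  "VV i s y = line_green (stp (-1) s y) (stp 0 s y) (stp 1 s y) i"

definition F :: "complex => complex => complex" where
  "F s y = line_ratio (stp (-1) s y) (stp 0 s y) (stp 1 s y)"

definition "snorm x s y = line_norm x (stp (-1) s y) (stp 0 s y) (stp 1 s y)"

text \<open>Two tilts x < x' below \<open>X0\<close> at which the step norms stay below 1, for y in
  an annulus around |y| = \<open>Y0\<close> inside the unit disc and s slightly beyond the unit
  disc. Two of them are needed to keep the product of the passage ratios to the right and to the
  left below 1 in modulus. The condition on phi between x' and \<open>X0\<close> identifies F at
  \<open>Y0\<close>.\<close>

definition region :: "real \<times> real \<times> real \<times> real => bool" where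
  "region = (%(x, x', \<delta>, q). 0 < x & x < x' & x' < X0 & 0 < \<delta> & \<delta> < 1 & q < 1 & Y0 * exp \<delta> < 1 \<and>
     (\<forall>t. x' <= t --> t < X0 --> phi p (ln t, v0) < 1) \<and>
     (\<forall>s y. norm s <= 1 + \<delta> --> Y0 * exp (- \<delta>) <= norm y --> norm y <= Y0 * exp \<delta> -->
        snorm x s y <= q & snorm x' s y <= q))"

lemma stp_bound:
  assumes "norm s <= 1 + \<delta>" "Y0 * exp (- \<delta>) <= norm y" "norm y <= Y0 * exp \<delta>" "\<delta> >= 0"
  shows "norm (stp k s y) <= (1 + \<delta>) * exp \<delta> * col k Y0"
proof -
  have y: "norm y > 0" using assms(2) Y0_pos by (meson exp_gt_zero mult_pos_pos less_le_trans)
  have 1: "1 <= (1 + \<delta>) * exp \<delta>" using assms(4) mult_mono[of 1 "1 + \<delta>" 1 "exp \<delta>"] by simp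
  have 2: "exp \<delta> <= (1 + \<delta>) * exp \<delta>" using assms(4) by simp
  have "norm (stp k s y) <= p k 1 * (norm s * norm y) + p k 0 + p k (-1) * (1 / norm y)"
    unfolding stp_def by (intro norm_triangle_le add_mono) (simp_all add: norm_mult norm_divide)
  also have "... <= p k 1 * ((1 + \<delta>) * (Y0 * exp \<delta>)) + p k 0 * ((1 + \<delta>) * exp \<delta>) + p k (-1) * ((1 + \<delta>) * exp \<delta> / Y0)"
  proof (intro add_mono mult_left_mono p_nonneg mult_mono)
    show "p k 0 <= p k 0 * ((1 + \<delta>) * exp \<delta>)" using mult_left_mono[OF 1 p_nonneg] by simp
    have "1 / norm y <= 1 / (Y0 * exp (- \<delta>))" using assms(2) Y0_pos y by (intro divide_left_mono) auto
    also have "... = exp \<delta> / Y0" using Y0_pos by (simp add: exp_minus field_simps)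
    also have "... <= (1 + \<delta>) * exp \<delta> / Y0" using 2 Y0_pos by (intro divide_right_mono) auto
    finally show "1 / norm y <= (1 + \<delta>) * exp \<delta> / Y0" .
  qed (use assms in auto)
  finally show ?thesis by (simp add: col_def algebra_simps)
qed

lemma ex_region: "\<exists>r. region r"
proof -
  obtain e where e: "e > 0" "\<And>h. h > 0 ==> h < e ==> phi p (u0 - h, v0) < 1"
    using DERIV_pos_inc_left[OF phi_has_derivative_u right_point(3)] right_point(1) by auto
  \<comment> \<open>Just left of the right-most point phi is less than 1, so e leaves room for both
    tilts. A small \<delta> then keeps the perturbed bound (1 + \<delta>) exp \<delta> m below
    1.\<close>
  define x where "x = exp (u0 - 2 * e / 3)"
  define x' where "x' = exp (u0 - e / 3)"
  define m where "m = max (phi p (u0 - 2 * e / 3, v0)) (phi p (u0 - e / 3, v0))"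
  have m: "m < 1" using e(2)[of "2 * e / 3"] e(2)[of "e / 3"] e(1) by (simp add: m_def)
  have "((%\<delta>. (1 + \<delta>) * exp \<delta> * m) \<longlongrightarrow> (1 + 0) * exp 0 * m) (at_right (0::real))"
    by (intro tendsto_intros)
  then have 1: "eventually (%\<delta>. (1 + \<delta>) * exp \<delta> * m < 1) (at_right (0::real))"
    by (rule order_tendstoD) (use m in simp)
  have "((%\<delta>. Y0 * exp \<delta>) \<longlongrightarrow> Y0 * exp 0) (at_right (0::real))" by (intro tendsto_intros)
  then have 2: "eventually (%\<delta>. Y0 * exp \<delta> < 1) (at_right (0::real))"
    by (rule order_tendstoD) (use Y0_less_1 in simp)
  have 3: "eventually (%\<delta>::real. 0 < \<delta> & \<delta> < 1) (at_right 0)"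
    using eventually_at_right_real[of 0 1] by (auto simp: eventually_conj_iff elim: eventually_mono)
  obtain \<delta> where \<delta>: "(1 + \<delta>) * exp \<delta> * m < 1" "Y0 * exp \<delta> < 1" "0 < \<delta>" "\<delta> < 1"
    using eventually_happens'[OF _ eventually_conj[OF 1 eventually_conj[OF 2 3]]] by auto
  have bd: "snorm (exp u) s y <= (1 + \<delta>) * exp \<delta> * m"
    if "norm s <= 1 + \<delta>" "Y0 * exp (- \<delta>) <= norm y" "norm y <= Y0 * exp \<delta>" "phi p (u, v0) <= m" for u s y
  proof -
    note st = stp_bound[OF that(1-3)]
    have "snorm (exp u) s y <= ((1 + \<delta>) * exp \<delta> * col (-1) Y0) / exp u + (1 + \<delta>) * exp \<delta> * col 0 Y0 + ((1 + \<delta>) * exp \<delta> * col 1 Y0) * exp u"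
      unfolding snorm_def line_norm_def using \<delta> by (intro add_mono divide_right_mono mult_right_mono st) auto
    also have "... = (1 + \<delta>) * exp \<delta> * phi p (u, v0)"
      unfolding phi_cols Y0_def by (simp add: field_simps)
    also have "... <= (1 + \<delta>) * exp \<delta> * m" using that(4) \<delta> by (intro mult_left_mono) auto
    finally show ?thesis .
  qed
  have "phi p (ln t, v0) < 1" if "x' <= t" "t < X0" for t
  proof -
    have t: "t > 0" using that(1) unfolding x'_def by (meson exp_gt_zero less_le_trans)
    have "u0 - e / 3 <= ln t" "ln t < u0"
      using that t unfolding x'_def X0_def by (metis exp_le_cancel_iff exp_ln, metis exp_less_cancel_iff exp_ln)
    then show ?thesis using e(2)[of "u0 - ln t"] e(1) by auto
  qed
  then have "region (x, x', \<delta>, (1 + \<delta>) * exp \<delta> * m)"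
    unfolding region_def using \<delta> e(1) bd[of _ _ "u0 - 2 * e / 3"] bd[of _ _ "u0 - e / 3"]
    by (auto simp: x_def x'_def X0_def m_def)
  then show ?thesis by blast
qed

definition "rg = (SOME r. region r)"
definition "xa = fst rg"
definition "xb = fst (snd rg)"
definition "dl0 = fst (snd (snd rg))"
definition "q0 = snd (snd (snd rg))"

definition ann :: "complex set" where "ann = {y. Y0 * exp (- dl0) <= norm y & norm y <= Y0 * exp dl0}"
definition ann' :: "complex set" where "ann' = {y. Y0 * exp (- dl0) < norm y & norm y < Y0 * exp dl0}"

lemma region: "0 < xa" "xa < xb" "xb < X0" "0 < dl0" "dl0 < 1" "q0 < 1" "Y0 * exp dl0 < 1"
  and phi_below: "\<And>t. xb <= t ==> t < X0 ==> phi p (ln t, v0) < 1"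
  and snorm: "\<And>s y. norm s <= 1 + dl0 ==> y \<in> ann ==> snorm xa s y <= q0"
    "\<And>s y. norm s <= 1 + dl0 ==> y \<in> ann ==> snorm xb s y <= q0"
proof -
  have "region rg" unfolding rg_def using ex_region by (rule someI_ex)
  then have "region (xa, xb, dl0, q0)" by (simp add: xa_def xb_def dl0_def q0_def)
  then show "0 < xa" "xa < xb" "xb < X0" "0 < dl0" "dl0 < 1" "q0 < 1" "Y0 * exp dl0 < 1"
    "\<And>t. xb <= t ==> t < X0 ==> phi p (ln t, v0) < 1"
    "\<And>s y. norm s <= 1 + dl0 ==> y \<in> ann ==> snorm xa s y <= q0"
    "\<And>s y. norm s <= 1 + dl0 ==> y \<in> ann ==> snorm xb s y <= q0"
    unfolding region_def ann_def by auto
qed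

lemma ann'_sub: "ann' \<subseteq> ann" and ann_nz: "0 \<notin> ann" and open_ann': "open ann'"
proof -
  show "ann' \<subseteq> ann" by (auto simp: ann_def ann'_def)
  have "\<not> Y0 * exp (- dl0) <= 0" using Y0_pos by (simp add: not_le)
  then show "0 \<notin> ann" by (auto simp: ann_def)
  have "ann' = {y. Y0 * exp (- dl0) < norm y} \<inter> {y. norm y < Y0 * exp dl0}" by (auto simp: ann'_def)
  then show "open ann'" by (auto intro!: open_Int open_Collect_less continuous_intros)
qed

lemma Y0_ann': "norm y = Y0 ==> y \<in> ann'"
  using Y0_pos region(4) by (simp add: ann'_def)

lemma xb_pos: "0 < xb" using region by simp

context
  fixes s y :: complex
  assumes s: "norm s <= 1 + dl0" and y: "y \<in> ann"
begin

lemma norm_less: "line_norm xa (stp (-1) s y) (stp 0 s y) (stp 1 s y) < 1" "line_norm xb (stp (-1) s y) (stp 0 s y) (stp 1 s y) < 1"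
  using snorm[OF s y] region(6) by (auto simp: snorm_def)

lemma VV_0_nz: "VV 0 s y ~= 0"
  unfolding VV_def by (rule line_green_0_nonzero[OF xb_pos norm_less(2)])

lemma VV_eq: "VV (int i) s y = VV 0 s y * F s y ^ i"
  unfolding VV_def F_def by (rule line_green_geometric[OF xb_pos norm_less(2)])

lemma F_bound: "norm (F s y) <= 1 / xb"
  unfolding F_def by (rule line_ratio_bound[OF xb_pos norm_less(2)])

lemma F_eq: "F s y = stp 1 s y + stp 0 s y * F s y + stp (-1) s y * (F s y)\<^sup>2"
  unfolding F_def by (rule line_ratio_eq[OF xb_pos norm_less(2)])

lemma VV_0: "VV 0 s y * (1 - stp 0 s y - 2 * stp (-1) s y * F s y) = 1"
  unfolding VV_def F_def
proof (rule line_green_ratio[OF xb_pos norm_less(2)])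
  \<comment> \<open>The backward ratio is at most xa and the forward one at most 1/xb, so their
    product is less than 1.\<close>
  have "norm (line_ratio (stp 1 s y) (stp 0 s y) (stp (-1) s y)) <= 1 / (1 / xa)"
    by (rule line_ratio_bound) (use norm_less(1) region(1) line_norm_reflect in auto)
  then have "norm (F s y * line_ratio (stp 1 s y) (stp 0 s y) (stp (-1) s y)) <= (1 / xb) * xa"
    unfolding norm_mult using F_bound xb_pos by (intro mult_mono) auto
  also have "... < 1" using region by simp
  finally show "line_ratio (stp (-1) s y) (stp 0 s y) (stp 1 s y) * line_ratio (stp 1 s y) (stp 0 s y) (stp (-1) s y) ~= 1"
    by (auto simp: F_def)
qed

lemma VV_bound: "norm (VV 0 s y) <= 1 / (1 - q0)"
proof -
  have "norm (VV 0 s y) <= 1 / (1 - snorm xb s y)"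
    unfolding VV_def snorm_def using line_green_bound[OF xb_pos norm_less(2), of 0] by simp
  also have "... <= 1 / (1 - q0)" using snorm(2)[OF s y] region(6) by (intro divide_left_mono) auto
  finally show ?thesis .
qed

end

lemma VV_hol_s: "y \<in> ann ==> (%s. VV i s y) holomorphic_on ball 0 (1 + dl0)"
  unfolding VV_def stp_def
  by (rule line_green_holomorphic[OF open_ball _ _ _ xb_pos region(6)])
     (use snorm(2) in \<open>auto intro!: holomorphic_intros simp: snorm_def stp_def\<close>)

lemma VV_hol_y: "norm s <= 1 + dl0 ==> (%y. VV i s y) holomorphic_on ann'"
  unfolding VV_def stp_def
  by (rule line_green_holomorphic[OF open_ann' _ _ _ xb_pos region(6)])
     (use snorm(2) ann'_sub ann_nz in \<open>auto intro!: holomorphic_intros simp: snorm_def stp_def subset_iff\<close>)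

lemma F_VV: "F s y = VV 1 s y / VV 0 s y"
  by (simp add: F_def VV_def)

lemma F_hol_s: "y \<in> ann ==> (%s. F s y) holomorphic_on ball 0 (1 + dl0)"
  unfolding F_VV using VV_0_nz by (intro holomorphic_intros VV_hol_s) auto

lemma F_hol_y: "norm s <= 1 + dl0 ==> (%y. F s y) holomorphic_on ann'"
  unfolding F_VV using VV_0_nz ann'_sub by (intro holomorphic_intros VV_hol_y) auto

lemma VV_cont: "continuous_on ({s. norm s <= 1 + dl0} \<times> ann) (%z. VV i (fst z) (snd z))"
  unfolding VV_def stp_def
  by (rule line_green_continuous(1)[OF _ _ _ xb_pos region(6)])
     (use snorm(2) ann_nz in \<open>auto intro!: continuous_intros simp: snorm_def stp_def\<close>)

lemma F_cont: "continuous_on ({s. norm s <= 1 + dl0} \<times> ann) (%z. F (fst z) (snd z))"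
  unfolding F_VV using VV_0_nz by (intro continuous_intros VV_cont) auto

lemma F_cont': "continuous_on A f ==> continuous_on A g ==> (\<And>z. z \<in> A ==> norm (f z) <= 1 + dl0 & g z \<in> ann)
   ==> continuous_on A (%z. F (f z) (g z))"
  by (rule continuous_on_compose2[OF F_cont, where f = "%z. (f z, g z)", simplified])
     (auto intro!: continuous_intros)

lemma VV_cont': "continuous_on A f ==> continuous_on A g ==> (\<And>z. z \<in> A ==> norm (f z) <= 1 + dl0 & g z \<in> ann)
   ==> continuous_on A (%z. VV i (f z) (g z))"
  by (rule continuous_on_compose2[OF VV_cont, where f = "%z. (f z, g z)", simplified])
     (auto intro!: continuous_intros)

text \<open>Only up steps carry s: differentiating the quadratic equation for F in s with F held
  fixed gives y \<open>upf\<close> F.\<close>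

definition upf :: "complex => complex" where
  "upf w = of_real (p 1 1) + of_real (p 0 1) * w + of_real (p (-1) 1) * w\<^sup>2"

text \<open>Implicit differentiation of the quadratic equation; the factor in front of the
  derivative is the reciprocal of \<open>VV 0\<close> by \<open>VV_0\<close>. That
  \<open>VV 0\<close> appears here is what allows the s-integral to be done by parts.\<close>

lemma F_deriv_s:
  assumes "norm s < 1 + dl0" "y \<in> ann"
  shows "((%s. F s y) has_field_derivative VV 0 s y * y * upf (F s y)) (at s)"
proof -
  define D where "D = deriv (%s. F s y) s"
  have d: "((%s. F s y) has_field_derivative D) (at s)"
    unfolding D_def using F_hol_s[OF assms(2)] assms(1) by (intro holomorphic_derivI) auto
  have "((%s. stp 1 s y + stp 0 s y * F s y + stp (-1) s y * (F s y)\<^sup>2) has_field_derivative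
     of_real (p 1 1) * y + (of_real (p 0 1) * y * F s y + stp 0 s y * D) +
      (of_real (p (-1) 1) * y * (F s y)\<^sup>2 + stp (-1) s y * (2 * F s y * D))) (at s)"
    unfolding stp_def by (auto intro!: derivative_eq_intros d)
  moreover have ev: "eventually (%s. F s y = stp 1 s y + stp 0 s y * F s y + stp (-1) s y * (F s y)\<^sup>2) (nhds s)"
  proof (rule eventually_mono)
    show "eventually (%s. s \<in> ball 0 (1 + dl0)) (nhds s)" using assms(1) by (intro eventually_nhds_in_open) auto
  qed (use F_eq[OF _ assms(2)] in auto)
  ultimately have "((%s. F s y) has_field_derivative 
     of_real (p 1 1) * y + (of_real (p 0 1) * y * F s y + stp 0 s y * D) +
      (of_real (p (-1) 1) * y * (F s y)\<^sup>2 + stp (-1) s y * (2 * F s y * D))) (at s)"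
    using DERIV_cong_ev[OF refl ev refl] by blast
  then have "D = of_real (p 1 1) * y + (of_real (p 0 1) * y * F s y + stp 0 s y * D) +
      (of_real (p (-1) 1) * y * (F s y)\<^sup>2 + stp (-1) s y * (2 * F s y * D))"
    using d DERIV_unique by blast
  moreover have key: "D * (1 - S - 2 * R * f) = A + B + C" if "D = A + (B + S * D) + (C + R * (2 * f * D))" for A B C S R f :: complex
    using that by algebra
  ultimately have "D * (1 - stp 0 s y - 2 * stp (-1) s y * F s y)
      = of_real (p 1 1) * y + of_real (p 0 1) * y * F s y + of_real (p (-1) 1) * y * (F s y)\<^sup>2"
    by (intro key)
  also have "... = y * upf (F s y)" by (simp add: upf_def algebra_simps)
  finally have e: "D * (1 - stp 0 s y - 2 * stp (-1) s y * F s y) = y * upf (F s y)" .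
  have "D = D * (VV 0 s y * (1 - stp 0 s y - 2 * stp (-1) s y * F s y))"
    using VV_0[OF _ assms(2), of s] assms(1) by simp
  also have "... = VV 0 s y * (D * (1 - stp 0 s y - 2 * stp (-1) s y * F s y))"
    by (rule mult.left_commute)
  finally have "D = VV 0 s y * (y * upf (F s y))" unfolding e .
  then show ?thesis using d by (simp add: mult.assoc)
qed

end

section \<open>Real nonnegative weights on the line\<close>

lemma line_weight_real:
  assumes "\<alpha> = of_real \<alpha>'" "\<beta> = of_real \<beta>'" "\<gamma> = of_real \<gamma>'" "0 <= \<alpha>'" "0 <= \<beta>'" "0 <= \<gamma>'"
  shows "\<exists>r\<ge>0. line_weight \<alpha> \<beta> \<gamma> n i = of_real r"
proof (induction n arbitrary: i)
  case 0
  show ?case by (intro exI[of _ "if i = 0 then 1 else 0"]) auto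
next
  case (Suc n)
  obtain r1 r2 r3 where r: "r1 >= 0" "line_weight \<alpha> \<beta> \<gamma> n (i + 1) = of_real r1" "r2 >= 0" "line_weight \<alpha> \<beta> \<gamma> n i = of_real r2"
    "r3 >= 0" "line_weight \<alpha> \<beta> \<gamma> n (i - 1) = of_real r3"
    using Suc by metis
  show ?case
    by (intro exI[of _ "\<alpha>' * r1 + \<beta>' * r2 + \<gamma>' * r3"]) (use r assms in auto)
qed

lemma line_green_real:
  assumes "\<alpha> = of_real \<alpha>'" "\<beta> = of_real \<beta>'" "\<gamma> = of_real \<gamma>'" "0 <= \<alpha>'" "0 <= \<beta>'" "0 <= \<gamma>'"
    and "x > 0" "line_norm x \<alpha> \<beta> \<gamma> < 1"
  shows "\<exists>r\<ge>0. line_green \<alpha> \<beta> \<gamma> i = of_real r"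
proof -
  obtain w where w: "\<And>n. w n >= 0" "\<And>n. line_weight \<alpha> \<beta> \<gamma> n i = of_real (w n)"
  proof (rule that[of "%n. Re (line_weight \<alpha> \<beta> \<gamma> n i)"])
    fix n
    obtain r where "r >= 0" "line_weight \<alpha> \<beta> \<gamma> n i = of_real r"
      using line_weight_real[OF assms(1-6)] by blast
    then show "Re (line_weight \<alpha> \<beta> \<gamma> n i) >= 0" "line_weight \<alpha> \<beta> \<gamma> n i = of_real (Re (line_weight \<alpha> \<beta> \<gamma> n i))" by auto
  qed
  have s: "(%n. complex_of_real (w n)) sums line_green \<alpha> \<beta> \<gamma> i"
    using summable_sums[OF line_weight_summable[OF assms(7,8), of i]] unfolding line_green_def w(2) .
  have "summable w" using sums_Re[OF s] by (simp add: sums_iff)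
  moreover have "line_green \<alpha> \<beta> \<gamma> i = of_real (suminf w)"
    using s sums_of_real[OF summable_sums[OF \<open>summable w\<close>]] sums_unique2 by blast
  ultimately show ?thesis using suminf_nonneg w(1) by blast
qed

lemma unit_complex_eq_1:
  assumes "norm w = 1" "0 <= s" "s <= 1" "s * Re w = 1"
  shows "s = 1" "w = 1"
proof -
  have "Re w <= 1" using complex_Re_le_cmod[of w] assms(1) by simp
  then have "s * Re w <= s" using assms(2) by (simp add: mult_left_le)
  then show s: "s = 1" using assms by linarith
  then have "Re w = 1" using assms by simp
  moreover have "(Re w)\<^sup>2 + (Im w)\<^sup>2 = 1" using assms(1) by (metis cmod_power2 one_power2)
  ultimately show "w = 1" by (simp add: complex_eq_iff)
qed

context drift_walk begin

section \<open>First passage for real and for rotated arguments\<close>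

definition fr :: "real => real" where "fr y = Re (F 1 (of_real y))"

lemma norm_1_le: "norm (1::complex) <= 1 + dl0"
  using region(4) by simp

context
  fixes y :: real
  assumes y: "y > 0" "of_real y \<in> ann"
begin

lemma stp_real: "stp k 1 (of_real y) = of_real (col k y)"
  by (simp add: stp_def col_def)

lemma VV_real: "\<exists>r\<ge>0. VV i 1 (of_real y) = of_real r"
  unfolding VV_def
  by (rule line_green_real[OF stp_real stp_real stp_real col_nonneg col_nonneg col_nonneg xb_pos norm_less(2)[OF norm_1_le y(2)]])
     (use y in auto)

lemma F_real: "F 1 (of_real y) = of_real (fr y)" and fr_pos: "fr y > 0"
proof -
  obtain r0 r1 where r: "r0 >= 0" "VV 0 1 (of_real y) = of_real r0" "r1 >= 0" "VV 1 1 (of_real y) = of_real r1"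
    using VV_real by metis
  have e: "F 1 (of_real y) = of_real (r1 / r0)" unfolding F_VV r by simp
  then show 1: "F 1 (of_real y) = of_real (fr y)" by (simp add: fr_def)
  have "fr y >= 0" using r e by (simp add: fr_def)
  moreover have "fr y ~= 0"
  proof
    assume "fr y = 0"
    then have "stp 1 1 (of_real y) = 0" using F_eq[OF norm_1_le y(2)] 1 by simp
    then show False using col_1_pos[OF y(1)] by (simp add: stp_real)
  qed
  ultimately show "fr y > 0" by simp
qed

lemma fr_eq: "fr y = col 1 y + col 0 y * fr y + col (-1) y * (fr y)\<^sup>2"
proof -
  have "complex_of_real (fr y) = of_real (col 1 y + col 0 y * fr y + col (-1) y * (fr y)\<^sup>2)"
    using F_eq[OF norm_1_le y(2)] unfolding F_real stp_real by simp
  then show ?thesis unfolding of_real_eq_iff .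
qed

lemma fr_phi: "phi p (- ln (fr y), ln y) = 1"
  using fr_eq fr_pos y unfolding phi_cols by (simp add: exp_minus divide_simps power2_eq_square algebra_simps)

text \<open>\<open>VV 0\<close> is nonnegative and its product with the derivative factor of the
  quadratic is 1. The sign of that factor selects the right-hand branch of the curve.\<close>

lemma fr_phi_u: "phi_u p (- ln (fr y)) (ln y) > 0"
proof -
  obtain r0 where r: "r0 >= 0" "VV 0 1 (of_real y) = of_real r0" using VV_real by blast
  have "complex_of_real (r0 * (1 - col 0 y - 2 * col (-1) y * fr y)) = of_real 1"
    using VV_0[OF norm_1_le y(2)] unfolding F_real stp_real r by simp
  then have "r0 * (1 - col 0 y - 2 * col (-1) y * fr y) = 1" unfolding of_real_eq_iff .
  then have "1 - col 0 y - 2 * col (-1) y * fr y > 0" using r(1) by (metis zero_less_mult_pos zero_less_one mult_zero_left less_le)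
  moreover have "fr y * phi_u p (- ln (fr y)) (ln y) = fr y * (1 - col 0 y - 2 * col (-1) y * fr y)"
  proof -
    have "fr y * fr y = fr y * (col 1 y + col 0 y * fr y + col (-1) y * (fr y)\<^sup>2)"
      by (rule arg_cong[OF fr_eq])
    then show ?thesis
      using fr_pos y unfolding phi_u_cols by (simp add: exp_minus divide_simps power2_eq_square algebra_simps)
  qed
  ultimately show ?thesis using fr_pos by simp
qed

lemma fr_bound: "xb <= 1 / fr y"
  using F_bound[OF norm_1_le y(2)] fr_pos xb_pos unfolding F_real by (simp add: field_simps)

end

lemma Y0_ann: "of_real Y0 \<in> ann" using Y0_ann'[of "of_real Y0"] ann'_sub Y0_pos by auto

text \<open>On the line of second coordinate v0 the tangent inequality at (u0, v0) excludes points
  of the curve to the right of u0. To the left, phi < 1 from xb up to \<open>X0\<close>, and 1/fr is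
  at least xb.\<close>

lemma fr_Y0: "fr Y0 = 1 / X0"
proof -
  define u where "u = - ln (fr Y0)"
  have pos: "fr Y0 > 0" by (rule fr_pos[OF Y0_pos Y0_ann])
  have eu: "exp u = 1 / fr Y0" using pos by (simp add: u_def exp_minus inverse_eq_divide)
  have ph: "phi p (u, v0) = 1" using fr_phi[OF Y0_pos Y0_ann] by (simp add: u_def Y0_def)
  have "\<not> exp u < X0"
  proof
    assume "exp u < X0"
    then have "phi p (ln (exp u), v0) < 1" using fr_bound[OF Y0_pos Y0_ann] by (intro phi_below) (simp_all add: eu)
    then show False using ph by simp
  qed
  moreover have "\<not> exp u > X0"
  proof
    assume "exp u > X0"
    then have "u > u0" by (simp add: X0_def)
    then have "phi_u p u0 v0 * (u - u0) > 0" using right_point(3) by simp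
    moreover have "phi_u p u0 v0 * (u - u0) < 0"
      using phi_tangent[of u v0 u0 v0] \<open>u > u0\<close> right_point ph by simp
    ultimately show False by linarith
  qed
  ultimately show ?thesis using eu pos X0_gt_1 by (simp add: field_simps)
qed

text \<open>The equality case of the triangle inequality, together with the fact that the steps of the
  walk generate the whole lattice or, in the diagonal case, its even sublattice.\<close>

lemma F_strict:
  assumes s: "0 <= s" "s <= 1" and y: "norm y = Y0" and ge: "norm (F (of_real s) y) >= 1 / X0"
  shows "s = 1 & (y = of_real Y0 | diagonal_mass p = 1 & y = - of_real Y0)"
proof -
  define f where "f = F (of_real s) y"
  define X where "X = 1 / f"
  define x where "x = norm X"
  have yann: "y \<in> ann" using Y0_ann'[OF y] ann'_sub by auto
  have sn: "norm (complex_of_real s) <= 1 + dl0" using s region(4) by simp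
  have y0: "y ~= 0" using y Y0_pos by auto
  have X0p: "X0 > 0" using X0_gt_1 by simp
  have "1 / X0 > 0" using X0p by simp
  then have fn: "norm f > 0" using ge unfolding f_def by linarith
  then have f0: "f ~= 0" by auto
  have X: "X ~= 0" "1 / X = f" using f0 by (auto simp: X_def)
  have x: "0 < x" "x <= X0" "xb <= x" "norm f = 1 / x"
    using fn ge F_bound[OF sn yann] X0p xb_pos by (auto simp: x_def X_def f_def norm_divide field_simps)
  have "f = stp 1 (of_real s) y + stp 0 (of_real s) y * f + stp (-1) (of_real s) y * f\<^sup>2"
    using F_eq[OF sn yann] by (simp add: f_def)
  then have "1 = stp 1 (of_real s) y * X + stp 0 (of_real s) y + stp (-1) (of_real s) y / X"
    using f0 unfolding X_def by (simp add: field_simps power2_eq_square)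
  then have sum1: "1 = of_real (p 1 1) * (of_real s * (X * y)) + of_real (p 1 0) * X + of_real (p 1 (-1)) * (X / y)
     + of_real (p 0 (-1)) * (1 / y) + of_real (p (-1) (-1)) * (1 / (X * y)) + of_real (p (-1) 0) * (1 / X)
     + of_real (p (-1) 1) * (of_real s * (y / X)) + of_real (p 0 1) * (of_real s * y)"
  proof -
    have "stp 1 (of_real s) y * X = of_real (p 1 1) * (of_real s * (X * y)) + of_real (p 1 0) * X + of_real (p 1 (-1)) * (X / y)"
      "stp (-1) (of_real s) y / X = of_real (p (-1) (-1)) * (1 / (X * y)) + of_real (p (-1) 0) * (1 / X) + of_real (p (-1) 1) * (of_real s * (y / X))"
      "stp 0 (of_real s) y = of_real (p 0 (-1)) * (1 / y) + of_real (p 0 1) * (of_real s * y)"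
      using X(1) y0 by (simp_all add: stp_def field_simps)
    then show ?thesis using \<open>1 = stp 1 (of_real s) y * X + stp 0 (of_real s) y + stp (-1) (of_real s) y / X\<close>
      by (simp only: add_ac)
  qed
  define g where "g P w m = (P::real) * (m - Re w)" for P w m
  \<comment> \<open>D adds up the gaps between the bound on the modulus and the real part of each
    term. Since the terms sum to 1, it equals phi - 1 at (ln x, v0).\<close>
  define D where "D = g (p 1 1) (of_real s * (X * y)) (x * Y0) + g (p 1 0) X x + g (p 1 (-1)) (X / y) (x / Y0)
     + g (p 0 (-1)) (1 / y) (1 / Y0) + g (p (-1) (-1)) (1 / (X * y)) (1 / (x * Y0)) + g (p (-1) 0) (1 / X) (1 / x)
     + g (p (-1) 1) (of_real s * (y / X)) (Y0 / x) + g (p 0 1) (of_real s * y) Y0"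
  have "D = phi p (ln x, v0) - 1"
  proof -
    have "phi p (ln x, v0) = p 1 1 * (x * Y0) + p 1 0 * x + p 1 (-1) * (x / Y0) + p 0 (-1) * (1 / Y0)
      + p (-1) (-1) * (1 / (x * Y0)) + p (-1) 0 * (1 / x) + p (-1) 1 * (Y0 / x) + p 0 1 * Y0"
      unfolding phi_expand Y0_def using x(1) by (simp add: exp_add exp_diff exp_minus field_simps)
    moreover have "1 = Re (of_real (p 1 1) * (of_real s * (X * y)) + of_real (p 1 0) * X + of_real (p 1 (-1)) * (X / y)
     + of_real (p 0 (-1)) * (1 / y) + of_real (p (-1) (-1)) * (1 / (X * y)) + of_real (p (-1) 0) * (1 / X)
     + of_real (p (-1) 1) * (of_real s * (y / X)) + of_real (p 0 1) * (of_real s * y))"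
      unfolding sum1[symmetric] by simp
    moreover have RM: "Re (of_real r * w) = r * Re w" for r w by simp
    ultimately show ?thesis unfolding D_def g_def plus_complex.sel RM by (simp only: right_diff_distrib)
  qed
  have Re_le: "Re w <= m" if "norm w <= m" for w m using complex_Re_le_cmod[of w] that by linarith
  have sle: "s * r <= r" if "r >= 0" for r using s that by (simp add: mult_left_le_one_le)
  have m: "norm (of_real s * (X * y)) <= x * Y0" "norm X <= x" "norm (X / y) <= x / Y0" "norm (1 / y) <= 1 / Y0"
     "norm (1 / (X * y)) <= 1 / (x * Y0)" "norm (1 / X) <= 1 / x" "norm (of_real s * (y / X)) <= Y0 / x" "norm (of_real s * y) <= Y0"
    using sle[of "x * Y0"] sle[of "Y0 / x"] sle[of Y0] s x(1) Y0_pos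
    by (simp_all add: norm_mult norm_divide y x_def)
  have g0: "0 <= g P w m" if "norm w <= m" "0 <= P" for P w m
    unfolding g_def using Re_le[OF that(1)] that(2) by simp
  note gm = g0[OF m(1) p_nonneg[of 1 1]] g0[OF m(2) p_nonneg[of 1 0]] g0[OF m(3) p_nonneg[of 1 "-1"]] g0[OF m(4) p_nonneg[of 0 "-1"]]
    g0[OF m(5) p_nonneg[of "-1" "-1"]] g0[OF m(6) p_nonneg[of "-1" 0]] g0[OF m(7) p_nonneg[of "-1" 1]] g0[OF m(8) p_nonneg[of 0 1]]
  have "D >= 0" unfolding D_def using gm by linarith
  then have "\<not> x < X0" using phi_below[OF x(3)] \<open>D = phi p (ln x, v0) - 1\<close> by linarith
  then have xX: "x = X0" using x(2) by simp
  then have "D = 0" using \<open>D = phi p (ln x, v0) - 1\<close> right_point(1) by (simp add: X0_def)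
  then have gz: "g (p 1 1) (of_real s * (X * y)) (x * Y0) = 0" "g (p 1 0) X x = 0" "g (p 1 (-1)) (X / y) (x / Y0) = 0"
     "g (p 0 (-1)) (1 / y) (1 / Y0) = 0" "g (p (-1) (-1)) (1 / (X * y)) (1 / (x * Y0)) = 0" "g (p (-1) 0) (1 / X) (1 / x) = 0"
     "g (p (-1) 1) (of_real s * (y / X)) (Y0 / x) = 0" "g (p 0 1) (of_real s * y) Y0 = 0"
    unfolding D_def using gm by linarith+
  have key: "s' = 1 & w = of_real m" if "g P (of_real s' * w) m = 0" "P > 0" "norm w = m" "m > 0" "0 <= s'" "s' <= 1" for P w m s'
  proof -
    have "s' * Re w = m" using that by (simp add: g_def)
    moreover have "Re (w / of_real m) = Re w / m" by simp
    ultimately have R1: "s' * Re (w / of_real m) = 1" using that(4) by simp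
    have n1: "norm (w / of_real m) = 1" using that(3,4) by (simp add: norm_divide)
    note u = unit_complex_eq_1[OF n1 that(5,6) R1]
    have "w = of_real m" using u(2) that(4) by (metis div_by_0 divide_eq_1_iff)
    then show ?thesis using u(1) by blast
  qed
  have nn: "norm (X * y) = x * Y0" "norm X = x" "norm (X / y) = x / Y0" "norm (1 / y) = 1 / Y0"
     "norm (1 / (X * y)) = 1 / (x * Y0)" "norm (1 / X) = 1 / x" "norm (y / X) = Y0 / x"
    by (simp_all add: norm_mult norm_divide y x_def)
  have pos: "x * Y0 > 0" "x / Y0 > 0" "1 / Y0 > 0" "1 / (x * Y0) > 0" "1 / x > 0" "Y0 / x > 0"
    using x(1) Y0_pos by auto
  have key1: "w = of_real m" if "g P w m = 0" "P > 0" "norm w = m" "m > 0" for P w m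
    using key[of P 1 w m] that(1) that(2-4) by simp
  have k11: "s = 1 & X * y = of_real (x * Y0)" if "p 1 1 > 0"
    using key[OF gz(1) that nn(1) pos(1) s] .
  have k10: "X = of_real x" if "p 1 0 > 0"
    using key1[OF gz(2) that nn(2) x(1)] .
  have k1m: "X / y = of_real (x / Y0)" if "p 1 (-1) > 0"
    using key1[OF gz(3) that nn(3) pos(2)] .
  have k0m: "1 / y = of_real (1 / Y0)" if "p 0 (-1) > 0"
    using key1[OF gz(4) that nn(4) pos(3)] .
  have kmm: "1 / (X * y) = of_real (1 / (x * Y0))" if "p (-1) (-1) > 0"
    using key1[OF gz(5) that nn(5) pos(4)] .
  have km0: "1 / X = of_real (1 / x)" if "p (-1) 0 > 0"
    using key1[OF gz(6) that nn(6) pos(5)] .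
  have km1: "s = 1 & y / X = of_real (Y0 / x)" if "p (-1) 1 > 0"
    using key[OF gz(7) that nn(7) pos(6) s] .
  have k01: "s = 1 & y = of_real Y0" if "p 0 1 > 0"
    using key[OF gz(8) that y Y0_pos s] .
  \<comment> \<open>Some up step has positive weight, and the term of an up step carries the factor
    s.\<close>
  have s1: "s = 1" using triples(7) k11 km1 k01 by blast
  have inv: "z = w" if "1 / z = 1 / w" for z w :: complex using that by (metis inverse_eq_divide inverse_inverse_eq)
  have A: "X = of_real x" if "p 1 0 > 0 | p (-1) 0 > 0"
    using that k10 inv[OF km0[unfolded of_real_divide of_real_1]] by blast
  have B: "y = of_real Y0" if "p 0 1 > 0 | p 0 (-1) > 0"
    using that k01 inv[OF k0m[unfolded of_real_divide of_real_1]] by blast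
  have Dg: "X * y = of_real x * of_real Y0" if "p 1 1 > 0 | p (-1) (-1) > 0"
    using that k11[unfolded of_real_mult] inv[OF kmm[unfolded of_real_divide of_real_1 of_real_mult]] by blast
  have E: "X * of_real Y0 = of_real x * y" if "p 1 (-1) > 0 | p (-1) 1 > 0"
    using that
  proof
    assume "p 1 (-1) > 0"
    then show ?thesis using k1m y0 Y0_pos by (simp add: field_simps)
  next
    assume "p (-1) 1 > 0"
    then show ?thesis using km1 X(1) x(1) by (simp add: field_simps)
  qed
  \<comment> \<open>If y differs from \<open>Y0\<close>, the vertical steps and then the horizontal
    ones must have weight 0; the two relations left for the diagonals give y^2 = Y0^2.\<close>
  have "y = of_real Y0 | diagonal_mass p = 1 & y = - of_real Y0"
  proof (cases "y = of_real Y0")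
    case nB: False
    then have p0: "p 0 1 = 0" "p 0 (-1) = 0" using B by (auto simp: pos_iff)
    have xc: "complex_of_real x ~= 0" using x(1) by simp
    have nA: "X ~= of_real x"
    proof
      assume XA: "X = of_real x"
      have "p 1 1 > 0 | p (-1) 1 > 0" using triples(7) p0 by auto
      then have "y = of_real Y0"
      proof
        assume "p 1 1 > 0"
        then show ?thesis using Dg XA xc by simp
      next
        assume "p (-1) 1 > 0"
        then show ?thesis using E XA xc by simp
      qed
      then show False using nB by simp
    qed
    then have pA: "p 1 0 = 0" "p (-1) 0 = 0" using A by (auto simp: pos_iff)
    have "p 1 1 > 0" "p 1 (-1) > 0" using triples(2,8) pA p0 by auto
    then have "X * y = of_real x * of_real Y0" "X * of_real Y0 = of_real x * y" using Dg E by auto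
    then have "of_real x * (y * y - of_real Y0 * of_real Y0) = 0" by algebra
    then have "y * y = of_real Y0 * of_real Y0" using xc by simp
    then have "y = - of_real Y0" using nB square_eq_iff by blast
    then show ?thesis using diagonal_iff p0 pA by simp
  qed simp
  then show ?thesis using s1 by simp
qed

section \<open>The logarithm of the first passage function and the saddle point\<close>

definition Lam :: "complex => complex" where "Lam z = Ln (F 1 (exp z))"
definition lam :: "real => real" where "lam v = ln (fr (exp v))"

definition r1 :: real where
  "r1 = (SOME r. r > 0 & (\<forall>z\<in>ball (of_real v0) r. exp z \<in> ann' & Re (F 1 (exp z)) > 0))"

lemma r1: "r1 > 0" and r1_ball: "\<And>z. z \<in> ball (of_real v0) r1 ==> exp z \<in> ann' & Re (F 1 (exp z)) > 0"
proof -
  have e0: "exp (complex_of_real v0) = of_real Y0" by (simp add: Y0_def exp_of_real)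
  have op: "open (exp -` ann' :: complex set)" using open_ann' continuous_on_exp[OF continuous_on_id] by (intro open_vimage) auto
  have "isCont (F 1) (exp (complex_of_real v0))"
    unfolding e0
    using holomorphic_on_imp_continuous_on[OF F_hol_y[OF norm_1_le]] Y0_ann'[of "of_real Y0"] Y0_pos
    by (simp add: continuous_on_eq_continuous_at[OF open_ann'])
  then have cont: "isCont (%z. Re (F 1 (exp z))) (of_real v0)"
    by (intro continuous_Re isCont_o2[where g = "F 1" and f = exp]) auto
  have pos: "Re (F 1 (exp (of_real v0))) > 0" unfolding e0 using fr_pos[OF Y0_pos Y0_ann] by (simp add: fr_def)
  have "((%z. Re (F 1 (exp z))) \<longlongrightarrow> Re (F 1 (exp (of_real v0)))) (nhds (of_real v0))"
    using cont unfolding isCont_def tendsto_nhds_iff by simp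
  then have "eventually (%z. Re (F 1 (exp z)) > 0) (nhds (complex_of_real v0))"
    by (rule order_tendstoD(1)[OF _ pos])
  moreover have "eventually (%z. exp z \<in> ann') (nhds (complex_of_real v0))"
    using eventually_nhds_in_open[OF op, of "of_real v0"] e0 Y0_ann'[of "of_real Y0"] Y0_pos by auto
  ultimately have "eventually (%z. exp z \<in> ann' & Re (F 1 (exp z)) > 0) (nhds (complex_of_real v0))"
    by eventually_elim auto
  then obtain d where "d > 0" "\<And>z. dist z (of_real v0) < d ==> exp z \<in> ann' & Re (F 1 (exp z)) > 0"
    unfolding eventually_nhds_metric by blast
  then have "\<exists>r. r > 0 & (\<forall>z\<in>ball (of_real v0) r. exp z \<in> ann' & Re (F 1 (exp z)) > 0)"
    by (intro exI[of _ d]) (auto simp: dist_commute)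
  then have "r1 > 0 & (\<forall>z\<in>ball (of_real v0) r1. exp z \<in> ann' & Re (F 1 (exp z)) > 0)"
    unfolding r1_def by (rule someI_ex)
  then show "r1 > 0" "\<And>z. z \<in> ball (of_real v0) r1 ==> exp z \<in> ann' & Re (F 1 (exp z)) > 0" by auto
qed

lemma Lam_hol: "Lam holomorphic_on ball (of_real v0) r1"
proof -
  have "(%z. F 1 (exp z)) holomorphic_on ball (of_real v0) r1"
    by (rule holomorphic_on_compose_gen[OF _ F_hol_y[OF norm_1_le], where f = exp, unfolded o_def])
       (use r1_ball in \<open>auto intro!: holomorphic_intros\<close>)
  moreover have "F 1 (exp z) \<notin> \<real>\<^sub>\<le>\<^sub>0" if "z \<in> ball (of_real v0) r1" for z
    using r1_ball[OF that] by (auto simp: complex_nonpos_Reals_iff)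
  ultimately show ?thesis unfolding Lam_def by (intro holomorphic_intros)
qed

lemma exp_Lam: "z \<in> ball (of_real v0) r1 ==> exp (Lam z) = F 1 (exp z)"
  using r1_ball[of z] unfolding Lam_def by (intro exp_Ln) auto

context
  fixes v :: real
  assumes v: "\<bar>v - v0\<bar> < r1"
begin

lemma v_ball: "of_real v \<in> ball (complex_of_real v0) r1"
  using v by (simp add: dist_real_def abs_minus_commute flip: of_real_diff)

lemma v_ann: "of_real (exp v) \<in> ann"
  using r1_ball[OF v_ball] ann'_sub by (auto simp: exp_of_real)

lemma Lam_real: "Lam (of_real v) = of_real (lam v)"
  unfolding Lam_def lam_def exp_of_real F_real[OF exp_gt_zero v_ann] using fr_pos[OF exp_gt_zero v_ann] by (simp add: Ln_of_real)

lemma lam_phi: "phi p (- lam v, v) = 1" and lam_phi_u: "phi_u p (- lam v) v > 0"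
  using fr_phi[OF exp_gt_zero v_ann] fr_phi_u[OF exp_gt_zero v_ann] by (simp_all add: lam_def)

end

lemma lam_v0: "lam v0 = - u0"
  unfolding lam_def Y0_def[symmetric] fr_Y0 by (simp add: X0_def ln_div)

definition lam' :: "real => real" where "lam' v = phi_v p (- lam v) v / phi_u p (- lam v) v"

text \<open>Implicit differentiation of phi (- lam v, v) = 1. Holomorphy of \<open>Lam\<close>
  already provides the derivative, and its imaginary part vanishes because \<open>Lam\<close> is
  real on the real line.\<close>

lemma lam_deriv:
  assumes "\<bar>v - v0\<bar> < r1"
  shows "(lam has_real_derivative lam' v) (at v)" "deriv Lam (of_real v) = of_real (lam' v)"
proof -
  define D where "D = deriv Lam (of_real v)"
  have D: "(Lam has_field_derivative D) (at (of_real v))"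
    unfolding D_def by (rule holomorphic_derivI[OF Lam_hol open_ball v_ball[OF assms]])
  have ev: "eventually (%w. \<bar>w - v0\<bar> < r1) (nhds v)"
  proof -
    have "open {w. \<bar>w - v0\<bar> < r1}" by (intro open_Collect_less continuous_intros)
    then show ?thesis using eventually_nhds_in_open[of "{w. \<bar>w - v0\<bar> < r1}" v] assms by simp
  qed
  have "((%w. Re (Lam (of_real w))) has_real_derivative Re D) (at v)"
    by (rule has_field_derivative_Re[OF has_vector_derivative_real_field[OF D]])
  then have lD: "(lam has_real_derivative Re D) (at v)"
    using DERIV_cong_ev[OF refl eventually_mono[OF ev] refl, of "%w. Re (Lam (of_real w))" lam] Lam_real by simp
  have "((%w. Im (Lam (of_real w))) has_real_derivative Im D) (at v)"
    by (rule has_field_derivative_Im[OF has_vector_derivative_real_field[OF D]])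
  then have "((%w. 0) has_real_derivative Im D) (at v)"
    using DERIV_cong_ev[OF refl eventually_mono[OF ev] refl, of "%w. Im (Lam (of_real w))" "%w. 0"] Lam_real by simp
  then have Im: "Im D = 0" using DERIV_unique DERIV_const by blast
  have "((%w. phi p (- lam w, w)) has_real_derivative (phi_u p (- lam v) v * (- Re D) + phi_v p (- lam v) v)) (at v)"
    unfolding phi_expand phi_u_def phi_v_def by (auto intro!: derivative_eq_intros lD simp: algebra_simps)
  moreover have "((%w. phi p (- lam w, w)) has_real_derivative 0) (at v)"
    using DERIV_cong_ev[OF refl eventually_mono[OF ev] refl, of "%w. phi p (- lam w, w)" "%w. 1" 0] lam_phi by simp
  ultimately have "phi_u p (- lam v) v * (- Re D) + phi_v p (- lam v) v = 0" using DERIV_unique by blast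
  then have "Re D = lam' v" using lam_phi_u[OF assms] by (simp add: lam'_def field_simps)
  then show "(lam has_real_derivative lam' v) (at v)" "deriv Lam (of_real v) = of_real (lam' v)"
    using lD Im by (auto simp: D_def complex_eq_iff)
qed

lemma lam'_v0: "lam' v0 = 0"
  using right_point(2) by (simp add: lam'_def lam_v0)

definition "sig2 = 2 * a X0 * Y0 / (X0 * phi_u p u0 v0)"

lemma sig2_pos: "sig2 > 0"
  using kernel_Y0(3) Y0_pos X0_gt_1 right_point(3) by (simp add: sig2_def)

text \<open>The slope of lam vanishes at v0, so only the second v-derivative of phi over
  \<open>phi_u\<close> survives. Times X0 Y0 that second derivative is a X0 Y0^2 + c X0, and the
  double root makes the two summands equal.\<close>

lemma lam'_deriv_v0: "(lam' has_real_derivative sig2) (at v0)"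
proof -
  have l: "(lam has_real_derivative 0) (at v0)" using lam_deriv(1)[of v0] r1 lam'_v0 by simp
  define D1 where "D1 = p 1 1 * exp (u0 + v0) + p 0 1 * exp v0 + p (-1) 1 * exp (v0 - u0)
     + p (-1) (-1) * exp (- u0 - v0) + p 0 (-1) * exp (- v0) + p 1 (-1) * exp (u0 - v0)"
  have 1: "((%v. phi_v p (- lam v) v) has_real_derivative D1) (at v0)"
    unfolding phi_v_def D1_def by (auto intro!: derivative_eq_intros l simp: lam_v0 algebra_simps)
  have 2: "((%v. phi_u p (- lam v) v) has_real_derivative phi_u p u0 v0 * 0 + (p 1 1 * exp (u0 + v0) - p 1 (-1) * exp (u0 - v0)
     + p (-1) (-1) * exp (- u0 - v0) - p (-1) 1 * exp (v0 - u0))) (at v0)"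
    unfolding phi_u_def by (auto intro!: derivative_eq_intros l simp: lam_v0 algebra_simps)
  have "D1 = 2 * a X0 * Y0 / X0"
  proof -
    have "X0 * Y0 * D1 = a X0 * Y0\<^sup>2 + c X0"
      unfolding D1_def a_eq c_eq X0_def Y0_def by (simp add: exp_add exp_diff exp_minus power2_eq_square field_simps)
    also have "... = X0 * Y0 * (2 * a X0 * Y0 / X0)" using kernel_Y0(1) X0_gt_1 by (simp add: power2_eq_square)
    finally show ?thesis using X0_gt_1 Y0_pos by (simp add: field_simps)
  qed
  then have s: "sig2 = D1 / phi_u p u0 v0" by (simp add: sig2_def)
  have "(lam' has_real_derivative sig2) (at v0)"
    unfolding lam'_def[abs_def] s
    by (rule DERIV_cong[OF DERIV_divide[OF 1 2]]) (use right_point in \<open>auto simp: lam_v0 field_simps power2_eq_square\<close>)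
  then show ?thesis .
qed

end

lemma deriv_eq_0_locally:
  assumes "(g has_field_derivative D) (at z)" "open U" "z \<in> U" "\<And>w. w \<in> U ==> g w = 0"
  shows "D = 0"
  using has_field_derivative_transform_within_open[OF assms] DERIV_unique DERIV_const by blast

context drift_walk begin

definition lam2 :: "real => real" where "lam2 v = Re (deriv (deriv Lam) (of_real v))"

lemma deriv_Lam_hol: "deriv Lam holomorphic_on ball (of_real v0) r1" "deriv (deriv Lam) holomorphic_on ball (of_real v0) r1"
  by (intro holomorphic_deriv Lam_hol open_ball)+

lemma nhds_ball_v: "\<bar>v - v0\<bar> < r1 ==> eventually (%w. \<bar>w - v0\<bar> < r1) (nhds v)"
proof -
  assume "\<bar>v - v0\<bar> < r1"
  moreover have "open {w. \<bar>w - v0\<bar> < r1}" by (intro open_Collect_less continuous_intros)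
  ultimately show ?thesis using eventually_nhds_in_open[of "{w. \<bar>w - v0\<bar> < r1}" v] by simp
qed

lemma lam'_deriv:
  assumes "\<bar>v - v0\<bar> < r1"
  shows "(lam' has_real_derivative lam2 v) (at v)" "deriv (deriv Lam) (of_real v) = of_real (lam2 v)"
proof -
  define D where "D = deriv (deriv Lam) (of_real v)"
  have D: "(deriv Lam has_field_derivative D) (at (of_real v))"
    unfolding D_def by (rule holomorphic_derivI[OF deriv_Lam_hol(1) open_ball v_ball[OF assms]])
  note ev = nhds_ball_v[OF assms]
  have "((%w. Re (deriv Lam (of_real w))) has_real_derivative Re D) (at v)"
    by (rule has_field_derivative_Re[OF has_vector_derivative_real_field[OF D]])
  then have lD: "(lam' has_real_derivative Re D) (at v)"
    using DERIV_cong_ev[OF refl eventually_mono[OF ev] refl, of "%w. Re (deriv Lam (of_real w))" lam'] lam_deriv(2) by simp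
  have "((%w. Im (deriv Lam (of_real w))) has_real_derivative Im D) (at v)"
    by (rule has_field_derivative_Im[OF has_vector_derivative_real_field[OF D]])
  then have "((%w. 0) has_real_derivative Im D) (at v)"
    using DERIV_cong_ev[OF refl eventually_mono[OF ev] refl, of "%w. Im (deriv Lam (of_real w))" "%w. 0"] lam_deriv(2) by simp
  then have Im: "Im D = 0" using DERIV_unique DERIV_const by blast
  show "(lam' has_real_derivative lam2 v) (at v)" "deriv (deriv Lam) (of_real v) = of_real (lam2 v)"
    using lD Im by (auto simp: D_def complex_eq_iff lam2_def)
qed

lemma lam2_v0: "lam2 v0 = sig2"
  using lam'_deriv(1)[of v0] lam'_deriv_v0 r1 DERIV_unique by simp

definition r2 :: real where
  "r2 = (SOME r. 0 < r & 2 * r < r1 & (\<forall>v. \<bar>v - v0\<bar> <= r --> lam2 v >= sig2 / 2))"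

lemma r2: "0 < r2" "2 * r2 < r1" and lam2_ge: "\<And>v. \<bar>v - v0\<bar> <= r2 ==> lam2 v >= sig2 / 2"
proof -
  have "isCont (deriv (deriv Lam)) (of_real v0)"
    using holomorphic_on_imp_continuous_on[OF deriv_Lam_hol(2)] r1
    by (simp add: continuous_on_eq_continuous_at[OF open_ball])
  then have "isCont (%v. Re (deriv (deriv Lam) (of_real v))) v0"
    by (intro continuous_Re isCont_o2[where g = "deriv (deriv Lam)" and f = of_real]) (auto intro!: continuous_intros)
  then have "lam2 \<midarrow>v0\<rightarrow> sig2" unfolding isCont_def lam2_def[symmetric] lam2_v0 .
  then have "eventually (%v. lam2 v > sig2 / 2) (at v0)"
    by (rule order_tendstoD(1)) (use sig2_pos in simp)
  then obtain d where d: "d > 0" "\<And>v. v ~= v0 ==> dist v v0 < d ==> lam2 v > sig2 / 2"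
    unfolding eventually_at by auto
  have "\<exists>r. 0 < r & 2 * r < r1 & (\<forall>v. \<bar>v - v0\<bar> <= r --> lam2 v >= sig2 / 2)"
  proof (intro exI[of _ "min (d / 2) (r1 / 3)"] conjI allI impI)
    fix v assume "\<bar>v - v0\<bar> <= min (d / 2) (r1 / 3)"
    then show "lam2 v >= sig2 / 2"
      using d(2)[of v] d(1) lam2_v0 sig2_pos by (cases "v = v0") (auto simp: dist_real_def)
  qed (use d r1 in auto)
  then have "0 < r2 & 2 * r2 < r1 & (\<forall>v. \<bar>v - v0\<bar> <= r2 --> lam2 v >= sig2 / 2)"
    unfolding r2_def by (rule someI_ex)
  then show "0 < r2" "2 * r2 < r1" "\<And>v. \<bar>v - v0\<bar> <= r2 ==> lam2 v >= sig2 / 2" by auto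
qed

lemma lam'_growth:
  assumes "v0 - r2 <= v" "v <= w" "w <= v0 + r2"
  shows "sig2 / 2 * (w - v) <= lam' w - lam' v"
proof (cases "v = w")
  case False
  then have "v < w" using assms by simp
  then obtain z where z: "v < z" "z < w" "lam' w - lam' v = (w - v) * lam2 z"
    using MVT2[of v w lam' lam2] lam'_deriv(1) assms r2 by (auto simp: abs_less_iff)
  have "sig2 / 2 * (w - v) <= lam2 z * (w - v)"
    using lam2_ge[of z] z assms by (intro mult_right_mono) auto
  then show ?thesis using z(3) by (simp add: mult.commute)
qed simp

text \<open>Within r2 of v0 the function lam' grows at rate at least sig2/2, so it covers
  [-t1, t1].\<close>

definition "t1 = sig2 * r2 / 2"

lemma t1_pos: "t1 > 0"
  using sig2_pos r2 by (simp add: t1_def)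

definition sv :: "real => real" where "sv t = snd (saddle p (arctan t))"

text \<open>By \<open>saddle_eqI\<close> the saddle of slope t is where lam' equals t. The Lipschitz
  constant 2/sig2 is the reciprocal of the growth rate of lam'.\<close>

lemma sv:
  assumes "\<bar>t\<bar> <= t1"
  shows "\<bar>sv t - v0\<bar> <= r2" "lam' (sv t) = t" "saddle p (arctan t) = (- lam (sv t), sv t)" "\<bar>sv t - v0\<bar> <= 2 / sig2 * \<bar>t\<bar>"
proof -
  have "\<exists>v\<ge>v0 - r2. v <= v0 + r2 & lam' v = t"
  proof (rule IVT)
    show "lam' (v0 - r2) <= t" "t <= lam' (v0 + r2)"
      using lam'_growth[of "v0 - r2" v0] lam'_growth[of v0 "v0 + r2"] r2 assms lam'_v0 by (auto simp: t1_def)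
    show "\<forall>x. v0 - r2 <= x & x <= v0 + r2 --> isCont lam' x"
    proof (intro allI impI)
      fix x assume "v0 - r2 <= x & x <= v0 + r2"
      then have "\<bar>x - v0\<bar> < r1" using r2 by linarith
      then show "isCont lam' x" by (rule DERIV_isCont[OF lam'_deriv(1)])
    qed
  qed (use r2 in auto)
  then obtain v where "v >= v0 - r2" "v <= v0 + r2" "lam' v = t" by blast
  then have v: "\<bar>v - v0\<bar> <= r2" "lam' v = t" by auto
  have vr: "\<bar>v - v0\<bar> < r1" using v r2 by linarith
  have "saddle p (arctan t) = (- lam v, v)"
    using lam_phi[OF vr] lam_phi_u[OF vr] v(2) by (intro saddle_eqI) (auto simp: lam'_def field_simps)
  then have "sv t = v" "saddle p (arctan t) = (- lam (sv t), sv t)" by (auto simp: sv_def)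
  then show "\<bar>sv t - v0\<bar> <= r2" "lam' (sv t) = t" "saddle p (arctan t) = (- lam (sv t), sv t)"
    using v by auto
  then show "\<bar>sv t - v0\<bar> <= 2 / sig2 * \<bar>t\<bar>"
    using lam'_growth[of v0 "sv t"] lam'_growth[of "sv t" v0] lam'_v0 sig2_pos
    by (cases "sv t >= v0") (auto simp: abs_le_iff field_simps)
qed

lemma sv_0: "sv 0 = v0"
  using sv(4)[of 0] t1_pos by simp

lemma s_xy: "\<bar>t\<bar> <= t1 ==> s_x p t = exp (- lam (sv t)) & s_y p t = exp (sv t)"
  using sv(3)[of t] by (simp add: s_x_def s_y_def)

lemma s_xy_0: "s_x p 0 = X0" "s_y p 0 = Y0"
  using s_xy[of 0] t1_pos by (simp_all add: sv_0 lam_v0 X0_def Y0_def)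

lemma sv_deriv: "(sv has_real_derivative 1 / sig2) (at 0)"
proof -
  have "isCont sv 0"
    unfolding isCont_def sv_0
  proof (rule LIM_zero_cancel, rule Lim_null_comparison)
    show "eventually (%t. norm (sv t - v0) <= 2 / sig2 * \<bar>t\<bar>) (at 0)"
      unfolding eventually_at using t1_pos sv(4) by (intro exI[of _ t1]) (auto simp: dist_real_def)
    show "((%t. 2 / sig2 * \<bar>t\<bar>) \<longlongrightarrow> 0) (at 0)"
      by (rule tendsto_eq_intros refl | simp)+
  qed
  then have "(sv has_real_derivative inverse sig2) (at 0)"
    using DERIV_inverse_function[of lam' sig2 sv 0 "- t1" t1] lam'_deriv_v0 sv(2) sig2_pos t1_pos
    by (auto simp: sv_0 abs_le_iff)
  then show ?thesis by (simp add: inverse_eq_divide)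
qed

lemma s_y_deriv: "(s_y p has_real_derivative Y0 / sig2) (at 0 within {0..})"
proof -
  have "((%t. exp (sv t)) has_real_derivative exp (sv 0) * (1 / sig2)) (at 0)"
    by (auto intro!: derivative_eq_intros sv_deriv)
  then have "((%t. exp (sv t)) has_real_derivative Y0 / sig2) (at 0)" by (simp add: sv_0 Y0_def)
  moreover have ev: "eventually (%t. exp (sv t) = s_y p t) (nhds 0)"
    unfolding eventually_nhds_metric using t1_pos s_xy by (intro exI[of _ t1]) (auto simp: dist_real_def)
  ultimately have "(s_y p has_real_derivative Y0 / sig2) (at 0)"
    using iffD1[OF DERIV_cong_ev[OF refl ev refl]] by blast
  then show ?thesis by (rule has_field_derivative_at_within)
qed

lemma s_y'0: "s_y'0 p = Y0 / sig2"
proof -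
  have "at (0::real) within {0..} ~= bot"
    by (simp add: at_within_Ici_at_right trivial_limit_at_right_real)
  then show ?thesis
    unfolding s_y'0_def using s_y_deriv
    by (intro vector_derivative_within) (auto simp: has_real_derivative_iff_has_vector_derivative)
qed

section \<open>The constants of the expansion\<close>

definition "gg = phi_u p u0 v0"

lemma gg_pos: "gg > 0" using right_point(3) by (simp add: gg_def)

lemma sig2_gg: "sig2 = 2 * a X0 * Y0 / (X0 * gg)"
  by (simp add: sig2_def gg_def)

text \<open>Inserting c = A Y0^2 and b = -2 A Y0 makes \<open>Pl_poly\<close> at x3 a perfect
  square, that of A times the x-derivative of the kernel, and this derivative is Y0 gg.\<close>

lemma axis_constants: "axis_constants p"
proof -
  define A where "A = a X0"
  have A: "A > 0" using kernel_Y0 by (simp add: A_def)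
  have X: "X0 > 0" using X0_gt_1 by simp
  have c: "c X0 = A * Y0\<^sup>2" "b X0 = - 2 * A * Y0" using kernel_Y0 by (auto simp: A_def)
  have ku: "a' X0 * Y0\<^sup>2 + b' X0 * Y0 + c' X0 = Y0 * gg"
    using kernel_phi_u[OF right_point(1)] by (simp add: X0_def Y0_def gg_def)
  have "poly (Pl_poly p) X0 = (A * c' X0 - a' X0 * c X0)\<^sup>2 - (b X0 * a' X0 - b' X0 * A) * (c X0 * b' X0 - c' X0 * b X0)"
    unfolding Pl_poly_def Let_def by (simp add: pderiv_abc A_def)
  also have "... = (A * (a' X0 * Y0\<^sup>2 + b' X0 * Y0 + c' X0))\<^sup>2"
    unfolding c by (simp add: power2_eq_square algebra_simps)
  finally have Pl: "sqrt (poly (Pl_poly p) X0) = A * (Y0 * gg)"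
    unfolding ku using A Y0_pos gg_pos by (simp add: real_sqrt_abs)
  have sc: "sqrt (c X0) = sqrt A * Y0" unfolding c using Y0_pos by (simp add: real_sqrt_mult)
  have pw: "A powr (3 / 2) = A * sqrt A"
    using A powr_add[of A 1 "1/2"] by (simp add: powr_half_sqrt)
  have sA: "sqrt A * sqrt A = A" using A by simp
  have "X0 * (A * (Y0 * gg)) / (2 * (A * sqrt A) * (sqrt A * Y0)) = Y0 / sig2"
  proof -
    have "2 * (A * sqrt A) * (sqrt A * Y0) = 2 * A * (sqrt A * sqrt A) * Y0" by (simp add: mult_ac)
    then show ?thesis unfolding sA using A X gg_pos Y0_pos by (simp add: sig2_gg A_def[symmetric] field_simps)
  qed
  then have D: "x3 p * sqrt (poly (Pl_poly p) (x3 p)) / (2 * (a (x3 p)) powr (3 / 2) * sqrt (c (x3 p))) = Y0 / sig2"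
    unfolding x3_eq Pl sc pw A_def[symmetric] .
  show ?thesis
    unfolding axis_constants_def Let_def D
    unfolding x3_eq s_xy_0
    using s_y_deriv kernel_Y0 Y0_pos by (simp add: field_simps)
qed

lemma tilde_polys:
  "cpoly (a_poly (flip p)) y = of_real (p 1 1) * y\<^sup>2 + of_real (p 1 0) * y + of_real (p 1 (-1))"
  "cpoly (b_poly (flip p)) y = of_real (p 0 1) * y\<^sup>2 - y + of_real (p 0 (-1))"
  "cpoly (c_poly (flip p)) y = of_real (p (-1) 1) * y\<^sup>2 + of_real (p (-1) 0) * y + of_real (p (-1) (-1))"
  by (simp_all add: a_poly_def b_poly_def c_poly_def flip_def map_poly_pCons power2_eq_square algebra_simps)

lemma cpoly_disc: "cpoly (disc_poly (flip p)) y = (cpoly (b_poly (flip p)) y)\<^sup>2 - 4 * cpoly (a_poly (flip p)) y * cpoly (c_poly (flip p)) y"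
  unfolding drift_walk.disc_coeffs[OF drift_walk_flip] tilde_polys
  by (simp add: flip_def map_poly_pCons power2_eq_square algebra_simps)

text \<open>For the exchanged weights x2 and x3 come from the lowest and the highest point of the
  curve, and the right-most point lies strictly between them in height.\<close>

lemma Y0_between: "x2 (flip p) < Y0 & Y0 < x3 (flip p)"
proof -
  interpret f: drift_walk "flip p" by (rule drift_walk_flip)
  obtain s t where st: "f.is_left_right s t" using f.ex_left_right by blast
  then obtain v w where vw: "phi (flip p) (ln s, v) = 1" "phi_v (flip p) (ln s) v = 0" "phi_u (flip p) (ln s) v < 0"
     "phi (flip p) (ln t, w) = 1" "phi_v (flip p) (ln t) w = 0" "phi_u (flip p) (ln t) w > 0" "0 < s" "1 < t"
    unfolding f.is_left_right_def by blast
  have 1: "phi p (v, ln s) = 1" "phi_u p v (ln s) = 0" "phi_v p v (ln s) < 0"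
    "phi p (w, ln t) = 1" "phi_u p w (ln t) = 0" "phi_v p w (ln t) > 0"
    using vw by (simp_all add: phi_flip phi_v_flip)
  have "(u0, v0) ~= (v, ln s)" "(u0, v0) ~= (w, ln t)" using 1 right_point by auto
  then have "phi_v p v (ln s) * (v0 - ln s) < 0" "phi_v p w (ln t) * (v0 - ln t) < 0"
    using phi_tangent[of u0 v0 v "ln s"] phi_tangent[of u0 v0 w "ln t"] 1 right_point(1) by auto
  then have "ln s < v0" "v0 < ln t" using 1 by (auto simp: mult_less_0_iff)
  then have "s < Y0" "Y0 < t" using vw(7,8) unfolding Y0_def
    by (metis exp_less_cancel_iff exp_ln, metis exp_less_cancel_iff exp_ln less_trans zero_less_one)
  then show ?thesis using f.branch_points_left_right(2,3)[OF st] by simp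
qed

lemma tilde_Y0:
  "poly (disc_poly (flip p)) Y0 = (Y0 * gg)\<^sup>2"
  "2 * (p 1 1 * Y0\<^sup>2 + p 1 0 * Y0 + p 1 (-1)) * X0 + (p 0 1 * Y0\<^sup>2 - Y0 + p 0 (-1)) = Y0 * gg"
  "(p 1 1 * Y0\<^sup>2 + p 1 0 * Y0 + p 1 (-1)) * X0\<^sup>2 + (p 0 1 * Y0\<^sup>2 - Y0 + p 0 (-1)) * X0
     + (p (-1) 1 * Y0\<^sup>2 + p (-1) 0 * Y0 + p (-1) (-1)) = 0"
proof -
  show k: "(p 1 1 * Y0\<^sup>2 + p 1 0 * Y0 + p 1 (-1)) * X0\<^sup>2 + (p 0 1 * Y0\<^sup>2 - Y0 + p 0 (-1)) * X0
     + (p (-1) 1 * Y0\<^sup>2 + p (-1) 0 * Y0 + p (-1) (-1)) = 0"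
    using kernel_phi[of u0 v0] right_point(1) unfolding X0_def[symmetric] Y0_def[symmetric] a_eq b_eq c_eq
    by (simp add: algebra_simps power2_eq_square)
  have "X0 * (2 * (p 1 1 * Y0\<^sup>2 + p 1 0 * Y0 + p 1 (-1)) * X0 + (p 0 1 * Y0\<^sup>2 - Y0 + p 0 (-1)))
     - ((p 1 1 * Y0\<^sup>2 + p 1 0 * Y0 + p 1 (-1)) * X0\<^sup>2 + (p 0 1 * Y0\<^sup>2 - Y0 + p 0 (-1)) * X0
     + (p (-1) 1 * Y0\<^sup>2 + p (-1) 0 * Y0 + p (-1) (-1))) = X0 * Y0 * gg"
    unfolding gg_def phi_u_def X0_def Y0_def
    by (simp add: exp_add exp_diff exp_minus power2_eq_square field_simps)
  then have "X0 * (2 * (p 1 1 * Y0\<^sup>2 + p 1 0 * Y0 + p 1 (-1)) * X0 + (p 0 1 * Y0\<^sup>2 - Y0 + p 0 (-1))) = X0 * (Y0 * gg)"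
    unfolding k by simp
  then show s: "2 * (p 1 1 * Y0\<^sup>2 + p 1 0 * Y0 + p 1 (-1)) * X0 + (p 0 1 * Y0\<^sup>2 - Y0 + p 0 (-1)) = Y0 * gg"
    using X0_gt_1 by (simp only: mult_cancel_left) simp
  have "poly (disc_poly (flip p)) Y0 = (p 0 1 * Y0\<^sup>2 - Y0 + p 0 (-1))\<^sup>2 - 4 * (p 1 1 * Y0\<^sup>2 + p 1 0 * Y0 + p 1 (-1)) * (p (-1) 1 * Y0\<^sup>2 + p (-1) 0 * Y0 + p (-1) (-1))"
    unfolding drift_walk.d_eq[OF drift_walk_flip] drift_walk.a_eq[OF drift_walk_flip] drift_walk.b_eq[OF drift_walk_flip] drift_walk.c_eq[OF drift_walk_flip]
    by (simp add: flip_def)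
  also have "... = (2 * (p 1 1 * Y0\<^sup>2 + p 1 0 * Y0 + p 1 (-1)) * X0 + (p 0 1 * Y0\<^sup>2 - Y0 + p 0 (-1)))\<^sup>2"
    using k by algebra
  finally show "poly (disc_poly (flip p)) Y0 = (Y0 * gg)\<^sup>2" unfolding s .
qed

text \<open>The kernel equation for X1 is differentiated twice. The first derivative vanishes
  because Y0 is a double root in y of the kernel at x = X0; in the second one the only source left
  is 2 a X0.\<close>

lemma X1_second_deriv: "(deriv ^^ 2) (X1 p) (of_real Y0) = - of_real (2 * a X0 / (Y0 * gg))"
proof -
  interpret f: drift_walk "flip p" by (rule drift_walk_flip)
  let ?a = "%y. of_real (p 1 1) * y\<^sup>2 + of_real (p 1 0) * y + of_real (p 1 (-1)) :: complex"
  let ?b = "%y. of_real (p 0 1) * y\<^sup>2 - y + of_real (p 0 (-1)) :: complex"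
  let ?c = "%y. of_real (p (-1) 1) * y\<^sup>2 + of_real (p (-1) 0) * y + of_real (p (-1) (-1)) :: complex"
  define f where "f = X1 p"
  define S where "S = sqrt_disc (flip p)"
  have S: "S holomorphic_on - (cut12 (flip p) \<union> cut34 (flip p))"
    "\<And>z. z \<in> - (cut12 (flip p) \<union> cut34 (flip p)) ==> (S z)\<^sup>2 = (?b z)\<^sup>2 - 4 * ?a z * ?c z"
    "\<And>t. x2 (flip p) < t ==> t < x3 (flip p) ==> S (of_real t) \<in> \<real> & 0 < Re (S (of_real t))"
    using f.sqrt_disc cpoly_disc unfolding is_sqrt_disc_def S_def[symmetric] tilde_polys by auto
  have aY: "p 1 1 * Y0\<^sup>2 + p 1 0 * Y0 + p 1 (-1) > 0"
    using f.a_pos[OF Y0_pos] unfolding f.a_eq by (simp add: flip_def)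
  have ca: "?a (of_real Y0) = of_real (p 1 1 * Y0\<^sup>2 + p 1 0 * Y0 + p 1 (-1))" by simp
  have "isCont ?a (of_real Y0)" by (intro continuous_intros)
  then have "eventually (%z. ?a z ~= 0) (at (of_real Y0))"
    unfolding isCont_def using aY ca by (intro tendsto_imp_eventually_ne) (auto simp del: of_real_add of_real_mult)
  then obtain d where d: "d > 0" "\<And>z. z ~= of_real Y0 ==> dist z (of_real Y0) < d ==> ?a z ~= 0"
    unfolding eventually_at by auto
  define e where "e = min d (min (Y0 - x2 (flip p)) (x3 (flip p) - Y0))"
  define U where "U = ball (complex_of_real Y0) e"
  have e: "e > 0" using d Y0_between by (auto simp: e_def)
  have Y0U: "of_real Y0 \<in> U" and oU: "open U" using e by (auto simp: U_def)
  have aU: "?a z ~= 0" if "z \<in> U" for z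
  proof (cases "z = of_real Y0")
    case True
    then show ?thesis using aY unfolding True ca of_real_eq_0_iff by simp
  next
    case False
    then show ?thesis using d(2)[of z] that by (auto simp: U_def e_def dist_commute)
  qed
  have x2p: "x2 (flip p) > 0"
    using f.is_branch_points by (auto simp: is_branch_points_def)
  have Ucut: "z \<in> - (cut12 (flip p) \<union> cut34 (flip p))" if z: "z \<in> U" for z
  proof -
    have n1: "z ~= of_real t" if "t <= x2 (flip p) | x3 (flip p) <= t" for t
      using z that by (auto simp: U_def e_def dist_of_real dist_real_def)
    have n2: "t <= x2 (flip p)" if "ereal t <= x4 (flip p)" "x4 (flip p) < 0" for t
      using that x2p by (metis ereal_less_eq(3) less_ereal.simps(1) less_imp_le order.strict_trans1 order.strict_trans zero_ereal_def)
    have "z \<notin> cut12 (flip p)"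
    proof
      assume "z \<in> cut12 (flip p)"
      then obtain x where "z = of_real x" "x <= x2 (flip p)" by (auto simp: cut12_def)
      then show False using n1[of x] by blast
    qed
    moreover have "z \<notin> cut34 (flip p)"
    proof
      assume "z \<in> cut34 (flip p)"
      then obtain x where "z = of_real x" "x3 (flip p) <= x | ereal x <= x4 (flip p) & x4 (flip p) < 0"
        by (auto simp: cut34_def split: if_splits)
      then show False using n1[of x] n2[of x] by blast
    qed
    ultimately show ?thesis by simp
  qed
  have fS: "2 * ?a z * f z + ?b z = S z" if "z \<in> U" for z
  proof -
    have "2 * A * ((- B + W) / (2 * A)) + B = W" if "A ~= 0" for A B W :: complex
      using that by (simp add: field_simps)
    then show ?thesis using aU[OF that] unfolding f_def X1_def tilde_polys S_def[symmetric] by blast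
  qed
  have two: "2 * A ~= 0" if "A ~= 0" for A :: complex using that by simp
  have f_hol: "f holomorphic_on U"
    unfolding f_def X1_def tilde_polys S_def[symmetric]
    by (intro holomorphic_intros holomorphic_on_subset[OF S(1)] two aU) (use Ucut in auto)
  have kern: "?a z * (f z)\<^sup>2 + ?b z * f z + ?c z = 0" if "z \<in> U" for z
  proof -
    have "4 * ?a z * (?a z * (f z)\<^sup>2 + ?b z * f z + ?c z) = (2 * ?a z * f z + ?b z)\<^sup>2 - ((?b z)\<^sup>2 - 4 * ?a z * ?c z)"
      by (simp add: power2_eq_square algebra_simps)
    also have "... = 0" unfolding fS[OF that] S(2)[OF Ucut[OF that]] by simp
    finally have "4 * ?a z * (?a z * (f z)\<^sup>2 + ?b z * f z + ?c z) = 0" .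
    then show ?thesis using aU[OF that] by (metis mult_eq_0_iff zero_neq_numeral)
  qed
  \<comment> \<open>The kernel determines only the square of S; its sign comes from the chosen
    branch, which is positive between the second and third branch points.\<close>
  have SY: "S (of_real Y0) = of_real (Y0 * gg)"
  proof -
    obtain r where r: "S (of_real Y0) = of_real r" "r > 0"
      using S(3)[of Y0] Y0_between by (metis Re_complex_of_real Reals_cases)
    have "(S (of_real Y0))\<^sup>2 = of_real ((Y0 * gg)\<^sup>2)"
      using cpoly_of_real[of "disc_poly (flip p)" Y0]
      unfolding tilde_Y0(1)[symmetric] S(2)[OF Ucut[OF Y0U]] cpoly_disc tilde_polys by simp
    then have "r\<^sup>2 = (Y0 * gg)\<^sup>2" unfolding r(1) of_real_power[symmetric] of_real_eq_iff .
    then show ?thesis using r gg_pos Y0_pos by (simp add: power2_eq_iff_nonneg del: power_mult_distrib)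
  qed
  have fY: "f (of_real Y0) = of_real X0"
  proof -
    have "2 * ?a (of_real Y0) * of_real X0 + ?b (of_real Y0) = S (of_real Y0)"
      unfolding SY tilde_Y0(2)[symmetric] by simp
    then have "2 * ?a (of_real Y0) * f (of_real Y0) = 2 * ?a (of_real Y0) * of_real X0" using fS[OF Y0U] by (metis add_right_cancel)
    moreover have "2 * ?a (of_real Y0) ~= 0" using aU[OF Y0U] by (rule two)
    ultimately show ?thesis by (metis mult_left_cancel)
  qed
  define f1 where "f1 = deriv f"
  have f1: "(f has_field_derivative f1 z) (at z)" if "z \<in> U" for z
    unfolding f1_def by (rule holomorphic_derivI[OF f_hol oU that])
  define f2 where "f2 = deriv f1 (of_real Y0)"
  have f2: "(f1 has_field_derivative f2) (at (of_real Y0))"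
    unfolding f2_def f1_def by (rule holomorphic_derivI[OF holomorphic_deriv[OF f_hol oU] oU Y0U])
  let ?a1 = "%y. 2 * of_real (p 1 1) * y + of_real (p 1 0) :: complex"
  let ?b1 = "%y. 2 * of_real (p 0 1) * y - 1 :: complex"
  let ?c1 = "%y. 2 * of_real (p (-1) 1) * y + of_real (p (-1) 0) :: complex"
  define E where "E z = (2 * ?a z * f z + ?b z) * f1 z + (?a1 z * (f z)\<^sup>2 + ?b1 z * f z + ?c1 z)" for z
  have E0: "E z = 0" if z: "z \<in> U" for z
  proof -
    have "((%z. ?a z * (f z)\<^sup>2 + ?b z * f z + ?c z) has_field_derivative E z) (at z)"
      unfolding E_def by (auto intro!: derivative_eq_intros f1[OF z] simp: algebra_simps power2_eq_square)
    then show ?thesis by (rule deriv_eq_0_locally[OF _ oU z kern])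
  qed
  have "?a1 (of_real Y0) * (of_real X0)\<^sup>2 + ?b1 (of_real Y0) * of_real X0 + ?c1 (of_real Y0) = of_real (2 * a X0 * Y0 + b X0)"
    unfolding a_eq b_eq by (simp add: algebra_simps)
  also have "... = 0" using kernel_Y0(2) by simp
  finally have z: "?a1 (of_real Y0) * (of_real X0)\<^sup>2 + ?b1 (of_real Y0) * of_real X0 + ?c1 (of_real Y0) = 0" .
  have fS': "2 * ?a (of_real Y0) * of_real X0 + ?b (of_real Y0) = of_real (Y0 * gg)"
    using fS[OF Y0U] unfolding fY SY .
  have "of_real (Y0 * gg) * f1 (of_real Y0) = 0"
    using E0[OF Y0U] unfolding E_def fY fS' z by (simp only: add_0_right)
  then have f10: "f1 (of_real Y0) = 0" using Y0_pos gg_pos by simp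
  have "(E has_field_derivative (2 * ?a (of_real Y0) * f (of_real Y0) + ?b (of_real Y0)) * f2 +
      (2 * of_real (p 1 1) * (f (of_real Y0))\<^sup>2 + 2 * of_real (p 0 1) * f (of_real Y0) + 2 * of_real (p (-1) 1))) (at (of_real Y0))"
    unfolding E_def[abs_def] using f1[OF Y0U] f2 by (auto intro!: derivative_eq_intros simp: f10 algebra_simps)
  then have "(2 * ?a (of_real Y0) * f (of_real Y0) + ?b (of_real Y0)) * f2 +
      (2 * of_real (p 1 1) * (f (of_real Y0))\<^sup>2 + 2 * of_real (p 0 1) * f (of_real Y0) + 2 * of_real (p (-1) 1)) = 0"
    by (rule deriv_eq_0_locally[OF _ oU Y0U E0])
  then have "of_real (Y0 * gg) * f2 + of_real (2 * a X0) = 0"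
    unfolding fY fS' a_eq by (simp add: algebra_simps)
  then have "f2 = - of_real (2 * a X0 / (Y0 * gg))"
    using Y0_pos gg_pos by (simp add: field_simps add_eq_0_iff)
  then show ?thesis unfolding f2_def f1_def f_def by (simp add: numeral_2_eq_2)
qed

text \<open>The right-hand side is the form that the Laplace integral produces. Both sides are
  positive, so it suffices to compare squares.\<close>

lemma C0_eq: "C0 p = X0 / (a X0 * sqrt (2 * pi * sig2))"
proof -
  define A where "A = a X0"
  have pos: "A > 0" "X0 > 0" "Y0 > 0" "gg > 0" using kernel_Y0 X0_gt_1 Y0_pos gg_pos by (auto simp: A_def)
  have R: "Re ((deriv ^^ 2) (X1 p) (of_real Y0)) = - (2 * A / (Y0 * gg))"
    unfolding X1_second_deriv A_def by simp
  have "- poly (disc_poly (flip p)) Y0 * (- (2 * A / (Y0 * gg))) = 2 * A * (Y0 * gg)"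
    unfolding tilde_Y0(1) using pos by (simp add: power2_eq_square)
  then have C: "C0 p = sqrt (2 / pi) * (Y0 / sig2 * sqrt X0) / sqrt (2 * A * (Y0 * gg))"
    unfolding C0_def s_xy_0 R s_y'0 by simp
  have Cp: "C0 p > 0" unfolding C using pos sig2_pos by simp
  have Rp: "X0 / (A * sqrt (2 * pi * sig2)) > 0" using pos sig2_pos by simp
  have "(C0 p)\<^sup>2 = (2 / pi) * ((Y0 / sig2)\<^sup>2 * X0) / (2 * A * (Y0 * gg))"
    unfolding C using pos by (simp add: power_divide power_mult_distrib)
  also have "... = X0\<^sup>2 / (A\<^sup>2 * (2 * pi * sig2))"
    unfolding sig2_gg A_def[symmetric] using pos by (simp add: power2_eq_square field_simps)
  also have "... = (X0 / (A * sqrt (2 * pi * sig2)))\<^sup>2"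
    using sig2_pos by (simp add: power_divide power_mult_distrib)
  finally show ?thesis using Cp Rp unfolding A_def by (metis less_imp_le power2_eq_imp_eq)
qed

end

section \<open>A uniform Laplace estimate\<close>

lemma gauss_integral:
  fixes a :: real
  assumes "a > 0"
  shows "integrable lborel (%x. exp (- a * x\<^sup>2))" "integral\<^sup>L lborel (%x. exp (- a * x\<^sup>2)) = sqrt (pi / a)"
proof -
  define \<sigma> where "\<sigma> = 1 / sqrt (2 * a)"
  have \<sigma>: "\<sigma> > 0" "2 * \<sigma>\<^sup>2 = 1 / a" using assms by (auto simp: \<sigma>_def power_divide)
  have e: "exp (- a * x\<^sup>2) = sqrt (pi / a) * normal_density 0 \<sigma> x" for x
  proof -
    have "normal_density 0 \<sigma> x = 1 / sqrt (pi * (2 * \<sigma>\<^sup>2)) * exp (- x\<^sup>2 / (2 * \<sigma>\<^sup>2))"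
      by (simp add: normal_density_def mult_ac)
    then show ?thesis unfolding \<sigma>(2) using assms by (simp add: real_sqrt_divide mult_ac)
  qed
  show "integrable lborel (%x. exp (- a * x\<^sup>2))" "integral\<^sup>L lborel (%x. exp (- a * x\<^sup>2)) = sqrt (pi / a)"
    unfolding e using integrable_normal_density[OF \<sigma>(1), of 0] integral_normal_density[OF \<sigma>(1), of 0] by auto
qed

text \<open>Outside the interval half of the exponent is at least a \<eta>^2/2, and the other half
  is kept as a Gaussian.\<close>

lemma gauss_interval:
  fixes a \<eta> :: real
  assumes "a > 0" "\<eta> > 0"
  shows "integral {-\<eta>..\<eta>} (%x. exp (- a * x\<^sup>2)) <= sqrt (pi / a)"
    and "sqrt (pi / a) - exp (- a * \<eta>\<^sup>2 / 2) * sqrt (2 * pi / a) <= integral {-\<eta>..\<eta>} (%x. exp (- a * x\<^sup>2))"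
proof -
  let ?f = "%x::real. exp (- a * x\<^sup>2)"
  note g = gauss_integral[OF assms(1)]
  have si: "set_integrable lborel {-\<eta>..\<eta>} ?f"
    unfolding set_integrable_def using g(1) by (intro integrable_mult_indicator) auto
  have e: "integral {-\<eta>..\<eta>} ?f = integral\<^sup>L lborel (%x. indicator {-\<eta>..\<eta>} x * ?f x)"
    using set_borel_integral_eq_integral(2)[OF si] by (simp add: set_lebesgue_integral_def)
  have i1: "integrable lborel (%x. indicator {-\<eta>..\<eta>} x * ?f x)"
    using si by (simp add: set_integrable_def)
  have "integral\<^sup>L lborel (%x. indicator {-\<eta>..\<eta>} x * ?f x) <= integral\<^sup>L lborel ?f"
    by (rule integral_mono[OF i1 g(1)]) (auto simp: indicator_def)
  then show "integral {-\<eta>..\<eta>} ?f <= sqrt (pi / a)" unfolding e g(2) .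
  have h: "a / 2 > 0" using assms by simp
  note g2 = gauss_integral[OF h]
  have "integral\<^sup>L lborel ?f - integral\<^sup>L lborel (%x. indicator {-\<eta>..\<eta>} x * ?f x)
      = integral\<^sup>L lborel (%x. ?f x - indicator {-\<eta>..\<eta>} x * ?f x)"
    by (rule Bochner_Integration.integral_diff[symmetric, OF g(1) i1])
  also have "... <= integral\<^sup>L lborel (%x. exp (- a * \<eta>\<^sup>2 / 2) * exp (- (a / 2) * x\<^sup>2))"
  proof (rule integral_mono)
    fix x :: real
    show "?f x - indicator {-\<eta>..\<eta>} x * ?f x <= exp (- a * \<eta>\<^sup>2 / 2) * exp (- (a / 2) * x\<^sup>2)"
    proof (cases "x \<in> {-\<eta>..\<eta>}")
      case False
      then have "\<eta>\<^sup>2 <= x\<^sup>2" using assms by (intro abs_le_square_iff[THEN iffD1]) auto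
      then have "a * \<eta>\<^sup>2 <= a * x\<^sup>2" using assms by simp
      then show ?thesis using False unfolding exp_add[symmetric] by (simp add: field_simps)
    qed auto
  qed (use g i1 g2 in auto)
  also have "... = exp (- a * \<eta>\<^sup>2 / 2) * sqrt (2 * pi / a)" using g2(2) by (simp add: mult.commute)
  finally show "sqrt (pi / a) - exp (- a * \<eta>\<^sup>2 / 2) * sqrt (2 * pi / a) <= integral {-\<eta>..\<eta>} ?f"
    unfolding e g(2) by linarith
qed

lemma exp_ge_self: "y <= exp (y::real)"
  using exp_ge_add_one_self[of y] by linarith

lemma quadratic_le_exp:
  fixes a x :: real
  assumes "a > 0" "x >= 0"
  shows "1 + x + x\<^sup>2 <= (1 + 2 / a + 8 / a\<^sup>2) * exp (a * x / 2)"
proof -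
  define y where "y = a * x / 2"
  have y: "y >= 0" "x = 2 / a * y" using assms by (auto simp: y_def)
  have e: "1 + y + y\<^sup>2 / 2 <= exp y" using exp_lower_Taylor_quadratic[OF y(1)] .
  have p: "0 <= 2 / a" "0 <= 8 / a\<^sup>2" using assms by auto
  have "1 + x + x\<^sup>2 = 1 + 2 / a * y + 8 / a\<^sup>2 * (y\<^sup>2 / 2)" unfolding y(2) by (simp add: power2_eq_square)
  also have "... <= exp y + 2 / a * exp y + 8 / a\<^sup>2 * exp y"
  proof (intro add_mono mult_left_mono p)
    have "0 <= y\<^sup>2" by simp
    then show "1 <= exp y" "y <= exp y" "y\<^sup>2 / 2 <= exp y" using e y(1) by linarith+
  qed
  finally show ?thesis by (simp add: y_def algebra_simps)
qed

text \<open>It depends only on \<eta>, the lower bound \<sigma>1 of the variance and B, because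
  variance, amplitude and phase all move with the saddle.\<close>

definition laplace_const :: "real => real => real => real" where
  "laplace_const \<eta> \<sigma>1 B = (let a = \<sigma>1 / 4 in
     (12 * B^3 + B + 5 * B\<^sup>2) * (1 + 2 / a + 8 / a\<^sup>2) * (4 / a) * sqrt (4 * pi / a) + B * (4 / (\<sigma>1 * \<eta>\<^sup>2)) * sqrt (4 * pi / \<sigma>1))"

text \<open>Besides w0 the subtracted terms are odd in th. What remains is of size 1/n times a
  Gaussian: powers of n th^2 are absorbed into part of the exponent, and one factor th^2 is traded
  for 1/n.\<close>

lemma laplace_pointwise:
  fixes w0 w1 \<kappa> w \<Phi> :: complex and n \<sigma> \<sigma>1 B \<eta> th :: real
  assumes "0 < \<eta>" "\<eta> <= 1" "0 < \<sigma>1" "\<sigma>1 <= \<sigma>" "0 <= B" "2 * B * \<eta> <= \<sigma>1 / 4" "n > 0" "\<bar>th\<bar> <= \<eta>"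
    and "norm \<kappa> <= B" "norm w0 <= B" "norm w1 <= B"
    and "norm (\<Phi> - (- of_real (\<sigma> * th\<^sup>2 / 2) + \<kappa> * of_real (th ^ 3))) <= B * th ^ 4"
    and "norm (w - (w0 + w1 * of_real th)) <= B * th\<^sup>2"
  shows "norm (w * exp (of_real n * \<Phi>) - of_real (exp (- (n * \<sigma> / 2) * th\<^sup>2)) * (w0 + w1 * of_real th + w0 * of_real n * \<kappa> * of_real (th ^ 3)))
     <= (12 * B^3 + B + 5 * B\<^sup>2) * (1 + 2 / (\<sigma>1 / 4) + 8 / (\<sigma>1 / 4)\<^sup>2) * (4 / (\<sigma>1 / 4)) / n * exp (- (n * (\<sigma>1 / 4) / 4) * th\<^sup>2)"
proof -
  define a where "a = \<sigma>1 / 4"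
  define A where "A = - (n * \<sigma> / 2) * th\<^sup>2"
  define E where "E = of_real n * \<Phi> - of_real A"
  define q where "q = \<bar>th\<bar>"
  have q: "0 <= q" "q <= \<eta>" "q <= 1" "th\<^sup>2 = q\<^sup>2" "th ^ 4 = q ^ 4" "\<bar>th ^ 3\<bar> = q ^ 3"
    using assms by (auto simp: q_def power_abs)
  have a: "a > 0" using assms by (simp add: a_def)
  have EK: "norm (E - of_real n * \<kappa> * of_real (th ^ 3)) <= n * (B * q ^ 4)"
  proof -
    have "E - of_real n * \<kappa> * of_real (th ^ 3) = of_real n * (\<Phi> - (- of_real (\<sigma> * th\<^sup>2 / 2) + \<kappa> * of_real (th ^ 3)))"
      by (simp add: E_def A_def algebra_simps)
    then show ?thesis using assms(7,12) unfolding q(5) by (simp add: norm_mult mult_left_mono)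
  qed
  have q34: "q ^ 4 <= q ^ 3" "q ^ 3 <= q\<^sup>2" using q by (auto intro!: power_decreasing)
  have E: "norm E <= 2 * n * B * q ^ 3"
  proof -
    have "norm E <= norm (E - of_real n * \<kappa> * of_real (th ^ 3)) + norm (of_real n * \<kappa> * of_real (th ^ 3))"
      by (metis diff_add_cancel norm_triangle_ineq)
    also have "norm (of_real n * \<kappa> * of_real (th ^ 3)) <= n * (B * q ^ 3)"
      using assms(7,9) q(1,6) by (simp add: norm_mult norm_power q_def mult_left_mono mult_right_mono)
    also have "norm (E - of_real n * \<kappa> * of_real (th ^ 3)) <= n * (B * q ^ 3)"
      using EK q34(1) assms(5,7) by (meson less_imp_le mult_left_mono order_trans)
    finally show ?thesis by (simp add: mult_ac)
  qed
  have ReE: "\<bar>Re E\<bar> <= n * a * q\<^sup>2"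
  proof -
    have "\<bar>Re E\<bar> <= 2 * n * B * q ^ 3" using E abs_Re_le_cmod[of E] by linarith
    also have "... = n * (2 * B * q) * q\<^sup>2" by (simp add: power2_eq_square power3_eq_cube)
    also have "... <= n * a * q\<^sup>2"
    proof (intro mult_right_mono mult_left_mono)
      have "2 * B * q <= 2 * B * \<eta>" using q assms by (intro mult_left_mono) auto
      then show "2 * B * q <= a" using assms(6) by (simp add: a_def)
    qed (use assms in auto)
    finally show ?thesis .
  qed
  have eA: "exp A <= exp (- n * a * q\<^sup>2)" "exp A * exp \<bar>Re E\<bar> <= exp (- n * a * q\<^sup>2)"
  proof -
    have "A <= - n * (2 * a) * q\<^sup>2" using assms q(4) by (simp add: A_def a_def mult_right_mono)
    moreover have "0 <= n * a * q\<^sup>2" using assms a by simp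
    ultimately show "exp A <= exp (- n * a * q\<^sup>2)" "exp A * exp \<bar>Re E\<bar> <= exp (- n * a * q\<^sup>2)"
      using ReE unfolding exp_add[symmetric] exp_le_cancel_iff by (auto simp: algebra_simps)
  qed
  \<comment> \<open>Only |Re E| enters the exponential, and by the smallness of \<eta> it takes up
    at most half of the Gaussian exponent.\<close>
  have T: "norm (exp E - 1 - E) <= exp \<bar>Re E\<bar> * (norm E)\<^sup>2"
    using Taylor_exp[of E 1] by (simp add: numeral_2_eq_2 algebra_simps)
  have wn: "norm w <= 3 * B"
  proof -
    have "norm w <= norm (w - (w0 + w1 * of_real th)) + norm w0 + norm (w1 * of_real th)"
      by (metis add.assoc diff_add_cancel norm_triangle_ineq norm_triangle_le add_left_mono order_trans)
    moreover have "norm (w1 * of_real th) <= B * 1" unfolding norm_mult using assms(2,5,8,11) by (intro mult_mono) auto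
    moreover have "B * th\<^sup>2 <= B * 1" using q assms(5) unfolding q(4) by (intro mult_left_mono) (auto simp: power_le_one)
    ultimately show ?thesis using assms(10,13) by linarith
  qed
  define z where "z = n * q\<^sup>2"
  have z: "z >= 0" using assms by (simp add: z_def)
  have "norm (w * exp (of_real n * \<Phi>) - of_real (exp A) * (w0 + w1 * of_real th + w0 * of_real n * \<kappa> * of_real (th ^ 3)))
    = exp A * norm (w * (exp E - 1 - E) + (w - (w0 + w1 * of_real th)) * (1 + E) + w0 * (E - of_real n * \<kappa> * of_real (th ^ 3)) + w1 * of_real th * E)"
  proof -
    have "exp (of_real n * \<Phi>) = of_real (exp A) * exp E" by (simp add: E_def exp_diff exp_of_real)
    then have "w * exp (of_real n * \<Phi>) - of_real (exp A) * (w0 + w1 * of_real th + w0 * of_real n * \<kappa> * of_real (th ^ 3))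
      = of_real (exp A) * (w * (exp E - 1 - E) + (w - (w0 + w1 * of_real th)) * (1 + E) + w0 * (E - of_real n * \<kappa> * of_real (th ^ 3)) + w1 * of_real th * E)"
      by (simp add: algebra_simps)
    then show ?thesis by (simp add: norm_mult)
  qed
  also have "... <= exp A * (3 * B * (exp \<bar>Re E\<bar> * (2 * n * B * q ^ 3)\<^sup>2) + B * q\<^sup>2 * (1 + 2 * n * B * q ^ 3) + B * (n * (B * q ^ 4)) + B * q * (2 * n * B * q ^ 3))"
  proof (intro mult_left_mono norm_triangle_le add_mono)
    show "norm (w * (exp E - 1 - E)) <= 3 * B * (exp \<bar>Re E\<bar> * (2 * n * B * q ^ 3)\<^sup>2)"
      unfolding norm_mult using wn T E assms(5)
      by (intro mult_mono order_trans[OF T] mult_left_mono power_mono) auto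
    have "norm (1 + E) <= 1 + 2 * n * B * q ^ 3" using E norm_triangle_ineq[of 1 E] by simp
    then show "norm ((w - (w0 + w1 * of_real th)) * (1 + E)) <= B * q\<^sup>2 * (1 + 2 * n * B * q ^ 3)"
      unfolding norm_mult using assms(5,13) q(4) by (intro mult_mono) auto
    show "norm (w0 * (E - of_real n * \<kappa> * of_real (th ^ 3))) <= B * (n * (B * q ^ 4))"
      unfolding norm_mult using assms(5,10) EK by (intro mult_mono) auto
    show "norm (w1 * of_real th * E) <= B * q * (2 * n * B * q ^ 3)"
      unfolding norm_mult using assms(5,11) E q by (intro mult_mono) (auto simp: q_def)
  qed simp
  also have "... = (exp A * exp \<bar>Re E\<bar>) * (12 * B^3 * q\<^sup>2 * z\<^sup>2) + exp A * (B * q\<^sup>2 + 2 * B\<^sup>2 * n * (q\<^sup>2 * q ^ 3) + 3 * B\<^sup>2 * q\<^sup>2 * z)"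
    by (simp add: z_def power2_eq_square power3_eq_cube power4_eq_xxxx algebra_simps)
  also have "... <= exp (- n * a * q\<^sup>2) * (12 * B^3 * q\<^sup>2 * z\<^sup>2) + exp (- n * a * q\<^sup>2) * (B * q\<^sup>2 + 2 * B\<^sup>2 * n * (q\<^sup>2 * q\<^sup>2) + 3 * B\<^sup>2 * q\<^sup>2 * z)"
    using assms(5,7) q z by (intro add_mono mult_mono eA mult_left_mono mult_right_mono q34) auto
  also have "... = exp (- n * a * q\<^sup>2) * (q\<^sup>2 * (12 * B^3 * z\<^sup>2 + B + 5 * B\<^sup>2 * z))"
    by (simp add: z_def power2_eq_square algebra_simps)
  also have "... <= exp (- n * a * q\<^sup>2) * (q\<^sup>2 * ((12 * B^3 + B + 5 * B\<^sup>2) * (1 + z + z\<^sup>2)))"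
  proof (intro mult_left_mono)
    have "0 <= B * z" "0 <= B * z\<^sup>2" "0 <= B\<^sup>2 * z\<^sup>2" "0 <= B^3 * z" "0 <= B^3" "0 <= B\<^sup>2" using z assms(5) by auto
    then show "12 * B^3 * z\<^sup>2 + B + 5 * B\<^sup>2 * z <= (12 * B^3 + B + 5 * B\<^sup>2) * (1 + z + z\<^sup>2)"
      by (simp add: algebra_simps)
  qed auto
  also have "... <= exp (- n * a * q\<^sup>2) * (q\<^sup>2 * ((12 * B^3 + B + 5 * B\<^sup>2) * ((1 + 2 / a + 8 / a\<^sup>2) * exp (a * z / 2))))"
    using assms(5) a z by (intro mult_left_mono quadratic_le_exp) auto
  also have "... <= exp (- n * a * q\<^sup>2) * ((4 / a / n * exp (a * z / 4)) * ((12 * B^3 + B + 5 * B\<^sup>2) * ((1 + 2 / a + 8 / a\<^sup>2) * exp (a * z / 2))))"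
  proof (intro mult_left_mono mult_right_mono)
    have "q\<^sup>2 = 4 / a / n * (a * z / 4)" using a assms(7) by (simp add: z_def)
    also have "... <= 4 / a / n * exp (a * z / 4)" using a assms(7) by (intro mult_left_mono exp_ge_self) auto
    finally show "q\<^sup>2 <= 4 / a / n * exp (a * z / 4)" .
  qed (use assms(5) a in auto)
  also have "... = (12 * B^3 + B + 5 * B\<^sup>2) * (1 + 2 / a + 8 / a\<^sup>2) * (4 / a) / n * (exp (- n * a * q\<^sup>2) * (exp (a * z / 4) * exp (a * z / 2)))"
    by simp
  also have "exp (- n * a * q\<^sup>2) * (exp (a * z / 4) * exp (a * z / 2)) = exp (- (n * a / 4) * th\<^sup>2)"
    unfolding exp_add[symmetric] q(4) by (simp add: z_def field_simps)
  finally show ?thesis unfolding A_def a_def .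
qed

lemma integral_odd:
  fixes f :: "real => complex"
  assumes "\<And>x. f (- x) = - f x"
  shows "integral {-\<eta>..\<eta>} f = 0"
proof -
  have "integral {-\<eta>..\<eta>} f = integral {-\<eta>..\<eta>} (%x. f (- x))"
    using Henstock_Kurzweil_Integration.integral_reflect_real[of "\<eta>" "-\<eta>" f] by simp
  also have "... = - integral {-\<eta>..\<eta>} f" unfolding assms by simp
  finally show ?thesis by simp
qed

text \<open>The odd corrections cancel over the symmetric interval, so the relative error is 1/n and
  not 1/sqrt n.\<close>

theorem laplace_estimate:
  fixes w0 w1 \<kappa> :: complex and w \<Phi> :: "real => complex" and n \<sigma> \<sigma>1 B \<eta> :: real
  assumes "0 < \<eta>" "\<eta> <= 1" "0 < \<sigma>1" "\<sigma>1 <= \<sigma>" "0 <= B" "2 * B * \<eta> <= \<sigma>1 / 4" "n >= 1"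
    and "norm \<kappa> <= B" "norm w0 <= B" "norm w1 <= B"
    and \<Phi>: "\<And>th. \<bar>th\<bar> <= \<eta> ==> norm (\<Phi> th - (- of_real (\<sigma> * th\<^sup>2 / 2) + \<kappa> * of_real (th ^ 3))) <= B * th ^ 4"
    and w: "\<And>th. \<bar>th\<bar> <= \<eta> ==> norm (w th - (w0 + w1 * of_real th)) <= B * th\<^sup>2"
    and cont: "continuous_on {-\<eta>..\<eta>} w" "continuous_on {-\<eta>..\<eta>} \<Phi>"
  shows "norm (integral {-\<eta>..\<eta>} (%th. w th * exp (of_real n * \<Phi> th)) - w0 * of_real (sqrt (2 * pi / (n * \<sigma>))))
     <= laplace_const \<eta> \<sigma>1 B / (n * sqrt n)"
proof -
  have n: "n > 0" using assms by simp
  have \<sigma>: "\<sigma> > 0" using assms by simp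
  define a where "a = \<sigma>1 / 4"
  have a: "a > 0" using assms by (simp add: a_def)
  define K where "K = (12 * B^3 + B + 5 * B\<^sup>2) * (1 + 2 / a + 8 / a\<^sup>2) * (4 / a)"
  have K: "K >= 0" using assms(5) a by (simp add: K_def)
  define g where "g th = complex_of_real (exp (- (n * \<sigma> / 2) * th\<^sup>2))" for th
  define odd where "odd th = g th * (w1 * of_real th + w0 * of_real n * \<kappa> * of_real (th ^ 3))" for th
  define I where "I th = w th * exp (of_real n * \<Phi> th)" for th
  have ig: "g integrable_on {-\<eta>..\<eta>}" unfolding g_def by (intro integrable_continuous_real continuous_intros)
  have io: "odd integrable_on {-\<eta>..\<eta>}" unfolding odd_def g_def by (intro integrable_continuous_real continuous_intros)
  have iI: "I integrable_on {-\<eta>..\<eta>}" unfolding I_def by (intro integrable_continuous_real continuous_intros cont)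
  have e0: "integral {-\<eta>..\<eta>} odd = 0"
    by (rule integral_odd) (simp add: odd_def g_def algebra_simps)
  have "norm (integral {-\<eta>..\<eta>} (%th. I th - (w0 * g th + odd th))) <= integral {-\<eta>..\<eta>} (%th. K / n * exp (- (n * a / 4) * th\<^sup>2))"
  proof (rule integral_norm_bound_integral)
    show "(%th. I th - (w0 * g th + odd th)) integrable_on {-\<eta>..\<eta>}"
      by (intro integrable_diff integrable_add iI io) (use integrable_on_mult_right[OF ig] in simp)
    show "(%th. K / n * exp (- (n * a / 4) * th\<^sup>2)) integrable_on {-\<eta>..\<eta>}"
      by (intro integrable_continuous_real continuous_intros)
    fix th assume "th \<in> {-\<eta>..\<eta>}"
    then have th: "\<bar>th\<bar> <= \<eta>" by auto
    have "I th - (w0 * g th + odd th) = w th * exp (of_real n * \<Phi> th) - of_real (exp (- (n * \<sigma> / 2) * th\<^sup>2)) * (w0 + w1 * of_real th + w0 * of_real n * \<kappa> * of_real (th ^ 3))"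
      by (simp add: I_def odd_def g_def algebra_simps)
    then show "norm (I th - (w0 * g th + odd th)) <= K / n * exp (- (n * a / 4) * th\<^sup>2)"
      using laplace_pointwise[OF assms(1-6) n th assms(8-10) \<Phi>[OF th] w[OF th]] unfolding K_def a_def by simp
  qed
  also have "... = K / n * integral {-\<eta>..\<eta>} (%th. exp (- (n * a / 4) * th\<^sup>2))" by simp
  also have "... <= K / n * sqrt (pi / (n * a / 4))"
    using K n a assms(1) by (intro mult_left_mono gauss_interval) auto
  also have "... = K * sqrt (4 * pi / a) / (n * sqrt n)" using n a by (simp add: real_sqrt_divide real_sqrt_mult field_simps)
  finally have 1: "norm (integral {-\<eta>..\<eta>} (%th. I th - (w0 * g th + odd th))) <= K * sqrt (4 * pi / a) / (n * sqrt n)" .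
  have i: "integral {-\<eta>..\<eta>} (%th. I th - (w0 * g th + odd th)) = integral {-\<eta>..\<eta>} I - w0 * integral {-\<eta>..\<eta>} g"
  proof -
    have "integral {-\<eta>..\<eta>} (%th. I th - (w0 * g th + odd th)) = integral {-\<eta>..\<eta>} I - (integral {-\<eta>..\<eta>} (%th. w0 * g th) + integral {-\<eta>..\<eta>} odd)"
      using iI io integrable_on_mult_right[OF ig, of w0] by (simp add: Henstock_Kurzweil_Integration.integral_diff Henstock_Kurzweil_Integration.integral_add integrable_add)
    then show ?thesis unfolding e0 by simp
  qed
  define G where "G = integral {-\<eta>..\<eta>} (%th. exp (- (n * \<sigma> / 2) * th\<^sup>2))"
  have gG: "integral {-\<eta>..\<eta>} g = of_real G"
    unfolding g_def G_def
    by (intro integral_unique has_integral_linear[OF integrable_integral bounded_linear_of_real, unfolded o_def]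
        integrable_continuous_real continuous_intros)
  define s where "s = sqrt (2 * pi / (n * \<sigma>))"
  have ns: "n * \<sigma> / 2 > 0" using n \<sigma> by simp
  have "s - exp (- (n * \<sigma> / 2) * \<eta>\<^sup>2 / 2) * sqrt (2 * pi / (n * \<sigma> / 2)) <= G" "G <= s"
    using gauss_interval[OF ns assms(1)] by (simp_all add: G_def s_def mult.commute)
  then have "norm (w0 * (of_real G - of_real s)) <= B * (exp (- (n * \<sigma> / 2) * \<eta>\<^sup>2 / 2) * sqrt (2 * pi / (n * \<sigma> / 2)))"
    unfolding norm_mult of_real_diff[symmetric] norm_of_real using assms(5,9) by (intro mult_mono) auto
  also have "... <= B * (4 / (n * \<sigma>1 * \<eta>\<^sup>2) * (sqrt (4 * pi / \<sigma>1) / sqrt n))"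
  proof (intro mult_left_mono mult_mono)
    define Z where "Z = n * \<sigma> * \<eta>\<^sup>2 / 4"
    have Z: "Z > 0" using n \<sigma> assms(1) by (simp add: Z_def)
    have "exp (- Z) <= 1 / Z" using exp_ge_self[of Z] Z by (simp add: exp_minus field_simps)
    also have "... = 4 / (n * \<sigma> * \<eta>\<^sup>2)" by (simp add: Z_def)
    also have "... <= 4 / (n * \<sigma>1 * \<eta>\<^sup>2)" using n \<sigma> assms by (intro divide_left_mono mult_right_mono mult_left_mono) auto
    finally show "exp (- (n * \<sigma> / 2) * \<eta>\<^sup>2 / 2) <= 4 / (n * \<sigma>1 * \<eta>\<^sup>2)" by (simp add: Z_def field_simps)
    have "2 * pi / (n * \<sigma> / 2) <= 4 * pi / \<sigma>1 / n"
      using n \<sigma> assms by (simp add: divide_simps mult_left_mono)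
    then show "sqrt (2 * pi / (n * \<sigma> / 2)) <= sqrt (4 * pi / \<sigma>1) / sqrt n"
      by (metis real_sqrt_divide real_sqrt_le_iff)
  qed (use assms n in auto)
  also have "... = B * (4 / (\<sigma>1 * \<eta>\<^sup>2)) * sqrt (4 * pi / \<sigma>1) / (n * sqrt n)" by (simp add: mult_ac)
  finally have 2: "norm (w0 * (of_real G - of_real s)) <= B * (4 / (\<sigma>1 * \<eta>\<^sup>2)) * sqrt (4 * pi / \<sigma>1) / (n * sqrt n)" .
  have "norm (integral {-\<eta>..\<eta>} I - w0 * of_real s) <= norm (integral {-\<eta>..\<eta>} I - w0 * of_real G) + norm (w0 * (of_real G - of_real s))"
    by (metis (no_types, lifting) diff_add_cancel add_diff_eq norm_triangle_ineq right_diff_distrib)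
  also have "... <= K * sqrt (4 * pi / a) / (n * sqrt n) + B * (4 / (\<sigma>1 * \<eta>\<^sup>2)) * sqrt (4 * pi / \<sigma>1) / (n * sqrt n)"
    using 1 2 unfolding i gG by (rule add_mono)
  also have "... = laplace_const \<eta> \<sigma>1 B / (n * sqrt n)"
    by (simp add: laplace_const_def Let_def K_def a_def add_divide_distrib)
  finally show ?thesis unfolding I_def s_def .
qed

text \<open>One constant serves all centres z in the disc; the centre will be the moving saddle
  point.\<close>

lemma taylor_uniform:
  fixes a :: complex
  assumes "f holomorphic_on ball a R" "r < R"
  shows "\<exists>B\<ge>0. (\<forall>z\<in>cball a r. \<forall>k\<le>Suc n. norm ((deriv ^^ k) f z) <= B) \<and>
     (\<forall>z\<in>cball a r. \<forall>w\<in>cball a r. norm (f w - (\<Sum>i\<le>n. (deriv ^^ i) f z * (w - z) ^ i / fact i)) <= B * norm (w - z) ^ Suc n)"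
proof -
  have sub: "cball a r \<subseteq> ball a R" using assms(2) by auto
  have hol: "(deriv ^^ k) f holomorphic_on ball a R" for k
    using assms(1) by (intro holomorphic_higher_deriv) auto
  have "\<exists>B. \<forall>z\<in>cball a r. norm ((deriv ^^ k) f z) <= B" for k
  proof -
    have "compact ((deriv ^^ k) f ` cball a r)"
      by (intro compact_continuous_image holomorphic_on_imp_continuous_on holomorphic_on_subset[OF hol sub]) auto
    then show ?thesis using compact_imp_bounded[of "(deriv ^^ k) f ` cball a r"] by (auto simp: bounded_iff)
  qed
  then obtain b where b: "\<And>k z. z \<in> cball a r ==> norm ((deriv ^^ k) f z) <= b k" by metis
  define B where "B = (\<Sum>k\<le>Suc n. \<bar>b k\<bar>)"
  have bB: "b k <= B" if "k <= Suc n" for k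
  proof -
    have "\<bar>b k\<bar> <= B" unfolding B_def using that by (intro member_le_sum) auto
    then show ?thesis by simp
  qed
  have B0: "0 <= B" by (auto simp: B_def intro!: sum_nonneg)
  have "norm (f w - (\<Sum>i\<le>n. (deriv ^^ i) f z * (w - z) ^ i / fact i)) <= B * norm (w - z) ^ Suc n"
    if zw: "z \<in> cball a r" "w \<in> cball a r" for z w
  proof -
    have "norm ((deriv ^^ 0) f w - (\<Sum>i\<le>n. (deriv ^^ i) f z * (w - z) ^ i / fact i)) <= B * norm (w - z) ^ Suc n / fact n"
    proof (rule complex_Taylor[OF convex_cball[of a r], where f = "%i. (deriv ^^ i) f"])
      fix i x assume "x \<in> cball a r"
      then show "((deriv ^^ i) f has_field_derivative (deriv ^^ Suc i) f x) (at x within cball a r)"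
        using holomorphic_derivI[OF hol open_ball, of x i] sub by (auto intro: has_field_derivative_at_within)
    next
      fix x assume "x \<in> cball a r"
      then show "norm ((deriv ^^ Suc n) f x) <= B" by (rule order_trans[OF b bB[OF order_refl]])
    qed (use zw in auto)
    also have "... <= B * norm (w - z) ^ Suc n / 1"
      using B0 by (intro divide_left_mono) (auto simp: fact_ge_1)
    finally show ?thesis by simp
  qed
  moreover have "norm ((deriv ^^ k) f z) <= B" if "z \<in> cball a r" "k <= Suc n" for z k
    by (rule order_trans[OF b[OF that(1)] bB[OF that(2)]])
  ultimately show ?thesis using B0 by blast
qed

context drift_walk begin

section \<open>Decay of the first passage function away from the real saddle\<close>

text \<open>The index in the integer lattice of the subgroup generated by the steps.\<close>

definition kap :: nat where "kap = (if diagonal_mass p = 1 then 2 else 1)"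
definition Th :: real where "Th = pi / kap"

lemma kap_pos: "kap > 0" and Th_pos: "Th > 0" and Th_le: "Th <= pi"
  by (auto simp: kap_def Th_def)

definition yy :: "real => real => complex" where "yy v th = exp (Complex v th)"

lemma norm_yy [simp]: "norm (yy v th) = exp v"
  by (simp add: yy_def)

lemma yy_ann: "\<bar>v - v0\<bar> <= dl0 ==> yy v th \<in> ann"
  unfolding ann_def Y0_def by (auto simp: exp_add[symmetric])

lemma yy_nonzero [simp]: "yy v th ~= 0"
  by (simp add: yy_def)

lemma yy_0: "yy v 0 = of_real (exp v)"
  by (simp add: yy_def complex_of_real_def[symmetric] exp_of_real)

lemma yy_eq: "yy v th = of_real (exp v) * exp (\<i> * of_real th)"
  by (simp add: yy_def Complex_eq exp_add exp_of_real)

text \<open>In the diagonal case the half period is pi/2, which keeps the second maximum at -Y0 out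
  of range.\<close>

lemma yy_strict: "\<bar>th\<bar> <= Th ==> 0 <= s ==> s <= 1 ==> s ~= 1 | th ~= 0 ==> norm (F (of_real s) (yy v0 th)) < 1 / X0"
proof (rule ccontr)
  assume A: "\<bar>th\<bar> <= Th" "0 <= s" "s <= 1" "s ~= 1 | th ~= 0" "\<not> norm (F (of_real s) (yy v0 th)) < 1 / X0"
  then have s1: "s = 1" and y: "yy v0 th = of_real Y0 | diagonal_mass p = 1 & yy v0 th = - of_real Y0"
    using F_strict[of s "yy v0 th"] by (auto simp: Y0_def)
  have th: "th ~= 0" "\<bar>th\<bar> <= pi" using A s1 Th_le by auto
  have Y: "complex_of_real (exp v0) ~= 0" by simp
  have e: "exp (\<i> * of_real th) = Complex (cos th) (sin th)" by (simp add: exp_Euler complex_eq_iff cos_of_real sin_of_real)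
  from y show False
  proof
    assume "yy v0 th = of_real Y0"
    then have "exp (\<i> * of_real th) = 1" unfolding yy_eq Y0_def using Y by (metis mult_cancel_left2)
    then have "cos th = 1" unfolding e by (simp add: complex_eq_iff)
    then have "cos \<bar>th\<bar> = cos 0" by simp
    then have "\<bar>th\<bar> = 0" using cos_inj_pi[of "\<bar>th\<bar>" 0] th(2) by simp
    then show False using th(1) by simp
  next
    assume B: "diagonal_mass p = 1 & yy v0 th = - of_real Y0"
    then have "of_real (exp v0) * exp (\<i> * of_real th) = of_real (exp v0) * (-1)" unfolding yy_eq Y0_def by simp
    then have "exp (\<i> * of_real th) = -1" using Y by (metis mult_left_cancel)
    then have c: "cos th = -1" unfolding e by (simp add: complex_eq_iff)
    have "\<bar>th\<bar> <= pi / 2" using A(1) B by (simp add: Th_def kap_def)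
    then have "cos th >= 0" using cos_ge_zero[of th] by auto
    then show False using c by simp
  qed
qed

lemma fr_exp: "\<bar>v - v0\<bar> <= dl0 ==> F 1 (yy v 0) = of_real (fr (exp v)) & fr (exp v) > 0"
  using F_real[of "exp v"] fr_pos[of "exp v"] yy_ann[of v 0] by (simp add: yy_0)

lemma F_yy_cont: "continuous_on ({v0 - dl0..v0 + dl0} \<times> {0..1} \<times> UNIV) (%(v, s, th). F (of_real s) (yy v th))"
  unfolding yy_def case_prod_unfold
proof (rule F_cont')
  fix z :: "real \<times> real \<times> real" assume z: "z \<in> {v0 - dl0..v0 + dl0} \<times> {0..1} \<times> UNIV"
  then have "norm (complex_of_real (fst (snd z))) <= 1 + dl0" using region(4) by (auto simp: case_prod_unfold)
  moreover have "\<bar>fst z - v0\<bar> <= dl0" using z by auto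
  ultimately show "norm (complex_of_real (fst (snd z))) <= 1 + dl0 & exp (Complex (fst z) (snd (snd z))) \<in> ann"
    using yy_ann[of "fst z" "snd (snd z)"] by (simp add: yy_def)
qed (auto intro!: continuous_intros)

text \<open>Compactness away from (s, th) = (1, 0): at v0 the ratio to the value on the real axis
  has a maximum less than 1, and uniform continuity extends this to nearby v.\<close>

lemma F_far:
  assumes "r > 0"
  shows "\<exists>\<epsilon>>0. \<exists>d>0. d <= dl0 & (\<forall>v s th. \<bar>v - v0\<bar> <= d --> 0 <= s --> s <= 1 --> \<bar>th\<bar> <= Th --> (s <= 1 - r | r <= \<bar>th\<bar>) -->
     norm (F (of_real s) (yy v th)) <= (1 - \<epsilon>) * fr (exp v))"
proof -
  define I where "I = {v0 - dl0..v0 + dl0}"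
  define K where "K = {0..min 1 (1 - r)} \<times> {-Th..Th} \<union> {0..1} \<times> ({-Th..-r} \<union> {r..Th})"
  define G where "G = (%(v, s, th). norm (F (of_real s) (yy v th)) / fr (exp v))"
  have K: "compact K" unfolding K_def by (intro compact_Un compact_Times) auto
  have K_sub: "K \<subseteq> {0..1} \<times> {-Th..Th}" using assms by (auto simp: K_def)
  have fr_Re: "fr (exp v) = Re (F 1 (yy v 0))" for v by (simp add: fr_def yy_0)
  have frc: "continuous_on (I \<times> K) (%z. fr (exp (fst z)))"
    unfolding fr_Re I_def
    by (intro continuous_on_Re continuous_on_compose2[OF F_yy_cont, where f = "%z. (fst z, 1, 0)", simplified])
       (auto intro!: continuous_intros)
  have Gc: "continuous_on (I \<times> K) G"
    unfolding G_def case_prod_unfold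
  proof (intro continuous_on_divide frc continuous_on_norm)
    show "continuous_on (I \<times> K) (%z. F (of_real (fst (snd z))) (yy (fst z) (snd (snd z))))"
      by (rule continuous_on_subset[OF F_yy_cont[unfolded case_prod_unfold]]) (use K_sub in \<open>auto simp: I_def\<close>)
    show "\<forall>z\<in>I \<times> K. fr (exp (fst z)) ~= 0"
    proof
      fix z assume "z \<in> I \<times> K"
      then have "\<bar>fst z - v0\<bar> <= dl0" by (auto simp: I_def)
      then show "fr (exp (fst z)) ~= 0" using fr_exp[of "fst z"] by simp
    qed
  qed
  have uc: "uniformly_continuous_on (I \<times> K) G"
    by (intro compact_uniformly_continuous Gc compact_Times K) (simp add: I_def)
  have "\<exists>m>0. \<forall>z\<in>K. G (v0, z) <= 1 - 2 * m"
  proof (cases "K = {}")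
    case False
    have "continuous_on K (%z. G (v0, z))"
      using region(4) by (intro continuous_on_compose2[OF Gc]) (auto intro!: continuous_intros simp: I_def)
    then obtain z where z: "z \<in> K" "\<And>w. w \<in> K ==> G (v0, w) <= G (v0, z)"
      using continuous_attains_sup[OF K False] by blast
    have "G (v0, z) < 1"
    proof -
      obtain s th where st: "z = (s, th)" by (cases z)
      have "\<bar>th\<bar> <= Th" "0 <= s" "s <= 1" "s ~= 1 | th ~= 0" using z(1) assms unfolding K_def st by auto
      then have "norm (F (of_real s) (yy v0 th)) < 1 / X0" by (rule yy_strict)
      moreover have "fr (exp v0) = 1 / X0" using fr_Y0 by (simp add: Y0_def)
      moreover have X: "X0 > 0" using X0_gt_1 by simp
      ultimately show ?thesis by (simp add: G_def st divide_less_eq pos_less_divide_eq[OF X])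
    qed
    then show ?thesis using z(2) by (intro exI[of _ "(1 - G (v0, z)) / 2"]) (auto simp: field_simps)
  qed (auto intro!: exI[of _ 1])
  then obtain m where m: "m > 0" "\<And>z. z \<in> K ==> G (v0, z) <= 1 - 2 * m" by blast
  obtain d where d: "d > 0" "\<And>x x'. x \<in> I \<times> K ==> x' \<in> I \<times> K ==> dist x' x < d ==> dist (G x') (G x) < m"
    using uc m(1) unfolding uniformly_continuous_on_def by meson
  show ?thesis
  proof (rule exI[of _ m], rule conjI[OF m(1)], rule exI[of _ "min (d / 2) dl0"], intro conjI allI impI)
    fix v s th :: real
    assume A: "\<bar>v - v0\<bar> <= min (d / 2) dl0" "0 <= s" "s <= 1" "\<bar>th\<bar> <= Th" "s <= 1 - r | r <= \<bar>th\<bar>"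
    have k: "(s, th) \<in> K" using A by (auto simp: K_def abs_le_iff)
    have "v \<in> I" "v0 \<in> I" using A(1) region(4) by (auto simp: I_def)
    then have "dist (G (v, s, th)) (G (v0, s, th)) < m"
      using A(1) d(1) k by (intro d(2)) (auto simp: dist_Pair_Pair dist_real_def)
    then have "G (v, s, th) <= 1 - m" using m(2)[OF k] by (auto simp: dist_real_def)
    then show "norm (F (of_real s) (yy v th)) <= (1 - m) * fr (exp v)"
      using fr_exp[of v] A(1) by (simp add: G_def divide_le_eq)
  qed (use m d region(4) in auto)
qed

text \<open>The logarithmic derivative of F in s, by \<open>F_deriv_s\<close>. It is positive at s =
  1 and y = Y0, and a positive lower bound for its real part nearby yields exponential decay in 1 -
  s.\<close>

definition sder :: "complex => complex => complex" where
  "sder s y = VV 0 s y * y * upf (F s y) / F s y"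

lemma upf_at: "upf (F 1 (of_real Y0)) = of_real (a X0 / X0\<^sup>2)" "F 1 (of_real Y0) = of_real (1 / X0)"
proof -
  show 1: "F 1 (of_real Y0) = of_real (1 / X0)" using F_real[OF Y0_pos Y0_ann] fr_Y0 by simp
  show "upf (F 1 (of_real Y0)) = of_real (a X0 / X0\<^sup>2)"
    unfolding 1 upf_def a_eq using X0_gt_1 by (simp add: field_simps power2_eq_square)
qed

lemma VV_at: "\<exists>r>0. VV 0 1 (of_real Y0) = of_real r"
  using VV_real[OF Y0_pos Y0_ann, of 0] VV_0_nz[OF norm_1_le Y0_ann] by (metis less_le of_real_0)

definition near_box :: "real => real => real => bool" where
  "near_box r k m \<longleftrightarrow> 0 < r & 0 < k & 0 < m & r < dl0 & r < r1 & r < 1 \<and>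
     (\<forall>s z. norm (s - 1) <= r --> norm (z - of_real v0) <= r -->
       exp z \<in> ann & norm s <= 1 + dl0 & Re (sder s (exp z)) >= k & Re (F s (exp z)) > 0 \<and>
       norm (F s (exp z)) >= m & norm (upf (F s (exp z))) >= m)"

lemma ex_near_box: "\<exists>r k m. near_box r k m"
proof -
  have e0: "exp (complex_of_real v0) = of_real Y0" by (simp add: Y0_def exp_of_real)
  have D: "exp z \<in> ann" if "norm (z - of_real v0) <= dl0" for z
  proof -
    have "\<bar>Re z - v0\<bar> <= dl0" using abs_Re_le_cmod[of "z - of_real v0"] that by simp
    then show ?thesis using yy_ann[of "Re z" "Im z"] by (simp add: yy_def)
  qed
  define N where "N = {sz :: complex \<times> complex. norm (fst sz - 1) < dl0 & norm (snd sz - of_real v0) < dl0}"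
  have N1: "norm (fst w) <= 1 + dl0 & exp (snd w) \<in> ann" if "w \<in> N" for w
    using that D[of "snd w"] norm_triangle_ineq2[of "fst w" 1] by (auto simp: N_def)
  have opN: "open N" unfolding N_def by (intro open_Collect_conj open_Collect_less continuous_intros)
  have w0: "(1, of_real v0) \<in> N" using region(4) by (simp add: N_def)
  have Fc: "continuous_on N (%w. F (fst w) (exp (snd w)))" by (intro F_cont' continuous_intros N1)
  have Vc: "continuous_on N (%w. VV 0 (fst w) (exp (snd w)))" by (intro VV_cont' continuous_intros N1)
  have uc: "continuous_on N (%w. upf (F (fst w) (exp (snd w))))"
    unfolding upf_def by (intro continuous_intros Fc)
  obtain rV where rV: "rV > 0" "VV 0 1 (of_real Y0) = of_real rV" using VV_at by blast
  define c where "c = rV * Y0 * (a X0 / X0\<^sup>2) / (1 / X0)"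
  have c: "c > 0" using rV Y0_pos X0_gt_1 kernel_Y0(3) by (simp add: c_def)
  have s0: "sder 1 (exp (of_real v0)) = of_real c"
    unfolding e0 sder_def upf_at(1) rV(2) c_def unfolding upf_at(2) by simp
  have F0: "F 1 (exp (of_real v0)) ~= 0" unfolding e0 upf_at using X0_gt_1 by simp
  have at: "isCont g (1, of_real v0)" if "continuous_on N g" for g :: "complex \<times> complex => complex"
    using that w0 by (simp add: continuous_on_eq_continuous_at[OF opN])
  have tn: "(g \<longlongrightarrow> g w) (nhds w)" if "isCont g w" for g :: "complex \<times> complex => complex" and w
    using that unfolding isCont_def tendsto_nhds_iff by simp
  have Ft: "((%w. F (fst w) (exp (snd w))) \<longlongrightarrow> F 1 (exp (of_real v0))) (nhds (1, of_real v0))"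
    using tn[OF at[OF Fc]] by simp
  have ut: "((%w. upf (F (fst w) (exp (snd w)))) \<longlongrightarrow> upf (F 1 (exp (of_real v0)))) (nhds (1, of_real v0))"
    using tn[OF at[OF uc]] by simp
  have st: "((%w. sder (fst w) (exp (snd w))) \<longlongrightarrow> of_real c) (nhds (1, of_real v0))"
    unfolding s0[symmetric] sder_def
  proof (rule tendsto_divide[OF tendsto_mult[OF tendsto_mult[OF _ _] ut] Ft F0])
    show "((%w. VV 0 (fst w) (exp (snd w))) \<longlongrightarrow> VV 0 1 (exp (of_real v0))) (nhds (1, of_real v0))"
      using tn[OF at[OF Vc]] by simp
    show "((%w. exp (snd w)) \<longlongrightarrow> exp (of_real v0)) (nhds (1 :: complex, complex_of_real v0))"
      using tn[where g = "%w. exp (snd w)" and w = "(1, of_real v0)"] by (auto intro!: continuous_intros)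
  qed
  have e1: "eventually (%w. Re (sder (fst w) (exp (snd w))) > c / 2) (nhds (1, of_real v0))"
    by (rule order_tendstoD(1)[OF tendsto_Re[OF st]]) (use c in simp)
  have e2: "eventually (%w. Re (F (fst w) (exp (snd w))) > 0) (nhds (1, of_real v0))"
    by (rule order_tendstoD(1)[OF tendsto_Re[OF Ft]]) (use X0_gt_1 in \<open>simp add: e0 upf_at\<close>)
  have e3: "eventually (%w. norm (F (fst w) (exp (snd w))) > 1 / X0 / 2) (nhds (1, of_real v0))"
    by (rule order_tendstoD(1)[OF tendsto_norm[OF Ft]]) (use X0_gt_1 in \<open>simp add: e0 upf_at norm_divide field_simps\<close>)
  have e4: "eventually (%w. norm (upf (F (fst w) (exp (snd w)))) > a X0 / X0\<^sup>2 / 2) (nhds (1, of_real v0))"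
  proof (rule order_tendstoD(1)[OF tendsto_norm[OF ut]])
    have "a X0 / X0\<^sup>2 > 0" using X0_gt_1 kernel_Y0(3) by simp
    moreover have "t / 2 < \<bar>t\<bar>" if "t > 0" for t :: real using that by simp
    ultimately show "a X0 / X0\<^sup>2 / 2 < norm (upf (F 1 (exp (of_real v0))))"
      unfolding e0 upf_at(1) norm_of_real by blast
  qed
  have e5: "eventually (%w. w \<in> N) (nhds (1, of_real v0))" by (rule eventually_nhds_in_open[OF opN w0])
  obtain e where e: "e > 0" "\<And>w. dist w (1, of_real v0) < e ==> Re (sder (fst w) (exp (snd w))) > c / 2 & Re (F (fst w) (exp (snd w))) > 0
     & norm (F (fst w) (exp (snd w))) > 1 / X0 / 2 & norm (upf (F (fst w) (exp (snd w)))) > a X0 / X0\<^sup>2 / 2 & w \<in> N"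
    using eventually_conj[OF e1 eventually_conj[OF e2 eventually_conj[OF e3 eventually_conj[OF e4 e5]]]]
    unfolding eventually_nhds_metric by blast
  define r where "r = Min {e / 3, dl0 / 2, r1 / 2, 1 / 2}"
  define m where "m = min (1 / X0 / 2) (a X0 / X0\<^sup>2 / 2)"
  have r: "0 < r" "r <= e / 3" "r <= dl0 / 2" "r <= r1 / 2" "r <= 1 / 2" using e region(4) r1 by (auto simp: r_def)
  have m: "m > 0" using X0_gt_1 kernel_Y0(3) by (simp add: m_def)
  show ?thesis
    unfolding near_box_def
  proof (rule exI[of _ r], rule exI[of _ "c / 2"], rule exI[of _ m], intro conjI allI impI)
    fix s z :: complex assume A: "norm (s - 1) <= r" "norm (z - of_real v0) <= r"
    have "dist (s, z) (1, of_real v0) <= norm (s - 1) + norm (z - of_real v0)"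
      by (simp add: dist_norm norm_Pair sqrt_sum_squares_le_sum)
    also have "... < e" using A r e(1) by linarith
    finally have d: "dist (s, z) (1, of_real v0) < e" .
    note E = e(2)[OF d, simplified]
    show "exp z \<in> ann" "norm s <= 1 + dl0" using N1[of "(s, z)"] E by auto
    show "c / 2 <= Re (sder s (exp z))" "0 < Re (F s (exp z))" using E by auto
    show "m <= norm (F s (exp z))" "m <= norm (upf (F s (exp z)))" using E by (auto simp: m_def)
  qed (use r c m region(4) r1 in auto)
qed

definition "nb = (SOME x. near_box (fst x) (fst (snd x)) (snd (snd x)))"
definition "r3 = fst nb"
definition "cs = fst (snd nb)"
definition "ms = snd (snd nb)"

lemma r3: "0 < r3" "0 < cs" "0 < ms" "r3 < dl0" "r3 < r1" "r3 < 1"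
  and near: "\<And>s z. norm (s - 1) <= r3 ==> norm (z - of_real v0) <= r3 ==> exp z \<in> ann & norm s <= 1 + dl0 & Re (sder s (exp z)) >= cs
     & Re (F s (exp z)) > 0 & norm (F s (exp z)) >= ms & norm (upf (F s (exp z))) >= ms"
proof -
  obtain r k m where "near_box r k m" using ex_near_box by blast
  then have "\<exists>x. near_box (fst x) (fst (snd x)) (snd (snd x))" by (intro exI[of _ "(r, k, m)"]) simp
  then have "near_box (fst nb) (fst (snd nb)) (snd (snd nb))" unfolding nb_def by (rule someI_ex)
  then have P: "near_box r3 cs ms" unfolding r3_def cs_def ms_def .
  then show "0 < r3" "0 < cs" "0 < ms" "r3 < dl0" "r3 < r1" "r3 < 1" unfolding near_box_def by blast+
  fix s z :: complex assume "norm (s - 1) <= r3" "norm (z - of_real v0) <= r3"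
  then show "exp z \<in> ann & norm s <= 1 + dl0 & Re (sder s (exp z)) >= cs
     & Re (F s (exp z)) > 0 & norm (F s (exp z)) >= ms & norm (upf (F s (exp z))) >= ms"
    using P unfolding near_box_def by blast
qed

text \<open>Mean value theorem for the real part of Ln F along real s, where the derivative is the
  real part of \<open>sder\<close>.\<close>

lemma F_decay_s:
  assumes "norm (z - of_real v0) <= r3" "1 - r3 <= s" "s <= 1"
  shows "norm (F (of_real s) (exp z)) <= norm (F 1 (exp z)) * exp (- cs * (1 - s))"
proof (cases "s = 1")
  case False
  define g where "g x = Re (Ln (F (of_real x) (exp z)))" for x
  have n1: "norm (complex_of_real x - 1) <= r3" if "1 - r3 <= x" "x <= 1" for x
  proof -
    have "norm (complex_of_real x - 1) = \<bar>x - 1\<bar>" by (metis norm_of_real of_real_1 of_real_diff)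
    then show ?thesis using that by linarith
  qed
  have nx: "exp z \<in> ann" "Re (sder (of_real x) (exp z)) >= cs" "Re (F (of_real x) (exp z)) > 0" if "1 - r3 <= x" "x <= 1" for x
    using near[OF n1[OF that] assms(1)] by auto
  have "\<exists>x. s < x & x < 1 & g 1 - g s = (1 - s) * Re (sder (of_real x) (exp z))"
  proof (rule MVT2)
    fix x assume x: "s <= x" "x <= 1"
    then have x': "1 - r3 <= x" "x <= 1" using assms by auto
    have nF: "F (of_real x) (exp z) \<notin> \<real>\<^sub>\<le>\<^sub>0" using nx(3)[OF x'] by (auto simp: complex_nonpos_Reals_iff)
    have "norm (complex_of_real x) < 1 + dl0" using x' r3(4,6) by (simp add: norm_of_real)
    then have d: "((%s. F s (exp z)) has_field_derivative VV 0 (of_real x) (exp z) * exp z * upf (F (of_real x) (exp z))) (at (of_real x))"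
      using F_deriv_s nx(1)[OF x'] by blast
    have "((%s. Ln (F s (exp z))) has_field_derivative sder (of_real x) (exp z)) (at (of_real x))"
      using DERIV_chain2[OF has_field_derivative_Ln[OF nF] d] by (simp add: sder_def field_simps)
    then show "(g has_real_derivative Re (sder (of_real x) (exp z))) (at x)"
      unfolding g_def by (intro has_field_derivative_Re has_vector_derivative_real_field)
  qed (use False assms in auto)
  then obtain x where x: "s < x" "x < 1" "g 1 - g s = (1 - s) * Re (sder (of_real x) (exp z))" by blast
  have "cs * (1 - s) <= g 1 - g s"
    unfolding x(3) using nx(2)[of x] x assms by (simp add: mult.commute mult_left_mono)
  then have "exp (g s) <= exp (g 1) * exp (- cs * (1 - s))" unfolding exp_add[symmetric] by simp
  moreover have "exp (g x) = norm (F (of_real x) (exp z))" if "1 - r3 <= x" "x <= 1" for x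
  proof -
    have "F (of_real x) (exp z) ~= 0" using nx(3)[OF that] by auto
    then show ?thesis unfolding g_def by (metis exp_Ln norm_exp_eq_Re)
  qed
  ultimately show ?thesis using assms r3(1) by simp
qed simp

lemma Lam_taylor:
  "\<exists>B\<ge>0. (\<forall>v. \<bar>v - v0\<bar> <= r3 --> norm ((deriv ^^ 3) Lam (of_real v)) <= B) \<and>
     (\<forall>v th. norm (Complex v th - of_real v0) <= r3 --> norm (Lam (Complex v th) - of_real (lam v) - \<i> * of_real (lam' v * th)
        - (- of_real (lam2 v * th\<^sup>2 / 2) + (- \<i> * (deriv ^^ 3) Lam (of_real v) / 6) * of_real (th ^ 3))) <= B * th ^ 4)"
proof -
  obtain B where B: "B >= 0" "\<And>z k. z \<in> cball (of_real v0) r3 ==> k <= Suc 3 ==> norm ((deriv ^^ k) Lam z) <= B"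
    "\<And>z w. z \<in> cball (of_real v0) r3 ==> w \<in> cball (of_real v0) r3 ==>
       norm (Lam w - (\<Sum>i\<le>3. (deriv ^^ i) Lam z * (w - z) ^ i / fact i)) <= B * norm (w - z) ^ Suc 3"
    using taylor_uniform[OF Lam_hol r3(5), of 3] by blast
  have vb: "of_real v \<in> cball (complex_of_real v0) r3" if "\<bar>v - v0\<bar> <= r3" for v
    using that by (simp add: dist_of_real dist_real_def abs_minus_commute)
  have "norm (Lam (Complex v th) - of_real (lam v) - \<i> * of_real (lam' v * th)
        - (- of_real (lam2 v * th\<^sup>2 / 2) + (- \<i> * (deriv ^^ 3) Lam (of_real v) / 6) * of_real (th ^ 3))) <= B * th ^ 4"
    if n: "norm (Complex v th - of_real v0) <= r3" for v th
  proof -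
    have v: "\<bar>v - v0\<bar> <= r3" using abs_Re_le_cmod[of "Complex v th - of_real v0"] n by simp
    then have v': "\<bar>v - v0\<bar> < r1" using r3(5) by simp
    have w: "Complex v th - of_real v = \<i> * of_real th" by (simp add: complex_eq_iff)
    have i3: "(\<i> * of_real th) ^ 3 = - \<i> * of_real (th ^ 3)" 
    proof -
      have "\<i> ^ 3 = - \<i>" by (simp add: power3_eq_cube)
      then show ?thesis by (simp add: power_mult_distrib)
    qed
    have "(\<Sum>i\<le>3. (deriv ^^ i) Lam (of_real v) * (Complex v th - of_real v) ^ i / fact i)
       = of_real (lam v) + \<i> * of_real (lam' v * th) + (- of_real (lam2 v * th\<^sup>2 / 2) + (- \<i> * (deriv ^^ 3) Lam (of_real v) / 6) * of_real (th ^ 3))"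
      unfolding w using Lam_real[OF v'] lam_deriv(2)[OF v'] lam'_deriv(2)[OF v'] i3
      by (simp add: eval_nat_numeral(3) numeral_2_eq_2 fact_numeral power_mult_distrib algebra_simps)
    moreover have "norm (Complex v th - of_real v) ^ Suc 3 = th ^ 4" unfolding w by (simp add: norm_mult)
    moreover have "Complex v th \<in> cball (of_real v0) r3" using n by (simp add: dist_norm norm_minus_commute)
    ultimately show ?thesis using B(3)[OF vb[OF v], of "Complex v th"] by (simp add: diff_diff_eq add.assoc)
  qed
  moreover have "norm ((deriv ^^ 3) Lam (of_real v)) <= B" if "\<bar>v - v0\<bar> <= r3" for v
    using B(2)[OF vb[OF that], of 3] by simp
  ultimately show ?thesis using B(1) by blast
qed

lemma F_decay_theta:
  "\<exists>c>0. \<exists>r>0. r <= r3 / 2 & r <= r2 & (\<forall>v th. \<bar>v - v0\<bar> <= r --> \<bar>th\<bar> <= r --> norm (F 1 (yy v th)) <= fr (exp v) * exp (- c * th\<^sup>2))"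
proof -
  obtain B where B: "B >= 0" "\<And>v. \<bar>v - v0\<bar> <= r3 ==> norm ((deriv ^^ 3) Lam (of_real v)) <= B"
    "\<And>v th. norm (Complex v th - of_real v0) <= r3 ==> norm (Lam (Complex v th) - of_real (lam v) - \<i> * of_real (lam' v * th)
        - (- of_real (lam2 v * th\<^sup>2 / 2) + (- \<i> * (deriv ^^ 3) Lam (of_real v) / 6) * of_real (th ^ 3))) <= B * th ^ 4"
    using Lam_taylor by blast
  \<comment> \<open>For |th| <= q the cubic and quartic Taylor terms take at most half of the
    quadratic one, which is at least sig2/4 times th^2.\<close>
  define q where "q = sig2 / (16 * (B + 1))"
  have q: "q > 0" using sig2_pos B(1) by (simp add: q_def)
  define r where "r = min (min (r3 / 2) r2) (min q 1)"
  have r': "0 < r" "r <= r3 / 2" "r <= r2" "r <= q" "r <= 1"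
    using r3(1) r2(1) q unfolding r_def by linarith+
  then have r: "0 < r" "r <= r3 / 2" "r <= r2" "r <= sig2 / (16 * (B + 1))" "r <= 1"
    by (auto simp: q_def)
  have "norm (F 1 (yy v th)) <= fr (exp v) * exp (- (sig2 / 8) * th\<^sup>2)" if A: "\<bar>v - v0\<bar> <= r" "\<bar>th\<bar> <= r" for v th
  proof -
    have "norm (Complex v th - of_real v0) <= \<bar>v - v0\<bar> + \<bar>th\<bar>"
      using cmod_le[of "Complex v th - of_real v0"] by simp
    then have n: "norm (Complex v th - of_real v0) <= r3" using A r by linarith
    have v: "\<bar>v - v0\<bar> < r1" "\<bar>v - v0\<bar> <= r3" "\<bar>v - v0\<bar> <= dl0" "\<bar>v - v0\<bar> <= r2" using A r r3 by linarith+
    define T where "T = - of_real (lam2 v * th\<^sup>2 / 2) + (- \<i> * (deriv ^^ 3) Lam (of_real v) / 6) * of_real (th ^ 3)"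
    have "Re (Lam (Complex v th)) - lam v - Re T <= B * th ^ 4"
      using B(3)[OF n] complex_Re_le_cmod[of "Lam (Complex v th) - of_real (lam v) - \<i> * of_real (lam' v * th) - T"] by (simp add: T_def)
    moreover have "Re T <= - (lam2 v * th\<^sup>2 / 2) + B * \<bar>th\<bar> ^ 3"
    proof -
      have "Re ((- \<i> * (deriv ^^ 3) Lam (of_real v) / 6) * of_real (th ^ 3)) <= norm ((- \<i> * (deriv ^^ 3) Lam (of_real v) / 6) * of_real (th ^ 3))"
        by (rule complex_Re_le_cmod)
      also have "... = norm ((deriv ^^ 3) Lam (of_real v)) / 6 * \<bar>th\<bar> ^ 3" by (simp add: norm_mult norm_divide norm_power)
      also have "... <= B * \<bar>th\<bar> ^ 3" using B(2)[OF v(2)] B(1) by (intro mult_right_mono) auto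
      finally show ?thesis by (simp add: T_def)
    qed
    moreover have "B * th ^ 4 + B * \<bar>th\<bar> ^ 3 <= (sig2 / 8) * th\<^sup>2"
    proof -
      have "th ^ 4 <= \<bar>th\<bar> ^ 3"
        using A r power_decreasing[of 3 4 "\<bar>th\<bar>"] by simp
      have "B * th ^ 4 + B * \<bar>th\<bar> ^ 3 <= 2 * (B + 1) * \<bar>th\<bar> ^ 3"
      proof -
        define X Y where "X = th ^ 4" and "Y = \<bar>th\<bar> ^ 3"
        have "B * X <= B * Y" "0 <= Y" using \<open>th ^ 4 <= \<bar>th\<bar> ^ 3\<close> B(1) by (auto simp: X_def Y_def intro: mult_left_mono)
        moreover have "2 * (B + 1) * Y = 2 * (B * Y) + 2 * Y" by (simp add: algebra_simps)
        ultimately show ?thesis unfolding X_def[symmetric] Y_def[symmetric] by linarith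
      qed
      also have "... = 2 * (B + 1) * \<bar>th\<bar> * th\<^sup>2" by (simp add: power3_eq_cube power2_eq_square abs_mult_self_eq)
      also have "... <= (sig2 / 8) * th\<^sup>2"
      proof (rule mult_right_mono)
        have "\<bar>th\<bar> <= sig2 / (16 * (B + 1))" using A(2) r(4) by simp
        then show "2 * (B + 1) * \<bar>th\<bar> <= sig2 / 8" using B(1) by (simp add: field_simps)
      qed simp
      finally show ?thesis .
    qed
    moreover have "sig2 / 4 * th\<^sup>2 <= lam2 v * th\<^sup>2 / 2"
      using mult_right_mono[OF lam2_ge[OF v(4)], of "th\<^sup>2"] by simp
    ultimately have "Re (Lam (Complex v th)) <= lam v + - (sig2 / 8) * th\<^sup>2" by simp
    then have "exp (Re (Lam (Complex v th))) <= exp (lam v) * exp (- (sig2 / 8) * th\<^sup>2)" unfolding exp_add[symmetric] exp_le_cancel_iff .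
    moreover have "exp (lam v) = fr (exp v)" using fr_exp[OF v(3)] by (simp add: lam_def)
    moreover have "exp (Lam (Complex v th)) = F 1 (yy v th)"
      unfolding yy_def using n r3(5) by (intro exp_Lam) (simp add: dist_norm norm_minus_commute)
    ultimately show ?thesis by (metis norm_exp_eq_Re)
  qed
  then have "\<forall>v th. \<bar>v - v0\<bar> <= r --> \<bar>th\<bar> <= r --> norm (F 1 (yy v th)) <= fr (exp v) * exp (- (sig2 / 8) * th\<^sup>2)"
    by blast
  moreover have "sig2 / 8 > 0" using sig2_pos by simp
  ultimately show ?thesis using r by blast
qed

text \<open>Near (1, 0) the decay in s and the decay in th multiply. Elsewhere the fixed loss 1 -
  \<epsilon> can be written as an exponential, since (1 - s) + th^2 is bounded by 1 + Th^2.\<close>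

theorem F_decay:
  "\<exists>c>0. \<exists>r>0. r <= r3 / 2 & r <= r2 & (\<forall>v s th. \<bar>v - v0\<bar> <= r --> 0 <= s --> s <= 1 --> \<bar>th\<bar> <= Th -->
     norm (F (of_real s) (yy v th)) <= fr (exp v) * exp (- c * ((1 - s) + th\<^sup>2)))"
proof -
  obtain c r where cr: "c > 0" "r > 0" "r <= r3 / 2" "r <= r2"
    "\<And>v th. \<bar>v - v0\<bar> <= r ==> \<bar>th\<bar> <= r ==> norm (F 1 (yy v th)) <= fr (exp v) * exp (- c * th\<^sup>2)"
    using F_decay_theta by blast
  obtain \<epsilon> d where ed: "\<epsilon> > 0" "d > 0" "d <= dl0"
    "\<And>v s th. \<bar>v - v0\<bar> <= d ==> 0 <= s ==> s <= 1 ==> \<bar>th\<bar> <= Th ==> s <= 1 - r | r <= \<bar>th\<bar> ==>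
     norm (F (of_real s) (yy v th)) <= (1 - \<epsilon>) * fr (exp v)"
    using F_far[OF cr(2)] by blast
  define k where "k = Min {c, cs, \<epsilon> / (1 + Th\<^sup>2)}"
  have T2: "1 + Th\<^sup>2 > 0" by (simp add: add_pos_nonneg)
  have k: "k > 0" "k <= c" "k <= cs" "k * (1 + Th\<^sup>2) <= \<epsilon>"
  proof -
    show "k > 0" using cr(1) r3(2) ed(1) T2 by (simp add: k_def)
    show "k <= c" "k <= cs" by (auto simp: k_def)
    have "k <= \<epsilon> / (1 + Th\<^sup>2)" by (simp add: k_def)
    then show "k * (1 + Th\<^sup>2) <= \<epsilon>" using T2 by (simp add: pos_le_divide_eq)
  qed
  have "norm (F (of_real s) (yy v th)) <= fr (exp v) * exp (- k * ((1 - s) + th\<^sup>2))"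
    if A: "\<bar>v - v0\<bar> <= min r d" "0 <= s" "s <= 1" "\<bar>th\<bar> <= Th" for v s th
  proof -
    have fp: "fr (exp v) > 0" using fr_exp[of v] A(1) ed(3) by auto
    show ?thesis
    proof (cases "s <= 1 - r | r <= \<bar>th\<bar>")
      case True
      have "norm (F (of_real s) (yy v th)) <= (1 - \<epsilon>) * fr (exp v)" using ed(4)[OF _ A(2-4) True] A(1) by simp
      also have "... <= exp (- k * ((1 - s) + th\<^sup>2)) * fr (exp v)"
      proof (rule mult_right_mono)
        have "th\<^sup>2 <= Th\<^sup>2" using A(4) Th_pos by (intro abs_le_square_iff[THEN iffD1]) auto
        then have "k * ((1 - s) + th\<^sup>2) <= k * (1 + Th\<^sup>2)" using A k(1) by (intro mult_left_mono) auto
        then have "1 - \<epsilon> <= 1 + (- k * ((1 - s) + th\<^sup>2))" using k(4) by simp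
        also have "... <= exp (- k * ((1 - s) + th\<^sup>2))" by (rule exp_ge_add_one_self)
        finally show "1 - \<epsilon> <= exp (- k * ((1 - s) + th\<^sup>2))" .
      qed (use fp in simp)
      finally show ?thesis by (simp add: mult.commute)
    next
      case False
      then have B: "1 - r3 <= s" "\<bar>th\<bar> <= r" using cr r3(1) by auto
      have "norm (Complex v th - of_real v0) <= \<bar>v - v0\<bar> + \<bar>th\<bar>"
        using cmod_le[of "Complex v th - of_real v0"] by simp
      then have n: "norm (Complex v th - of_real v0) <= r3" using A(1) B cr by linarith
      have "norm (F (of_real s) (yy v th)) <= norm (F 1 (yy v th)) * exp (- cs * (1 - s))"
        using F_decay_s[OF n B(1) A(3)] by (simp add: yy_def)
      also have "... <= (fr (exp v) * exp (- c * th\<^sup>2)) * exp (- cs * (1 - s))"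
        using cr(5)[of v th] A(1) B by (intro mult_right_mono) auto
      also have "... = fr (exp v) * (exp (- c * th\<^sup>2) * exp (- cs * (1 - s)))" by simp
      also have "exp (- c * th\<^sup>2) * exp (- cs * (1 - s)) = exp (- c * th\<^sup>2 - cs * (1 - s))"
        unfolding exp_add[symmetric] by simp
      also have "fr (exp v) * exp (- c * th\<^sup>2 - cs * (1 - s)) <= fr (exp v) * exp (- k * ((1 - s) + th\<^sup>2))"
      proof (intro mult_left_mono, subst exp_le_cancel_iff)
        have "k * th\<^sup>2 <= c * th\<^sup>2" "k * (1 - s) <= cs * (1 - s)" using k A by (auto intro!: mult_right_mono)
        then show "- c * th\<^sup>2 - cs * (1 - s) <= - k * ((1 - s) + th\<^sup>2)" by (simp add: algebra_simps)
      qed (use fp in auto)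
      finally show ?thesis .
    qed
  qed
  then have "\<forall>v s th. \<bar>v - v0\<bar> <= min r d --> 0 <= s --> s <= 1 --> \<bar>th\<bar> <= Th -->
     norm (F (of_real s) (yy v th)) <= fr (exp v) * exp (- k * ((1 - s) + th\<^sup>2))" by blast
  moreover have "min r d > 0" "min r d <= r3 / 2" "min r d <= r2" using cr ed by auto
  ultimately show ?thesis using k(1) by blast
qed

end

lemma exp_minus_le_power:
  fixes x :: real
  assumes "x > 0" "n > 0"
  shows "exp (- x) <= (real n / x) ^ n"
proof -
  have "x / real n <= exp (x / real n)" by (rule exp_ge_self)
  then have "(x / real n) ^ n <= exp (x / real n) ^ n" using assms by (intro power_mono) auto
  also have "exp (x / real n) ^ n = exp x" using assms by (simp add: exp_of_nat_mult[symmetric])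
  finally show ?thesis using assms by (simp add: exp_minus power_divide field_simps)
qed

lemma integral_exp_linear:
  fixes x a :: real
  assumes "x > 0" "a <= 1"
  shows "integral {a..1} (%s. exp (- x * (1 - s))) <= 1 / x"
proof -
  have "((%s. exp (- x * (1 - s))) has_integral (exp (- x * (1 - 1)) / x - exp (- x * (1 - a)) / x)) {a..1}"
    using assms by (intro fundamental_theorem_of_calculus)
      (auto intro!: derivative_eq_intros simp: has_real_derivative_iff_has_vector_derivative[symmetric])
  then have "integral {a..1} (%s. exp (- x * (1 - s))) = 1 / x - exp (- x * (1 - a)) / x"
    by (simp add: integral_unique)
  then show ?thesis using assms by simp
qed

context drift_walk begin

definition decay :: "real \<times> real => bool" where
  "decay x \<longleftrightarrow> fst x > 0 & snd x > 0 & snd x <= r3 / 2 & snd x <= r2 & (\<forall>v s th. \<bar>v - v0\<bar> <= snd x --> 0 <= s --> s <= 1 --> \<bar>th\<bar> <= Th -->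
     norm (F (of_real s) (yy v th)) <= fr (exp v) * exp (- fst x * ((1 - s) + th\<^sup>2)))"

definition "dk = (SOME x. decay x)"
definition "cd = fst dk"
definition "rd = snd dk"

lemma rd: "cd > 0" "rd > 0" "rd <= r3 / 2" "rd <= r2"
  and decay_bound: "\<And>v s th. \<bar>v - v0\<bar> <= rd ==> 0 <= s ==> s <= 1 ==> \<bar>th\<bar> <= Th ==>
     norm (F (of_real s) (yy v th)) <= fr (exp v) * exp (- cd * ((1 - s) + th\<^sup>2))"
proof -
  have "\<exists>x. decay x" unfolding decay_def using F_decay by (metis fst_conv snd_conv)
  then have "decay dk" unfolding dk_def by (rule someI_ex)
  then show "cd > 0" "rd > 0" "rd <= r3 / 2" "rd <= r2"
    "\<And>v s th. \<bar>v - v0\<bar> <= rd ==> 0 <= s ==> s <= 1 ==> \<bar>th\<bar> <= Th ==>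
     norm (F (of_real s) (yy v th)) <= fr (exp v) * exp (- cd * ((1 - s) + th\<^sup>2))"
    unfolding decay_def cd_def rd_def by blast+
qed

end

section \<open>The s-integral for an abstract boundary term\<close>

locale boundary_term = drift_walk p for p +
  fixes \<alpha> :: "complex => complex" and m0 n0 :: nat
  assumes \<alpha>: "\<alpha> holomorphic_on ball 0 1"
begin

text \<open>The first term belongs to the start (n0, m0), the second to the restarted paths that are
  to be removed; \<alpha> will be y times the derivative of the absorption series of the vertical
  axis.\<close>

definition Din :: "nat => complex => complex => complex" where
  "Din i s y = of_nat m0 * y ^ m0 * VV (int i - int n0) s y - \<alpha> y * VV (int i) s y"

definition amp :: "complex => complex => complex" where
  "amp s y = of_nat m0 * y ^ m0 / F s y ^ n0 - \<alpha> y"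

text \<open>Chosen so that i times \<open>Din\<close> is hh times the s-derivative of F^i, by
  \<open>F_deriv_s\<close> and \<open>Din_amp\<close>. Integration by parts then leaves the value of
  hh at s = 1.\<close>

definition hh :: "complex => complex => complex" where
  "hh s y = F s y * amp s y / (y * upf (F s y))"

lemma ann_ball: "ann \<subseteq> ball 0 1"
  using region(7) by (auto simp: ann_def)

lemma alpha_bound: "\<exists>M\<ge>0. \<forall>y\<in>ann. norm (\<alpha> y) <= M"
proof -
  have "closed ann"
    unfolding ann_def by (intro closed_Collect_conj closed_Collect_le continuous_intros)
  moreover have "bounded ann"
    using ann_ball bounded_subset bounded_ball by blast
  ultimately have "compact ann" by (simp add: compact_eq_bounded_closed)
  then have "compact (\<alpha> ` ann)"
    using \<alpha> ann_ball by (intro compact_continuous_image holomorphic_on_imp_continuous_on) (auto intro: holomorphic_on_subset)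
  then have "bounded (\<alpha> ` ann)" by (rule compact_imp_bounded)
  then obtain M where "\<And>y. y \<in> ann ==> norm (\<alpha> y) <= M" unfolding bounded_iff by blast
  then have "\<And>y. y \<in> ann ==> norm (\<alpha> y) <= max M 0" by (meson max.coboundedI1)
  then show ?thesis by (intro exI[of _ "max M 0"]) simp
qed

definition "M\<alpha> = (SOME M. M >= 0 & (\<forall>y\<in>ann. norm (\<alpha> y) <= M))"

lemma M\<alpha>: "M\<alpha> >= 0" "y \<in> ann ==> norm (\<alpha> y) <= M\<alpha>"
proof -
  have "M\<alpha> >= 0 & (\<forall>y\<in>ann. norm (\<alpha> y) <= M\<alpha>)" unfolding M\<alpha>_def using alpha_bound by (rule someI_ex)
  then show "M\<alpha> >= 0" "y \<in> ann ==> norm (\<alpha> y) <= M\<alpha>" by auto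
qed

definition "A0 = real m0 / ms ^ n0 + M\<alpha>"
definition "M0 = 1 / xb * A0 / (Y0 * exp (- dl0) * ms)"

lemma A0_nonneg: "A0 >= 0" and M0_nonneg: "M0 >= 0"
  using r3(3) M\<alpha>(1) xb_pos Y0_pos by (auto simp: A0_def M0_def)

lemma amp_hh_bound:
  assumes "norm (s - 1) <= r3" "norm (z - of_real v0) <= r3"
  shows "norm (amp s (exp z)) <= A0" "norm (hh s (exp z)) <= M0"
proof -
  note n = near[OF assms]
  have ez: "exp z \<in> ball 0 1" using n ann_ball by blast
  have y: "exp z \<in> ann" "norm (exp z) <= 1" "Y0 * exp (- dl0) <= norm (exp z)"
  proof -
    show "exp z \<in> ann" using n by blast
    then show "Y0 * exp (- dl0) <= norm (exp z)" unfolding ann_def by blast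
    show "norm (exp z) <= 1" using ez unfolding mem_ball dist_0_norm by (rule less_imp_le)
  qed
  have Fn: "norm (F s (exp z)) >= ms" "norm (upf (F s (exp z))) >= ms" using n by auto
  have "norm (of_nat m0 * exp z ^ m0 / F s (exp z) ^ n0) = real m0 * norm (exp z) ^ m0 / norm (F s (exp z)) ^ n0"
    by (simp add: norm_mult norm_divide norm_power)
  also have "... <= real m0 * 1 / ms ^ n0"
    using y(2) Fn(1) r3(3) by (intro frac_le mult_left_mono power_mono power_le_one) auto
  finally show 1: "norm (amp s (exp z)) <= A0"
    unfolding amp_def A0_def using M\<alpha>(2)[OF y(1)] norm_triangle_ineq4[of "of_nat m0 * exp z ^ m0 / F s (exp z) ^ n0" "\<alpha> (exp z)"] by simp
  have "norm (hh s (exp z)) = norm (F s (exp z)) * norm (amp s (exp z)) / (norm (exp z) * norm (upf (F s (exp z))))"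
    by (simp add: hh_def norm_mult norm_divide)
  also have "... <= 1 / xb * A0 / (Y0 * exp (- dl0) * ms)"
    using F_bound[of s "exp z"] n 1 y Fn r3(3) Y0_pos xb_pos A0_nonneg by (intro frac_le mult_mono) auto
  finally show "norm (hh s (exp z)) <= M0" by (simp add: M0_def)
qed

lemma hh_hol_s:
  assumes "norm (z - of_real v0) <= r3"
  shows "(%s. hh s (exp z)) holomorphic_on ball 1 r3"
proof -
  have n: "F s (exp z) ~= 0" "upf (F s (exp z)) ~= 0" if "s \<in> ball 1 r3" for s
    using near[OF _ assms, of s] that r3(3) by (auto simp: dist_norm norm_minus_commute)
  have "ball (1 :: complex) r3 \<subseteq> ball 0 (1 + dl0)"
  proof
    fix x :: complex assume "x \<in> ball 1 r3"
    then have "norm (x - 1) < r3" by (simp add: dist_norm norm_minus_commute)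
    moreover have "norm x <= norm (x - 1) + norm (1 :: complex)" by (metis diff_add_cancel norm_triangle_ineq)
    ultimately have "norm x < 1 + dl0" using r3(4) unfolding norm_one by linarith
    then show "x \<in> ball 0 (1 + dl0)" by simp
  qed
  then have Fh: "(%s. F s (exp z)) holomorphic_on ball 1 r3"
    using F_hol_s[of "exp z"] near[of 1 z] assms r3(1) by (auto intro: holomorphic_on_subset)
  show ?thesis
    unfolding hh_def amp_def upf_def using n by (intro holomorphic_intros Fh) (auto simp: upf_def)
qed

lemma hh_deriv:
  assumes "norm (z - of_real v0) <= r3" "norm (s - 1) <= r3 / 2"
  shows "((%s. hh s (exp z)) has_field_derivative deriv (%s. hh s (exp z)) s) (at s)"
    "norm (deriv (%s. hh s (exp z)) s) <= 3 * (M0 + 1) / r3"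
proof -
  have s: "s \<in> ball 1 r3" using assms r3(1) by (simp add: dist_norm norm_minus_commute)
  show "((%s. hh s (exp z)) has_field_derivative deriv (%s. hh s (exp z)) s) (at s)"
    by (rule holomorphic_derivI[OF hh_hol_s[OF assms(1)] open_ball s])
  have sub: "cball s (r3 / 3) \<subseteq> ball 1 r3"
  proof
    fix x assume "x \<in> cball s (r3 / 3)"
    then have "dist s x <= r3 / 3" by simp
    moreover have "dist 1 s <= r3 / 2" using assms(2) by (simp add: dist_norm norm_minus_commute)
    ultimately have "dist 1 x < r3" using dist_triangle[of 1 x s] r3(1) by linarith
    then show "x \<in> ball 1 r3" by simp
  qed
  have bsub: "ball s (r3 / 3) \<subseteq> ball 1 r3" using sub ball_subset_cball by blast
  \<comment> \<open>Cauchy's estimate with radius r3/3; the centre is within r3/2 of 1, so the disc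
    stays inside radius r3. M0 is raised by 1 to get an open ball.\<close>
  have "norm ((deriv ^^ 1) (%s. hh s (exp z)) s) <= fact 1 * (M0 + 1) / (r3 / 3) ^ 1"
  proof (rule Cauchy_higher_deriv_bound[where y = 0])
    show "(%s. hh s (exp z)) holomorphic_on ball s (r3 / 3)"
      by (rule holomorphic_on_subset[OF hh_hol_s[OF assms(1)] bsub])
    show "continuous_on (cball s (r3 / 3)) (%s. hh s (exp z))"
      by (rule holomorphic_on_imp_continuous_on[OF holomorphic_on_subset[OF hh_hol_s[OF assms(1)] sub]])
    fix w assume "w \<in> ball s (r3 / 3)"
    then have "norm (w - 1) <= r3" using bsub by (force simp: dist_norm norm_minus_commute)
    then have "norm (hh w (exp z)) < M0 + 1" using amp_hh_bound(2)[OF _ assms(1)] by fastforce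
    then show "hh w (exp z) \<in> ball 0 (M0 + 1)" by simp
  qed (use r3(1) in auto)
  then show "norm (deriv (%s. hh s (exp z)) s) <= 3 * (M0 + 1) / r3" by (simp add: field_simps)
qed

lemma Din_factor:
  assumes "norm s <= 1 + dl0" "y \<in> ann" "i >= n0"
  shows "Din i s y = VV 0 s y * (of_nat m0 * y ^ m0 * F s y ^ (i - n0) - \<alpha> y * F s y ^ i)"
proof -
  have e: "int i - int n0 = int (i - n0)" using assms(3) by simp
  have dist: "t * (V * f) - u * (V * g) = V * (t * f - u * g)" for t u V f g :: complex
    by (simp add: algebra_simps)
  show ?thesis
    unfolding Din_def e VV_eq[OF assms(1,2), of "i - n0"] VV_eq[OF assms(1,2), of i] by (rule dist)
qed

lemma Din_amp:
  assumes "norm s <= 1 + dl0" "y \<in> ann" "i >= n0" "F s y ~= 0"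
  shows "Din i s y = VV 0 s y * amp s y * F s y ^ i"
proof -
  have "F s y ^ i = F s y ^ (i - n0) * F s y ^ n0" using assms(3) by (simp add: power_add[symmetric])
  then have "F s y ^ (i - n0) = F s y ^ i / F s y ^ n0" using assms(4) by simp
  then show ?thesis unfolding Din_factor[OF assms(1-3)] amp_def by (simp add: algebra_simps)
qed

lemma Din_continuous:
  "continuous_on ({v0 - dl0..v0 + dl0} \<times> {0..1} \<times> UNIV) (%(v, s, th). Din i (of_real s) (yy v th))"
proof -
  let ?S = "{v0 - dl0..v0 + dl0} \<times> {0..1::real} \<times> (UNIV :: real set)"
  have z: "norm (complex_of_real (fst (snd z))) <= 1 + dl0 & yy (fst z) (snd (snd z)) \<in> ann" if "z \<in> ?S" for z
    using that region(4) yy_ann[of "fst z" "snd (snd z)"] by (auto simp: case_prod_unfold)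
  have yc: "continuous_on ?S (%z. yy (fst z) (snd (snd z)))" unfolding yy_def by (intro continuous_intros)
  have ac: "continuous_on ?S (%z. \<alpha> (yy (fst z) (snd (snd z))))"
    by (rule continuous_on_compose2[OF holomorphic_on_imp_continuous_on[OF \<alpha>] yc]) (use z ann_ball in blast)
  have Vc: "continuous_on ?S (%z. VV k (of_real (fst (snd z))) (yy (fst z) (snd (snd z))))" for k
    by (rule VV_cont'[OF _ yc z]) (intro continuous_intros)
  show ?thesis
    unfolding Din_def case_prod_unfold
    by (intro continuous_on_diff continuous_on_mult continuous_on_power continuous_on_const yc ac Vc)
qed

lemma exp_Complex: "exp (Complex v th) = yy v th"
  by (simp add: yy_def)

lemma by_parts:
  assumes z: "norm (Complex v th - of_real v0) <= r3" and \<eta>: "0 <= \<eta>" "\<eta> <= r3 / 2" and i: "i >= n0" "i > 0"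
  defines "y \<equiv> yy v th"
  shows "((%s. of_nat i * Din i (of_real s) y + F (of_real s) y ^ i * deriv (%s. hh s y) (of_real s)) has_integral
     F 1 y ^ i * hh 1 y - F (of_real (1 - \<eta>)) y ^ i * hh (of_real (1 - \<eta>)) y) {1 - \<eta>..1}"
proof -
  have "((%s. of_nat i * Din i (of_real s) y + F (of_real s) y ^ i * deriv (%s. hh s y) (of_real s)) has_integral
     F (of_real 1) y ^ i * hh (of_real 1) y - F (of_real (1 - \<eta>)) y ^ i * hh (of_real (1 - \<eta>)) y) {1 - \<eta>..1}"
  proof (rule fundamental_theorem_of_calculus)
    fix s :: real assume s: "s \<in> {1 - \<eta>..1}"
    have e: "norm (complex_of_real s - 1) = \<bar>s - 1\<bar>" by (metis norm_of_real of_real_1 of_real_diff)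
    have s2: "norm (complex_of_real s - 1) <= r3 / 2" "norm (complex_of_real s - 1) <= r3"
      using s \<eta> r3(1) unfolding e by auto
    have sn: "norm (complex_of_real s) < 1 + dl0" using s \<eta> r3 by (auto simp: norm_of_real)
    note n = near[OF s2(2) z, unfolded exp_Complex, folded y_def]
    have F0: "F (of_real s) y ~= 0" "upf (F (of_real s) y) ~= 0" using n r3(3) by auto
    have y0: "y ~= 0" by (simp add: y_def)
    have dF: "((%s. F s y) has_field_derivative VV 0 (of_real s) y * y * upf (F (of_real s) y)) (at (of_real s))"
      using F_deriv_s[OF sn] n by blast
    have dh: "((%s. hh s y) has_field_derivative deriv (%s. hh s y) (of_real s)) (at (of_real s))"
      using hh_deriv(1)[OF z s2(1)] unfolding exp_Complex y_def .
    have "((%s. F s y ^ i * hh s y) has_field_derivative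
       (of_nat i * (VV 0 (of_real s) y * y * upf (F (of_real s) y) * F (of_real s) y ^ (i - 1))) * hh (of_real s) y
         + F (of_real s) y ^ i * deriv (%s. hh s y) (of_real s)) (at (of_real s))"
      by (rule DERIV_cong[OF DERIV_mult[OF DERIV_power[OF dF] dh]]) simp
    moreover have B: "(of_nat i * (VV 0 (of_real s) y * y * upf (F (of_real s) y) * F (of_real s) y ^ (i - 1))) * hh (of_real s) y
        = of_nat i * Din i (of_real s) y"
    proof -
      have "F (of_real s) y ^ i = F (of_real s) y ^ (i - 1) * F (of_real s) y"
        using i(2) by (metis Suc_diff_1 power_Suc2)
      then show ?thesis
        unfolding Din_amp[OF less_imp_le[OF sn] conjunct1[OF n] i(1) F0(1)] hh_def using F0 y0 by simp
    qed
    ultimately have "((%s. F s y ^ i * hh s y) has_field_derivative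
       (of_nat i * Din i (of_real s) y + F (of_real s) y ^ i * deriv (%s. hh s y) (of_real s))) (at (of_real s))"
      by (simp only: B)
    then show "((%s. F (of_real s) y ^ i * hh (of_real s) y) has_vector_derivative
       (of_nat i * Din i (of_real s) y + F (of_real s) y ^ i * deriv (%s. hh s y) (of_real s))) (at s within {1 - \<eta>..1})"
      by (rule has_vector_derivative_real_field)
  qed (use \<eta> in simp)
  then show ?thesis by simp
qed

definition "CD = A0 / (1 - q0)"

lemma CD_nonneg: "CD >= 0"
  using A0_nonneg region(6) by (simp add: CD_def)

lemma fr_ge: "\<bar>v - v0\<bar> <= r3 ==> ms <= fr (exp v)"
proof -
  assume v: "\<bar>v - v0\<bar> <= r3"
  have "norm (complex_of_real v - of_real v0) <= r3" using v by (metis norm_of_real of_real_diff)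
  then have "ms <= norm (F 1 (yy v 0))"
    using near[of 1 "of_real v"] r3(1) by (simp add: yy_0 exp_of_real)
  then show ?thesis using fr_exp[of v] v r3(4) by simp
qed

text \<open>The first term contains only the power i - n0 of F; i >= 2 n0 makes this at least i/2,
  whence the halved rate cd/2.\<close>

lemma Din_bound:
  assumes "\<bar>v - v0\<bar> <= rd" "0 <= s" "s <= 1" "\<bar>th\<bar> <= Th" "i >= 2 * n0"
  shows "norm (Din i (of_real s) (yy v th)) <= CD * fr (exp v) ^ i * exp (- (cd / 2 * real i) * ((1 - s) + th\<^sup>2))"
proof -
  define f where "f = norm (F (of_real s) (yy v th))"
  define X where "X = (1 - s) + th\<^sup>2"
  define k where "k = fr (exp v)"
  have X: "X >= 0" using assms by (simp add: X_def)
  have v: "\<bar>v - v0\<bar> <= dl0" "\<bar>v - v0\<bar> <= r3" using assms(1) rd(3) r3(1,4) by linarith+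
  have k: "ms <= k" "0 < k" using fr_ge[OF v(2)] r3(3) by (auto simp: k_def)
  have f: "0 <= f" "f <= k * exp (- cd * X)" using decay_bound[OF assms(1-4)] by (auto simp: f_def k_def X_def)
  have ya: "yy v th \<in> ann" using yy_ann v by blast
  have sn: "norm (complex_of_real s) <= 1 + dl0" using assms region(4) by simp
  have i: "i >= n0" "real i / 2 <= real (i - n0)" using assms(5) by (auto simp: of_nat_diff)
  have E: "exp (- cd * X) ^ m <= exp (- (cd / 2 * real i) * X)" if "real i / 2 <= real m" for m
  proof -
    have "exp (- cd * X) ^ m = exp (- (real m * (cd * X)))" by (simp add: exp_of_nat_mult[symmetric])
    moreover have "cd / 2 * real i * X <= real m * (cd * X)"
      using mult_right_mono[OF that, of "cd * X"] rd(1) X by (simp add: mult_ac)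
    ultimately show ?thesis by simp
  qed
  have p1: "f ^ (i - n0) <= k ^ i / ms ^ n0 * exp (- (cd / 2 * real i) * X)"
  proof -
    have "f ^ (i - n0) <= (k * exp (- cd * X)) ^ (i - n0)" using f by (intro power_mono) auto
    also have "... = k ^ i / k ^ n0 * exp (- cd * X) ^ (i - n0)"
      using k i(1) by (simp add: power_mult_distrib power_diff)
    also have "... <= k ^ i / ms ^ n0 * exp (- (cd / 2 * real i) * X)"
      using k r3(3) by (intro mult_mono E i divide_left_mono power_mono) auto
    finally show ?thesis .
  qed
  have p2: "f ^ i <= k ^ i * exp (- (cd / 2 * real i) * X)"
  proof -
    have "f ^ i <= (k * exp (- cd * X)) ^ i" using f by (intro power_mono) auto
    also have "... <= k ^ i * exp (- (cd / 2 * real i) * X)"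
      unfolding power_mult_distrib using k by (intro mult_left_mono E) auto
    finally show ?thesis .
  qed
  have yn: "norm (yy v th) <= 1" using ya ann_ball by (force simp: dist_norm)
  have "norm (Din i (of_real s) (yy v th)) <= 1 / (1 - q0) * (real m0 * 1 * f ^ (i - n0) + M\<alpha> * f ^ i)"
    unfolding Din_factor[OF sn ya i(1)] norm_mult f_def
  proof (intro mult_mono VV_bound sn ya)
    show "norm (of_nat m0 * yy v th ^ m0 * F (of_real s) (yy v th) ^ (i - n0) - \<alpha> (yy v th) * F (of_real s) (yy v th) ^ i)
      <= real m0 * 1 * norm (F (of_real s) (yy v th)) ^ (i - n0) + M\<alpha> * norm (F (of_real s) (yy v th)) ^ i"
    proof (rule order_trans[OF norm_triangle_ineq4], rule add_mono)
      show "norm (of_nat m0 * yy v th ^ m0 * F (of_real s) (yy v th) ^ (i - n0)) <= real m0 * 1 * norm (F (of_real s) (yy v th)) ^ (i - n0)"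
        unfolding norm_mult norm_power norm_of_nat using yn by (intro mult_right_mono mult_left_mono power_le_one) auto
      show "norm (\<alpha> (yy v th) * F (of_real s) (yy v th) ^ i) <= M\<alpha> * norm (F (of_real s) (yy v th)) ^ i"
        unfolding norm_mult norm_power by (intro mult_right_mono M\<alpha>(2)[OF ya]) auto
    qed
  qed (use region(6) in auto)
  also have "... <= 1 / (1 - q0) * (real m0 * 1 * (k ^ i / ms ^ n0 * exp (- (cd / 2 * real i) * X)) + M\<alpha> * (k ^ i * exp (- (cd / 2 * real i) * X)))"
    using region(6) M\<alpha>(1) by (intro mult_left_mono add_mono p1 p2) auto
  also have "... = CD * k ^ i * exp (- (cd / 2 * real i) * X)"
    by (simp add: CD_def A0_def algebra_simps add_divide_distrib)
  finally show ?thesis by (simp add: k_def X_def)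
qed

definition inner :: "nat => real => real => complex" where
  "inner i v th = integral {0..1} (%s. Din i (of_real s) (yy v th))"

lemma Din_cont_s: "\<bar>v - v0\<bar> <= dl0 ==> continuous_on {0..1} (%s. Din i (of_real s) (yy v th))"
  by (rule continuous_on_compose2[OF Din_continuous, where f = "%s. (v, s, th)", simplified])
     (auto intro!: continuous_intros)

lemma inner_continuous: "\<bar>v - v0\<bar> <= dl0 ==> continuous_on A (inner i v)"
proof -
  assume v: "\<bar>v - v0\<bar> <= dl0"
  have "continuous_on (UNIV \<times> cbox 0 1) (%(th, s). Din i (of_real s) (yy v th))"
    unfolding case_prod_unfold
    by (rule continuous_on_compose2[OF Din_continuous[unfolded case_prod_unfold], where f = "%z. (v, snd z, fst z)", simplified])
       (use v in \<open>auto intro!: continuous_intros\<close>)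
  then have "continuous_on UNIV (%th. integral (cbox 0 1) (%s. Din i (of_real s) (yy v th)))"
    by (rule integral_continuous_on_param)
  then show ?thesis unfolding inner_def[abs_def] by (auto intro: continuous_on_subset)
qed

lemma inner_far:
  assumes "\<bar>v - v0\<bar> <= rd" "\<bar>th\<bar> <= Th" "i >= 2 * n0"
  shows "norm (inner i v th) <= CD * fr (exp v) ^ i * exp (- (cd / 2 * real i) * th\<^sup>2)"
proof -
  have v: "\<bar>v - v0\<bar> <= dl0" using assms(1) rd(3) r3(1,4) by linarith
  have k: "fr (exp v) > 0" using fr_exp[OF v] by simp
  have "norm (inner i v th) <= integral {0..1::real} (%s. CD * fr (exp v) ^ i * exp (- (cd / 2 * real i) * th\<^sup>2))"
    unfolding inner_def
  proof (rule integral_norm_bound_integral)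
    fix s :: real assume s: "s \<in> {0..1}"
    have "norm (Din i (of_real s) (yy v th)) <= CD * fr (exp v) ^ i * exp (- (cd / 2 * real i) * ((1 - s) + th\<^sup>2))"
      using Din_bound[OF assms(1) _ _ assms(2,3)] s by simp
    also have "... <= CD * fr (exp v) ^ i * exp (- (cd / 2 * real i) * th\<^sup>2)"
    proof (intro mult_left_mono, subst exp_le_cancel_iff)
      have "0 <= cd / 2 * real i * (1 - s)" using rd(1) s by simp
      then show "- (cd / 2 * real i) * ((1 - s) + th\<^sup>2) <= - (cd / 2 * real i) * th\<^sup>2" by (simp add: algebra_simps)
    qed (use CD_nonneg k in auto)
    finally show "norm (Din i (of_real s) (yy v th)) <= CD * fr (exp v) ^ i * exp (- (cd / 2 * real i) * th\<^sup>2)" .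
  qed (auto intro!: integrable_continuous_real Din_cont_s v)
  then show ?thesis by simp
qed

text \<open>The endpoint s = 1 gives the main term. The three constants belong to the s below 1 -
  \<eta>, to the boundary value at 1 - \<eta>, and to the integral with the derivative of hh; each
  is of order 1/i^2.\<close>

lemma inner_near:
  assumes \<eta>: "0 < \<eta>" "\<eta> <= rd" "\<eta> < 1" and v: "\<bar>v - v0\<bar> <= \<eta>" and th: "\<bar>th\<bar> <= \<eta>" "\<bar>th\<bar> <= Th" and i: "i >= 2 * n0" "i > 0"
  shows "norm (inner i v th - F 1 (yy v th) ^ i * hh 1 (yy v th) / of_nat i)
    <= (CD * (4 / (cd * \<eta>))\<^sup>2 + M0 / (cd * \<eta>) + 3 * (M0 + 1) / (r3 * cd)) * fr (exp v) ^ i * exp (- (cd / 2 * real i) * th\<^sup>2) / (real i)\<^sup>2"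
proof -
  define y where "y = yy v th"
  define k where "k = fr (exp v)"
  define E where "E = exp (- (cd / 2 * real i) * th\<^sup>2)"
  have vrd: "\<bar>v - v0\<bar> <= rd" and vd: "\<bar>v - v0\<bar> <= dl0" using v \<eta> rd(3) r3(1,4) by linarith+
  have k: "k > 0" using fr_exp[OF vd] by (simp add: k_def)
  have in0: "i >= n0" using i by simp
  have i0: "real i > 0" using i by simp
  have "norm (Complex v th - of_real v0) <= \<bar>v - v0\<bar> + \<bar>th\<bar>" using cmod_le[of "Complex v th - of_real v0"] by simp
  then have z: "norm (Complex v th - of_real v0) <= r3" using v th \<eta> rd(3) by linarith
  have \<eta>r: "0 <= \<eta>" "\<eta> <= r3 / 2" using \<eta> rd(3) by auto
  define D where "D s = Din i (of_real s) y" for s :: real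
  define H where "H s = F (of_real s) y ^ i * deriv (%s. hh s y) (of_real s)" for s :: real
  define B where "B s = F (of_real s) y ^ i * hh (of_real s) y" for s :: real
  have Dc: "continuous_on {0..1} D" unfolding D_def y_def by (rule Din_cont_s[OF vd])
  have D1: "D integrable_on {0..1-\<eta>}" "D integrable_on {1-\<eta>..1}" "D integrable_on {0..1}"
    using \<eta> by (auto intro!: integrable_continuous_real continuous_on_subset[OF Dc])
  have bp: "((%s. of_nat i * D s + H s) has_integral B 1 - B (1 - \<eta>)) {1 - \<eta>..1}"
    using by_parts[OF z \<eta>r in0 i(2)] by (simp add: D_def H_def B_def y_def)
  have iD: "((%s. of_nat i * D s) has_integral of_nat i * integral {1 - \<eta>..1} D) {1 - \<eta>..1}"
    by (intro has_integral_mult_right integrable_integral D1)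
  have hH: "(H has_integral (B 1 - B (1 - \<eta>) - of_nat i * integral {1 - \<eta>..1} D)) {1 - \<eta>..1}"
    using has_integral_diff[OF bp iD] by simp
  have eq: "integral {1 - \<eta>..1} D = (B 1 - B (1 - \<eta>) - integral {1 - \<eta>..1} H) / of_nat i"
    using hH i by (simp add: integral_unique field_simps)
  have split: "inner i v th = integral {0..1 - \<eta>} D + integral {1 - \<eta>..1} D"
  proof -
    have "inner i v th = integral {0..1} D" unfolding inner_def D_def[abs_def] y_def ..
    also have "... = integral {0..1 - \<eta>} D + integral {1 - \<eta>..1} D"
      by (rule Henstock_Kurzweil_Integration.integral_combine[symmetric]) (use \<eta> D1 in auto)
    finally show ?thesis .
  qed
  have diff: "inner i v th - F 1 y ^ i * hh 1 y / of_nat i = integral {0..1 - \<eta>} D - B (1 - \<eta>) / of_nat i - integral {1 - \<eta>..1} H / of_nat i"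
    unfolding split eq by (simp add: B_def diff_divide_distrib)
  have dec: "norm (F (of_real s) y) ^ i <= k ^ i * exp (- (cd * real i) * (1 - s)) * E" if "0 <= s" "s <= 1" for s
  proof -
    have "norm (F (of_real s) y) ^ i <= (k * exp (- cd * ((1 - s) + th\<^sup>2))) ^ i"
      unfolding y_def k_def using decay_bound[OF vrd that th(2)] by (intro power_mono) auto
    also have "... = k ^ i * exp (- (cd * real i) * ((1 - s) + th\<^sup>2))"
      by (simp add: power_mult_distrib exp_of_nat_mult[symmetric] mult_ac)
    also have "... <= k ^ i * (exp (- (cd * real i) * (1 - s)) * E)"
    proof (intro mult_left_mono)
      have "0 <= cd / 2 * real i * th\<^sup>2" using rd(1) by simp
      then show "exp (- (cd * real i) * ((1 - s) + th\<^sup>2)) <= exp (- (cd * real i) * (1 - s)) * E"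
        unfolding E_def exp_add[symmetric] exp_le_cancel_iff by (simp add: algebra_simps)
    qed (use k in simp)
    finally show ?thesis by (simp add: mult.assoc)
  qed
  have ex1: "exp (- (cd * real i * \<eta>)) <= 1 / (cd * \<eta>) / real i"
    using exp_minus_le_power[of "cd * real i * \<eta>" 1] rd(1) \<eta> i0 by (simp add: mult_ac)
  have ex2: "exp (- (cd / 2 * real i * \<eta>)) <= (4 / (cd * \<eta>))\<^sup>2 / (real i)\<^sup>2"
  proof -
    have "exp (- (cd / 2 * real i * \<eta>)) <= (real 2 / (cd / 2 * real i * \<eta>)) ^ 2"
      using rd(1) \<eta> i0 by (intro exp_minus_le_power) auto
    also have "... = (4 / (cd * \<eta>))\<^sup>2 / (real i)\<^sup>2" by (simp add: power_divide power_mult_distrib mult_ac)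
    finally show ?thesis .
  qed
  have b1: "norm (integral {0..1 - \<eta>} D) <= CD * (4 / (cd * \<eta>))\<^sup>2 * k ^ i * E / (real i)\<^sup>2"
  proof -
    have "norm (integral {0..1 - \<eta>} D) <= integral {0..1 - \<eta>} (%s. CD * k ^ i * (exp (- (cd / 2 * real i * \<eta>)) * E))"
    proof (rule integral_norm_bound_integral[OF D1(1)])
      fix s assume s: "s \<in> {0..1 - \<eta>}"
      have "norm (D s) <= CD * k ^ i * exp (- (cd / 2 * real i) * ((1 - s) + th\<^sup>2))"
        unfolding D_def y_def k_def using Din_bound[OF vrd _ _ th(2) i(1)] s \<eta> by simp
      also have "... <= CD * k ^ i * (exp (- (cd / 2 * real i * \<eta>)) * E)"
      proof (intro mult_left_mono)
        have "cd / 2 * real i * \<eta> <= cd / 2 * real i * (1 - s)" using s rd(1) by (intro mult_left_mono) auto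
        then show "exp (- (cd / 2 * real i) * ((1 - s) + th\<^sup>2)) <= exp (- (cd / 2 * real i * \<eta>)) * E"
          unfolding E_def exp_add[symmetric] exp_le_cancel_iff by (simp add: algebra_simps)
      qed (use CD_nonneg k in auto)
      finally show "norm (D s) <= CD * k ^ i * (exp (- (cd / 2 * real i * \<eta>)) * E)" .
    qed auto
    also have "... = (1 - \<eta>) * (CD * k ^ i * (exp (- (cd / 2 * real i * \<eta>)) * E))" using \<eta> by simp
    also have "... <= 1 * (CD * k ^ i * ((4 / (cd * \<eta>))\<^sup>2 / (real i)\<^sup>2 * E))"
      using CD_nonneg k \<eta> ex2 by (intro mult_mono mult_left_mono mult_right_mono) (auto simp: E_def)
    finally show ?thesis by (simp add: mult_ac)
  qed
  have b2: "norm (B (1 - \<eta>) / of_nat i) <= M0 / (cd * \<eta>) * k ^ i * E / (real i)\<^sup>2"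
  proof -
    have "norm (complex_of_real (1 - \<eta>) - 1) = \<eta>" using \<eta> by simp
    then have "norm (hh (of_real (1 - \<eta>)) y) <= M0"
      using amp_hh_bound(2)[OF _ z, of "of_real (1 - \<eta>)"] \<eta>r r3(1) by (simp add: exp_Complex y_def)
    then have "norm (B (1 - \<eta>)) <= (k ^ i * exp (- (cd * real i * \<eta>)) * E) * M0"
      unfolding B_def norm_mult norm_power using dec[of "1 - \<eta>"] \<eta> k by (intro mult_mono) (auto simp: E_def)
    also have "... <= (k ^ i * (1 / (cd * \<eta>) / real i) * E) * M0"
      using k M0_nonneg by (intro mult_right_mono mult_left_mono ex1) (auto simp: E_def)
    finally have "norm (B (1 - \<eta>)) / real i <= (k ^ i * (1 / (cd * \<eta>) / real i) * E) * M0 / real i"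
      using i0 by (intro divide_right_mono) auto
    then show ?thesis by (simp add: norm_divide power2_eq_square mult_ac)
  qed
  have b3: "norm (integral {1 - \<eta>..1} H / of_nat i) <= 3 * (M0 + 1) / (r3 * cd) * k ^ i * E / (real i)\<^sup>2"
  proof -
    define c3 where "c3 = 3 * (M0 + 1) / r3"
    have c3: "c3 >= 0" using M0_nonneg r3(1) by (simp add: c3_def)
    have "norm (integral {1 - \<eta>..1} H) <= integral {1 - \<eta>..1} (%s. (c3 * k ^ i * E) * exp (- (cd * real i) * (1 - s)))"
    proof (rule integral_norm_bound_integral)
      show "H integrable_on {1 - \<eta>..1}" using hH by blast
      show "(%s. (c3 * k ^ i * E) * exp (- (cd * real i) * (1 - s))) integrable_on {1 - \<eta>..1}"
        by (intro integrable_continuous_real continuous_intros)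
      fix s assume s: "s \<in> {1 - \<eta>..1}"
      have "norm (complex_of_real s - 1) = \<bar>s - 1\<bar>" by (metis norm_of_real of_real_1 of_real_diff)
      then have "norm (complex_of_real s - 1) <= r3 / 2" using s \<eta>r by auto
      then have "norm (deriv (%s. hh s y) (of_real s)) <= c3"
        using hh_deriv(2)[OF z] by (simp add: exp_Complex y_def c3_def)
      then have "norm (H s) <= (k ^ i * exp (- (cd * real i) * (1 - s)) * E) * c3"
        unfolding H_def norm_mult norm_power using dec[of s] s \<eta> k by (intro mult_mono) (auto simp: E_def)
      then show "norm (H s) <= (c3 * k ^ i * E) * exp (- (cd * real i) * (1 - s))" by (simp add: mult_ac)
    qed
    also have "... <= (c3 * k ^ i * E) * (1 / (cd * real i))"
      unfolding integral_mult_right using c3 k rd(1) i0 \<eta> by (intro mult_left_mono integral_exp_linear) (auto simp: E_def)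
    finally have "norm (integral {1 - \<eta>..1} H) / real i <= (c3 * k ^ i * E) * (1 / (cd * real i)) / real i"
      using i0 by (intro divide_right_mono) auto
    then show ?thesis by (simp add: norm_divide power2_eq_square c3_def mult_ac)
  qed
  have "norm (inner i v th - F 1 y ^ i * hh 1 y / of_nat i) <= norm (integral {0..1 - \<eta>} D) + norm (B (1 - \<eta>) / of_nat i) + norm (integral {1 - \<eta>..1} H / of_nat i)"
    unfolding diff by (meson add_mono norm_triangle_ineq4 order_refl order_trans)
  also have "... <= CD * (4 / (cd * \<eta>))\<^sup>2 * k ^ i * E / (real i)\<^sup>2 + M0 / (cd * \<eta>) * k ^ i * E / (real i)\<^sup>2 + 3 * (M0 + 1) / (r3 * cd) * k ^ i * E / (real i)\<^sup>2"
    by (intro add_mono b1 b2 b3)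
  also have "... = (CD * (4 / (cd * \<eta>))\<^sup>2 + M0 / (cd * \<eta>) + 3 * (M0 + 1) / (r3 * cd)) * k ^ i * E / (real i)\<^sup>2"
    by (simp add: add_divide_distrib distrib_right)
  finally show ?thesis by (simp add: y_def k_def E_def)
qed

end

section \<open>The Markov chain\<close>

locale absorbed_chain = drift_walk p for p +
  fixes M :: "'w measure" and X Y :: "nat => 'w => nat" and n0 m0 :: nat
  assumes chain: "absorbed_walk p n0 m0 M X Y" and n0: "n0 >= 1" and m0: "m0 >= 1"
begin

definition S :: "nat => 'w => nat \<times> nat" where "S n w = (X n w, Y n w)"

definition occ :: "nat => nat \<times> nat => 'w set" where "occ n z = {w \<in> space M. S n w = z}"

lemma prob_space_M: "prob_space M"
  using chain by (simp add: absorbed_walk_def)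

sublocale P: prob_space M by (rule prob_space_M)

lemma S_measurable [measurable]: "S n \<in> measurable M (count_space UNIV)"
proof -
  have [measurable]: "X n \<in> measurable M (count_space UNIV)" "Y n \<in> measurable M (count_space UNIV)"
    using chain by (auto simp: absorbed_walk_def)
  have "(%w. (X n w, Y n w)) \<in> measurable M (count_space UNIV \<Otimes>\<^sub>M count_space UNIV)" by measurable
  then show ?thesis unfolding S_def[abs_def] by (simp add: pair_measure_countable)
qed

lemma occ_sets [measurable]: "occ n z \<in> sets M"
  unfolding occ_def by measurable

lemma occ_disjoint: "disjoint_family_on (%z. occ n z \<inter> A) I"
  by (auto simp: disjoint_family_on_def occ_def)

lemma path_step:
  "measure M {w \<in> space M. \<forall>k\<le>Suc n. S k w = s k} = measure M {w \<in> space M. \<forall>k\<le>n. S k w = s k} * transition p (s n) (s (Suc n))"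
  using chain by (simp add: absorbed_walk_def S_def)

text \<open>The chain is given by products over whole trajectories, so the event at time n is split
  over the countably many histories that end in z.\<close>

lemma one_step: "emeasure M (occ n z \<inter> occ (Suc n) w) = emeasure M (occ n z) * ennreal (transition p z w)"
proof -
  define I where "I = {xs :: (nat \<times> nat) list. length xs = Suc n & xs ! n = z}"
  define W where "W xs = {v \<in> space M. \<forall>k\<le>n. S k v = xs ! k}" for xs
  have W [measurable]: "W xs \<in> sets M" for xs unfolding W_def by measurable
  have tr: "0 <= transition p a b" for a b by (simp add: transition_def)
  have disj: "disjoint_family_on (%xs. W xs \<inter> A) I" for A
    unfolding disjoint_family_on_def
  proof (intro ballI impI)
    fix xs ys assume A: "xs \<in> I" "ys \<in> I" "xs ~= ys"
    have False if "v \<in> W xs" "v \<in> W ys" for v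
    proof -
      have "xs ! k = ys ! k" if "k <= n" for k using \<open>v \<in> W xs\<close> \<open>v \<in> W ys\<close> that by (auto simp: W_def)
      then have "xs = ys" using A by (intro nth_equalityI) (auto simp: I_def)
      then show False using A by simp
    qed
    then show "W xs \<inter> A \<inter> (W ys \<inter> A) = {}" for A by blast
  qed
  have un: "occ n z = (\<Union>xs\<in>I. W xs)"
  proof (intro set_eqI iffI)
    fix v assume v: "v \<in> occ n z"
    define xs where "xs = map (%k. S k v) [0..<Suc n]"
    have "xs ! k = S k v" if "k <= n" for k using that by (simp add: xs_def del: upt_Suc)
    then have "xs \<in> I" "v \<in> W xs" using v by (auto simp: I_def W_def occ_def xs_def)
    then show "v \<in> (\<Union>xs\<in>I. W xs)" by blast
  qed (auto simp: I_def W_def occ_def)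
  have step: "emeasure M (W xs \<inter> occ (Suc n) w) = emeasure M (W xs) * ennreal (transition p z w)" if "xs \<in> I" for xs
  proof -
    define s where "s k = (if k <= n then xs ! k else w)" for k
    have 1: "{v \<in> space M. \<forall>k\<le>Suc n. S k v = s k} = W xs \<inter> occ (Suc n) w"
      by (auto simp: s_def W_def occ_def le_Suc_eq)
    have 2: "{v \<in> space M. \<forall>k\<le>n. S k v = s k} = W xs" by (auto simp: s_def W_def)
    have "measure M (W xs \<inter> occ (Suc n) w) = measure M (W xs) * transition p z w"
      using path_step[of n s] that unfolding 1 2 by (simp add: s_def I_def)
    then show ?thesis by (simp add: P.emeasure_eq_measure ennreal_mult tr)
  qed
  have "emeasure M (occ n z \<inter> occ (Suc n) w) = emeasure M (\<Union>xs\<in>I. W xs \<inter> occ (Suc n) w)"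
    unfolding un by (rule arg_cong[where f = "emeasure M"]) blast
  also have "... = (\<integral>\<^sup>+xs. emeasure M (W xs \<inter> occ (Suc n) w) \<partial>count_space I)"
    by (rule emeasure_UN_countable) (auto intro: disj)
  also have "... = (\<integral>\<^sup>+xs. emeasure M (W xs) * ennreal (transition p z w) \<partial>count_space I)"
    by (rule nn_integral_cong) (simp add: step)
  also have "... = (\<integral>\<^sup>+xs. emeasure M (W xs) \<partial>count_space I) * ennreal (transition p z w)"
    by (rule nn_integral_multc) simp
  also have "(\<integral>\<^sup>+xs. emeasure M (W xs) \<partial>count_space I) = emeasure M (\<Union>xs\<in>I. W xs)"
    by (rule emeasure_UN_countable[symmetric]) (use disj[of UNIV] in auto)
  finally show ?thesis unfolding un .
qed

definition pr :: "nat => nat \<times> nat => real" where "pr n z = measure M (occ n z)"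

lemma pr_Suc:
  assumes "finite A" "\<And>z. z \<notin> A ==> transition p z w = 0"
  shows "pr (Suc n) w = (\<Sum>z\<in>A. pr n z * transition p z w)"
proof -
  have tr: "0 <= transition p a b" for a b by (simp add: transition_def)
  have "occ (Suc n) w = (\<Union>z. occ n z \<inter> occ (Suc n) w)" by (auto simp: occ_def)
  then have "emeasure M (occ (Suc n) w) = emeasure M (\<Union>z. occ n z \<inter> occ (Suc n) w)" by simp
  also have "... = (\<integral>\<^sup>+z. emeasure M (occ n z \<inter> occ (Suc n) w) \<partial>count_space UNIV)"
    by (rule emeasure_UN_countable) (auto intro: occ_disjoint)
  also have "... = (\<integral>\<^sup>+z. emeasure M (occ n z) * ennreal (transition p z w) \<partial>count_space UNIV)"
    unfolding one_step ..
  also have "... = (\<Sum>z\<in>A. emeasure M (occ n z) * ennreal (transition p z w))"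
    by (rule nn_integral_count_space') (use assms in auto)
  also have "... = ennreal (\<Sum>z\<in>A. pr n z * transition p z w)"
    by (simp add: P.emeasure_eq_measure pr_def ennreal_mult[symmetric] tr sum_ennreal)
  finally show ?thesis
    by (simp add: P.emeasure_eq_measure pr_def tr sum_nonneg)
qed

lemma pr_0: "pr 0 z = (if z = (n0, m0) then 1 else 0)"
proof -
  have 1: "pr 0 (n0, m0) = 1" using chain by (simp add: absorbed_walk_def pr_def occ_def S_def)
  show ?thesis
  proof (cases "z = (n0, m0)")
    case False
    have "pr 0 z + pr 0 (n0, m0) = measure M (occ 0 z \<union> occ 0 (n0, m0))"
      unfolding pr_def using False by (intro P.finite_measure_Union[symmetric]) (auto simp: occ_def)
    also have "... <= 1" by simp
    finally have "pr 0 z <= 0" using 1 by linarith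
    moreover have "0 <= pr 0 z" by (simp add: pr_def)
    ultimately show ?thesis using False by (simp only: if_False)
  qed (use 1 in simp)
qed

definition QQ :: "nat => int => int => real" where "QQ n = Q n (int n0) (int m0)"

lemma box_sum:
  fixes w :: "nat \<times> nat" and g :: "int => int => real"
  assumes "\<And>x y. x < 1 | y < 1 ==> g x y = 0"
  shows "(\<Sum>z\<in>{1..fst w + 1} \<times> {1..snd w + 1}. g (int (fst z)) (int (snd z)) * p (int (fst w) - int (fst z)) (int (snd w) - int (snd z)))
     = (\<Sum>k\<in>{-1..1}. \<Sum>e\<in>{-1..1}. p k e * g (int (fst w) - k) (int (snd w) - e))"
proof -
  define h where "h = (%x y :: int. p (int (fst w) - x) (int (snd w) - y) * g x y)"
  have "(\<Sum>z\<in>{1..fst w + 1} \<times> {1..snd w + 1}. g (int (fst z)) (int (snd z)) * p (int (fst w) - int (fst z)) (int (snd w) - int (snd z)))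
     = (\<Sum>z\<in>{1..int (fst w) + 1} \<times> {1..int (snd w) + 1}. h (fst z) (snd z))"
    by (rule sum.reindex_bij_witness[of _ "%z. (nat (fst z), nat (snd z))" "%z. (int (fst z), int (snd z))"])
       (auto simp: h_def)
  also have "... = (\<Sum>z\<in>({1..int (fst w) + 1} \<times> {1..int (snd w) + 1}) \<inter> ({int (fst w) - 1..int (fst w) + 1} \<times> {int (snd w) - 1..int (snd w) + 1}). h (fst z) (snd z))"
    by (rule sum.mono_neutral_right) (auto simp: h_def intro!: p_far)
  also have "... = (\<Sum>z\<in>{int (fst w) - 1..int (fst w) + 1} \<times> {int (snd w) - 1..int (snd w) + 1}. h (fst z) (snd z))"
    by (rule sum.mono_neutral_left) (auto simp: h_def intro!: assms)
  also have "... = (\<Sum>z\<in>{-1..1} \<times> {-1..1}. p (fst z) (snd z) * g (int (fst w) - fst z) (int (snd w) - snd z))"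
    by (rule sum.reindex_bij_witness[of _ "%z. (int (fst w) - fst z, int (snd w) - snd z)" "%z. (int (fst w) - fst z, int (snd w) - snd z)"])
       (auto simp: h_def)
  also have "... = (\<Sum>k\<in>{-1..1}. \<Sum>e\<in>{-1..1}. p k e * g (int (fst w) - k) (int (snd w) - e))"
    by (simp add: sum.cartesian_product case_prod_unfold)
  finally show ?thesis .
qed

lemma transition_interior: "transition p z w = p (int (fst w) - int (fst z)) (int (snd w) - int (snd z))" if "1 <= fst z" "1 <= snd z"
  using that by (simp add: transition_def)

lemma transition_zero:
  assumes "z \<notin> {1..fst w + 1} \<times> {1..snd w + 1}" "z ~= w"
  shows "transition p z w = 0"
  using assms by (cases z; cases w) (auto simp: transition_def intro!: p_far)

lemma pr_interior: "i >= 1 ==> j >= 1 ==> pr n (i, j) = QQ n (int i) (int j)"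
proof (induction n arbitrary: i j)
  case 0
  then show ?case using n0 m0 by (auto simp: pr_0 QQ_def)
next
  case (Suc n)
  let ?A = "{1..i + 1} \<times> {1..j + 1}"
  have "pr (Suc n) (i, j) = (\<Sum>z\<in>?A. pr n z * transition p z (i, j))"
    by (rule pr_Suc) (use Suc.prems in \<open>auto intro!: transition_zero\<close>)
  also have "... = (\<Sum>z\<in>?A. QQ n (int (fst z)) (int (snd z)) * p (int i - int (fst z)) (int j - int (snd z)))"
    by (rule sum.cong) (auto simp: Suc.IH transition_interior)
  also have "... = (\<Sum>k\<in>{-1..1}. \<Sum>e\<in>{-1..1}. p k e * QQ n (int i - k) (int j - e))"
    using box_sum[of "QQ n" "(i, j)"] by (simp add: QQ_def Q_outside)
  also have "... = QQ (Suc n) (int i) (int j)" using Suc.prems unfolding QQ_def Q_forward by simp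
  finally show ?case .
qed

lemma pr_axis_Suc: "l >= 1 ==> pr (Suc n) (0, l) = pr n (0, l) + hit (Suc n) (int n0) (int m0) (int l)"
proof -
  assume l: "l >= 1"
  let ?A = "{1..0 + 1} \<times> {1..l + 1}"
  have "pr (Suc n) (0, l) = (\<Sum>z\<in>insert (0, l) ?A. pr n z * transition p z (0, l))"
    by (rule pr_Suc) (auto intro!: transition_zero)
  also have "... = pr n (0, l) * transition p (0, l) (0, l) + (\<Sum>z\<in>?A. pr n z * transition p z (0, l))"
    by (subst sum.insert) auto
  also have "(\<Sum>z\<in>?A. pr n z * transition p z (0, l)) = (\<Sum>z\<in>?A. QQ n (int (fst z)) (int (snd z)) * p (int 0 - int (fst z)) (int l - int (snd z)))"
    by (rule sum.cong) (auto simp: pr_interior transition_interior)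
  also have "... = (\<Sum>k\<in>{-1..1}. \<Sum>e\<in>{-1..1}. p k e * QQ n (int 0 - k) (int l - e))"
    using box_sum[of "QQ n" "(0, l)"] by (simp add: QQ_def Q_outside)
  also have "... = hit (Suc n) (int n0) (int m0) (int l)"
    by (simp add: hit_Suc QQ_def sum_unit_interval Q_outside)
  finally show ?thesis by (simp add: transition_def)
qed

definition H :: "nat => nat => real" where "H r l = hit r (int n0) (int m0) (int l)"

text \<open>With X and Y exchanged the event in \<open>absorption_prob\<close> is that of reaching
  (0, l).\<close>

definition ht :: "nat => real" where "ht l = absorption_prob M Y X l"

lemma pr_axis: "l >= 1 ==> pr n (0, l) = (\<Sum>r\<le>n. H r l)"
  by (induction n) (use n0 in \<open>simp_all add: pr_0 pr_axis_Suc H_def\<close>)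

lemma absorbing: "l >= 1 ==> AE w in M. S n w = (0, l) --> S (Suc n) w = (0, l)"
proof -
  assume l: "l >= 1"
  let ?a = "(0, l)"
  have "emeasure M (occ n ?a \<inter> occ (Suc n) ?a) = emeasure M (occ n ?a)"
    unfolding one_step by (simp add: transition_def)
  then have "emeasure M (occ n ?a - occ n ?a \<inter> occ (Suc n) ?a) = 0"
    by (subst emeasure_Diff) (auto simp: P.emeasure_eq_measure)
  then have "occ n ?a - occ n ?a \<inter> occ (Suc n) ?a \<in> null_sets M" by (auto simp: null_sets_def)
  then have "AE w in M. w \<notin> occ n ?a - occ n ?a \<inter> occ (Suc n) ?a" by (rule AE_not_in)
  then show ?thesis by (rule AE_mp) (auto intro!: AE_I2 simp: occ_def)
qed

text \<open>Almost surely the chain stays at (0, l) once there, so absorption by time N means being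
  at (0, l) at time N; continuity from below gives the limit.\<close>

lemma ht_sums: "l >= 1 ==> (%r. H r l) sums ht l"
proof -
  assume l: "l >= 1"
  define A where "A N = {w \<in> space M. \<exists>n\<le>N. S n w = (0, l)}" for N
  have A [measurable]: "A N \<in> sets M" for N unfolding A_def by measurable
  have "AE w in M. \<forall>n. S n w = (0, l) --> S (Suc n) w = (0, l)" using absorbing[OF l] by (simp add: AE_all_countable)
  then have ae: "AE w in M. w \<in> A N \<longleftrightarrow> w \<in> occ N (0, l)" for N
  proof (rule AE_mp, intro AE_I2 impI)
    fix w assume w: "w \<in> space M" and st: "\<forall>n. S n w = (0, l) --> S (Suc n) w = (0, l)"
    have "S N w = (0, l)" if "S n w = (0, l)" "n <= N" for n
      using that(2,1) by (induction N rule: dec_induct) (use st in auto)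
    then show "w \<in> A N \<longleftrightarrow> w \<in> occ N (0, l)" using w by (auto simp: A_def occ_def)
  qed
  have mA: "measure M (A N) = pr N (0, l)" for N
    unfolding pr_def using ae by (intro measure_eq_AE) auto
  have "(%N. measure M (A N)) \<longlonglongrightarrow> measure M (\<Union>N. A N)"
    by (rule P.finite_Lim_measure_incseq) (auto simp: incseq_def A_def intro: order_trans)
  moreover have "(\<Union>N. A N) = {w \<in> space M. \<exists>n. (Y n w, X n w) = (l, 0)}" by (auto simp: A_def S_def)
  ultimately have "(%N. \<Sum>r\<le>N. H r l) \<longlonglongrightarrow> ht l"
    unfolding mA pr_axis[OF l] ht_def absorption_prob_def by simp
  then show ?thesis unfolding sums_def_le .
qed

lemma ht_nonneg: "0 <= ht l" and ht_le_1: "ht l <= 1"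
  by (auto simp: ht_def absorption_prob_def)

lemma green_eq: "i >= 1 ==> j >= 1 ==> green M X Y i j = (\<Sum>n. ennreal (QQ n (int i) (int j)))"
proof -
  assume ij: "i >= 1" "j >= 1"
  have "green M X Y i j = (\<integral>\<^sup>+w. (\<Sum>n. indicator (occ n (i, j)) w) \<partial>M)"
    unfolding green_def by (rule nn_integral_cong) (auto simp: indicator_def occ_def S_def intro!: suminf_cong)
  also have "... = (\<Sum>n. \<integral>\<^sup>+w. indicator (occ n (i, j)) w \<partial>M)" by (rule nn_integral_suminf) auto
  also have "... = (\<Sum>n. ennreal (QQ n (int i) (int j)))"
    by (simp add: P.emeasure_eq_measure pr_def[symmetric] pr_interior[OF ij])
  finally show ?thesis .
qed

end

lemma inv_sqrt_lipschitz:
  fixes x y m :: real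
  assumes "0 < m" "m <= x" "m <= y"
  shows "\<bar>1 / sqrt x - 1 / sqrt y\<bar> <= \<bar>x - y\<bar> / (m * sqrt m)"
proof -
  have s: "sqrt x > 0" "sqrt y > 0" "sqrt m > 0" "sqrt m <= sqrt x" "sqrt m <= sqrt y" using assms by auto
  have e1: "(sqrt y - sqrt x) * (sqrt x + sqrt y) = y - x"
    using assms by (simp add: algebra_simps)
  have e2: "1 / sqrt x - 1 / sqrt y = (y - x) / ((sqrt x * sqrt y) * (sqrt x + sqrt y))"
  proof -
    have "sqrt x * sqrt y ~= 0" "sqrt x + sqrt y ~= 0" using s(1,2) mult_pos_pos[of "sqrt x" "sqrt y"] by linarith+
    moreover have "1 / p - 1 / q = ((q - p) * (p + q)) / ((p * q) * (p + q))" if "p * q ~= 0" "p + q ~= 0" for p q :: real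
      using that by (simp add: divide_simps)
    ultimately show ?thesis unfolding e1[symmetric] by blast
  qed
  have "m = sqrt m * sqrt m" using assms by simp
  also have "... <= sqrt x * sqrt y" using s by (intro mult_mono) auto
  finally have e3: "m <= sqrt x * sqrt y" .
  have "\<bar>1 / sqrt x - 1 / sqrt y\<bar> = \<bar>x - y\<bar> / ((sqrt x * sqrt y) * (sqrt x + sqrt y))"
    unfolding e2 using s by (simp add: abs_mult abs_minus_commute)
  also have "... <= \<bar>x - y\<bar> / (m * sqrt m)"
  proof (rule divide_left_mono)
    have q: "sqrt m <= sqrt x + sqrt y" "0 < sqrt x + sqrt y" "0 <= sqrt x * sqrt y" "0 < sqrt x * sqrt y" "0 <= sqrt m"
      using s mult_pos_pos[of "sqrt x" "sqrt y"] by linarith+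
    show "m * sqrt m <= sqrt x * sqrt y * (sqrt x + sqrt y)" by (rule mult_mono[OF e3 q(1) q(3) q(5)])
    show "0 < sqrt x * sqrt y * (sqrt x + sqrt y) * (m * sqrt m)"
      by (rule mult_pos_pos[OF mult_pos_pos[OF q(4) q(2)] mult_pos_pos[OF assms(1) s(3)]])
  qed simp
  finally show ?thesis .
qed

context drift_walk begin

lemma lam2_lipschitz: "\<exists>L\<ge>0. \<forall>v. \<bar>v - v0\<bar> <= r2 --> \<bar>v - v0\<bar> <= r3 --> \<bar>lam2 v - sig2\<bar> <= L * \<bar>v - v0\<bar>"
proof -
  obtain L where L: "L >= 0" and H: "\<And>z w. z \<in> cball (of_real v0) r3 ==> w \<in> cball (of_real v0) r3 ==>
      norm (deriv (deriv Lam) w - (\<Sum>i\<le>0. (deriv ^^ i) (deriv (deriv Lam)) z * (w - z) ^ i / fact i)) <= L * norm (w - z) ^ Suc 0"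
    using taylor_uniform[OF deriv_Lam_hol(2) r3(5), of 0] by blast
  have "\<bar>lam2 v - sig2\<bar> <= L * \<bar>v - v0\<bar>" if v: "\<bar>v - v0\<bar> <= r3" for v
  proof -
    have n: "norm (complex_of_real v - of_real v0) = \<bar>v - v0\<bar>" by (metis norm_of_real of_real_diff)
    have "norm (deriv (deriv Lam) (of_real v) - deriv (deriv Lam) (of_real v0)) <= L * \<bar>v - v0\<bar>"
      using H[of "of_real v0" "of_real v"] v r3(1) n by (simp add: dist_norm norm_minus_commute)
    moreover have "deriv (deriv Lam) (of_real v) - deriv (deriv Lam) (of_real v0) = of_real (lam2 v - lam2 v0)"
      using lam'_deriv(2)[of v] lam'_deriv(2)[of v0] v r3(1,5) r1 by simp
    ultimately have "norm (complex_of_real (lam2 v - sig2)) <= L * \<bar>v - v0\<bar>" unfolding lam2_v0 by simp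
    then show ?thesis unfolding norm_of_real .
  qed
  then show ?thesis using L by blast
qed

lemma exp_lam: "\<bar>v - v0\<bar> <= dl0 ==> exp (lam v) = fr (exp v)"
  using fr_exp[of v] by (simp add: lam_def)

lemma norm_yy_powi: "norm (yy v th powi (- e)) = exp (- of_int e * v)"
  by (simp add: norm_power_int exp_power_int)

lemma yy_powi: "yy v th powi (- e) = of_real (exp (- of_int e * v)) * exp (- \<i> * of_real (of_int e * th))"
proof -
  have "Complex v th = of_real v + \<i> * of_real th" by (simp add: complex_eq_iff)
  then show ?thesis
    unfolding yy_def exp_power_int exp_of_real[symmetric] exp_add[symmetric] by (simp add: algebra_simps)
qed

text \<open>At the saddle point belonging to \<open>j / i\<close> the subtracted linear term is the one coming from
  \<open>y\<^sup>-\<^sup>j\<close>.\<close>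

definition phase :: "real => real => complex" where
  "phase v th = Lam (Complex v th) - of_real (lam v) - \<i> * of_real (lam' v * th)"

lemma phase_eq:
  assumes v: "\<bar>v - v0\<bar> <= dl0" and z: "Complex v th \<in> ball (of_real v0) r1" and j: "real j = lam' v * real i"
  shows "F 1 (yy v th) ^ i * yy v th powi (- int j) = of_real (fr (exp v) ^ i * exp (- real j * v)) * exp (of_nat i * phase v th)"
proof -
  have "F 1 (yy v th) = exp (Lam (Complex v th))" using exp_Lam[OF z] by (simp add: yy_def)
  then have 1: "F 1 (yy v th) ^ i = exp (of_nat i * Lam (Complex v th))" by (simp add: exp_of_nat_mult)
  have 2: "complex_of_real (fr (exp v) ^ i) = exp (of_nat i * of_real (lam v))"
    by (simp add: exp_lam[OF v, symmetric] exp_of_nat_mult exp_of_real)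
  have "of_nat i * (\<i> * of_real (lam' v * th)) = \<i> * of_real (real j * th)" unfolding j by (simp add: mult_ac)
  then have 3: "of_nat i * Lam (Complex v th) + - \<i> * of_real (real j * th) = of_nat i * of_real (lam v) + of_nat i * phase v th"
    unfolding phase_def by (simp add: algebra_simps)
  have "exp (of_nat i * Lam (Complex v th)) * exp (- \<i> * of_real (real j * th)) = exp (of_nat i * of_real (lam v)) * exp (of_nat i * phase v th)"
    unfolding exp_add[symmetric] 3 ..
  then show ?thesis unfolding 1 yy_powi of_real_mult 2 by (simp add: mult_ac)
qed

end

section \<open>Laplace analysis of the angular integral\<close>

context boundary_term begin

lemma hh_1_holomorphic: "(%z. hh 1 (exp z)) holomorphic_on ball (of_real v0) r3"
proof -
  have sub: "exp z \<in> ann'" if "z \<in> ball (of_real v0) r3" for z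
    using r1_ball[of z] that r3(5) by auto
  have ne: "F 1 (exp z) ~= 0" "upf (F 1 (exp z)) ~= 0" if "z \<in> ball (of_real v0) r3" for z
    using near[of 1 z] that r3(1,3) by (auto simp: dist_norm norm_minus_commute)
  have Fh: "(%z. F 1 (exp z)) holomorphic_on ball (of_real v0) r3"
    using holomorphic_on_compose_gen[OF holomorphic_on_exp F_hol_y[OF norm_1_le], of "ball (of_real v0) r3"] sub
    by (simp add: o_def image_subset_iff)
  have "exp ` ball (complex_of_real v0) r3 \<subseteq> ball 0 1" using sub ann'_sub ann_ball by blast
  from holomorphic_on_compose_gen[OF holomorphic_on_exp \<alpha> this]
  have ah: "(%z. \<alpha> (exp z)) holomorphic_on ball (of_real v0) r3" by (simp add: o_def)
  show ?thesis
    unfolding hh_def amp_def upf_def using ne by (intro holomorphic_intros Fh ah) (auto simp: upf_def)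
qed

definition JJ :: "nat => nat => real => complex" where
  "JJ i j v = integral {-Th..Th} (%th. inner i v th * yy v th powi (- int j))"

lemma JJ_continuous: "\<bar>v - v0\<bar> <= dl0 ==> continuous_on A (%th. inner i v th * yy v th powi (- int j))"
proof -
  assume "\<bar>v - v0\<bar> <= dl0"
  moreover have "continuous_on A (%th. yy v th powi (- int j))"
    unfolding yy_powi by (intro continuous_intros)
  ultimately show ?thesis by (intro continuous_on_mult inner_continuous)
qed

definition "far_const \<eta> = 2 * Th * CD * (6 / (cd * \<eta>\<^sup>2)) ^ 3"

lemma cube_le: "i > 0 ==> 1 / real i ^ 3 <= 1 / ((real i)\<^sup>2 * sqrt (real i))"
proof -
  assume i: "i > 0"
  have "sqrt (real i) <= real i" using i by (simp add: real_le_lsqrt real_sqrt_le_iff' power2_eq_square)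
  then have "(real i)\<^sup>2 * sqrt (real i) <= (real i)\<^sup>2 * real i" by (intro mult_left_mono) auto
  also have "... = real i ^ 3" by (simp add: power2_eq_square power3_eq_cube)
  finally show ?thesis using i by (intro divide_left_mono) auto
qed

text \<open>Away from th = 0 the integrand is exponentially small in i. The cubic bound on the
  exponential is just strong enough to reach the order i^(-5/2).\<close>

lemma far_part:
  assumes \<eta>: "0 < \<eta>" "\<eta> <= Th" and v: "\<bar>v - v0\<bar> <= rd" and i: "i >= 2 * n0" "i > 0"
    and AB: "A = -Th & B = -\<eta> | A = \<eta> & B = Th"
  shows "norm (integral {A..B} (%th. inner i v th * yy v th powi (- int j)))
    <= far_const \<eta> / 2 * (fr (exp v) ^ i * exp (- real j * v)) / ((real i)\<^sup>2 * sqrt (real i))"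
proof -
  define k where "k = fr (exp v)"
  have vd: "\<bar>v - v0\<bar> <= dl0" using v rd(3) r3(1,4) by linarith
  have k: "k > 0" using fr_exp[OF vd] by (simp add: k_def)
  have i0: "real i > 0" using i by simp
  define x where "x = cd / 2 * real i * \<eta>\<^sup>2"
  have x: "x > 0" using rd(1) i0 \<eta> by (simp add: x_def)
  have ex: "exp (- x) <= (6 / (cd * \<eta>\<^sup>2)) ^ 3 * (1 / ((real i)\<^sup>2 * sqrt (real i)))"
  proof -
    have "exp (- x) <= (real 3 / x) ^ 3" by (rule exp_minus_le_power[OF x]) simp
    also have "... = (6 / (cd * \<eta>\<^sup>2)) ^ 3 * (1 / real i ^ 3)" by (simp add: x_def power_divide power_mult_distrib mult_ac)
    also have "... <= (6 / (cd * \<eta>\<^sup>2)) ^ 3 * (1 / ((real i)\<^sup>2 * sqrt (real i)))"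
      using rd(1) by (intro mult_left_mono cube_le i zero_le_power) auto
    finally show ?thesis .
  qed
  have AB': "A <= B" "B - A <= Th" "\<And>th. th \<in> {A..B} ==> \<eta> <= \<bar>th\<bar> & \<bar>th\<bar> <= Th" using AB \<eta> by auto
  have "norm (integral {A..B} (%th. inner i v th * yy v th powi (- int j))) <= integral {A..B} (%th. CD * k ^ i * exp (- x) * exp (- real j * v))"
  proof (rule integral_norm_bound_integral)
    show "(%th. inner i v th * yy v th powi (- int j)) integrable_on {A..B}"
      by (rule integrable_continuous_real[OF JJ_continuous[OF vd]])
    fix th assume th: "th \<in> {A..B}"
    have "\<eta>\<^sup>2 <= th\<^sup>2" using AB'(3)[OF th] \<eta> by (metis abs_le_square_iff abs_of_pos)
    then have "cd / 2 * real i * \<eta>\<^sup>2 <= cd / 2 * real i * th\<^sup>2" using rd(1) by (intro mult_left_mono) auto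
    then have "exp (- (cd / 2 * real i) * th\<^sup>2) <= exp (- x)" by (simp add: x_def)
    then have "norm (inner i v th) <= CD * k ^ i * exp (- x)"
      using inner_far[OF v _ i(1), of th] AB'(3)[OF th] CD_nonneg k unfolding k_def[symmetric]
      by (meson mult_left_mono mult_nonneg_nonneg order_trans zero_le_power less_imp_le)
    then show "norm (inner i v th * yy v th powi (- int j)) <= CD * k ^ i * exp (- x) * exp (- real j * v)"
      unfolding norm_mult norm_yy_powi by (simp add: mult_right_mono)
  qed auto
  also have "... = (B - A) * (CD * k ^ i * exp (- x) * exp (- real j * v))" using AB' by simp
  also have "... <= Th * (CD * k ^ i * ((6 / (cd * \<eta>\<^sup>2)) ^ 3 * (1 / ((real i)\<^sup>2 * sqrt (real i)))) * exp (- real j * v))"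
    using CD_nonneg k AB' ex Th_pos by (intro mult_mono mult_left_mono mult_right_mono) auto
  also have "... = far_const \<eta> / 2 * (fr (exp v) ^ i * exp (- real j * v)) / ((real i)\<^sup>2 * sqrt (real i))"
    by (simp add: far_const_def k_def)
  finally show ?thesis .
qed

definition "near_const \<eta> = (CD * (4 / (cd * \<eta>))\<^sup>2 + M0 / (cd * \<eta>) + 3 * (M0 + 1) / (r3 * cd)) * sqrt (2 * pi / cd)"

lemma near_part:
  assumes \<eta>: "0 < \<eta>" "\<eta> <= rd" "\<eta> < 1" "\<eta> <= Th" "\<eta> <= r3 / 4" and v: "\<bar>v - v0\<bar> <= \<eta>" and i: "i >= 2 * n0" "i > 0"
  shows "norm (integral {-\<eta>..\<eta>} (%th. inner i v th * yy v th powi (- int j))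
        - integral {-\<eta>..\<eta>} (%th. hh 1 (yy v th) * F 1 (yy v th) ^ i * yy v th powi (- int j)) / of_nat i)
    <= near_const \<eta> * (fr (exp v) ^ i * exp (- real j * v)) / ((real i)\<^sup>2 * sqrt (real i))"
proof -
  define k where "k = fr (exp v)"
  have vrd: "\<bar>v - v0\<bar> <= rd" and vd: "\<bar>v - v0\<bar> <= dl0" using v \<eta> rd(3) r3(1,4) by linarith+
  have k: "k > 0" using fr_exp[OF vd] by (simp add: k_def)
  have i0: "real i > 0" using i by simp
  define Cn where "Cn = CD * (4 / (cd * \<eta>))\<^sup>2 + M0 / (cd * \<eta>) + 3 * (M0 + 1) / (r3 * cd)"
  have Cn: "Cn >= 0" using CD_nonneg M0_nonneg rd(1) \<eta> r3(1) by (simp add: Cn_def)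
  define m where "m th = hh 1 (yy v th) * F 1 (yy v th) ^ i * yy v th powi (- int j)" for th
  have ball: "Complex v th \<in> ball (of_real v0) r3" if "th \<in> {-\<eta>..\<eta>}" for th
  proof -
    have "norm (Complex v th - of_real v0) <= \<bar>v - v0\<bar> + \<bar>th\<bar>" using cmod_le[of "Complex v th - of_real v0"] by simp
    moreover have "\<bar>th\<bar> <= \<eta>" using that by auto
    ultimately show ?thesis using v \<eta>(5) r3(1) by (simp add: dist_norm norm_minus_commute)
  qed
  have cC: "continuous_on {-\<eta>..\<eta>} (Complex v)" unfolding Complex_eq by (intro continuous_intros)
  have hc: "continuous_on {-\<eta>..\<eta>} (%th. hh 1 (yy v th))"
    unfolding yy_def by (rule continuous_on_compose2[OF holomorphic_on_imp_continuous_on[OF hh_1_holomorphic] cC]) (use ball in blast)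
  have Fc: "continuous_on {-\<eta>..\<eta>} (%th. F 1 (yy v th))"
    using vd norm_1_le yy_ann[OF vd] by (intro F_cont') (auto simp: yy_def intro!: continuous_intros cC)
  have mc: "continuous_on {-\<eta>..\<eta>} m"
    unfolding m_def yy_powi by (intro continuous_intros hc Fc)
  have "norm (integral {-\<eta>..\<eta>} (%th. inner i v th * yy v th powi (- int j)) - integral {-\<eta>..\<eta>} m / of_nat i)
     = norm (integral {-\<eta>..\<eta>} (%th. inner i v th * yy v th powi (- int j) - m th / of_nat i))"
    by (subst Henstock_Kurzweil_Integration.integral_diff)
       (auto intro!: integrable_continuous_real JJ_continuous vd continuous_on_divide mc continuous_on_const simp: i)
  also have "... <= integral {-\<eta>..\<eta>} (%th. (Cn * k ^ i / (real i)\<^sup>2 * exp (- real j * v)) * exp (- (cd / 2 * real i) * th\<^sup>2))"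
  proof (rule integral_norm_bound_integral)
    show "(%th. inner i v th * yy v th powi (- int j) - m th / of_nat i) integrable_on {-\<eta>..\<eta>}"
      by (intro integrable_continuous_real continuous_on_diff JJ_continuous vd continuous_on_divide mc continuous_on_const) (use i in auto)
    show "(%th. (Cn * k ^ i / (real i)\<^sup>2 * exp (- real j * v)) * exp (- (cd / 2 * real i) * th\<^sup>2)) integrable_on {-\<eta>..\<eta>}"
      by (intro integrable_continuous_real continuous_intros)
    fix th assume th: "th \<in> {-\<eta>..\<eta>}"
    have "norm (inner i v th - F 1 (yy v th) ^ i * hh 1 (yy v th) / of_nat i) <= Cn * k ^ i * exp (- (cd / 2 * real i) * th\<^sup>2) / (real i)\<^sup>2"
      unfolding Cn_def k_def using th \<eta> by (intro inner_near v i) auto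
    then have "norm (inner i v th - F 1 (yy v th) ^ i * hh 1 (yy v th) / of_nat i) * exp (- real j * v)
       <= Cn * k ^ i * exp (- (cd / 2 * real i) * th\<^sup>2) / (real i)\<^sup>2 * exp (- real j * v)"
      by (rule mult_right_mono) simp
    moreover have "inner i v th * yy v th powi (- int j) - m th / of_nat i
       = (inner i v th - F 1 (yy v th) ^ i * hh 1 (yy v th) / of_nat i) * yy v th powi (- int j)"
      by (simp add: m_def algebra_simps)
    ultimately show "norm (inner i v th * yy v th powi (- int j) - m th / of_nat i)
       <= (Cn * k ^ i / (real i)\<^sup>2 * exp (- real j * v)) * exp (- (cd / 2 * real i) * th\<^sup>2)"
      by (simp add: norm_mult norm_yy_powi mult_ac)
  qed
  also have "... <= (Cn * k ^ i / (real i)\<^sup>2 * exp (- real j * v)) * sqrt (pi / (cd / 2 * real i))"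
    unfolding integral_mult_right using Cn k rd(1) i0 \<eta>(1) by (intro mult_left_mono gauss_interval(1)) auto
  also have "sqrt (pi / (cd / 2 * real i)) = sqrt (2 * pi / cd) / sqrt (real i)"
    by (simp add: real_sqrt_divide[symmetric] real_sqrt_mult[symmetric] mult_ac)
  finally show ?thesis
    unfolding near_const_def Cn_def[symmetric] m_def k_def by (simp add: mult_ac)
qed

lemma hh_taylor:
  "\<exists>B\<ge>0. \<forall>v th. \<bar>v - v0\<bar> <= r3 / 4 --> \<bar>th\<bar> <= r3 / 4 -->
     norm (hh 1 (yy v 0)) <= B & norm (\<i> * deriv (%z. hh 1 (exp z)) (of_real v)) <= B \<and>
     norm (hh 1 (yy v th) - (hh 1 (yy v 0) + \<i> * deriv (%z. hh 1 (exp z)) (of_real v) * of_real th)) <= B * th\<^sup>2 \<and>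
     norm (hh 1 (yy v 0) - hh 1 (of_real Y0)) <= 2 * B * \<bar>v - v0\<bar>"
proof -
  define g where "g z = hh 1 (exp z)" for z
  have "g holomorphic_on ball (of_real v0) r3" using hh_1_holomorphic by (simp add: g_def[abs_def])
  moreover have "r3 / 2 < r3" using r3(1) by simp
  ultimately obtain B where B: "B >= 0" and Bk: "\<And>z k. z \<in> cball (of_real v0) (r3 / 2) ==> k <= Suc 1 ==> norm ((deriv ^^ k) g z) <= B"
    and Bt: "\<And>z w. z \<in> cball (of_real v0) (r3 / 2) ==> w \<in> cball (of_real v0) (r3 / 2) ==>
      norm (g w - (\<Sum>i\<le>1. (deriv ^^ i) g z * (w - z) ^ i / fact i)) <= B * norm (w - z) ^ Suc 1"
    using taylor_uniform[of g "of_real v0" r3 "r3 / 2" 1] by blast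
  have Bt': "norm (g w - (g z + deriv g z * (w - z))) <= B * (norm (w - z))\<^sup>2"
    if "z \<in> cball (of_real v0) (r3 / 2)" "w \<in> cball (of_real v0) (r3 / 2)" for z w
    using Bt[OF that] by (simp add: numeral_2_eq_2)
  have "norm (hh 1 (yy v 0)) <= B & norm (\<i> * deriv g (of_real v)) <= B \<and>
     norm (hh 1 (yy v th) - (hh 1 (yy v 0) + \<i> * deriv g (of_real v) * of_real th)) <= B * th\<^sup>2 \<and>
     norm (hh 1 (yy v 0) - hh 1 (of_real Y0)) <= 2 * B * \<bar>v - v0\<bar>" if v: "\<bar>v - v0\<bar> <= r3 / 4" and th: "\<bar>th\<bar> <= r3 / 4" for v th
  proof -
    have n: "norm (complex_of_real v - of_real v0) = \<bar>v - v0\<bar>" by (metis norm_of_real of_real_diff)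
    have zv: "of_real v \<in> cball (complex_of_real v0) (r3 / 2)" and z0: "of_real v0 \<in> cball (complex_of_real v0) (r3 / 2)"
      using v n r3(1) by (simp_all add: dist_norm norm_minus_commute)
    have "norm (Complex v th - of_real v0) <= \<bar>v - v0\<bar> + \<bar>th\<bar>" using cmod_le[of "Complex v th - of_real v0"] by simp
    then have zw: "Complex v th \<in> cball (complex_of_real v0) (r3 / 2)" using v th by (simp add: dist_norm norm_minus_commute)
    have e: "Complex v th - of_real v = \<i> * of_real th" by (simp add: complex_eq_iff)
    have g: "g (of_real v) = hh 1 (yy v 0)" "g (Complex v th) = hh 1 (yy v th)" "g (of_real v0) = hh 1 (of_real Y0)"
      by (simp_all only: g_def yy_0 exp_of_real Y0_def) (simp_all add: yy_def)
    have 1: "norm (hh 1 (yy v 0)) <= B" using Bk[OF zv, of 0] by (simp add: g)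
    have 2: "norm (\<i> * deriv g (of_real v)) <= B" using Bk[OF zv, of 1] by (simp add: norm_mult)
    have 3: "norm (hh 1 (yy v th) - (hh 1 (yy v 0) + \<i> * deriv g (of_real v) * of_real th)) <= B * th\<^sup>2"
      using Bt'[OF zv zw] unfolding e g by (simp add: norm_mult power_mult_distrib mult_ac)
    have d0: "norm (deriv g (of_real v0) * (of_real v - of_real v0)) <= B * \<bar>v - v0\<bar>"
      unfolding norm_mult n using Bk[OF z0, of 1] by (intro mult_right_mono) auto
    have "norm (g (of_real v) - g (of_real v0)) <= B * (\<bar>v - v0\<bar>)\<^sup>2 + B * \<bar>v - v0\<bar>"
      using Bt'[OF z0 zv] d0 norm_triangle_ineq[of "g (of_real v) - (g (of_real v0) + deriv g (of_real v0) * (of_real v - of_real v0))" "deriv g (of_real v0) * (of_real v - of_real v0)"]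
      unfolding n by simp
    also have "... <= B * (1 * \<bar>v - v0\<bar>) + B * \<bar>v - v0\<bar>"
      unfolding power2_eq_square using v r3 B by (intro add_mono mult_left_mono mult_right_mono) auto
    finally show ?thesis using 1 2 3 unfolding g by simp
  qed
  then show ?thesis using B unfolding g_def[abs_def] by blast
qed

text \<open>The circle passes through the saddle \<open>sv (j / i)\<close>. The relative error 1/i
  collects the far part, the s-integral and the Laplace remainder. The error j/i is the price of
  evaluating amplitude and variance at v0 instead of the saddle, which is at distance of order
  j/i.\<close>

theorem JJ_estimate:
  "\<exists>C\<ge>0. \<exists>d>0. \<exists>N. d <= t1 & (\<forall>i j. N <= i --> 1 <= i --> real j <= d * real i --> \<bar>sv (real j / real i) - v0\<bar> <= rd \<and>
     norm (JJ i j (sv (real j / real i)) - of_real (fr (exp (sv (real j / real i))) ^ i * exp (- real j * sv (real j / real i)) * (sqrt (2 * pi / sig2) / (real i * sqrt (real i)))) * hh 1 (of_real Y0))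
      <= C * (fr (exp (sv (real j / real i))) ^ i * exp (- real j * sv (real j / real i))) * ((1 / real i + real j / real i) / (real i * sqrt (real i))))"
proof -
  obtain B1 where B1: "B1 >= 0" and H1: "\<And>v th. \<bar>v - v0\<bar> <= r3 / 4 ==> \<bar>th\<bar> <= r3 / 4 ==>
     norm (hh 1 (yy v 0)) <= B1 & norm (\<i> * deriv (%z. hh 1 (exp z)) (of_real v)) <= B1 \<and>
     norm (hh 1 (yy v th) - (hh 1 (yy v 0) + \<i> * deriv (%z. hh 1 (exp z)) (of_real v) * of_real th)) <= B1 * th\<^sup>2 \<and>
     norm (hh 1 (yy v 0) - hh 1 (of_real Y0)) <= 2 * B1 * \<bar>v - v0\<bar>"
    using hh_taylor by blast
  obtain B2 where B2: "B2 >= 0" and H2: "\<And>v. \<bar>v - v0\<bar> <= r3 ==> norm ((deriv ^^ 3) Lam (of_real v)) <= B2"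
    and H3: "\<And>v th. norm (Complex v th - of_real v0) <= r3 ==> norm (Lam (Complex v th) - of_real (lam v) - \<i> * of_real (lam' v * th)
        - (- of_real (lam2 v * th\<^sup>2 / 2) + (- \<i> * (deriv ^^ 3) Lam (of_real v) / 6) * of_real (th ^ 3))) <= B2 * th ^ 4"
    using Lam_taylor by blast
  obtain L where L: "L >= 0" and HL: "\<And>v. \<bar>v - v0\<bar> <= r2 ==> \<bar>v - v0\<bar> <= r3 ==> \<bar>lam2 v - sig2\<bar> <= L * \<bar>v - v0\<bar>"
    using lam2_lipschitz by blast
  define B where "B = B1 + B2"
  have B: "B >= 0" "B1 <= B" "B2 <= B" using B1 B2 by (auto simp: B_def)
  \<comment> \<open>The last entry makes 2 B \<eta> at most sig2/8, as
    \<open>laplace_estimate\<close> demands for \<sigma>1 = sig2/2.\<close>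
  define \<eta> where "\<eta> = Min {rd, r3 / 4, 1 / 2, Th, sig2 / (16 * (B + 1))}"
  have \<eta>0: "\<eta> > 0" using rd(2) r3(1) Th_pos sig2_pos B by (simp add: \<eta>_def)
  have \<eta>: "\<eta> <= rd" "\<eta> <= r3 / 4" "\<eta> <= 1 / 2" "\<eta> <= Th" "\<eta> <= sig2 / (16 * (B + 1))"
    unfolding \<eta>_def by (rule Min_le; simp)+
  have \<eta>B: "2 * B * \<eta> <= (sig2 / 2) / 4"
  proof -
    have "2 * B * \<eta> <= 2 * (B + 1) * \<eta>" using \<eta>0 by (intro mult_right_mono) auto
    also have "... <= 2 * (B + 1) * (sig2 / (16 * (B + 1)))" using B by (intro mult_left_mono \<eta>) auto
    also have "... = (sig2 / 2) / 4" using B by (simp add: field_simps)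
    finally show ?thesis .
  qed
  \<comment> \<open>By the Lipschitz bound for \<open>sv\<close> this keeps the saddle within \<eta>
    of v0.\<close>
  define d where "d = min t1 (sig2 * \<eta> / 2)"
  have d: "d > 0" "d <= t1" "d <= sig2 * \<eta> / 2" using t1_pos sig2_pos \<eta>0 by (auto simp: d_def)
  define LC where "LC = laplace_const \<eta> (sig2 / 2) B"
  define m where "m = sig2 / 2"
  have m: "m > 0" "m <= sig2" using sig2_pos by (auto simp: m_def)
  define Ct where "Ct = sqrt (2 * pi) * (2 * B * (1 / sqrt sig2) + B * (L / (m * sqrt m))) * (2 / sig2)"
  have Ct: "Ct >= 0" using B L m sig2_pos by (simp add: Ct_def)
  have LCn: "0 <= LC" unfolding LC_def laplace_const_def Let_def using B sig2_pos by (intro add_nonneg_nonneg mult_nonneg_nonneg) auto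
  define C where "C = far_const \<eta> + near_const \<eta> + LC + Ct"
  have fnn: "far_const \<eta> >= 0" using Th_pos CD_nonneg rd(1) by (simp add: far_const_def)
  have nnn: "near_const \<eta> >= 0" using CD_nonneg M0_nonneg rd(1) \<eta>0 r3(1) by (simp add: near_const_def)
  have C: "C >= 0" using fnn nnn LCn Ct by (simp add: C_def)
  have main: "\<bar>v - v0\<bar> <= rd & norm (JJ i j v - of_real (k * (sqrt (2 * pi / sig2) / (real i * sqrt (real i)))) * hh 1 (of_real Y0))
      <= C * k * ((1 / real i + t) / (real i * sqrt (real i)))"
    if i: "2 * n0 <= i" "1 <= i" and jd: "real j <= d * real i" and t: "t = real j / real i" and vt: "v = sv t"
      and kd: "k = fr (exp v) ^ i * exp (- real j * v)" for i j v t k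
  proof -
    have i0: "real i > 0" using i by simp
    have t0: "0 <= t" "t <= d" using jd i0 by (auto simp: t field_simps)
    then have tt: "\<bar>t\<bar> <= t1" using d by simp
    have "\<bar>v - v0\<bar> <= 2 / sig2 * t" using sv(4)[OF tt] t0 unfolding vt by simp
    moreover have "2 / sig2 * t <= 2 / sig2 * (sig2 * \<eta> / 2)" using t0 d sig2_pos by (intro mult_left_mono) auto
    ultimately have vt2: "\<bar>v - v0\<bar> <= 2 / sig2 * t" and v\<eta>: "\<bar>v - v0\<bar> <= \<eta>" using sig2_pos by auto
    have lv: "lam' v = t" using sv(2)[OF tt] by (simp add: vt)
    have v: "\<bar>v - v0\<bar> <= rd" "\<bar>v - v0\<bar> <= r3 / 4" "\<bar>v - v0\<bar> <= r3" "\<bar>v - v0\<bar> <= r2" "\<bar>v - v0\<bar> <= dl0"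
      using v\<eta> \<eta> rd r3 by linarith+
    have kp: "fr (exp v) > 0" using fr_exp[OF v(5)] by simp
    then have k0: "k > 0" by (simp add: kd)
    have jl: "real j = lam' v * real i" using i0 by (simp add: lv t)
    define w where "w th = hh 1 (yy v th)" for th
    define w0 where "w0 = hh 1 (yy v 0)"
    define w1 where "w1 = \<i> * deriv (%z. hh 1 (exp z)) (of_real v)"
    define g where "g th = inner i v th * yy v th powi (- int j)" for th
    have gi: "g integrable_on {x..y}" for x y unfolding g_def[abs_def] by (rule integrable_continuous_real[OF JJ_continuous[OF v(5)]])
    have zn: "norm (Complex v th - of_real v0) <= r3 / 2" if "\<bar>th\<bar> <= \<eta>" for th
    proof -
      have "norm (Complex v th - of_real v0) <= \<bar>v - v0\<bar> + \<bar>th\<bar>" using cmod_le[of "Complex v th - of_real v0"] by simp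
      then show ?thesis using that v(2) \<eta>(2) by linarith
    qed
    have zr: "Complex v th \<in> ball (of_real v0) r" if "\<bar>th\<bar> <= \<eta>" "r = r1 | r = r3" for th r
      using zn[OF that(1)] that(2) r3(1,5) by (auto simp: dist_norm norm_minus_commute)
    have cC: "continuous_on {-\<eta>..\<eta>} (Complex v)" unfolding Complex_eq by (intro continuous_intros)
    have wc: "continuous_on {-\<eta>..\<eta>} w" unfolding w_def yy_def
      by (rule continuous_on_compose2[OF holomorphic_on_imp_continuous_on[OF hh_1_holomorphic] cC]) (use zr in auto)
    have pc: "continuous_on {-\<eta>..\<eta>} (phase v)" unfolding phase_def[abs_def]
      by (intro continuous_intros continuous_on_compose2[OF holomorphic_on_imp_continuous_on[OF Lam_hol] cC]) (use zr in auto)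
    have lap: "norm (integral {-\<eta>..\<eta>} (%th. w th * exp (of_real (real i) * phase v th)) - w0 * of_real (sqrt (2 * pi / (real i * lam2 v)))) <= LC / (real i * sqrt (real i))"
      unfolding LC_def
    proof (rule laplace_estimate[where \<kappa> = "- \<i> * (deriv ^^ 3) Lam (of_real v) / 6" and ?w1.0 = w1])
      show "0 < \<eta>" "\<eta> <= 1" "0 < sig2 / 2" "sig2 / 2 <= lam2 v" "0 <= B" "2 * B * \<eta> <= sig2 / 2 / 4" "1 <= real i"
        using \<eta>0 \<eta> sig2_pos lam2_ge[OF v(4)] B \<eta>B i by auto
      have "norm ((deriv ^^ 3) Lam (of_real v)) <= B" using H2[OF v(3)] B by linarith
      then show "norm (- \<i> * (deriv ^^ 3) Lam (of_real v) / 6) <= B" using B(1) by (simp add: norm_mult norm_divide)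
      have "\<bar>0 :: real\<bar> <= r3 / 4" using r3(1) by simp
      from H1[OF v(2) this] show "norm w0 <= B" "norm w1 <= B" unfolding w0_def w1_def using B by auto
      fix th :: real assume th: "\<bar>th\<bar> <= \<eta>"
      have "norm (Complex v th - of_real v0) <= r3" using zn[OF th] r3(1) by linarith
      from H3[OF this] have "norm (phase v th - (- of_real (lam2 v * th\<^sup>2 / 2) + (- \<i> * (deriv ^^ 3) Lam (of_real v) / 6) * of_real (th ^ 3))) <= B2 * th ^ 4"
        by (simp add: phase_def)
      also have "... <= B * th ^ 4" using B by (intro mult_right_mono) auto
      finally show "norm (phase v th - (- of_real (lam2 v * th\<^sup>2 / 2) + (- \<i> * (deriv ^^ 3) Lam (of_real v) / 6) * of_real (th ^ 3))) <= B * th ^ 4" .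
      have "norm (w th - (w0 + w1 * of_real th)) <= B1 * th\<^sup>2"
        using H1[OF v(2), of th] th \<eta>(2) by (simp add: w_def w0_def w1_def)
      also have "... <= B * th\<^sup>2" using B by (intro mult_right_mono) auto
      finally show "norm (w th - (w0 + w1 * of_real th)) <= B * th\<^sup>2" .
    qed (rule wc pc)+
    define IL where "IL = integral {-\<eta>..\<eta>} (%th. w th * exp (of_real (real i) * phase v th))"
    have mid: "integral {-\<eta>..\<eta>} (%th. hh 1 (yy v th) * F 1 (yy v th) ^ i * yy v th powi (- int j)) = of_real k * IL"
    proof -
      have "integral {-\<eta>..\<eta>} (%th. hh 1 (yy v th) * F 1 (yy v th) ^ i * yy v th powi (- int j))
         = integral {-\<eta>..\<eta>} (%th. of_real k * (w th * exp (of_real (real i) * phase v th)))"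
      proof (rule integral_cong)
        fix th assume "th \<in> {-\<eta>..\<eta>}"
        then have "\<bar>th\<bar> <= \<eta>" by auto
        from phase_eq[OF v(5) zr[OF this] jl] show "hh 1 (yy v th) * F 1 (yy v th) ^ i * yy v th powi (- int j) = of_real k * (w th * exp (of_real (real i) * phase v th))"
          by (simp add: w_def kd mult.assoc)
      qed
      then show ?thesis by (simp add: IL_def)
    qed
    define D where "D = (real i)\<^sup>2 * sqrt (real i)"
    have D: "D > 0" using i0 by (simp add: D_def)
    have split: "JJ i j v = integral {-Th..-\<eta>} g + integral {-\<eta>..\<eta>} g + integral {\<eta>..Th} g"
    proof -
      have "integral {-Th..-\<eta>} g + integral {-\<eta>..Th} g = integral {-Th..Th} g"
        by (rule Henstock_Kurzweil_Integration.integral_combine) (use \<eta>0 \<eta>(4) gi in auto)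
      moreover have "integral {-\<eta>..\<eta>} g + integral {\<eta>..Th} g = integral {-\<eta>..Th} g"
        by (rule Henstock_Kurzweil_Integration.integral_combine) (use \<eta>0 \<eta>(4) gi in auto)
      moreover have "JJ i j v = integral {-Th..Th} g" by (simp add: JJ_def g_def[abs_def])
      ultimately show ?thesis by (metis add.assoc)
    qed
    have ii: "i > 0" using i by simp
    have f1: "norm (integral {-Th..-\<eta>} g) <= far_const \<eta> / 2 * k / D" and f2: "norm (integral {\<eta>..Th} g) <= far_const \<eta> / 2 * k / D"
      unfolding g_def[abs_def] kd D_def by (rule far_part[OF \<eta>0 \<eta>(4) v(1) i(1) ii]; simp)+
    have "norm (integral {-\<eta>..\<eta>} g - of_real k * IL / of_nat i) <= near_const \<eta> * k / D"
      unfolding mid[symmetric] unfolding g_def[abs_def] kd D_def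
      by (rule near_part[OF \<eta>0 \<eta>(1) _ \<eta>(4,2) v\<eta> i(1) ii]) (use \<eta>(3) in simp)
    then have n1: "norm (integral {-\<eta>..\<eta>} g - of_real k * IL / of_nat i) <= near_const \<eta> * k / D" .
    define W where "W = w0 * of_real (sqrt (2 * pi / (real i * lam2 v)))"
    have l1: "norm (of_real k * IL / of_nat i - of_real k * W / of_nat i) <= LC * k / D"
    proof -
      have "of_real k * IL / of_nat i - of_real k * W / of_nat i = of_real (k / real i) * (IL - W)" by (simp add: algebra_simps diff_divide_distrib)
      then have "norm (of_real k * IL / of_nat i - of_real k * W / of_nat i) = k / real i * norm (IL - W)"
        using k0 i0 by (simp add: norm_mult norm_divide)
      also have "... <= k / real i * (LC / (real i * sqrt (real i)))"
        using lap k0 i0 unfolding IL_def W_def by (intro mult_left_mono) auto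
      finally show ?thesis by (simp add: D_def power2_eq_square mult_ac)
    qed
    define h0 where "h0 = hh 1 (of_real Y0)"
    have l2: "norm (of_real k * W / of_nat i - of_real (k * (sqrt (2 * pi / sig2) / (real i * sqrt (real i)))) * h0) <= Ct * k * t / (real i * sqrt (real i))"
    proof -
      define A1 where "A1 = 1 / sqrt (lam2 v)"
      define A2 where "A2 = 1 / sqrt sig2"
      have s1: "sqrt (2 * pi / (real i * lam2 v)) = sqrt (2 * pi) * A1 / sqrt (real i)" and s2: "sqrt (2 * pi / sig2) = sqrt (2 * pi) * A2"
        by (simp_all add: A1_def A2_def real_sqrt_divide real_sqrt_mult mult_ac)
      have e: "of_real k * W / of_nat i - of_real (k * (sqrt (2 * pi / sig2) / (real i * sqrt (real i)))) * h0
         = of_real (k * sqrt (2 * pi) / (real i * sqrt (real i))) * ((w0 - h0) * of_real A2 + w0 * of_real (A1 - A2))"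
        unfolding W_def s1 s2 by (simp add: algebra_simps diff_divide_distrib add_divide_distrib)
      have r4: "\<bar>0::real\<bar> <= r3 / 4" using r3(1) by simp
      have x1: "norm (w0 - h0) <= 2 * B * \<bar>v - v0\<bar>"
        using H1[OF v(2) r4] B mult_right_mono[of "2 * B1" "2 * B" "\<bar>v - v0\<bar>"] unfolding w0_def h0_def by linarith
      have x2: "norm w0 <= B" using H1[OF v(2) r4] B by (auto simp: w0_def)
      have x3: "\<bar>A1 - A2\<bar> <= L * \<bar>v - v0\<bar> / (m * sqrt m)"
      proof -
        have "\<bar>A1 - A2\<bar> <= \<bar>lam2 v - sig2\<bar> / (m * sqrt m)"
          unfolding A1_def A2_def using m lam2_ge[OF v(4)] by (intro inv_sqrt_lipschitz) (auto simp: m_def)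
        also have "... <= L * \<bar>v - v0\<bar> / (m * sqrt m)" using HL[OF v(4,3)] m by (intro divide_right_mono) auto
        finally show ?thesis .
      qed
      have A2: "A2 >= 0" using sig2_pos by (simp add: A2_def)
      have "norm ((w0 - h0) * of_real A2 + w0 * of_real (A1 - A2)) <= norm (w0 - h0) * A2 + norm w0 * \<bar>A1 - A2\<bar>"
        by (rule order_trans[OF norm_triangle_ineq]) (simp only: norm_mult norm_of_real abs_of_nonneg[OF A2] order_refl)
      also have "... <= (2 * B * \<bar>v - v0\<bar>) * A2 + B * (L * \<bar>v - v0\<bar> / (m * sqrt m))"
        using x1 x2 x3 A2 B by (intro add_mono mult_mono) auto
      also have "... = (2 * B * A2 + B * (L / (m * sqrt m))) * \<bar>v - v0\<bar>" by (simp add: algebra_simps)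
      also have "... <= (2 * B * A2 + B * (L / (m * sqrt m))) * (2 / sig2 * t)"
        using vt2 B A2 L m by (intro mult_left_mono) auto
      finally have x4: "norm ((w0 - h0) * of_real A2 + w0 * of_real (A1 - A2)) <= (2 * B * A2 + B * (L / (m * sqrt m))) * (2 / sig2 * t)" .
      have pn: "k * sqrt (2 * pi) / (real i * sqrt (real i)) >= 0" using k0 i0 by simp
      show ?thesis
        unfolding e norm_mult norm_of_real abs_of_nonneg[OF pn]
        by (rule order_trans[OF mult_left_mono[OF x4 pn]]) (simp add: Ct_def A2_def mult_ac)
    qed
    define P where "P = of_real (k * (sqrt (2 * pi / sig2) / (real i * sqrt (real i)))) * h0"
    have "JJ i j v - P = integral {-Th..-\<eta>} g + integral {\<eta>..Th} g + (integral {-\<eta>..\<eta>} g - of_real k * IL / of_nat i)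
       + (of_real k * IL / of_nat i - of_real k * W / of_nat i) + (of_real k * W / of_nat i - P)"
      unfolding split by simp
    also have "norm ... <= far_const \<eta> / 2 * k / D + far_const \<eta> / 2 * k / D + near_const \<eta> * k / D + LC * k / D + Ct * k * t / (real i * sqrt (real i))"
      by (intro norm_triangle_le add_mono f1 f2 n1 l1 l2[folded P_def])
    also have "... = (far_const \<eta> + near_const \<eta> + LC) * (k * (1 / real i / (real i * sqrt (real i)))) + Ct * (k * (t / (real i * sqrt (real i))))"
      by (simp add: D_def power2_eq_square add_divide_distrib algebra_simps)
    also have "... <= C * (k * (1 / real i / (real i * sqrt (real i)))) + C * (k * (t / (real i * sqrt (real i))))"
      using fnn nnn LCn Ct k0 i0 t0 by (intro add_mono mult_right_mono) (auto simp: C_def)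
    also have "... = C * k * ((1 / real i + t) / (real i * sqrt (real i)))"
      by (simp add: add_divide_distrib distrib_left mult.assoc)
    finally show ?thesis using v(1) by (simp add: P_def h0_def)
  qed
  show ?thesis
    by (intro exI[of _ C] conjI C exI[of _ d] d exI[of _ "2 * n0"] allI impI) (use main in blast)+
qed

end

section \<open>Fourier inversion of the path sums\<close>

lemma integral_exp_i:
  fixes e :: int and L :: real
  assumes "L > 0" "e ~= 0" "\<exists>k::int. of_int e * L = of_int k * pi"
  shows "integral {-L..L} (%th. exp (- \<i> * of_real (of_int e * th))) = 0"
proof -
  define c where "c = - \<i> * of_int e"
  have c: "c ~= 0" using assms by (simp add: c_def)
  have "((%th. exp (c * of_real th)) has_integral (exp (c * of_real L) / c - exp (c * of_real (- L)) / c)) {-L..L}"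
  proof (rule fundamental_theorem_of_calculus)
    fix x
    have "((%z. exp (c * z) / c) has_field_derivative exp (c * of_real x)) (at (of_real x))"
      using c by (auto intro!: derivative_eq_intros)
    then show "((%th. exp (c * of_real th) / c) has_vector_derivative exp (c * of_real x)) (at x within {-L..L})"
      by (rule has_vector_derivative_real_field)
  qed (use assms in simp)
  moreover have "exp (c * of_real L) = exp (c * of_real (- L))"
  proof -
    obtain k :: int where k: "of_int e * L = of_int k * pi" using assms by blast
    have "c * of_real L = c * of_real (- L) + of_int (2 * (- k)) * of_real pi * \<i>"
    proof -
      have "complex_of_int e * of_real L = of_int k * of_real pi" using arg_cong[OF k, of complex_of_real] by simp
      then have "c * of_real L = - \<i> * (of_int k * of_real pi)" by (simp add: c_def mult.assoc)
      then show ?thesis by (simp add: algebra_simps)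
    qed
    then show ?thesis unfolding exp_eq by (intro exI[of _ "- k"]) simp
  qed
  ultimately have "integral {-L..L} (%th. exp (c * of_real th)) = 0" by (simp add: integral_unique)
  then show ?thesis by (simp add: c_def mult_ac)
qed

context drift_walk begin

definition U :: "nat => int => int => real" where "U n i e = (\<Sum>u\<le>n. T n i e u)"

lemma sum_T_Suc:
  "(\<Sum>u\<le>Suc n. T (Suc n) i e u * g u) =
     (\<Sum>k\<in>{-1..1}. p k 1 * (\<Sum>u\<le>n. T n (i - k) (e - 1) u * g (Suc u)) + p k 0 * (\<Sum>u\<le>n. T n (i - k) e u * g u)
        + p k (-1) * (\<Sum>u\<le>n. T n (i - k) (e + 1) u * g u))"
proof -
  have z: "T n x y (Suc n) = 0" for x y by (rule T_zero) simp
  have "(\<Sum>u\<le>Suc n. T (Suc n) i e u * g u) = (\<Sum>u\<le>Suc n. up_op (T n) i e u * g u) + (\<Sum>u\<le>Suc n. flat_op (T n) i e u * g u) + (\<Sum>u\<le>Suc n. down_op (T n) i e u * g u)"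
    by (simp only: T.simps distrib_right sum.distrib)
  also have "(\<Sum>u\<le>Suc n. up_op (T n) i e u * g u) = p (-1) 1 * (\<Sum>u\<le>n. T n (i + 1) (e - 1) u * g (Suc u)) + p 0 1 * (\<Sum>u\<le>n. T n i (e - 1) u * g (Suc u)) + p 1 1 * (\<Sum>u\<le>n. T n (i - 1) (e - 1) u * g (Suc u))"
    by (subst sum.atMost_Suc_shift) (simp add: up_op_def sum_distrib_left distrib_right sum.distrib mult.assoc)
  also have "(\<Sum>u\<le>Suc n. flat_op (T n) i e u * g u) = p (-1) 0 * (\<Sum>u\<le>n. T n (i + 1) e u * g u) + p 1 0 * (\<Sum>u\<le>n. T n (i - 1) e u * g u)"
    by (simp add: flat_op_def z sum_distrib_left distrib_right sum.distrib mult.assoc)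
  also have "(\<Sum>u\<le>Suc n. down_op (T n) i e u * g u) = p (-1) (-1) * (\<Sum>u\<le>n. T n (i + 1) (e + 1) u * g u) + p 0 (-1) * (\<Sum>u\<le>n. T n i (e + 1) u * g u) + p 1 (-1) * (\<Sum>u\<le>n. T n (i - 1) (e + 1) u * g u)"
    by (simp add: down_op_def z sum_distrib_left distrib_right sum.distrib mult.assoc)
  finally show ?thesis by (simp add: sum_unit_interval algebra_simps)
qed

text \<open>A Chernoff bound: tilting by xa and Y0 turns each step into the factor
  \<open>snorm xa 1 Y0\<close>, which is at most q0.\<close>

lemma U_bound: "U n i e <= q0 ^ n * (xa powi (- i) * Y0 powi (- e))"
proof (induction n arbitrary: i e)
  case 0
  show ?case using region(1) Y0_pos by (auto simp: U_def)
next
  case (Suc n)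
  have x: "xa > 0" "Y0 > 0" using region(1) Y0_pos by auto
  have q: "q0 >= 0" using order_trans[OF line_norm_nonneg[OF x(1)] snorm(1)[OF norm_1_le Y0_ann, unfolded snorm_def]] .
  define B where "B = q0 ^ n * (xa powi (- i) * Y0 powi (- e))"
  have B: "B >= 0" using x q by (simp add: B_def)
  have IH: "U n (i - k) (e - l) <= B * (xa powi k * Y0 powi l)" for k l
  proof -
    have "xa powi (- (i - k)) = xa powi (- i) * xa powi k" "Y0 powi (- (e - l)) = Y0 powi (- e) * Y0 powi l"
      using x by (simp_all add: power_int_add[symmetric])
    then show ?thesis using Suc[of "i - k" "e - l"] by (simp add: B_def mult_ac)
  qed
  have "U (Suc n) i e = (\<Sum>k\<in>{-1..1}. p k 1 * U n (i - k) (e - 1) + p k 0 * U n (i - k) e + p k (-1) * U n (i - k) (e + 1))"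
    using sum_T_Suc[of n i e "%_. 1"] by (simp add: U_def)
  also have "... <= (\<Sum>k\<in>{-1..1}. p k 1 * (B * (xa powi k * Y0 powi 1)) + p k 0 * (B * (xa powi k * Y0 powi 0)) + p k (-1) * (B * (xa powi k * Y0 powi (-1))))"
    using IH[of _ 1] IH[of _ 0] IH[of _ "-1"] by (intro sum_mono add_mono mult_left_mono) auto
  also have "... = B * (\<Sum>k\<in>{-1..1}. col k Y0 * xa powi k)"
    by (simp add: sum_distrib_left col_def algebra_simps power_int_minus divide_inverse)
  also have "(\<Sum>k\<in>{-1..1}. col k Y0 * xa powi k) = snorm xa 1 (of_real Y0)"
    unfolding snorm_def line_norm_def stp_real[OF Y0_pos Y0_ann] using x col_nonneg[OF Y0_pos]
    by (simp add: sum_unit_interval power_int_minus divide_inverse)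
  also have "B * ... <= B * q0" using B snorm(1)[OF norm_1_le Y0_ann] by (rule mult_left_mono[rotated])
  finally show ?case by (simp add: B_def mult_ac)
qed

lemma q0_nonneg: "q0 >= 0"
  using order_trans[OF line_norm_nonneg[OF region(1)] snorm(1)[OF norm_1_le Y0_ann, unfolded snorm_def]] .

text \<open>Fourier inversion in the second coordinate. In the diagonal case half a period suffices for
  the points of the right parity.\<close>

definition "bx = cbox (-Th, 0) (Th, 1 :: real)"

definition FI :: "(real \<times> real => complex) => complex" where
  "FI f = of_real (real kap / (2 * pi)) * integral bx f"

lemma FI_add:
  assumes "continuous_on bx f" "continuous_on bx g"
  shows "FI (%z. f z + g z) = FI f + FI g"
proof -
  have "f integrable_on bx" "g integrable_on bx" using assms unfolding bx_def by (auto intro: integrable_continuous)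
  then show ?thesis by (simp only: FI_def Henstock_Kurzweil_Integration.integral_add distrib_left)
qed

lemma FI_cmult: "FI (%z. w * f z) = w * FI f"
  by (simp add: FI_def)

lemma FI_uniform:
  assumes "uniform_limit bx f g sequentially" "\<And>n. continuous_on bx (f n)"
  shows "(%n. FI (f n)) \<longlonglongrightarrow> FI g"
proof -
  obtain I J where IJ: "\<And>n. (f n has_integral I n) bx" "(g has_integral J) bx" "I \<longlonglongrightarrow> J"
    using uniform_limit_integral_cbox[where a = "(-Th, 0)" and b = "(Th, 1)" and f = f and g = g and F = sequentially] assms unfolding bx_def
    by (metis trivial_limit_sequentially)
  have "I n = integral bx (f n)" for n using IJ(1)[of n] by (simp add: integral_unique)
  moreover have "J = integral bx g" using IJ(2) by (simp add: integral_unique)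
  ultimately have "(%n. integral bx (f n)) \<longlonglongrightarrow> integral bx g" using IJ(3) by presburger
  then show ?thesis unfolding FI_def by (intro tendsto_intros)
qed

lemma FI_iterated:
  assumes "continuous_on bx f"
  shows "FI f = of_real (real kap / (2 * pi)) * integral {-Th..Th} (%th. integral {0..1} (%s. f (th, s)))"
  unfolding FI_def bx_def using integral_prod_continuous[of "-Th" 0 Th 1 f] assms by (simp add: bx_def)

definition LW :: "nat => complex => complex => int => complex" where
  "LW n s y i = line_weight (stp (-1) s y) (stp 0 s y) (stp 1 s y) n i"

lemma continuous_line_weight:
  assumes "continuous_on A f" "continuous_on A g" "continuous_on A k"
  shows "continuous_on A (%z. line_weight (f z) (g z) (k z) n i)"
  by (induction n arbitrary: i) (auto intro!: continuous_intros assms)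

lemma yy_cont: "continuous_on A (%z. yy v (fst z))"
  unfolding yy_eq by (intro continuous_intros)

lemma yy_powi_cont: "continuous_on A (%z. yy v (fst z) powi k)"
  by (intro continuous_on_power_int yy_cont) auto

lemma LW_cont: "continuous_on A (%z. LW n (of_real (snd z)) (yy v (fst z)) i)"
  unfolding LW_def stp_def by (intro continuous_line_weight continuous_intros yy_cont) auto

lemma LW_Suc: "LW (Suc n) s y i = (\<Sum>k\<in>{-1..1}. stp k s y * LW n s y (i - k))"
  by (simp add: LW_def sum_unit_interval algebra_simps)

text \<open>In the diagonal case both components of a step are odd.\<close>

lemma p_parity: "p k e ~= 0 ==> int kap dvd k - e"
proof (cases "diagonal_mass p = 1")
  case True
  assume pk: "p k e ~= 0"
  have "\<bar>k\<bar> <= 1" "\<bar>e\<bar> <= 1" using pk p_far[of k e] by (meson not_le)+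
  then have "k = -1 | k = 0 | k = 1" "e = -1 | e = 0 | e = 1" by auto
  then show ?thesis using pk True diagonal_iff by (auto simp: kap_def)
qed (simp add: kap_def)

text \<open>The s-integral gives 1/(q + 1). In the angular one e Th is a multiple of pi, so the
  exponential takes equal values at both ends and only e = 0 survives.\<close>

lemma FI_base:
  assumes "int kap dvd e"
  shows "FI (%z. of_real (snd z) ^ q * yy v (fst z) powi (- e)) = of_real (if e = 0 then 1 / (real q + 1) else 0)"
proof -
  have in1: "integral {0..1} (%s. complex_of_real s ^ q) = of_real (1 / (real q + 1))"
  proof -
    have "((%s. complex_of_real s ^ q) has_integral (of_real 1 ^ Suc q / of_nat (Suc q) - of_real 0 ^ Suc q / of_nat (Suc q))) {0..1::real}"
    proof (rule fundamental_theorem_of_calculus)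
      fix x :: real
      have "((%z :: complex. z ^ Suc q / of_nat (Suc q)) has_field_derivative of_real x ^ q) (at (of_real x))"
        by (auto intro!: derivative_eq_intros simp del: of_nat_Suc power_Suc)
      then show "((%s. complex_of_real s ^ Suc q / of_nat (Suc q)) has_vector_derivative of_real x ^ q) (at x within {0..1})"
        by (rule has_vector_derivative_real_field)
    qed simp
    then show ?thesis by (simp add: integral_unique add.commute)
  qed
  have "FI (%z. of_real (snd z) ^ q * yy v (fst z) powi (- e))
     = of_real (real kap / (2 * pi)) * integral {-Th..Th} (%th. integral {0..1} (%s. of_real s ^ q * yy v th powi (- e)))"
    by (subst FI_iterated) (auto intro!: continuous_intros yy_powi_cont)
  also have "... = of_real (real kap / (2 * pi)) * (of_real (1 / (real q + 1)) * integral {-Th..Th} (%th. yy v th powi (- e)))"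
    by (simp add: in1 integral_mult_right integral_mult_left)
  also have "... = of_real (if e = 0 then 1 / (real q + 1) else 0)"
  proof (cases "e = 0")
    case True
    then show ?thesis using Th_pos kap_pos by (simp add: Th_def scaleR_conv_of_real)
  next
    case False
    obtain k where k: "e = int kap * k" using assms by auto
    have "of_int e * Th = of_int k * pi" using kap_pos unfolding k Th_def by simp
    then have "integral {-Th..Th} (%th. exp (- \<i> * of_real (of_int e * th))) = 0"
      using integral_exp_i[OF Th_pos False] by blast
    then show ?thesis using False by (simp add: yy_powi)
  qed
  finally show ?thesis .
qed

text \<open>The power q of s is kept general because an up step raises it by one. Predecessors
  inherit the parity condition through steps of nonzero weight; for the other steps the factor
  \<open>p k l\<close> vanishes.\<close>

theorem FI_LW:
  "int kap dvd i - e ==> FI (%z. of_real (snd z) ^ q * LW n (of_real (snd z)) (yy v (fst z)) i * yy v (fst z) powi (- e))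
     = of_real (\<Sum>u\<le>n. T n i e u * (1 / (real u + real q + 1)))"
proof (induction n arbitrary: i e q)
  case 0
  show ?case
  proof (cases "i = 0")
    case True
    then have "int kap dvd e" using 0 by simp
    from FI_base[OF this, of q v] show ?thesis using True by (simp add: LW_def)
  next
    case False
    then show ?thesis by (simp add: LW_def FI_def)
  qed
next
  case (Suc n)
  define f where "f q i e = (%z. of_real (snd z) ^ q * LW n (of_real (snd z)) (yy v (fst z)) i * yy v (fst z) powi (- e))" for q i e
  have fc: "continuous_on bx (f q i e)" for q i e
    unfolding f_def by (intro continuous_intros LW_cont yy_powi_cont)
  define G where "G k e q = (\<Sum>u\<le>n. T n (i - k) e u * (1 / (real u + real q + 1)))" for k e q
  have IH: "of_real (p k l) * FI (f q' (i - k) (e - l)) = of_real (p k l * G k (e - l) q')" for k l q'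
  proof (cases "p k l = 0")
    case False
    from dvd_diff[OF Suc.prems p_parity[OF this]] have "int kap dvd (i - k) - (e - l)" by (simp add: algebra_simps)
    from Suc.IH[OF this, of q'] show ?thesis by (simp add: f_def G_def)
  qed simp
  have pt: "of_real (snd z) ^ q * LW (Suc n) (of_real (snd z)) (yy v (fst z)) i * yy v (fst z) powi (- e)
     = (\<Sum>k\<in>{-1..1}. of_real (p k 1) * f (Suc q) (i - k) (e - 1) z + of_real (p k 0) * f q (i - k) e z + of_real (p k (-1)) * f q (i - k) (e + 1) z)" for z
  proof -
    define y where "y = yy v (fst z)"
    have y: "y ~= 0" by (simp add: y_def)
    have y1: "y powi (- (e - 1)) = y * y powi (- e)" "y powi (- (e + 1)) = y powi (- e) / y"
      using y by (simp_all add: power_int_add power_int_diff power_int_minus divide_inverse)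
    show ?thesis
      unfolding LW_Suc f_def y_def[symmetric] y1 sum_distrib_left sum_distrib_right
      by (rule sum.cong) (simp_all add: stp_def algebra_simps)
  qed
  have "FI (%z. of_real (snd z) ^ q * LW (Suc n) (of_real (snd z)) (yy v (fst z)) i * yy v (fst z) powi (- e))
     = (\<Sum>k\<in>{-1..1}. of_real (p k 1) * FI (f (Suc q) (i - k) (e - 1)) + of_real (p k 0) * FI (f q (i - k) e) + of_real (p k (-1)) * FI (f q (i - k) (e + 1)))"
    unfolding pt sum_unit_interval by (simp add: FI_add FI_cmult continuous_on_add continuous_on_mult continuous_on_const fc)
  also have "... = (\<Sum>k\<in>{-1..1}. of_real (p k 1 * G k (e - 1) (Suc q)) + of_real (p k 0 * G k e q) + of_real (p k (-1) * G k (e + 1) q))"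
  proof (rule sum.cong[OF refl])
    fix k
    show "of_real (p k 1) * FI (f (Suc q) (i - k) (e - 1)) + of_real (p k 0) * FI (f q (i - k) e) + of_real (p k (-1)) * FI (f q (i - k) (e + 1))
      = of_real (p k 1 * G k (e - 1) (Suc q)) + of_real (p k 0 * G k e q) + of_real (p k (-1) * G k (e + 1) q)"
      using IH[of k 1 "Suc q"] IH[of k 0 q, unfolded diff_0_right] IH[of k "-1" q, unfolded diff_minus_eq_add] by (simp only:)
  qed
  also have "... = of_real (\<Sum>u\<le>Suc n. T (Suc n) i e u * (1 / (real u + real q + 1)))"
    unfolding sum_T_Suc by (simp add: G_def add_ac)
  finally show ?case .
qed

lemma bx_iff: "z \<in> bx \<longleftrightarrow> \<bar>fst z\<bar> <= Th & 0 <= snd z & snd z <= 1"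
  by (cases z) (auto simp: bx_def cbox_Pair_eq abs_le_iff)

lemma bx_region:
  assumes "\<bar>v - v0\<bar> <= dl0" "z \<in> bx"
  shows "norm (complex_of_real (snd z)) <= 1 + dl0" "yy v (fst z) \<in> ann"
proof -
  have "0 <= snd z" "snd z <= 1" using assms(2) by (simp_all add: bx_iff)
  then show "norm (complex_of_real (snd z)) <= 1 + dl0" using region(4) by simp
qed (rule yy_ann[OF assms(1)])

lemma VV_bx_cont: "\<bar>v - v0\<bar> <= dl0 ==> continuous_on bx (%z. VV i (of_real (snd z)) (yy v (fst z)))"
  by (rule VV_cont'[OF continuous_on_of_real[OF continuous_on_snd[OF continuous_on_id]] yy_cont]) (blast intro: bx_region)

definition VI :: "nat => real => int => int => complex" where
  "VI q v i e = FI (%z. of_real (snd z) ^ q * VV i (of_real (snd z)) (yy v (fst z)) * yy v (fst z) powi (- e))"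

text \<open>Uniform convergence of the line Green function on the compact box allows summation under
  the integral. The left side does not involve v, so the circle can later be moved to the
  saddle.\<close>

theorem VI_sums:
  assumes v: "\<bar>v - v0\<bar> <= dl0" and par: "int kap dvd i - e"
  shows "(%n. complex_of_real (\<Sum>u\<le>n. T n i e u * (1 / (real u + real q + 1)))) sums VI q v i e"
proof -
  define h where "h z = of_real (snd z) ^ q * yy v (fst z) powi (- e)" for z :: "real \<times> real"
  define f where "f n z = LW n (of_real (snd z)) (yy v (fst z)) i" for n and z :: "real \<times> real"
  have hc: "continuous_on bx h" unfolding h_def by (intro continuous_intros yy_powi_cont)
  have fc: "continuous_on bx (f n)" for n unfolding f_def by (rule LW_cont)
  have "uniform_limit bx (%n z. \<Sum>k<n. f k z) (%z. VV i (of_real (snd z)) (yy v (fst z))) sequentially"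
    unfolding f_def LW_def VV_def
  proof (rule line_green_continuous(2)[where x = xa and q = q0])
    have sc: "continuous_on bx (%z. stp k (of_real (snd z)) (yy v (fst z)))" for k
      unfolding stp_def by (intro continuous_intros yy_cont) auto
    show "continuous_on bx (%z. stp (-1) (of_real (snd z)) (yy v (fst z)))" by (rule sc)
    show "continuous_on bx (%z. stp 0 (of_real (snd z)) (yy v (fst z)))" by (rule sc)
    show "continuous_on bx (%z. stp 1 (of_real (snd z)) (yy v (fst z)))" by (rule sc)
    show "0 < xa" "q0 < 1" by (rule region)+
    fix z assume "z \<in> bx"
    from snorm(1)[OF bx_region[OF v this]] show "line_norm xa (stp (-1) (of_real (snd z)) (yy v (fst z))) (stp 0 (of_real (snd z)) (yy v (fst z))) (stp 1 (of_real (snd z)) (yy v (fst z))) <= q0"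
      by (simp add: snorm_def)
  qed
  then have "uniform_limit bx (%n z. h z * (\<Sum>k<n. f k z)) (%z. h z * VV i (of_real (snd z)) (yy v (fst z))) sequentially"
  proof (rule uniform_lim_mult[OF uniform_limit_const])
    have cb: "compact bx" unfolding bx_def by (rule compact_cbox)
    show "bounded (h ` bx)" by (intro compact_imp_bounded compact_continuous_image hc cb)
    show "bounded ((%z. VV i (of_real (snd z)) (yy v (fst z))) ` bx)"
      by (intro compact_imp_bounded compact_continuous_image VV_bx_cont v cb)
  qed
  then have lim: "(%n. FI (%z. h z * (\<Sum>k<n. f k z))) \<longlonglongrightarrow> FI (%z. h z * VV i (of_real (snd z)) (yy v (fst z)))"
    by (rule FI_uniform) (intro continuous_intros hc fc)
  have "FI (%z. h z * (\<Sum>k<n. f k z)) = (\<Sum>k<n. FI (%z. h z * f k z))" for n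
  proof (induction n)
    case 0 then show ?case by (simp add: FI_def)
  next
    case (Suc n)
    have "FI (%z. h z * (\<Sum>k<n. f k z) + h z * f n z) = FI (%z. h z * (\<Sum>k<n. f k z)) + FI (%z. h z * f n z)"
      by (rule FI_add) (intro continuous_intros hc fc)+
    then show ?case using Suc by (simp add: distrib_left)
  qed
  moreover have "FI (%z. h z * f n z) = of_real (\<Sum>u\<le>n. T n i e u * (1 / (real u + real q + 1)))" for n
    using FI_LW[OF par, of q n v] by (simp add: h_def f_def mult_ac)
  moreover have "FI (%z. h z * VV i (of_real (snd z)) (yy v (fst z))) = VI q v i e"
    by (simp add: VI_def h_def mult_ac)
  ultimately show ?thesis using lim by (simp add: sums_def)
qed

lemma T1_sums:
  assumes "\<bar>v - v0\<bar> <= dl0" "int kap dvd i - e"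
  shows "(%n. complex_of_real (T1 n i e)) sums VI 0 v i e"
  using VI_sums[OF assms, of 0] by (simp add: T1_def)

lemma T2_sums:
  assumes "\<bar>v - v0\<bar> <= dl0" "int kap dvd i - e"
  shows "(%n. complex_of_real (T2 n i e)) sums (VI 0 v i e - VI 1 v i e)"
proof -
  have "t / ((real u + 1) * (real u + 2)) = t * (1 / (real u + real 0 + 1)) - t * (1 / (real u + real 1 + 1))" for t u
    by (simp add: field_simps)
  then have "T2 n i e = (\<Sum>u\<le>n. T n i e u * (1 / (real u + real 0 + 1))) - (\<Sum>u\<le>n. T n i e u * (1 / (real u + real 1 + 1)))" for n
    by (simp only: T2_def sum_subtractf)
  then show ?thesis using sums_diff[OF VI_sums[OF assms, of 0] VI_sums[OF assms, of 1]] by simp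
qed

lemma T2_integral:
  assumes v: "\<bar>v - v0\<bar> <= dl0"
  shows "VI 0 v i e - VI 1 v i e = FI (%z. (1 - of_real (snd z)) * VV i (of_real (snd z)) (yy v (fst z)) * yy v (fst z) powi (- e))"
proof -
  define f where "f q z = of_real (snd z) ^ q * VV i (of_real (snd z)) (yy v (fst z)) * yy v (fst z) powi (- e)" for q and z :: "real \<times> real"
  have fc: "continuous_on bx (f q)" for q
    unfolding f_def by (intro continuous_intros yy_powi_cont VV_bx_cont v)
  have "FI (%z. f 0 z + (-1) * f 1 z) = FI (f 0) + FI (%z. (-1) * f 1 z)"
    by (rule FI_add[OF fc]) (intro continuous_on_mult continuous_on_const fc)
  also have "FI (%z. (-1) * f 1 z) = (-1) * FI (f 1)" by (rule FI_cmult)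
  finally have "FI (f 0) - FI (f 1) = FI (%z. f 0 z + (-1) * f 1 z)" by simp
  moreover have "f 0 z + (-1) * f 1 z = (1 - of_real (snd z)) * VV i (of_real (snd z)) (yy v (fst z)) * yy v (fst z) powi (- e)" for z
    by (simp add: f_def algebra_simps)
  moreover have "VI q v i e = FI (f q)" for q unfolding VI_def f_def[abs_def] ..
  ultimately show ?thesis by simp
qed

end

section \<open>The Green function\<close>

lemma sums_approx:
  fixes f g e :: "nat => real"
  assumes "f sums A" "g sums B" "e sums C" "\<And>n. \<bar>f n - k * g n\<bar> <= w * e n"
  shows "\<bar>A - k * B\<bar> <= w * C"
proof -
  have 1: "(%n. f n - k * g n) sums (A - k * B)" by (intro sums_diff sums_mult assms)
  have 2: "(%n. w * e n) sums (w * C)" by (intro sums_mult assms)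
  have s: "summable (%n. \<bar>f n - k * g n\<bar>)"
    by (rule summable_comparison_test'[OF sums_summable[OF 2], of 0]) (use assms(4) in auto)
  have "\<bar>A - k * B\<bar> = \<bar>\<Sum>n. f n - k * g n\<bar>" using 1 by (simp add: sums_iff)
  also have "... <= (\<Sum>n. \<bar>f n - k * g n\<bar>)" by (rule summable_rabs[OF s])
  also have "... <= (\<Sum>n. w * e n)" by (rule suminf_le[OF assms(4) s sums_summable[OF 2]])
  finally show ?thesis using 2 by (simp add: sums_iff)
qed

lemma summable_square_geometric:
  fixes r :: real
  assumes "0 <= r" "r < 1"
  shows "summable (%l. (real l)\<^sup>2 * r ^ l)"
proof -
  have g: "summable (%n. x ^ n)" if "norm x < 1" for x :: real using that by (rule summable_geometric)
  have 1: "summable (%n. diffs (%_. 1) n * x ^ n)" if "norm x < 1" for x :: real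
    by (rule termdiff_converges[OF that]) (use g in simp)
  have 2: "summable (%n. diffs (diffs (%_. 1)) n * r ^ n)"
    by (rule termdiff_converges[of r 1]) (use assms 1 in auto)
  show ?thesis
  proof (rule summable_comparison_test'[OF 2, of 0])
    fix n :: nat
    have "real n * real n <= (1 + real n) * (2 + real n)" by (intro mult_mono) auto
    then have "(real n)\<^sup>2 * r ^ n <= ((1 + real n) * (2 + real n)) * r ^ n"
      using assms by (intro mult_right_mono) (auto simp: power2_eq_square)
    then show "norm ((real n)\<^sup>2 * r ^ n) <= diffs (diffs (%_. 1)) n * r ^ n"
      using assms by (simp add: diffs_def norm_mult algebra_simps)
  qed
qed

context drift_walk begin

text \<open>The factor 1 - s vanishes where F^i is largest, so the s-integral is of order 1/i^2
  instead of 1/i; the Gaussian in th contributes 1/sqrt i.\<close>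

lemma T2_bound:
  "\<exists>C\<ge>0. \<forall>v i e. \<bar>v - v0\<bar> <= rd --> i >= 1 --> norm (VI 0 v (int i) e - VI 1 v (int i) e)
     <= C * (fr (exp v) ^ i * exp (- of_int e * v) / ((real i)\<^sup>2 * sqrt (real i)))"
proof -
  define C where "C = real kap / (2 * pi) * (1 / (1 - q0) * (4 / cd\<^sup>2) * sqrt (pi / cd))"
  have q: "1 / (1 - q0) >= 0" using region(6) by simp
  have C: "C >= 0" using q rd(1) by (simp add: C_def)
  have "norm (VI 0 v (int i) e - VI 1 v (int i) e) <= C * (fr (exp v) ^ i * exp (- of_int e * v) / ((real i)\<^sup>2 * sqrt (real i)))"
    if v: "\<bar>v - v0\<bar> <= rd" and i: "i >= 1" for v i e
  proof -
    define k where "k = fr (exp v)"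
    have vd: "\<bar>v - v0\<bar> <= dl0" using v rd(3) r3(1,4) by linarith
    have k: "k > 0" using fr_exp[OF vd] by (simp add: k_def)
    define x where "x = cd * real i"
    have x: "x > 0" using rd(1) i by (simp add: x_def)
    define f where "f z = (1 - of_real (snd z)) * VV (int i) (of_real (snd z)) (yy v (fst z)) * yy v (fst z) powi (- e)" for z :: "real \<times> real"
    have fc: "continuous_on bx f"
      unfolding f_def by (intro continuous_intros yy_powi_cont VV_bx_cont vd)
    define D where "D = 1 / (1 - q0) * k ^ i * exp (- of_int e * v)"
    have D: "D >= 0" unfolding D_def using q k by (intro mult_nonneg_nonneg) auto
    have pt: "norm (f (th, s)) <= (D * exp (- x * th\<^sup>2) * (2 / x)) * exp (- (x / 2) * (1 - s))" if th: "\<bar>th\<bar> <= Th" and s: "0 <= s" "s <= 1" for th s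
    proof -
      have z: "(th, s) \<in> bx" using th s by (simp add: bx_iff)
      note rg = bx_region[OF vd z, simplified]
      have "norm (F (of_real s) (yy v th)) ^ i <= (k * exp (- cd * ((1 - s) + th\<^sup>2))) ^ i"
        unfolding k_def using decay_bound[OF v s th] by (intro power_mono) auto
      also have "... = k ^ i * (exp (- x * (1 - s)) * exp (- x * th\<^sup>2))"
        by (simp add: power_mult_distrib exp_of_nat_mult[symmetric] exp_add[symmetric] x_def algebra_simps)
      finally have p: "norm (F (of_real s) (yy v th)) ^ i <= k ^ i * (exp (- x * (1 - s)) * exp (- x * th\<^sup>2))" .
      have V: "norm (VV (int i) (of_real s) (yy v th)) <= 1 / (1 - q0) * (k ^ i * (exp (- x * (1 - s)) * exp (- x * th\<^sup>2)))"
        using bx_region[OF vd z] p q unfolding VV_eq[OF bx_region[OF vd z], simplified] norm_mult norm_power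
        by (intro mult_mono VV_bound) auto
      \<comment> \<open>Half of the exponential in 1 - s pays for the linear factor, by exp z >=
        z.\<close>
      have e1: "(1 - s) * exp (- x * (1 - s)) <= (2 / x) * exp (- (x / 2) * (1 - s))"
      proof -
        have "x / 2 * (1 - s) * exp (- (x / 2) * (1 - s)) <= exp (x / 2 * (1 - s)) * exp (- (x / 2) * (1 - s))"
          by (intro mult_right_mono exp_ge_self) auto
        also have "... = 1" by (simp add: exp_add[symmetric] algebra_simps)
        finally have "(1 - s) * exp (- (x / 2) * (1 - s)) <= 2 / x" using x by (simp add: field_simps)
        then have "(1 - s) * exp (- (x / 2) * (1 - s)) * exp (- (x / 2) * (1 - s)) <= 2 / x * exp (- (x / 2) * (1 - s))"
          by (rule mult_right_mono) simp
        moreover have "exp (- (x / 2) * (1 - s)) * exp (- (x / 2) * (1 - s)) = exp (- x * (1 - s))"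
          by (simp add: exp_add[symmetric] algebra_simps)
        ultimately show ?thesis by (simp add: mult.assoc)
      qed
      have s1: "norm (1 - complex_of_real s) = 1 - s" using s by (metis abs_of_nonneg diff_ge_0_iff_ge norm_of_real of_real_1 of_real_diff)
      have yn: "norm (yy v th powi (- e)) = exp (- of_int e * v)" by (rule norm_yy_powi)
      have "norm (f (th, s)) = (1 - s) * norm (VV (int i) (of_real s) (yy v th)) * exp (- of_int e * v)"
        unfolding f_def by (simp only: norm_mult fst_conv snd_conv s1 yn)
      also have "... <= (1 - s) * (1 / (1 - q0) * (k ^ i * (exp (- x * (1 - s)) * exp (- x * th\<^sup>2)))) * exp (- of_int e * v)"
        using s by (intro mult_right_mono mult_left_mono V) auto
      also have "... = D * exp (- x * th\<^sup>2) * ((1 - s) * exp (- x * (1 - s)))" by (simp add: D_def)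
      also have "... <= D * exp (- x * th\<^sup>2) * ((2 / x) * exp (- (x / 2) * (1 - s)))"
        using D by (intro mult_left_mono e1) auto
      finally show ?thesis by (simp add: mult.assoc)
    qed
    have fs: "continuous_on {0..1} (%s. f (th, s))" if "\<bar>th\<bar> <= Th" for th
      by (rule continuous_on_compose2[OF fc]) (use that in \<open>auto intro!: continuous_intros simp: bx_iff\<close>)
    have in1: "norm (integral {0..1} (%s. f (th, s))) <= (D * (4 / x\<^sup>2)) * exp (- x * th\<^sup>2)" if th: "\<bar>th\<bar> <= Th" for th
    proof -
      have "norm (integral {0..1} (%s. f (th, s))) <= integral {0..1} (%s. (D * exp (- x * th\<^sup>2) * (2 / x)) * exp (- (x / 2) * (1 - s)))"
      proof (rule integral_norm_bound_integral)
        show "(%s. f (th, s)) integrable_on {0..1}" by (rule integrable_continuous_real[OF fs[OF th]])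
        show "(%s. (D * exp (- x * th\<^sup>2) * (2 / x)) * exp (- (x / 2) * (1 - s))) integrable_on {0..1}"
          by (intro integrable_continuous_real continuous_on_mult continuous_on_const continuous_on_exp continuous_on_diff continuous_on_id)
        show "norm (f (th, s)) <= (D * exp (- x * th\<^sup>2) * (2 / x)) * exp (- (x / 2) * (1 - s))" if "s \<in> {0..1}" for s
          using pt[OF th, of s] that by simp
      qed
      also have "... <= (D * exp (- x * th\<^sup>2) * (2 / x)) * (1 / (x / 2))"
        unfolding integral_mult_right using D x by (intro mult_left_mono integral_exp_linear) auto
      finally show ?thesis by (simp add: power2_eq_square mult_ac)
    qed
    have "norm (integral {-Th..Th} (%th. integral {0..1} (%s. f (th, s)))) <= integral {-Th..Th} (%th. (D * (4 / x\<^sup>2)) * exp (- x * th\<^sup>2))"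
    proof (rule integral_norm_bound_integral)
      show "(%th. integral {0..1} (%s. f (th, s))) integrable_on {-Th..Th}"
        using integral_integrable_2dim[where a = "-Th" and b = Th and c = 0 and d = 1 and f = f] fc by (simp add: bx_def)
      show "(%th. (D * (4 / x\<^sup>2)) * exp (- x * th\<^sup>2)) integrable_on {-Th..Th}"
        by (intro integrable_continuous_real continuous_intros)
    qed (use in1 in auto)
    also have "... <= (D * (4 / x\<^sup>2)) * sqrt (pi / x)"
      unfolding integral_mult_right using D x Th_pos by (intro mult_left_mono gauss_interval(1)) auto
    finally have in2: "norm (integral {-Th..Th} (%th. integral {0..1} (%s. f (th, s)))) <= (D * (4 / x\<^sup>2)) * sqrt (pi / x)" .
    have "norm (FI f) = real kap / (2 * pi) * norm (integral {-Th..Th} (%th. integral {0..1} (%s. f (th, s))))"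
      unfolding FI_iterated[OF fc] norm_mult norm_of_real by simp
    also have "... <= real kap / (2 * pi) * ((D * (4 / x\<^sup>2)) * sqrt (pi / x))" by (rule mult_left_mono[OF in2]) simp
    also have "... = C * (fr (exp v) ^ i * exp (- of_int e * v) / ((real i)\<^sup>2 * sqrt (real i)))"
      by (simp add: C_def D_def x_def k_def power_mult_distrib real_sqrt_divide real_sqrt_mult mult_ac)
    finally show ?thesis unfolding T2_integral[OF vd] f_def .
  qed
  then show ?thesis using C by blast
qed

lemma Q_parity: "Q n x y i j ~= 0 ==> int kap dvd (i - x) - (j - y)"
proof (induction n arbitrary: x y)
  case 0
  then show ?case by (auto split: if_splits)
next
  case (Suc n)
  then have "(\<Sum>k\<in>{-1..1}. \<Sum>e\<in>{-1..1}. p k e * Q n (x + k) (y + e) i j) ~= 0" by (auto split: if_splits)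
  then obtain k e where "p k e * Q n (x + k) (y + e) i j ~= 0" by (meson sum.neutral)
  then have "int kap dvd (i - (x + k)) - (j - (y + e))" "int kap dvd k - e" using Suc.IH p_parity by auto
  from dvd_add[OF this] show ?case by (simp add: algebra_simps)
qed

lemma hit_parity: "hit n x y l ~= 0 ==> int kap dvd x + l - y"
proof -
  assume "hit n x y l ~= 0"
  then obtain m where "(\<Sum>e\<in>{-1..1}. p (-1) e * Q m x y 1 (l - e)) ~= 0" by (auto simp: hit_def split: nat.splits)
  then obtain e where "p (-1) e * Q m x y 1 (l - e) ~= 0" by (meson sum.neutral)
  then have "int kap dvd (1 - x) - (l - e - y)" "int kap dvd - 1 - e" using Q_parity p_parity by auto
  from dvd_add[OF this] have "int kap dvd - (x + l - y)" by (simp add: algebra_simps)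
  then show ?thesis by (simp only: dvd_minus_iff)
qed

lemma K_sums:
  assumes j: "j >= 1"
  shows "summable (%n. K n l i j)" "(\<Sum>n. K n l i j) <= xa powi (- i) * Y0 powi (- (j - int l)) / (1 - q0)"
proof -
  define B where "B = xa powi (- i) * Y0 powi (- (j - int l))"
  have le: "K n l i j <= q0 ^ n * B" for n
    using order_trans[OF K_le[OF j, of n l i] U_bound[of n i "j - int l", unfolded U_def]] by (simp add: B_def)
  have gs: "(%n. q0 ^ n * B) sums (1 / (1 - q0) * B)"
    using q0_nonneg region(6) by (intro sums_mult2 geometric_sums) auto
  show 1: "summable (%n. K n l i j)"
    by (rule summable_comparison_test'[OF sums_summable[OF gs], of 0]) (use le K_nonneg[OF j] in auto)
  have "(\<Sum>n. K n l i j) <= (\<Sum>n. q0 ^ n * B)" by (rule suminf_le[OF le 1 sums_summable[OF gs]])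
  then show "(\<Sum>n. K n l i j) <= xa powi (- i) * Y0 powi (- (j - int l)) / (1 - q0)"
    using gs by (simp add: sums_iff B_def mult.commute)
qed

lemma K_zero [simp]: "K n 0 i j = 0"
  by (simp add: K_def)

lemma K_sum_approx:
  assumes "\<bar>v - v0\<bar> <= dl0" "int kap dvd i - (j - int l)" "j >= 1"
  shows "\<bar>(\<Sum>n. K n l i j) - of_int j * (real l * Re (VI 0 v i (j - int l)))\<bar>
    <= 4 * (of_int j)\<^sup>2 * (real l)\<^sup>2 * norm (VI 0 v i (j - int l) - VI 1 v i (j - int l))"
proof -
  have 1: "(%n. T1 n i (j - int l)) sums Re (VI 0 v i (j - int l))" using sums_Re[OF T1_sums[OF assms(1,2)]] by simp
  have 2: "(%n. T2 n i (j - int l)) sums Re (VI 0 v i (j - int l) - VI 1 v i (j - int l))" using sums_Re[OF T2_sums[OF assms(1,2)]] by simp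
  have "\<bar>(\<Sum>n. K n l i j) - (of_int j * real l) * Re (VI 0 v i (j - int l))\<bar> <= (4 * (of_int j)\<^sup>2 * (real l)\<^sup>2) * Re (VI 0 v i (j - int l) - VI 1 v i (j - int l))"
    by (rule sums_approx[OF summable_sums[OF K_sums(1)[OF assms(3)]] 1 2]) (use K_approx[OF assms(3)] in \<open>simp add: mult_ac\<close>)
  also have "... <= (4 * (of_int j)\<^sup>2 * (real l)\<^sup>2) * norm (VI 0 v i (j - int l) - VI 1 v i (j - int l))"
    by (intro mult_left_mono complex_Re_le_cmod) auto
  finally show ?thesis by (simp add: mult.assoc)
qed

end

context absorbed_chain begin

lemma H_far: "l > m0 + r ==> H r l = 0"
  by (simp add: H_def hit_far)

lemma ht_parity: "ht l ~= 0 ==> l >= 1 ==> int kap dvd int n0 + int l - int m0"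
proof (rule ccontr)
  assume "ht l ~= 0" "l >= 1" "\<not> int kap dvd int n0 + int l - int m0"
  then have "H r l = 0" for r using hit_parity[of r "int n0" "int m0" "int l"] unfolding H_def by blast
  then have "ht l = (\<Sum>r. 0)" using sums_unique[OF ht_sums[OF \<open>l >= 1\<close>]] by simp
  then show False using \<open>ht l ~= 0\<close> by simp
qed

text \<open>Summed over time, the convolution in \<open>half_plane_decomposition\<close> is a Cauchy
  product. The sum over absorption heights and the limit in time are exchanged by Tannery's theorem:
  \<open>ht l\<close> is at most 1, and the half-plane sums from (0, l) decay like Y0^l, which is
  where Y0 < 1 enters.\<close>

theorem Q_sums:
  assumes i: "i >= 1" and j: "j >= 1"
  shows "(%n. QQ n i j) sums ((\<Sum>n. K n m0 (i - int n0) j) - (\<Sum>l. ht l * (\<Sum>n. K n l i j)))"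
    "summable (%l. ht l * (\<Sum>n. K n l i j))"
proof -
  define e where "e n l = (\<Sum>r\<le>n. H r l * K (n - r) l i j)" for n l
  have e0: "e n l >= 0" for n l unfolding e_def H_def by (intro sum_nonneg mult_nonneg_nonneg hit_nonneg K_nonneg j)
  have efar: "e n l = 0" if "l > m0 + n" for n l
    unfolding e_def using that by (intro sum.neutral) (auto intro!: H_far)
  \<comment> \<open>Heights beyond m0 + n contribute nothing, so the common range up to m0 + N
    serves all n <= N.\<close>
  have dec: "QQ n i j = K n m0 (i - int n0) j - (\<Sum>l\<le>m0 + N. e n l)" if "n <= N" for n N
  proof -
    have "K n m0 (i - int n0) j = QQ n i j + (\<Sum>r\<le>n. \<Sum>l=1..m0 + N. H r l * K (n - r) l i j)"
      using half_plane_decomposition[OF n0 m0, of j n "m0 + N" i] i j that by (simp add: QQ_def H_def)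
    also have "(\<Sum>r\<le>n. \<Sum>l=1..m0 + N. H r l * K (n - r) l i j) = (\<Sum>l=1..m0 + N. e n l)"
      unfolding e_def by (rule sum.swap)
    also have "... = (\<Sum>l\<le>m0 + N. e n l)"
      by (rule sum.mono_neutral_left) (auto simp: e_def not_le)
    finally show ?thesis by simp
  qed
  define kk where "kk l = (\<Sum>n. K n l i j)" for l
  have es: "(%n. e n l) sums (ht l * kk l)" for l
  proof (cases "l >= 1")
    case True
    have "summable (%r. norm (H r l))" using ht_sums[OF True] by (simp add: sums_iff H_def hit_nonneg)
    moreover have "summable (%n. norm (K n l i j))" using K_sums(1)[OF j] K_nonneg[OF j] by simp
    ultimately have "(%n. \<Sum>r\<le>n. H r l * K (n - r) l i j) sums ((\<Sum>r. H r l) * (\<Sum>n. K n l i j))"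
      by (rule Cauchy_product_sums)
    then show ?thesis unfolding e_def kk_def sums_unique[OF ht_sums[OF True]] .
  qed (simp add: e_def kk_def not_le)
  define R where "R = xa powi (- i) * Y0 powi (- j) / (1 - q0)"
  have b0: "0 <= ht l * kk l" for l unfolding kk_def by (intro mult_nonneg_nonneg ht_nonneg suminf_nonneg K_sums(1) K_nonneg j)
  have bl: "ht l * kk l <= R * Y0 ^ l" for l
  proof -
    have "kk l <= xa powi (- i) * Y0 powi (- (j - int l)) / (1 - q0)" unfolding kk_def by (rule K_sums(2)[OF j])
    also have "Y0 powi (- (j - int l)) = Y0 powi (- j) * Y0 ^ l"
      using Y0_pos by (simp add: power_int_add[symmetric] flip: power_int_of_nat)
    finally have "kk l <= R * Y0 ^ l" by (simp add: R_def mult_ac)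
    moreover have "0 <= kk l" unfolding kk_def by (intro suminf_nonneg K_sums(1) K_nonneg j)
    ultimately have "ht l * kk l <= 1 * (R * Y0 ^ l)" using ht_le_1 ht_nonneg by (intro mult_mono) auto
    then show ?thesis by simp
  qed
  have sR: "summable (%l. R * Y0 ^ l)" using Y0_pos Y0_less_1 by (intro summable_mult summable_geometric) auto
  have s2: "summable (%l. ht l * kk l)"
    by (rule summable_comparison_test'[OF sR, of 0]) (use b0 bl in auto)
  then show "summable (%l. ht l * (\<Sum>n. K n l i j))" by (simp add: kk_def)
  have part: "(\<Sum>n<N. \<Sum>l\<le>m0 + N. e n l) = (\<Sum>l. \<Sum>n<N. e n l)" for N
  proof -
    have "(\<Sum>l. \<Sum>n<N. e n l) = (\<Sum>l\<le>m0 + N. \<Sum>n<N. e n l)"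
      by (rule suminf_finite) (auto intro!: sum.neutral efar)
    also have "... = (\<Sum>n<N. \<Sum>l\<le>m0 + N. e n l)" by (rule sum.swap)
    finally show ?thesis ..
  qed
  have le: "(\<Sum>n<N. e n l) <= ht l * kk l" for N l
    using sum_le_suminf[OF sums_summable[OF es[of l]], of "{..<N}"] e0 sums_unique[OF es[of l]] by simp
  have lim: "(%N. \<Sum>l. \<Sum>n<N. e n l) \<longlonglongrightarrow> (\<Sum>l. ht l * kk l)"
  proof -
    have "((%N. suminf (%l. (%l N. \<Sum>n<N. e n l) l N)) \<longlonglongrightarrow> (\<Sum>l. ht l * kk l))"
    proof (rule conjunct2[OF conjunct2[OF tannerys_theorem[where M = "%l. R * Y0 ^ l"]]])
      show "(%N. \<Sum>n<N. e n l) \<longlonglongrightarrow> ht l * kk l" for l using es[of l] by (simp add: sums_def)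
      show "\<forall>\<^sub>F (l, N) in sequentially \<times>\<^sub>F sequentially. norm (\<Sum>n<N. e n l) <= R * Y0 ^ l"
        using order_trans[OF le bl] e0 by (intro always_eventually) (simp add: sum_nonneg)
    qed (rule sR, simp)
    then show ?thesis .
  qed
  have "(%N. (\<Sum>n<N. K n m0 (i - int n0) j) - (\<Sum>l. \<Sum>n<N. e n l)) \<longlonglongrightarrow> (\<Sum>n. K n m0 (i - int n0) j) - (\<Sum>l. ht l * kk l)"
    by (intro tendsto_diff lim summable_LIMSEQ K_sums(1) j)
  moreover have "(\<Sum>n<N. QQ n i j) = (\<Sum>n<N. K n m0 (i - int n0) j) - (\<Sum>l. \<Sum>n<N. e n l)" for N
    unfolding part[symmetric] sum_subtractf[symmetric] by (rule sum.cong) (auto intro!: dec)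
  ultimately show "(%n. QQ n i j) sums ((\<Sum>n. K n m0 (i - int n0) j) - (\<Sum>l. ht l * (\<Sum>n. K n l i j)))"
    by (simp add: sums_def kk_def)
qed

text \<open>y times the derivative of the generating function of \<open>ht\<close>; the factor l is
  that of the ballot factor for a restart at height l.\<close>

definition al :: "complex => complex" where "al y = (\<Sum>l. of_real (real l * ht l) * y ^ l)"

lemma al_norm: "norm (of_real (real l * ht l) * (y :: complex) ^ l) = real l * ht l * norm y ^ l"
  unfolding norm_mult norm_power norm_of_real using ht_nonneg by (simp add: abs_mult)

lemma al_summable:
  fixes y :: complex
  assumes y: "norm y < 1"
  shows "summable (%l. norm (of_real (real l * ht l) * y ^ l))"
  unfolding al_norm
proof (rule summable_comparison_test'[OF summable_square_geometric[of "norm y"], of 0])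
  fix l :: nat
  have "real l * ht l <= (real l)\<^sup>2 * 1"
  proof (cases l)
    case (Suc k)
    then have "real l * ht l <= real l * real l" using ht_le_1[of l] by (intro mult_left_mono) auto
    then show ?thesis by (simp add: power2_eq_square)
  qed simp
  then have "real l * ht l * norm y ^ l <= (real l)\<^sup>2 * norm y ^ l" by (intro mult_right_mono) auto
  moreover have "0 <= real l * ht l * norm y ^ l" by (intro mult_nonneg_nonneg ht_nonneg) auto
  ultimately show "norm (real l * ht l * norm y ^ l) <= (real l)\<^sup>2 * norm y ^ l" by simp
qed (use y in auto)

lemma al_sums: "norm y < 1 ==> (%l. of_real (real l * ht l) * y ^ l) sums al y"
  unfolding al_def by (rule summable_sums[OF summable_norm_cancel[OF al_summable]])

lemma al_holomorphic: "al holomorphic_on ball 0 1"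
proof (rule power_series_holomorphic[where a = "%l. of_real (real l * ht l)"])
  fix w :: complex assume "w \<in> ball 0 1"
  then have "norm w < 1" by simp
  from al_sums[OF this] show "(%n. of_real (real n * ht n) * (w - 0) ^ n) sums al w" by (simp only: diff_zero)
qed

sublocale B: boundary_term p al m0 n0
  by unfold_locales (rule al_holomorphic)

lemma norm_yy_less: "\<bar>v - v0\<bar> <= dl0 ==> exp v <= Y0 * exp dl0"
  unfolding Y0_def exp_add[symmetric] exp_le_cancel_iff by linarith

lemma absorbed_sum:
  assumes v: "\<bar>v - v0\<bar> <= dl0"
  shows "(%l. of_real (real l * ht l) * VI 0 v i (j - int l)) sums
     FI (%z. al (yy v (fst z)) * VV i (of_real (snd z)) (yy v (fst z)) * yy v (fst z) powi (- j))"
proof -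
  define h where "h z = VV i (of_real (snd z)) (yy v (fst z)) * yy v (fst z) powi (- j)" for z :: "real \<times> real"
  have hc: "continuous_on bx h" unfolding h_def by (intro continuous_intros yy_powi_cont VV_bx_cont v)
  have cb: "compact bx" unfolding bx_def by (rule compact_cbox)
  define r where "r = exp v"
  have r: "0 <= r" "r < 1" unfolding r_def by (rule exp_ge_zero) (rule le_less_trans[OF norm_yy_less[OF v] region(7)])
  define t where "t l z = of_real (real l * ht l) * yy v (fst z) ^ l" for l and z :: "real \<times> real"
  have tc: "continuous_on bx (t l)" for l unfolding t_def by (intro continuous_intros yy_cont)
  have yn: "norm (yy v (fst z)) < 1" for z :: "real \<times> real" unfolding norm_yy using r(2) by (simp only: r_def)
  have al: "al (yy v (fst z)) = (\<Sum>l. t l z)" for z using sums_unique[OF al_sums[OF yn[of z]]] by (simp add: t_def)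
  have "uniform_limit bx (%n z. \<Sum>l<n. t l z) (%z. \<Sum>l. t l z) sequentially"
  proof (rule Weierstrass_m_test)
    show "summable (%l. real l * ht l * r ^ l)"
      using al_summable[of "of_real r"] r unfolding al_norm by simp
    show "norm (t l z) <= real l * ht l * r ^ l" for l z
      unfolding t_def al_norm norm_yy r_def by (rule order_refl)
  qed
  then have "uniform_limit bx (%n z. h z * (\<Sum>l<n. t l z)) (%z. h z * (\<Sum>l. t l z)) sequentially"
  proof (rule uniform_lim_mult[OF uniform_limit_const])
    show "bounded (h ` bx)" by (intro compact_imp_bounded compact_continuous_image hc cb)
    have "continuous_on bx (%z. al (yy v (fst z)))"
      by (rule continuous_on_compose2[OF holomorphic_on_imp_continuous_on[OF al_holomorphic] yy_cont]) (use yn in auto)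
    then show "bounded ((%z. \<Sum>l. t l z) ` bx)" unfolding al by (intro compact_imp_bounded compact_continuous_image cb)
  qed
  then have lim: "(%n. FI (%z. h z * (\<Sum>l<n. t l z))) \<longlonglongrightarrow> FI (%z. h z * (\<Sum>l. t l z))"
    by (rule FI_uniform) (intro continuous_intros hc tc)
  have part: "FI (%z. h z * (\<Sum>l<n. t l z)) = (\<Sum>l<n. FI (%z. h z * t l z))" for n
  proof (induction n)
    case 0 then show ?case by (simp add: FI_def)
  next
    case (Suc n)
    have "FI (%z. h z * (\<Sum>l<n. t l z) + h z * t n z) = FI (%z. h z * (\<Sum>l<n. t l z)) + FI (%z. h z * t n z)"
      by (rule FI_add) (intro continuous_intros hc tc)+
    then show ?case using Suc by (simp add: distrib_left)
  qed
  have one: "FI (%z. h z * t l z) = of_real (real l * ht l) * VI 0 v i (j - int l)" for l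
  proof -
    have "h z * t l z = of_real (real l * ht l) * (of_real (snd z) ^ 0 * VV i (of_real (snd z)) (yy v (fst z)) * yy v (fst z) powi (- (j - int l)))" for z
    proof -
      have "yy v (fst z) powi (- (j - int l)) = yy v (fst z) powi (- j) * yy v (fst z) ^ l"
        by (simp add: power_int_add[symmetric] flip: power_int_of_nat)
      then show ?thesis by (simp add: h_def t_def mult_ac)
    qed
    then show ?thesis by (simp only: FI_cmult VI_def)
  qed
  have "h z * (\<Sum>l. t l z) = al (yy v (fst z)) * VV i (of_real (snd z)) (yy v (fst z)) * yy v (fst z) powi (- j)" for z
    by (simp add: al[symmetric] h_def mult_ac)
  then show ?thesis using lim unfolding part one sums_def by simp
qed

text \<open>The shift by m0 in the second coordinate becomes the factor y^m0, so start and restarts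
  combine into one integrand \<open>Din\<close> over the same circle.\<close>

lemma main_term:
  assumes v: "\<bar>v - v0\<bar> <= dl0"
  shows "of_nat m0 * VI 0 v (int i - int n0) (int j - int m0)
      - FI (%z. al (yy v (fst z)) * VV (int i) (of_real (snd z)) (yy v (fst z)) * yy v (fst z) powi (- int j))
    = of_real (real kap / (2 * pi)) * B.JJ i j v"
proof -
  define f where "f z = of_real (snd z) ^ 0 * VV (int i - int n0) (of_real (snd z)) (yy v (fst z)) * yy v (fst z) powi (- (int j - int m0))" for z :: "real \<times> real"
  define g where "g z = al (yy v (fst z)) * VV (int i) (of_real (snd z)) (yy v (fst z)) * yy v (fst z) powi (- int j)" for z :: "real \<times> real"
  have yn: "norm (yy v (fst z)) < 1" for z :: "real \<times> real"
    unfolding norm_yy by (rule le_less_trans[OF norm_yy_less[OF v] region(7)])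
  have fc: "continuous_on bx f" unfolding f_def by (intro continuous_intros yy_powi_cont VV_bx_cont v)
  have ac: "continuous_on bx (%z. al (yy v (fst z)))"
    by (rule continuous_on_compose2[OF holomorphic_on_imp_continuous_on[OF al_holomorphic] yy_cont]) (use yn in auto)
  have gc: "continuous_on bx g" unfolding g_def by (intro continuous_intros ac yy_powi_cont VV_bx_cont v)
  have "FI (%z. of_nat m0 * f z + (-1) * g z) = FI (%z. of_nat m0 * f z) + FI (%z. (-1) * g z)"
    by (rule FI_add) (intro continuous_on_mult continuous_on_const fc gc)+
  then have "of_nat m0 * FI f - FI g = FI (%z. of_nat m0 * f z + (-1) * g z)"
    unfolding FI_cmult by simp
  also have "(%z. of_nat m0 * f z + (-1) * g z) = (%z. B.Din i (of_real (snd z)) (yy v (fst z)) * yy v (fst z) powi (- int j))"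
  proof
    fix z :: "real \<times> real"
    have "yy v (fst z) powi (- (int j - int m0)) = yy v (fst z) powi (- int j) * yy v (fst z) ^ m0"
      by (simp add: power_int_add[symmetric] flip: power_int_of_nat)
    then show "of_nat m0 * f z + (-1) * g z = B.Din i (of_real (snd z)) (yy v (fst z)) * yy v (fst z) powi (- int j)"
      by (simp add: f_def g_def B.Din_def algebra_simps)
  qed
  also have "FI ... = of_real (real kap / (2 * pi)) * B.JJ i j v"
  proof (subst FI_iterated)
    have "continuous_on bx (%z. of_nat m0 * f z + (-1) * g z)" by (intro continuous_intros fc gc)
    then show "continuous_on bx (%z. B.Din i (of_real (snd z)) (yy v (fst z)) * yy v (fst z) powi (- int j))"
      unfolding \<open>(%z. of_nat m0 * f z + (-1) * g z) = _\<close> .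
  qed (simp add: B.JJ_def B.inner_def integral_mult_left)
  finally show ?thesis by (simp add: VI_def f_def g_def)
qed

definition GG :: "nat => nat => real" where "GG i j = (\<Sum>n. QQ n (int i) (int j))"

text \<open>In both parts of \<open>Q_sums\<close> the ballot factors are replaced by their
  first-order terms. By \<open>T2_bound\<close> this costs j^2 i^(-5/2); over the absorption heights
  the errors are summable because exp v stays below some \<rho> < 1.\<close>

theorem GG_estimate:
  "\<exists>C\<ge>0. \<exists>N. \<forall>v i j. \<bar>v - v0\<bar> <= rd --> i >= N --> i >= 1 --> j >= 1 --> int kap dvd (int i - int n0) - (int j - int m0) -->
     \<bar>GG i j - real j * (real kap / (2 * pi) * Re (B.JJ i j v))\<bar> <= C * (real j)\<^sup>2 * (fr (exp v) ^ i * exp (- real j * v) / ((real i)\<^sup>2 * sqrt (real i)))"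
proof -
  obtain C where C: "C >= 0" and HC: "\<And>v i e. \<bar>v - v0\<bar> <= rd ==> i >= 1 ==> norm (VI 0 v (int i) e - VI 1 v (int i) e)
     <= C * (fr (exp v) ^ i * exp (- of_int e * v) / ((real i)\<^sup>2 * sqrt (real i)))"
    using T2_bound by blast
  define \<rho> where "\<rho> = Y0 * exp dl0"
  have \<rho>: "0 <= \<rho>" "\<rho> < 1" using region(7) Y0_pos by (auto simp: \<rho>_def)
  define S2 where "S2 = (\<Sum>l. (real l)\<^sup>2 * \<rho> ^ l)"
  have sS2: "summable (%l. (real l)\<^sup>2 * \<rho> ^ l)" by (rule summable_square_geometric[OF \<rho>])
  have S2: "S2 >= 0" unfolding S2_def using \<rho> by (intro suminf_nonneg sS2) auto
  define C' where "C' = 4 * ((real m0)\<^sup>2 * (C / ms ^ n0 * 8) + C * S2)"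
  have C': "C' >= 0" using C S2 r3(3) by (simp add: C'_def)
  have main: "\<bar>GG i j - real j * (real kap / (2 * pi) * Re (B.JJ i j v))\<bar> <= C' * (real j)\<^sup>2 * (fr (exp v) ^ i * exp (- real j * v) / ((real i)\<^sup>2 * sqrt (real i)))"
    if v: "\<bar>v - v0\<bar> <= rd" and i: "i >= 2 * n0" "i >= 1" and j: "j >= 1" and par: "int kap dvd (int i - int n0) - (int j - int m0)" for v i j
  proof -
    have vd: "\<bar>v - v0\<bar> <= dl0" and vr: "\<bar>v - v0\<bar> <= r3" using v rd(3) r3(1,4) by linarith+
    have j': "int j >= 1" using j by simp
    define k where "k = fr (exp v)"
    have k: "k > 0" "ms <= k" using fr_exp[OF vd] B.fr_ge[OF vr] by (auto simp: k_def)
    have ev: "exp v <= \<rho>" unfolding \<rho>_def by (rule norm_yy_less[OF vd])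
    define W where "W = k ^ i * exp (- real j * v) / ((real i)\<^sup>2 * sqrt (real i))"
    have W: "W >= 0" using k by (simp add: W_def)
    define D where "D = int i - int n0"
    have Dn: "D = int (i - n0)" using i by (simp add: D_def)
    have i1: "i - n0 >= 1" "2 * (i - n0) >= i" using i n0 by auto
    define V where "V l = VI 0 v (int i) (int j - int l)" for l
    define V2 where "V2 l = norm (VI 0 v (int i) (int j - int l) - VI 1 v (int i) (int j - int l))" for l
    define kk where "kk l = (\<Sum>n. K n l (int i) (int j))" for l
    have V2: "V2 l <= C * W * exp v ^ l" for l
    proof -
      have "exp (- of_int (int j - int l) * v) = exp (- real j * v) * exp v ^ l"
        by (simp add: exp_of_nat_mult[symmetric] exp_add[symmetric] algebra_simps)
      then show ?thesis using HC[OF v i(2), of "int j - int l"] by (simp add: V2_def W_def k_def mult_ac)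
    qed
    have a1: "\<bar>(\<Sum>n. K n m0 D (int j)) - real j * (real m0 * Re (VI 0 v D (int j - int m0)))\<bar> <= 4 * (real j)\<^sup>2 * ((real m0)\<^sup>2 * (C / ms ^ n0 * 8) * W)"
    proof -
      have "\<bar>(\<Sum>n. K n m0 D (int j)) - real j * (real m0 * Re (VI 0 v D (int j - int m0)))\<bar> <= 4 * (real j)\<^sup>2 * (real m0)\<^sup>2 * norm (VI 0 v D (int j - int m0) - VI 1 v D (int j - int m0))"
        using K_sum_approx[OF vd par j'] by (simp add: D_def)
      also have "... <= 4 * (real j)\<^sup>2 * (real m0)\<^sup>2 * (C * (1 / ms ^ n0 * (8 * W)))"
      proof (rule mult_left_mono)
        have "norm (VI 0 v D (int j - int m0) - VI 1 v D (int j - int m0)) <= C * (k ^ (i - n0) * exp (- of_int (int j - int m0) * v) / ((real (i - n0))\<^sup>2 * sqrt (real (i - n0))))"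
          unfolding Dn k_def by (rule HC[OF v i1(1)])
        also have "... <= C * ((k ^ i / ms ^ n0) * exp (- real j * v) / (((real i)\<^sup>2 * sqrt (real i)) / 8))"
        proof (intro mult_left_mono frac_le mult_mono)
          have "k ^ (i - n0) = k ^ i / k ^ n0" using k i by (simp add: power_diff)
          also have "... <= k ^ i / ms ^ n0" using k r3(3) by (intro divide_left_mono power_mono) auto
          finally show "k ^ (i - n0) <= k ^ i / ms ^ n0" .
          have "v <= 0" using ev \<rho> by (metis exp_le_one_iff less_le_trans less_imp_le order_trans)
          then have "real m0 * v <= 0" by (simp add: mult_nonneg_nonpos)
          then show "exp (- of_int (int j - int m0) * v) <= exp (- real j * v)" by (simp add: algebra_simps)
          \<comment> \<open>Since i - n0 is at least i/2, passing from i - n0 to i costs at most the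
            factor 8 in i^2 sqrt i.\<close>
          have h: "real i / 2 <= real (i - n0)" using i1(2) by (simp add: field_simps flip: of_nat_mult)
          have "(real i)\<^sup>2 * sqrt (real i) / 8 <= (real i / 2)\<^sup>2 * (sqrt (real i) / 2)" by (simp add: power2_eq_square)
          also have "... <= (real (i - n0))\<^sup>2 * sqrt (real (i - n0))"
          proof (intro mult_mono power_mono h)
            have "sqrt (real i) / 2 = sqrt (real i / 4)" by (simp add: real_sqrt_divide)
            also have "... <= sqrt (real (i - n0))" using h by simp
            finally show "sqrt (real i) / 2 <= sqrt (real (i - n0))" .
          qed auto
          finally show "(real i)\<^sup>2 * sqrt (real i) / 8 <= (real (i - n0))\<^sup>2 * sqrt (real (i - n0))" .
        qed (use C k r3(3) i in auto)
        also have "... = C * (1 / ms ^ n0 * (8 * W))" by (simp add: W_def)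
        finally show "norm (VI 0 v D (int j - int m0) - VI 1 v D (int j - int m0)) <= C * (1 / ms ^ n0 * (8 * W))" .
      qed simp
      finally show ?thesis by (simp add: mult_ac)
    qed
    have Vs: "(%l. real l * ht l * Re (V l)) sums Re (FI (%z. al (yy v (fst z)) * VV (int i) (of_real (snd z)) (yy v (fst z)) * yy v (fst z) powi (- int j)))"
      using sums_Re[OF absorbed_sum[OF vd, of "int i" "int j"]] by (simp add: V_def)
    have V2s: "summable (%l. ht l * (real l)\<^sup>2 * V2 l)" and V2le: "(\<Sum>l. ht l * (real l)\<^sup>2 * V2 l) <= C * W * S2"
    proof -
      have le: "ht l * (real l)\<^sup>2 * V2 l <= C * W * ((real l)\<^sup>2 * \<rho> ^ l)" for l
      proof -
        have "V2 l <= C * W * \<rho> ^ l" using order_trans[OF V2 mult_left_mono[OF power_mono[OF ev]]] C W by simp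
        then have "ht l * (real l)\<^sup>2 * V2 l <= 1 * (real l)\<^sup>2 * (C * W * \<rho> ^ l)"
          using ht_le_1 ht_nonneg by (intro mult_mono) (auto simp: V2_def)
        then show ?thesis by (simp add: mult_ac)
      qed
      show s: "summable (%l. ht l * (real l)\<^sup>2 * V2 l)"
        by (rule summable_comparison_test'[OF summable_mult[OF sS2, of "C * W"], of 0]) (use le ht_nonneg in \<open>auto simp: V2_def abs_mult\<close>)
      have "(\<Sum>l. ht l * (real l)\<^sup>2 * V2 l) <= (\<Sum>l. C * W * ((real l)\<^sup>2 * \<rho> ^ l))"
        by (rule suminf_le[OF le s summable_mult[OF sS2]])
      then show "(\<Sum>l. ht l * (real l)\<^sup>2 * V2 l) <= C * W * S2" by (simp add: S2_def suminf_mult[OF sS2])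
    qed
    have pt: "\<bar>ht l * kk l - real j * (real l * ht l * Re (V l))\<bar> <= 4 * (real j)\<^sup>2 * (ht l * (real l)\<^sup>2 * V2 l)" for l
    \<comment> \<open>The integral formula is available only for the right parity; for the other
      heights the absorption probability is 0.\<close>
    proof (cases "ht l = 0 | l = 0")
      case False
      then have "int kap dvd int n0 + int l - int m0" using ht_parity by simp
      from dvd_add[OF par this] have pl: "int kap dvd int i - (int j - int l)" by (simp add: algebra_simps)
      have "\<bar>ht l * kk l - real j * (real l * ht l * Re (V l))\<bar> = ht l * \<bar>kk l - real j * (real l * Re (V l))\<bar>"
      proof -
        have "ht l * kk l - real j * (real l * ht l * Re (V l)) = ht l * (kk l - real j * (real l * Re (V l)))" by (simp add: algebra_simps)
        then show ?thesis by (simp only: abs_mult abs_of_nonneg[OF ht_nonneg])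
      qed
      also have "... <= ht l * (4 * (real j)\<^sup>2 * (real l)\<^sup>2 * V2 l)"
        using K_sum_approx[OF vd pl j'] ht_nonneg by (intro mult_left_mono) (auto simp: kk_def V_def V2_def)
      finally show ?thesis by (simp add: mult_ac)
    qed (auto simp: kk_def)
    have a2: "\<bar>(\<Sum>l. ht l * kk l) - real j * Re (FI (%z. al (yy v (fst z)) * VV (int i) (of_real (snd z)) (yy v (fst z)) * yy v (fst z) powi (- int j)))\<bar>
       <= 4 * (real j)\<^sup>2 * (\<Sum>l. ht l * (real l)\<^sup>2 * V2 l)"
      by (rule sums_approx[OF summable_sums Vs summable_sums[OF V2s] pt]) (use Q_sums(2)[of "int i" "int j"] i j in \<open>simp add: kk_def\<close>)
    also have "... <= 4 * (real j)\<^sup>2 * (C * W * S2)" by (intro mult_left_mono V2le) auto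
    finally have a2: "\<bar>(\<Sum>l. ht l * kk l) - real j * Re (FI (%z. al (yy v (fst z)) * VV (int i) (of_real (snd z)) (yy v (fst z)) * yy v (fst z) powi (- int j)))\<bar>
       <= 4 * (real j)\<^sup>2 * (C * W * S2)" .
    have G: "GG i j = (\<Sum>n. K n m0 D (int j)) - (\<Sum>l. ht l * kk l)"
      using Q_sums(1)[of "int i" "int j"] i j by (simp add: GG_def sums_iff D_def kk_def)
    have mt: "real kap / (2 * pi) * Re (B.JJ i j v) = real m0 * Re (VI 0 v D (int j - int m0))
      - Re (FI (%z. al (yy v (fst z)) * VV (int i) (of_real (snd z)) (yy v (fst z)) * yy v (fst z) powi (- int j)))"
      using arg_cong[OF main_term[OF vd, of i j], of Re] by (simp add: D_def)
    have ab: "\<bar>(x - y) - w * (x' - y')\<bar> <= \<bar>x - w * x'\<bar> + \<bar>y - w * y'\<bar>" for x y x' y' w :: real by (simp add: algebra_simps)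
    have "\<bar>GG i j - real j * (real kap / (2 * pi) * Re (B.JJ i j v))\<bar> <= 4 * (real j)\<^sup>2 * ((real m0)\<^sup>2 * (C / ms ^ n0 * 8) * W) + 4 * (real j)\<^sup>2 * (C * W * S2)"
      unfolding G mt by (rule order_trans[OF ab add_mono[OF a1 a2]])
    also have "... = C' * (real j)\<^sup>2 * W" by (simp add: C'_def algebra_simps)
    finally show ?thesis by (simp add: W_def k_def)
  qed
  show ?thesis by (intro exI[of _ C'] conjI C' exI[of _ "2 * n0"] allI impI) (use main in blast)
qed

end

section \<open>Positivity of the leading coefficient\<close>

context drift_walk begin

lemma exp_step_sum:
  fixes \<alpha> \<beta> :: real and x y :: int
  shows "(\<Sum>k\<in>{-1..1}. \<Sum>e\<in>{-1..1}. p k e * exp (\<alpha> * of_int (x + k) + \<beta> * of_int (y + e))) = exp (\<alpha> * of_int x + \<beta> * of_int y) * phi p (\<alpha>, \<beta>)"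
  unfolding phi_def sum_distrib_left
  by (intro sum.cong refl) (simp add: exp_add[symmetric] algebra_simps)

text \<open>This function is harmonic, because \<open>(u0, v0)\<close> is the point of \<open>{phi = 1}\<close> where
  \<open>phi_v\<close> vanishes. It vanishes on the horizontal axis.\<close>

definition hf :: "int => int => real" where
  "hf x y = of_int y * exp (u0 * of_int x + v0 * of_int y)"

lemma hf_harmonic: "(\<Sum>k\<in>{-1..1}. \<Sum>e\<in>{-1..1}. p k e * hf (x + k) (y + e)) = hf x y"
proof -
  define E where "E = exp (u0 * of_int x + v0 * of_int y)"
  have E: "exp (u0 * of_int (x + k) + v0 * of_int (y + e)) = E * exp (u0 * of_int k + v0 * of_int e)" for k e
    unfolding E_def exp_add[symmetric] by (simp add: algebra_simps)
  have "(\<Sum>k\<in>{-1..1}. \<Sum>e\<in>{-1..1}. p k e * hf (x + k) (y + e))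
     = of_int y * (\<Sum>k\<in>{-1..1}. \<Sum>e\<in>{-1..1}. p k e * exp (u0 * of_int (x + k) + v0 * of_int (y + e)))
       + (\<Sum>k\<in>{-1..1}. \<Sum>e\<in>{-1..1}. p k e * (of_int e * exp (u0 * of_int (x + k) + v0 * of_int (y + e))))"
    unfolding hf_def sum_distrib_left sum.distrib[symmetric] by (intro sum.cong refl) (simp add: algebra_simps)
  also have "(\<Sum>k\<in>{-1..1}. \<Sum>e\<in>{-1..1}. p k e * (of_int e * exp (u0 * of_int (x + k) + v0 * of_int (y + e)))) = E * phi_v p u0 v0"
    unfolding E by (simp add: sum_unit_interval phi_v_def algebra_simps)
  finally show ?thesis unfolding exp_step_sum right_point by (simp add: hf_def)
qed

text \<open>Expectation of \<open>hf\<close> at time n over the walks from (x, y) that are still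
  alive.\<close>

primrec VN :: "nat => int => int => real" where
  "VN 0 = (%x y. if x >= 1 & y >= 1 then hf x y else 0)"
| "VN (Suc n) = (%x y. if x >= 1 & y >= 1 then \<Sum>k\<in>{-1..1}. \<Sum>e\<in>{-1..1}. p k e * VN n (x + k) (y + e) else 0)"

lemma VN_outside: "x < 1 | y < 1 ==> VN n x y = 0"
  by (cases n) auto

lemma VN_nonneg: "0 <= VN n x y"
  by (induction n arbitrary: x y) (auto simp: hf_def intro!: sum_nonneg mult_nonneg_nonneg)

lemma VN_step:
  assumes "x >= 1" "y >= 1" "k \<in> {-1..1}" "e \<in> {-1..1}"
  shows "p k e * VN n (x + k) (y + e) <= VN (Suc n) x y"
proof -
  have "p k e * VN n (x + k) (y + e) <= (\<Sum>e\<in>{-1..1}. p k e * VN n (x + k) (y + e))"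
    by (rule member_le_sum) (use assms VN_nonneg in auto)
  also have "... <= (\<Sum>k\<in>{-1..1}. \<Sum>e\<in>{-1..1}. p k e * VN n (x + k) (y + e))"
    by (rule member_le_sum[where f = "%k. \<Sum>e\<in>{-1..1}. p k e * VN n (x + k) (y + e)"])
       (use assms VN_nonneg in \<open>auto intro!: sum_nonneg\<close>)
  finally show ?thesis using assms by simp
qed

lemma hit_outside: "x < 1 | y < 1 ==> hit n x y l = 0"
proof -
  assume "x < 1 | y < 1"
  then have "Q m x y i j = 0" for m i j by (cases m) auto
  then show ?thesis by (simp add: hit_def split: nat.split)
qed

text \<open>Optional stopping. Paths that end on the horizontal axis contribute nothing, since
  \<open>hf\<close> vanishes there.\<close>

lemma VN_decomposition:
  assumes "x >= 1" "y >= 1" "int L >= y + int n"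
  shows "hf x y = VN n x y + (\<Sum>r\<le>n. \<Sum>l=1..L. hit r x y (int l) * hf 0 (int l))"
  using assms
proof (induction n arbitrary: x y)
  case (Suc n)
  define R where "R n x y = (\<Sum>r\<le>n. \<Sum>l=1..L. hit r x y (int l) * hf 0 (int l))" for n x y
  have pt: "hf (x + k) (y + e) = VN n (x + k) (y + e) + R n (x + k) (y + e) + (if x + k = 0 then hf 0 (y + e) else 0)"
    if "k \<in> {-1..1}" "e \<in> {-1..1}" for k e
  proof (cases "x + k >= 1 & y + e >= 1")
    case True
    then show ?thesis using Suc.IH[of "x + k" "y + e"] Suc.prems that by (simp add: R_def)
  next
    case False
    then have o: "x + k < 1 | y + e < 1" by auto
    have "x + k >= 0" "y + e >= 0" using Suc.prems that by auto
    then have "x + k = 0 | y + e = 0" using o by linarith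
    then show ?thesis using VN_outside[OF o] hit_outside[OF o] by (auto simp: R_def hf_def)
  qed
  have one: "(\<Sum>l=1..L. hit (Suc 0) x y (int l) * hf 0 (int l)) = (\<Sum>k\<in>{-1..1}. \<Sum>e\<in>{-1..1}. p k e * (if x + k = 0 then hf 0 (y + e) else 0))"
  proof -
    have "(\<Sum>l=1..L. hit (Suc 0) x y (int l) * hf 0 (int l)) = (\<Sum>l=1..L. \<Sum>e\<in>{-1..1}. p (-1) e * (if x = 1 & int l = y + e then hf 0 (int l) else 0))"
    proof (rule sum.cong[OF refl])
      fix l
      show "hit (Suc 0) x y (int l) * hf 0 (int l) = (\<Sum>e\<in>{-1..1}. p (-1) e * (if x = 1 & int l = y + e then hf 0 (int l) else 0))"
        unfolding hit_Suc sum_distrib_right using Suc.prems by (intro sum.cong refl) auto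
    qed
    also have "... = (\<Sum>e\<in>{-1..1}. \<Sum>l=1..L. p (-1) e * (if x = 1 & int l = y + e then hf 0 (int l) else 0))" by (rule sum.swap)
    also have "... = (\<Sum>e\<in>{-1..1}. p (-1) e * (if x = 1 then hf 0 (y + e) else 0))"
    proof (rule sum.cong[OF refl])
      fix e :: int assume e: "e \<in> {-1..1}"
      define l0 where "l0 = nat (y + e)"
      have l0: "int l0 = y + e" using e Suc.prems by (simp add: l0_def)
      have "(\<Sum>l=1..L. p (-1) e * (if x = 1 & int l = y + e then hf 0 (int l) else 0)) = (\<Sum>l=1..L. if l = l0 then p (-1) e * (if x = 1 then hf 0 (y + e) else 0) else 0)"
        unfolding l0[symmetric] by (intro sum.cong refl) auto
      also have "... = p (-1) e * (if x = 1 then hf 0 (y + e) else 0)"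
      proof (cases "l0 = 0")
        case True
        then have "y + e = 0" using l0 by simp
        then show ?thesis by (simp add: hf_def sum.delta)
      next
        case False
        have "l0 <= L" using l0 e Suc.prems by auto
        then show ?thesis using False by (simp add: sum.delta)
      qed
      finally show "(\<Sum>l=1..L. p (-1) e * (if x = 1 & int l = y + e then hf 0 (int l) else 0)) = p (-1) e * (if x = 1 then hf 0 (y + e) else 0)" .
    qed
    also have "... = (\<Sum>k\<in>{-1..1}. \<Sum>e\<in>{-1..1}. p k e * (if x + k = 0 then hf 0 (y + e) else 0))"
      using Suc.prems by (simp add: sum_unit_interval[of "%k. \<Sum>e\<in>{-1..1}. p k e * (if x + k = 0 then hf 0 (y + e) else 0)"])
    finally show ?thesis .
  qed
  have rec: "R (Suc n) x y = (\<Sum>l=1..L. hit (Suc 0) x y (int l) * hf 0 (int l)) + (\<Sum>k\<in>{-1..1}. \<Sum>e\<in>{-1..1}. p k e * R n (x + k) (y + e))"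
  proof -
    define g where "g r x y = (\<Sum>l=1..L. hit r x y (int l) * hf 0 (int l))" for r x y
    have g: "g (Suc (Suc r)) x y = (\<Sum>k\<in>{-1..1}. \<Sum>e\<in>{-1..1}. p k e * g (Suc r) (x + k) (y + e))" for r
      unfolding g_def hit_Suc_Suc[OF Suc.prems(1,2)] sum_unit_interval
      by (simp add: sum_distrib_left sum.distrib algebra_simps)
    have g0: "g 0 x' y' = 0" for x' y' by (simp add: g_def)
    have sh: "(\<Sum>r\<le>m. g r x' y') = (\<Sum>r<m. g (Suc r) x' y')" for m x' y'
      by (simp add: sum.atMost_shift g0)
    have "R (Suc n) x y = (\<Sum>r<Suc n. g (Suc r) x y)" unfolding R_def g_def[symmetric] by (rule sh)
    also have "... = g (Suc 0) x y + (\<Sum>r<n. g (Suc (Suc r)) x y)" by (rule sum.lessThan_Suc_shift)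
    also have "(\<Sum>r<n. g (Suc (Suc r)) x y) = (\<Sum>k\<in>{-1..1}. \<Sum>e\<in>{-1..1}. p k e * (\<Sum>r<n. g (Suc r) (x + k) (y + e)))"
      unfolding g sum_unit_interval by (simp add: sum_distrib_left sum.distrib algebra_simps)
    finally show ?thesis unfolding R_def g_def[symmetric] sh .
  qed
  have "hf x y = (\<Sum>k\<in>{-1..1}. \<Sum>e\<in>{-1..1}. p k e * hf (x + k) (y + e))" by (rule hf_harmonic[symmetric])
  also have "... = (\<Sum>k\<in>{-1..1}. \<Sum>e\<in>{-1..1}. p k e * VN n (x + k) (y + e)) + (\<Sum>k\<in>{-1..1}. \<Sum>e\<in>{-1..1}. p k e * R n (x + k) (y + e))
     + (\<Sum>k\<in>{-1..1}. \<Sum>e\<in>{-1..1}. p k e * (if x + k = 0 then hf 0 (y + e) else 0))"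
    unfolding sum.distrib[symmetric] by (intro sum.cong refl) (simp add: pt distrib_left)
  also have "... = VN (Suc n) x y + R (Suc n) x y" unfolding rec one using Suc.prems by simp
  finally show ?case by (simp add: R_def)
qed simp

text \<open>The exponential is superharmonic, as phi <= 1 at its exponents, and dominates
  \<open>hf\<close> on both axes, on the vertical one by \<eta> t <= exp (\<eta> t). So the
  difference is a subharmonic barrier that is nonpositive on the boundary.\<close>

lemma VN_lower:
  fixes \<alpha> \<beta> \<eta> :: real
  assumes "phi p (\<alpha>, \<beta>) <= 1" "\<beta> = v0 + \<eta>" "\<eta> > 0" "x >= 1" "y >= 1"
  shows "hf x y - 1 / \<eta> * exp (\<alpha> * of_int x + \<beta> * of_int y) <= VN n x y"
  using assms(4,5)
proof (induction n arbitrary: x y)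
  case (Suc n)
  define g where "g x y = 1 / \<eta> * exp (\<alpha> * of_int x + \<beta> * of_int y)" for x y :: int
  have g0: "g x y > 0" for x y using assms by (simp add: g_def)
  have pt: "hf (x + k) (y + e) - g (x + k) (y + e) <= VN n (x + k) (y + e)" if "k \<in> {-1..1}" "e \<in> {-1..1}" for k e
  proof (cases "x + k >= 1 & y + e >= 1")
    case True
    then show ?thesis using Suc.IH[of "x + k" "y + e"] by (simp add: g_def)
  next
    case False
    then have o: "x + k < 1 | y + e < 1" by auto
    have nn: "x + k >= 0" "y + e >= 0" using Suc.prems that by auto
    have "hf (x + k) (y + e) - g (x + k) (y + e) <= 0"
    proof (cases "y + e = 0")
      case True
      then show ?thesis using g0[of "x + k" "y + e"] by (simp add: hf_def)
    next
      case F: False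
      then have "x + k = 0" using o nn by linarith
      moreover define t :: real where "t = of_int (y + e)"
      moreover have "t * exp (v0 * t) <= 1 / \<eta> * exp (\<beta> * t)"
      proof -
        have "\<eta> * t <= exp (\<eta> * t)" by (rule exp_ge_self)
        then have "t <= 1 / \<eta> * exp (\<eta> * t)" using assms by (simp add: field_simps)
        then have "t * exp (v0 * t) <= 1 / \<eta> * exp (\<eta> * t) * exp (v0 * t)" by (rule mult_right_mono) simp
        also have "... = 1 / \<eta> * exp (\<beta> * t)" by (simp add: assms(2) exp_add[symmetric] algebra_simps)
        finally show ?thesis .
      qed
      ultimately show ?thesis by (simp add: hf_def g_def)
    qed
    then show ?thesis using VN_outside[OF o] by simp
  qed
  have "(\<Sum>k\<in>{-1..1}. \<Sum>e\<in>{-1..1}. p k e * g (x + k) (y + e)) = 1 / \<eta> * (exp (\<alpha> * of_int x + \<beta> * of_int y) * phi p (\<alpha>, \<beta>))"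
    unfolding exp_step_sum[symmetric] sum_distrib_left g_def by (intro sum.cong refl) simp
  also have "... <= 1 / \<eta> * (exp (\<alpha> * of_int x + \<beta> * of_int y) * 1)" using assms by (intro mult_left_mono) auto
  finally have "hf x y - g x y <= (\<Sum>k\<in>{-1..1}. \<Sum>e\<in>{-1..1}. p k e * hf (x + k) (y + e)) - (\<Sum>k\<in>{-1..1}. \<Sum>e\<in>{-1..1}. p k e * g (x + k) (y + e))"
    unfolding hf_harmonic by (simp add: g_def)
  also have "... = (\<Sum>k\<in>{-1..1}. \<Sum>e\<in>{-1..1}. p k e * (hf (x + k) (y + e) - g (x + k) (y + e)))"
    by (simp add: sum_subtractf right_diff_distrib)
  also have "... <= (\<Sum>k\<in>{-1..1}. \<Sum>e\<in>{-1..1}. p k e * VN n (x + k) (y + e))"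
    by (intro sum_mono mult_left_mono pt) auto
  finally show ?case using Suc.prems by (simp add: g_def)
qed (use assms in \<open>simp add: hf_def\<close>)

text \<open>The triples guarantee one of three ways to move right without losing height. In the
  third, going up before going down to the right keeps the walk in the interior.\<close>

lemma right_move:
  "\<exists>q>0. \<exists>m. \<exists>e\<in>{0, 1}. \<forall>n x y. x >= 1 --> y >= 1 --> q * VN n (x + 1) (y + e) <= VN (n + m) x y"
proof -
  consider "p 1 0 > 0" | "p 1 1 > 0" | "p 0 1 > 0" "p 1 (-1) > 0" using triples by blast
  then show ?thesis
  proof cases
    case 1
    have "p 1 0 * VN n (x + 1) (y + 0) <= VN (n + 1) x y" if "x >= 1" "y >= 1" for n x y
      using VN_step[OF that, of 1 0 n] by simp
    then show ?thesis using 1 by blast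
  next
    case 2
    have "p 1 1 * VN n (x + 1) (y + 1) <= VN (n + 1) x y" if "x >= 1" "y >= 1" for n x y
      using VN_step[OF that, of 1 1 n] by simp
    then show ?thesis using 2 by blast
  next
    case 3
    have "(p 0 1 * p 1 (-1)) * VN n (x + 1) (y + 0) <= VN (n + 2) x y" if "x >= 1" "y >= 1" for n x y
    proof -
      have "p 1 (-1) * VN n (x + 1) (y + 1 + -1) <= VN (Suc n) x (y + 1)"
        using that by (intro VN_step) auto
      then have "p 0 1 * (p 1 (-1) * VN n (x + 1) y) <= p 0 1 * VN (Suc n) x (y + 1)" by (intro mult_left_mono) auto
      also have "... <= VN (Suc (Suc n)) x y" using VN_step[OF that, of 0 1 "Suc n"] by simp
      finally show ?thesis by (simp add: mult.assoc)
    qed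
    moreover have "p 0 1 * p 1 (-1) > 0" using 3 by simp
    ultimately show ?thesis by blast
  qed
qed

text \<open>Far to the right \<open>hf\<close> exceeds the exponential in \<open>VN_lower\<close>,
  whose rate \<alpha> in x is less than u0. Finitely many moves of positive weight lead there and
  cost only a constant factor.\<close>

lemma VN_limit_pos:
  assumes xy: "x >= 1" "y >= 1"
  shows "\<exists>\<delta>>0. \<exists>N. \<forall>n\<ge>N. \<delta> <= VN n x y"
proof -
  obtain q m e where q: "q > 0" and e: "e = 0 | e = 1"
    and step: "\<And>n x y. x >= 1 ==> y >= 1 ==> q * VN n (x + 1) (y + e) <= VN (n + m) x y"
    using right_move by blast
  have steps: "q ^ k * VN n (x + int k) (y + int k * e) <= VN (n + k * m) x y" if "x >= 1" "y >= 1" for k n x y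
    using that
  proof (induction k arbitrary: x y)
    case (Suc k)
    have "q ^ k * VN n (x + 1 + int k) (y + e + int k * e) <= VN (n + k * m) (x + 1) (y + e)"
      by (rule Suc.IH) (use Suc.prems e in auto)
    then have "q * (q ^ k * VN n (x + 1 + int k) (y + e + int k * e)) <= q * VN (n + k * m) (x + 1) (y + e)"
      using q by (intro mult_left_mono) auto
    also have "... <= VN (n + k * m + m) x y" by (rule step[OF Suc.prems])
    finally show ?case by (simp add: algebra_simps)
  qed simp
  define xm where "xm = (xb + X0) / 2"
  have xm: "xb <= xm" "xm < X0" "xm > 0" using region(3) xb_pos by (auto simp: xm_def)
  define \<alpha> where "\<alpha> = ln xm"
  have "ln xm < ln X0" using xm by simp
  then have \<alpha>: "\<alpha> < u0" by (simp add: \<alpha>_def X0_def)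
  have ph: "phi p (\<alpha>, v0) < 1" unfolding \<alpha>_def by (rule phi_below[OF xm(1,2)])
  have "isCont (%v. phi p (\<alpha>, v)) v0" by (rule DERIV_isCont[OF phi_has_derivative_v])
  then have "((%v. phi p (\<alpha>, v)) \<longlongrightarrow> phi p (\<alpha>, v0)) (at v0)" by (simp add: isCont_def)
  from order_tendstoD(2)[OF this ph] obtain r where r: "r > 0" and rv: "\<And>v. v ~= v0 ==> dist v v0 < r ==> phi p (\<alpha>, v) < 1"
    unfolding eventually_at by blast
  \<comment> \<open>\<eta> < u0 - \<alpha> keeps the gain s per move positive even when the move
    also goes up, where the exponential gains \<eta>.\<close>
  define \<eta> where "\<eta> = min (r / 2) ((u0 - \<alpha>) / 2)"
  have \<eta>: "\<eta> > 0" "\<eta> < u0 - \<alpha>" "\<eta> < r" using r \<alpha> by (auto simp: \<eta>_def min_def field_simps)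
  have le1: "phi p (\<alpha>, v0 + \<eta>) <= 1" using rv[of "v0 + \<eta>"] \<eta> by (simp add: dist_real_def)
  define s where "s = (u0 - \<alpha>) - of_int e * \<eta>"
  have s: "s > 0" using \<eta> \<alpha> e by (auto simp: s_def)
  define c0 where "c0 = (\<alpha> - u0) * of_int x + \<eta> * of_int y"
  \<comment> \<open>After k moves the exponential relative to exp (u0 x + v0 y) has exponent c0 - k
    s; this k pushes it below ln \<eta>.\<close>
  obtain k :: nat where k: "real k > (c0 - ln \<eta>) / s" using reals_Archimedean2 by blast
  define x' y' where "x' = x + int k" and "y' = y + int k * e"
  have xy': "x' >= 1" "y' >= 1" using xy e by (auto simp: x'_def y'_def)
  define D where "D = hf x' y' - 1 / \<eta> * exp (\<alpha> * of_int x' + (v0 + \<eta>) * of_int y')"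
  have D: "D > 0"
  proof -
    have "exp (\<alpha> * of_int x' + (v0 + \<eta>) * of_int y') = exp (u0 * of_int x' + v0 * of_int y') * exp (c0 - real k * s)"
      unfolding exp_add[symmetric] by (rule arg_cong[where f = exp]) (simp add: c0_def s_def x'_def y'_def algebra_simps)
    then have "D = exp (u0 * of_int x' + v0 * of_int y') * (of_int y' - 1 / \<eta> * exp (c0 - real k * s))"
      by (simp add: D_def hf_def algebra_simps)
    moreover have "1 / \<eta> * exp (c0 - real k * s) < 1"
    proof -
      have "c0 - real k * s < ln \<eta>" using k s by (simp add: field_simps)
      then have "exp (c0 - real k * s) < exp (ln \<eta>)" by (simp only: exp_less_cancel_iff)
      also have "... = \<eta>" using \<eta> by simp
      finally show ?thesis using \<eta> by (simp add: field_simps)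
    qed
    moreover have "real_of_int y' >= 1" using xy'(2) by simp
    ultimately show ?thesis by (simp add: zero_less_mult_iff)
  qed
  have "q ^ k * D <= VN n x y" if "n >= k * m" for n
  proof -
    have "q ^ k * D <= q ^ k * VN (n - k * m) x' y'"
      unfolding D_def using q by (intro mult_left_mono VN_lower[OF le1 refl \<eta>(1) xy']) auto
    also have "... <= VN (n - k * m + k * m) x y" unfolding x'_def y'_def by (rule steps[OF xy])
    finally show ?thesis using that by simp
  qed
  moreover have "q ^ k * D > 0" using q D by simp
  ultimately show ?thesis by blast
qed

end

context absorbed_chain begin

lemma al_Y0: "(%l. real l * ht l * Y0 ^ l) sums Re (al (of_real Y0))" "al (of_real Y0) = of_real (Re (al (of_real Y0)))"
proof -
  have n: "norm (complex_of_real Y0) < 1" using Y0_pos Y0_less_1 by simp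
  have 1: "(%l. complex_of_real (real l * ht l * Y0 ^ l)) sums al (of_real Y0)" using al_sums[OF n] by simp
  show "(%l. real l * ht l * Y0 ^ l) sums Re (al (of_real Y0))" using sums_Re[OF 1] by simp
  have "(%l. Im (complex_of_real (real l * ht l * Y0 ^ l))) sums Im (al (of_real Y0))" by (rule sums_Im[OF 1])
  then have "(%l. 0 :: real) sums Im (al (of_real Y0))" by (simp only: Im_complex_of_real)
  then have "Im (al (of_real Y0)) = 0" by (simp add: sums_iff)
  then show "al (of_real Y0) = of_real (Re (al (of_real Y0)))" by (simp add: complex_eq_iff)
qed

definition "Br = real m0 * X0 ^ n0 * Y0 ^ m0 - Re (al (of_real Y0))"

text \<open>By \<open>VN_decomposition\<close> the harmonic function at the start minus its mass
  absorbed on the vertical axis up to time n is \<open>VN n\<close>, which stays above some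
  \<delta>. All absorbed terms are nonnegative, so it is enough to bound finite sums over l.\<close>

theorem Br_pos: "Br > 0"
proof -
  have xy: "int n0 >= 1" "int m0 >= 1" using n0 m0 by auto
  obtain \<delta> N where \<delta>: "\<delta> > 0" and N: "\<And>n. n >= N ==> \<delta> <= VN n (int n0) (int m0)" using VN_limit_pos[OF xy] by blast
  have ex: "exp (u0 * real i + v0 * real j) = X0 ^ i * Y0 ^ j" for i j
    by (simp add: X0_def Y0_def exp_of_nat_mult[symmetric] exp_add[symmetric] mult_ac)
  have f0: "hf (int n0) (int m0) = real m0 * X0 ^ n0 * Y0 ^ m0" using ex[of n0 m0] by (simp add: hf_def)
  have fl: "hf 0 (int l) = real l * Y0 ^ l" for l using ex[of 0 l] by (simp add: hf_def)
  have part: "(\<Sum>l<L. real l * ht l * Y0 ^ l) <= hf (int n0) (int m0) - \<delta>" for L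
  proof (rule LIMSEQ_le_const2)
    show "(%n. \<Sum>l<L. real l * (\<Sum>r\<le>n. H r l) * Y0 ^ l) \<longlonglongrightarrow> (\<Sum>l<L. real l * ht l * Y0 ^ l)"
    proof (rule tendsto_sum)
      fix l
      show "(%n. real l * (\<Sum>r\<le>n. H r l) * Y0 ^ l) \<longlonglongrightarrow> real l * ht l * Y0 ^ l"
      proof (cases "l >= 1")
        case True
        then show ?thesis using ht_sums[OF True] by (intro tendsto_intros) (simp add: sums_def_le)
      qed (simp add: not_le)
    qed
    show "\<exists>N. \<forall>n\<ge>N. (\<Sum>l<L. real l * (\<Sum>r\<le>n. H r l) * Y0 ^ l) <= hf (int n0) (int m0) - \<delta>"
    proof (intro exI allI impI)
      fix n assume n: "N <= n"
      define L' where "L' = L + m0 + n"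
      have t0: "0 <= real l * (\<Sum>r\<le>n. H r l) * Y0 ^ l" for l
        using Y0_pos by (intro mult_nonneg_nonneg sum_nonneg) (auto simp: H_def hit_nonneg)
      have "(\<Sum>l<L. real l * (\<Sum>r\<le>n. H r l) * Y0 ^ l) = (\<Sum>l\<in>{1..<L}. real l * (\<Sum>r\<le>n. H r l) * Y0 ^ l)"
        by (rule sum.mono_neutral_right) auto
      also have "... <= (\<Sum>l=1..L'. real l * (\<Sum>r\<le>n. H r l) * Y0 ^ l)"
        by (rule sum_mono2) (use t0 in \<open>auto simp: L'_def\<close>)
      also have "... = (\<Sum>l=1..L'. \<Sum>r\<le>n. H r l * hf 0 (int l))"
        unfolding fl by (intro sum.cong refl) (simp add: sum_distrib_left sum_distrib_right mult_ac)
      also have "... = (\<Sum>r\<le>n. \<Sum>l=1..L'. hit r (int n0) (int m0) (int l) * hf 0 (int l))"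
        unfolding H_def by (rule sum.swap)
      also have "... = hf (int n0) (int m0) - VN n (int n0) (int m0)"
        using VN_decomposition[OF xy, of n L'] by (simp add: L'_def)
      also have "... <= hf (int n0) (int m0) - \<delta>" using N[OF n] by simp
      finally show "(\<Sum>l<L. real l * (\<Sum>r\<le>n. H r l) * Y0 ^ l) <= hf (int n0) (int m0) - \<delta>" .
    qed
  qed
  have "Re (al (of_real Y0)) <= hf (int n0) (int m0) - \<delta>"
    by (rule LIMSEQ_le_const2[OF al_Y0(1)[unfolded sums_def]]) (use part in blast)
  then show ?thesis using \<delta> by (simp add: Br_def f0)
qed

section \<open>Identification of the leading coefficient\<close>

lemma hh_value: "B.hh 1 (of_real Y0) = of_real (X0 * Br / (Y0 * a X0))"
proof -
  have "B.amp 1 (of_real Y0) = of_real Br"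
    unfolding B.amp_def upf_at(2) by (subst al_Y0(2)) (simp add: Br_def power_divide mult_ac)
  then show ?thesis
    unfolding B.hh_def upf_at(1) unfolding upf_at(2) using kernel_Y0(3) Y0_pos X0_gt_1 by (simp add: power2_eq_square)
qed

text \<open>Whichever branch \<open>holomorphic_extension\<close> takes, the function agrees with
  the absorption series on the unit disc. Y0 lies inside, so the derivative is read off the power
  series.\<close>

lemma h_tilde_deriv: "Re (deriv (h_tilde p M X Y) (of_real Y0)) = Re (al (of_real Y0)) / Y0"
proof -
  define w where "w = complex_of_real Y0"
  have w: "norm w < 1" "w ~= 0" using Y0_pos Y0_less_1 by (auto simp: w_def)
  define cf where "cf l = (if l = 0 then 0 else complex_of_real (ht l))" for l
  have cs: "summable (%l. cf l * z ^ l)" if "norm z < 1" for z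
  proof (rule summable_comparison_test'[OF summable_geometric[of "norm z"], of 0])
    have "norm (cf l) <= 1" for l using ht_le_1 ht_nonneg by (simp add: cf_def)
    then show "norm (cf l * z ^ l) <= norm z ^ l" for l
      unfolding norm_mult norm_power using mult_right_mono[of "norm (cf l)" 1 "norm z ^ l"] by simp
  qed (use that in simp)
  have ser: "absorption_series M Y X z = (\<Sum>l. cf l * z ^ l)" if "norm z < 1" for z
    using suminf_split_head[OF cs[OF that]] by (simp add: absorption_series_def cf_def ht_def)
  have D: "((%z. \<Sum>l. cf l * z ^ l) has_field_derivative (\<Sum>l. diffs cf l * w ^ l)) (at w)"
  proof -
    define K0 where "K0 = complex_of_real ((1 + Y0) / 2)"
    have "norm K0 = (1 + Y0) / 2" "norm w = Y0" unfolding K0_def w_def norm_of_real using Y0_pos by simp_all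
    then have "norm K0 < 1" "norm w < norm K0" using Y0_less_1 by simp_all
    then show ?thesis using termdiffs_strong[OF cs[of K0], of w] by blast
  qed
  have eq: "h_tilde p M X Y z = (\<Sum>l. cf l * z ^ l)" if "z \<in> ball 0 1" for z
  proof -
    have "h_tilde p M X Y z = absorption_series M Y X z"
    proof (cases "\<exists>F. F holomorphic_on - cut34 (flip p) & (\<forall>z\<in>ball 0 1. F z = absorption_series M Y X z)")
      case True
      have "h_tilde p M X Y = (SOME F. F holomorphic_on - cut34 (flip p) & (\<forall>z\<in>ball 0 1. F z = absorption_series M Y X z))"
        unfolding h_tilde_def h_def holomorphic_extension_def if_P[OF True] ..
      then show ?thesis using someI_ex[OF True] that by metis
    next
      case False
      show ?thesis unfolding h_tilde_def h_def holomorphic_extension_def if_not_P[OF False] ..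
    qed
    then show ?thesis using ser[of z] that by simp
  qed
  have "eventually (%z. z \<in> ball 0 1) (nhds w)" using w by (intro eventually_nhds_in_open) auto
  then have ev: "eventually (%z. h_tilde p M X Y z = (\<Sum>l. cf l * z ^ l)) (nhds w)" by eventually_elim (rule eq)
  have "deriv (h_tilde p M X Y) w = (\<Sum>l. diffs cf l * w ^ l)"
    using deriv_cong_ev[OF ev refl] DERIV_imp_deriv[OF D] by simp
  moreover have "w * (\<Sum>l. diffs cf l * w ^ l) = al w"
  proof -
    have s: "summable (%l. of_real (real l * ht l) * w ^ l)" using al_sums[OF w(1)] by (simp add: sums_iff)
    have sd: "summable (%l. diffs cf l * w ^ l)" by (rule termdiff_converges[OF w(1) cs])
    have "al w = (\<Sum>l. of_real (real (Suc l) * ht (Suc l)) * w ^ Suc l)"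
      unfolding al_def using suminf_split_head[OF s] by simp
    also have "... = (\<Sum>l. w * (diffs cf l * w ^ l))"
      by (rule suminf_cong) (simp add: diffs_def cf_def mult_ac)
    also have "... = w * (\<Sum>l. diffs cf l * w ^ l)" by (rule suminf_mult[OF sd])
    finally show ?thesis ..
  qed
  ultimately have "deriv (h_tilde p M X Y) w = al w / w" using w by (simp add: field_simps)
  then show ?thesis unfolding w_def by (subst (asm) al_Y0(2)) (simp flip: of_real_divide)
qed

lemma leading: "leading_factor p M X Y n0 m0 = C0 p * (Br / Y0)"
proof -
  have "Y0 ^ m0 = Y0 ^ (m0 - 1) * Y0" using m0 by (metis Suc_diff_1 Suc_le_eq One_nat_def power_Suc2)
  then show ?thesis
    unfolding leading_factor_def s_xy_0 h_tilde_deriv using Y0_pos by (simp add: Br_def field_simps)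
qed

lemma leading_pos: "leading_factor p M X Y n0 m0 > 0"
  unfolding leading C0_eq using Br_pos Y0_pos kernel_Y0(3) X0_gt_1 sig2_pos by simp

text \<open>The prefactor of the Fourier integral, the Gaussian width and the boundary value of hh
  multiply to \<open>C0\<close> times the bracket, all expressed through sig2.\<close>

lemma leading_hh: "1 / (2 * pi) * sqrt (2 * pi / sig2) * Re (B.hh 1 (of_real Y0)) = leading_factor p M X Y n0 m0"
proof -
  define r where "r = sqrt (2 * pi)"
  have r: "r > 0" "2 * pi = r * r" by (simp_all add: r_def)
  have q: "sqrt sig2 > 0" using sig2_pos by simp
  have "1 / (2 * pi) * sqrt (2 * pi / sig2) = 1 / sqrt (2 * pi * sig2)"
    unfolding real_sqrt_divide real_sqrt_mult[of "2 * pi" sig2] r_def[symmetric] using r q by (simp add: field_simps)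
  then have "1 / (2 * pi) * sqrt (2 * pi / sig2) * Re (B.hh 1 (of_real Y0)) = 1 / sqrt (2 * pi * sig2) * (X0 * Br / (Y0 * a X0))"
    by (simp only: hh_value Re_complex_of_real)
  also have "... = leading_factor p M X Y n0 m0" unfolding leading C0_eq by (simp add: mult_ac)
  finally show ?thesis .
qed

lemma green_GG:
  assumes "i >= 1" "j >= 1"
  shows "green M X Y i j = ennreal (GG i j)" "GG i j >= 0"
proof -
  have s: "summable (%n. QQ n (int i) (int j))" using Q_sums(1)[of "int i" "int j"] assms by (simp add: sums_iff)
  have n: "0 <= QQ n (int i) (int j)" for n by (simp add: QQ_def Q_nonneg)
  show "green M X Y i j = ennreal (GG i j)" unfolding green_eq[OF assms] GG_def by (rule suminf_ennreal2[OF n s])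
  show "GG i j >= 0" unfolding GG_def by (rule suminf_nonneg[OF s n])
qed

lemma green_parity:
  assumes "i >= 1" "j >= 1" "\<not> int kap dvd (int i - int n0) - (int j - int m0)"
  shows "green M X Y i j = 0"
proof -
  have "QQ n (int i) (int j) = 0" for n unfolding QQ_def using Q_parity assms(3) by blast
  then show ?thesis unfolding green_eq[OF assms(1,2)] by simp
qed

end

section \<open>From the estimates to the expansion near the axis\<close>

lemma eventually_near_axis:
  assumes "d > 0" "\<And>i j. N <= i ==> 1 <= i ==> 1 <= j ==> real j <= d * real i ==> (i, j) \<in> A ==> P (i, j)"
  shows "eventually P (inf near_axis (principal A))"
proof -
  have "eventually (%z. max N 1 <= fst z) (filtercomap fst at_top)"
    by (rule eventually_filtercomapI[OF eventually_ge_at_top])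
  then have 1: "eventually (%z :: nat \<times> nat. max N 1 <= fst z) near_axis"
    unfolding near_axis_def by (rule filter_leD[OF inf_le1])
  have "eventually (%z. z \<in> {(i :: nat, j :: nat). 0 < j}) (principal {(i, j). 0 < j})"
    by (simp add: eventually_principal)
  then have 2: "eventually (%z. z \<in> {(i :: nat, j :: nat). 0 < j}) near_axis"
    unfolding near_axis_def by (rule filter_leD[OF le_infI2[OF inf_le1]])
  have "eventually (%x. x \<in> {..<d}) (nhds (0 :: real))" using assms(1) by (intro eventually_nhds_in_open) auto
  then have "eventually (%z. (%(i, j). real j / real i) z \<in> {..<d}) (filtercomap (%(i :: nat, j :: nat). real j / real i) (nhds 0))"
    by (rule eventually_filtercomapI)
  then have 3: "eventually (%z. (%(i :: nat, j :: nat). real j / real i) z \<in> {..<d}) near_axis"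
    unfolding near_axis_def by (rule filter_leD[OF le_infI2[OF inf_le2]])
  from 1 2 3 have "eventually (%z. z \<in> A --> P z) near_axis"
  proof eventually_elim
    case (elim z)
    obtain i j where z: "z = (i, j)" by (cases z)
    have "N <= i" "1 <= i" "1 <= j" "real j / real i < d" using elim by (auto simp: z)
    then show ?case using assms(2)[of i j] by (simp add: z divide_less_eq less_imp_le)
  qed
  then show ?thesis by (simp add: eventually_inf_principal)
qed

context absorbed_chain begin

text \<open>The error function \<epsilon> is obtained by solving the claimed identity for it, which
  requires a nonzero leading factor. Its bound adds the ballot error and the Laplace error.\<close>

theorem expansion:
  assumes A: "\<And>i j. (i, j) \<in> A ==> int kap dvd (int i - int n0) - (int j - int m0)"
  shows "axis_expansion (real kap) A p M X Y n0 m0"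
proof -
  obtain C1 d N1 where C1: "C1 >= 0" and d: "d > 0" "d <= t1"
    and J: "\<And>i j. N1 <= i ==> 1 <= i ==> real j <= d * real i ==> \<bar>sv (real j / real i) - v0\<bar> <= rd \<and>
     norm (B.JJ i j (sv (real j / real i)) - of_real (fr (exp (sv (real j / real i))) ^ i * exp (- real j * sv (real j / real i)) * (sqrt (2 * pi / sig2) / (real i * sqrt (real i)))) * B.hh 1 (of_real Y0))
      <= C1 * (fr (exp (sv (real j / real i))) ^ i * exp (- real j * sv (real j / real i))) * ((1 / real i + real j / real i) / (real i * sqrt (real i)))"
    using B.JJ_estimate by blast
  obtain C2 N2 where C2: "C2 >= 0" and G: "\<And>v i j. \<bar>v - v0\<bar> <= rd ==> i >= N2 ==> i >= 1 ==> j >= 1 ==> int kap dvd (int i - int n0) - (int j - int m0) ==>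
     \<bar>GG i j - real j * (real kap / (2 * pi) * Re (B.JJ i j v))\<bar> <= C2 * (real j)\<^sup>2 * (fr (exp v) ^ i * exp (- real j * v) / ((real i)\<^sup>2 * sqrt (real i)))"
    using GG_estimate by blast
  define L where "L = leading_factor p M X Y n0 m0"
  have L: "L > 0" unfolding L_def by (rule leading_pos)
  have k0: "real kap > 0" using kap_pos by simp
  define C3 where "C3 = C2 + real kap / (2 * pi) * (2 * C1)"
  define E where "E i j = s_x p (real j / real i) ^ i * s_y p (real j / real i) ^ j" for i j
  define \<epsilon> where "\<epsilon> = (%(i, j). GG i j * E i j / (real kap * L) - real j / (real i * sqrt (real i)))"
  have main: "E i j > 0 & \<bar>\<epsilon> (i, j)\<bar> <= C3 / (real kap * L) * ((real j)\<^sup>2 / ((real i)\<^sup>2 * sqrt (real i)))"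
    if i: "max N1 N2 <= i" "1 <= i" and j: "1 <= j" "real j <= d * real i" and ij: "(i, j) \<in> A" for i j
  proof -
    have i0: "real i > 0" using i by simp
    define t where "t = real j / real i"
    have t: "0 <= t" "t <= t1" using j(2) d i0 by (auto simp: t_def field_simps intro: order_trans)
    then have t': "\<bar>t\<bar> <= t1" by simp
    define v where "v = sv t"
    have Jv: "\<bar>v - v0\<bar> <= rd" and Je: "norm (B.JJ i j v - of_real (fr (exp v) ^ i * exp (- real j * v) * (sqrt (2 * pi / sig2) / (real i * sqrt (real i)))) * B.hh 1 (of_real Y0))
      <= C1 * (fr (exp v) ^ i * exp (- real j * v)) * ((1 / real i + real j / real i) / (real i * sqrt (real i)))"
      using J[of i j] i j by (simp_all add: v_def t_def)
    have vd: "\<bar>v - v0\<bar> <= dl0" using Jv rd(3) r3(1,4) by linarith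
    have fp: "fr (exp v) > 0" using fr_exp[OF vd] by simp
    define k where "k = fr (exp v) ^ i * exp (- real j * v)"
    have k: "k > 0" using fp by (simp add: k_def)
    \<comment> \<open>\<open>s_x\<close> is the reciprocal of F at the saddle, so the saddle powers
      in the claim are the reciprocal of the size k of the integrand.\<close>
    have E: "E i j = 1 / k"
    proof -
      have "s_x p t = 1 / fr (exp v)" "s_y p t = exp v"
        using s_xy[OF t'] exp_lam[OF vd] by (simp_all add: v_def exp_minus inverse_eq_divide)
      then have "E i j = (1 / fr (exp v)) ^ i * exp v ^ j" unfolding E_def t_def[symmetric] by (simp only:)
      also have "... = 1 / k"
        using fp by (simp add: k_def power_divide exp_minus exp_of_nat_mult[symmetric] field_simps)
      finally show ?thesis .
    qed
    define D where "D = (real i)\<^sup>2 * sqrt (real i)"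
    have D: "D > 0" using i0 by (simp add: D_def)
    define c where "c = 1 / (2 * pi) * sqrt (2 * pi / sig2) * Re (B.hh 1 (of_real Y0))"
    have cL: "c = L" unfolding c_def L_def by (rule leading_hh)
    have R1: "\<bar>Re (B.JJ i j v) - 2 * pi * L * k / (real i * sqrt (real i))\<bar> <= 2 * C1 * k * real j / D"
    proof -
      have e: "Re (of_real (k * (sqrt (2 * pi / sig2) / (real i * sqrt (real i)))) * B.hh 1 (of_real Y0)) = 2 * pi * L * k / (real i * sqrt (real i))"
      proof -
        have "Re (of_real r * z) = r * Re z" for r z by simp
        then show ?thesis unfolding cL[symmetric] c_def by (simp add: field_simps)
      qed
      have "\<bar>Re (B.JJ i j v) - 2 * pi * L * k / (real i * sqrt (real i))\<bar> <= C1 * k * ((1 / real i + real j / real i) / (real i * sqrt (real i)))"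
        unfolding e[symmetric] minus_complex.sel(1)[symmetric] using order_trans[OF abs_Re_le_cmod Je[folded k_def]] .
      \<comment> \<open>As j >= 1, the relative error 1/i is absorbed into j/i.\<close>
      also have "... <= C1 * k * ((real j / real i + real j / real i) / (real i * sqrt (real i)))"
        using C1 k i0 j(1) by (intro mult_left_mono divide_right_mono add_right_mono) auto
      also have "... = 2 * C1 * k * real j / D" by (simp add: D_def power2_eq_square field_simps)
      finally show ?thesis .
    qed
    have R2: "\<bar>GG i j - real j * (real kap / (2 * pi) * Re (B.JJ i j v))\<bar> <= C2 * (real j)\<^sup>2 * (k / D)"
      unfolding k_def D_def by (rule G[OF Jv _ i(2) j(1) A[OF ij]]) (use i in simp)
    have R3: "\<bar>real j * (real kap / (2 * pi) * Re (B.JJ i j v)) - real kap * L * k * (real j / (real i * sqrt (real i)))\<bar> <= real kap / (2 * pi) * (2 * C1) * (real j)\<^sup>2 * (k / D)"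
    proof -
      define z where "z = real j * (real kap / (2 * pi))"
      have z: "z >= 0" by (simp add: z_def)
      have "real j * (real kap / (2 * pi) * Re (B.JJ i j v)) - real kap * L * k * (real j / (real i * sqrt (real i)))
         = z * (Re (B.JJ i j v) - 2 * pi * L * k / (real i * sqrt (real i)))" by (simp add: z_def field_simps)
      also have "\<bar>...\<bar> <= z * (2 * C1 * k * real j / D)"
        unfolding abs_mult abs_of_nonneg[OF z] by (rule mult_left_mono[OF R1 z])
      finally show ?thesis by (simp add: z_def power2_eq_square mult_ac)
    qed
    have R4: "\<bar>GG i j - real kap * L * k * (real j / (real i * sqrt (real i)))\<bar> <= C3 * ((real j)\<^sup>2 * (k / D))"
    proof -
      have tri: "\<bar>x - z\<bar> <= \<bar>x - y\<bar> + \<bar>y - z\<bar>" for x y z :: real by simp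
      have "C2 * (real j)\<^sup>2 * (k / D) + real kap / (2 * pi) * (2 * C1) * (real j)\<^sup>2 * (k / D) = C3 * ((real j)\<^sup>2 * (k / D))"
        by (simp only: C3_def distrib_right mult.assoc)
      then show ?thesis using order_trans[OF tri add_mono[OF R2 R3]] by (simp only:)
    qed
    have "\<epsilon> (i, j) = (GG i j - real kap * L * k * (real j / (real i * sqrt (real i)))) / (real kap * L * k)"
      using k L k0 by (simp add: \<epsilon>_def E diff_divide_distrib)
    then have "\<bar>\<epsilon> (i, j)\<bar> = \<bar>GG i j - real kap * L * k * (real j / (real i * sqrt (real i)))\<bar> / (real kap * L * k)"
      using k L k0 by (simp add: abs_mult)
    also have "... <= C3 * ((real j)\<^sup>2 * (k / D)) / (real kap * L * k)" using k L k0 by (intro divide_right_mono R4) auto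
    also have "... = C3 / (real kap * L) * ((real j)\<^sup>2 / D)" using k by simp
    finally show ?thesis using k by (simp add: E D_def)
  qed
  show ?thesis
    unfolding axis_expansion_def
  proof (intro exI[of _ \<epsilon>] conjI)
    show "\<epsilon> \<in> O[inf near_axis (principal A)](%(i, j). (real j)\<^sup>2 / ((real i)\<^sup>2 * sqrt (real i)))"
    proof (rule bigoI[where c = "C3 / (real kap * L)"], rule eventually_near_axis[OF d(1), where N = "max N1 N2"])
      fix i j assume "max N1 N2 <= i" "1 <= i" "1 <= j" "real j <= d * real i" "(i, j) \<in> A"
      from main[OF this] show "norm (\<epsilon> (i, j)) <= C3 / (real kap * L) * norm (case (i, j) of (i, j) => (real j)\<^sup>2 / ((real i)\<^sup>2 * sqrt (real i)))"
        by simp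
    qed
    show "\<forall>\<^sub>F (i, j) in inf near_axis (principal A). green M X Y i j < \<infinity> \<and>
       enn2real (green M X Y i j) = real kap * (leading_factor p M X Y n0 m0 / (s_x p (real j / real i) ^ i * s_y p (real j / real i) ^ j) * (real j / (real i * sqrt (real i)) + \<epsilon> (i, j)))"
    proof (rule eventually_near_axis[OF d(1), where N = "max N1 N2"])
      fix i j assume ij: "max N1 N2 <= i" "1 <= i" "1 <= j" "real j <= d * real i" "(i, j) \<in> A"
      have E: "E i j > 0" using main[OF ij] by simp
      have "real kap * (L / E i j * (real j / (real i * sqrt (real i)) + \<epsilon> (i, j))) = GG i j"
        using E L k0 by (simp add: \<epsilon>_def)
      then show "case (i, j) of (i, j) => green M X Y i j < \<infinity> \<and>
       enn2real (green M X Y i j) = real kap * (leading_factor p M X Y n0 m0 / (s_x p (real j / real i) ^ i * s_y p (real j / real i) ^ j) * (real j / (real i * sqrt (real i)) + \<epsilon> (i, j)))"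
        using green_GG[OF ij(2,3)] by (simp add: L_def E_def)
    qed
  qed
qed

end

lemma absorbed_walk_flip:
  assumes "absorbed_walk p n0 m0 M X Y"
  shows "absorbed_walk (flip p) m0 n0 M Y X"
proof -
  have tr: "transition (flip p) s t = transition p (prod.swap s) (prod.swap t)" for s t
    by (cases s; cases t) (auto simp: transition_def flip_def)
  have eq: "{w \<in> space M. \<forall>k\<le>n. (Y k w, X k w) = s k} = {w \<in> space M. \<forall>k\<le>n. (X k w, Y k w) = (prod.swap \<circ> s) k}" for n s
    by (auto simp: prod_eq_iff)
  have "{w \<in> space M. (Y 0 w, X 0 w) = (m0, n0)} = {w \<in> space M. (X 0 w, Y 0 w) = (n0, m0)}" by auto
  then show ?thesis using assms unfolding absorbed_walk_def eq tr by (simp add: o_def)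
qed

lemma diagonal_mass_flip: "diagonal_mass (flip p) = diagonal_mass p"
  by (simp add: diagonal_mass_def flip_def)

theorem theorem26:
  fixes p :: "int \<Rightarrow> int \<Rightarrow> real" and M :: "'w measure" and X Y :: "nat \<Rightarrow> 'w \<Rightarrow> nat"
    and n0 m0 :: nat
  assumes "walk_weights p" and "drift_x p > 0" and "drift_y p > 0"
    and "n0 \<ge> 1" and "m0 \<ge> 1"
    and "absorbed_walk p n0 m0 M X Y"
  shows "(p 1 1 + p (-1) (-1) + p 1 (-1) + p (-1) 1 < 1 \<longrightarrow>
            axis_expansion 1 UNIV p M X Y n0 m0 \<and> axis_constants p \<and>
            axis_expansion 1 UNIV (flip p) M Y X m0 n0 \<and> axis_constants (flip p)) \<and>
         (p 1 1 + p (-1) (-1) + p 1 (-1) + p (-1) 1 = 1 \<longrightarrow>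
            (\<forall>i\<ge>1. \<forall>j\<ge>1. even (n0 + m0) \<noteq> even (i + j) \<longrightarrow> green M X Y i j = 0) \<and>
            axis_expansion 2 {(i, j). even (n0 + m0) = even (i + j)} p M X Y n0 m0 \<and>
            axis_constants p \<and>
            axis_expansion 2 {(j, i). even (n0 + m0) = even (i + j)} (flip p) M Y X m0 n0 \<and>
            axis_constants (flip p))"
proof -
  interpret W: drift_walk p by unfold_locales (use assms in auto)
  interpret A: absorbed_chain p M X Y n0 m0 by unfold_locales (use assms in auto)
  \<comment> \<open>The regime near the vertical axis is the one already treated, for the exchanged
    weights, start and coordinates.\<close>
  interpret F: drift_walk "flip p" by (rule W.drift_walk_flip)
  interpret B: absorbed_chain "flip p" M Y X m0 n0
    by unfold_locales (use assms in \<open>auto intro: absorbed_walk_flip\<close>)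
  have dm: "p 1 1 + p (-1) (-1) + p 1 (-1) + p (-1) 1 = diagonal_mass p" by (simp add: diagonal_mass_def)
  have par: "even ((int i - int n) - (int j - int m)) \<longleftrightarrow> even (n + m) = even (i + j)" for i j n m :: nat
    by (simp; blast)
  show ?thesis
    unfolding dm
  proof (intro conjI impI)
    assume "diagonal_mass p < 1"
    then have k: "W.kap = 1" "F.kap = 1" by (simp_all add: W.kap_def F.kap_def diagonal_mass_flip)
    show "axis_expansion 1 UNIV p M X Y n0 m0" using A.expansion[of UNIV] k by simp
    show "axis_expansion 1 UNIV (flip p) M Y X m0 n0" using B.expansion[of UNIV] k by simp
    show "axis_constants p" "axis_constants (flip p)" by (rule W.axis_constants F.axis_constants)+
  next
    assume "diagonal_mass p = 1"
    then have k: "W.kap = 2" "F.kap = 2" by (simp_all add: W.kap_def F.kap_def diagonal_mass_flip)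
    show "\<forall>i\<ge>1. \<forall>j\<ge>1. even (n0 + m0) \<noteq> even (i + j) \<longrightarrow> green M X Y i j = 0"
    proof (intro allI impI)
      fix i j :: nat
      assume ij: "1 \<le> i" "1 \<le> j" "even (n0 + m0) \<noteq> even (i + j)"
      then have "\<not> int W.kap dvd (int i - int n0) - (int j - int m0)" unfolding k using par[of i n0 j m0] by simp
      from A.green_parity[OF ij(1,2) this] show "green M X Y i j = 0" .
    qed
    have "axis_expansion (real W.kap) {(i, j). even (n0 + m0) = even (i + j)} p M X Y n0 m0"
    proof (rule A.expansion)
      fix i j :: nat assume "(i, j) \<in> {(i, j). even (n0 + m0) = even (i + j)}"
      then show "int W.kap dvd (int i - int n0) - (int j - int m0)" using par[of i n0 j m0] unfolding k by simp
    qed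
    then show "axis_expansion 2 {(i, j). even (n0 + m0) = even (i + j)} p M X Y n0 m0" unfolding k of_nat_numeral .
    have "axis_expansion (real F.kap) {(j, i). even (n0 + m0) = even (i + j)} (flip p) M Y X m0 n0"
    proof (rule B.expansion)
      fix j i :: nat assume "(j, i) \<in> {(j, i). even (n0 + m0) = even (i + j)}"
      then show "int F.kap dvd (int j - int m0) - (int i - int n0)" using par[of j m0 i n0] unfolding k by (auto simp: add.commute)
    qed
    then show "axis_expansion 2 {(j, i). even (n0 + m0) = even (i + j)} (flip p) M Y X m0 n0" unfolding k of_nat_numeral .
    show "axis_constants p" "axis_constants (flip p)" by (rule W.axis_constants F.axis_constants)+
  qed
qed

end
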